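(* Let $\mathrm F=\mathcal R$ be the Radon transform (and $M=m$), or let $n=m=2$ and let $\mathrm F=\mathcal D$ be the 2D ray transform (and $M=1$). Let $v^0\in L^p(\Sigma;\mathbb R^M)$ and assume that there exists $w\in W^{s,p}(\Omega;K)$ with $\mathrm F[w]=v^0$. Then there exists a $\Phi^l_{[d]}$-minimizing solution $w^\dagger\in W^{s,p}(\Omega;K)$ of $\mathrm F[w]=v^0$, and the following hold. (Existence) For every $v\in L^p(\Sigma;\mathbb R^M)$ and every $\alpha>0$ the functional $\mathcal F^{\alpha,v}_{[d]}:W^{s,p}(\Omega;K)\to[0,\infty)$ attains a minimizer in $W^{s,p}(\Omega;K)$. (Stability) Let $\alpha>0$ be fixed, $v^\delta\in L^p(\Sigma;\mathbb R^M)$, and let $(v_k)_{k\in\mathbb N}$ be a sequence in $L^p(\Sigma;\mathbb R^M)$ with $\|v^\delta-v_k\|_{L^p(\Sigma;\mathbb R^M)}\to0$. Then every sequence $(w_k)_{k\in\mathbb N}$ with $w_k\in\arg\min\{\mathcal F^{\alpha,v_k}_{[d]}(w): w\in W^{s,p}(\Omega;K)\}$ has a subsequence converging with respect to the weak topology of $W^{s,p}(\Omega;\mathbb R^m)$. The limit $\tilde w$ of every such converging subsequence $(w_{k_j})_{j\in\mathbb N}$ is a minimizer of $\mathcal F^{\alpha,v^\delta}_{[d]}$ over $W^{s,p}(\Omega;K)$, and $\Phi^l_{[d]}(w_{k_j})\to\Phi^l_{[d]}(\tilde w)$ as $j\to\infty$. (Convergence) Let $\alpha:(0,\infty)\to(0,\infty)$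 satisfy $\alpha(\delta)\to0$ and $\delta^p/\alpha(\delta)\to0$ as $\delta\to0$. Let $(\delta_k)_{k\in\mathbb N}$ be a sequence of positive real numbers converging to $0$, let $(v_k)_{k\in\mathbb N}$ be a sequence in $L^p(\Sigma;\mathbb R^M)$ with $\|v^0-v_k\|_{L^p(\Sigma;\mathbb R^M)}\le\delta_k$, and set $\alpha_k:=\alpha(\delta_k)$. Then every sequence $(w_k)_{k\in\mathbb N}$ with $w_k\in\arg\min\{\mathcal F^{\alpha_k,v_k}_{[d]}(w): w\in W^{s,p}(\Omega;K)\}$ has a subsequence $w_{k_j}\rightharpoonup\tilde w$ converging weakly in $W^{s,p}(\Omega;\mathbb R^m)$, the limit $\tilde w$ is a $\Phi^l_{[d]}$-minimizing solution, and $\Phi^l_{[d]}(w_{k_j})\to\Phi^l_{[d]}(\tilde w)$. Moreover, if the $\Phi^l_{[d]}$-minimizing solution $w^\dagger$ is unique, then $w_k\rightharpoonup w^\dagger$ weakly in $W^{s,p}(\Omega;\mathbb R^m)$ and $\Phi^l_{[d]}(w_k)\to\Phi^l_{[d]}(w^\dagger)$ for the whole sequence.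
   Context: Standing assumptions: $p\in(1,\infty)$, $s\in(0,1)$, $l\in\{0,1\}$; $\Omega\subset\mathbb R^n$ is a nonempty, bounded, connected open set with Lipschitz boundary, compactly contained in the ball $\mathcal B_R(0)$ of radius $R$; $K\subseteq\mathbb R^m$ is nonempty and closed; $|\cdot|$ is the Euclidean norm. $d:K\times K\to[0,\infty)$ is a metric on $K$ for which there is $C_u>0$ with $|a-b|\le d(a,b)\le C_u|a-b|$ for all $a,b\in K$. Mollifier: a non-negative, radially symmetric $\rho\in C_c^\infty(\mathbb R^n;\mathbb R)$ with $\int_{\mathbb R^n}\rho=1$. It satisfies the separation property if for all $0<\tau<\|\rho\|_{L^\infty}$ there is $\eta>0$ with $\{z:\rho(z)\ge\tau\}=\{z:|z|\le\eta\}$. Here $\rho$ is a mollifier satisfying the separation property. Spaces: $W^{s,p}(\Omega;\mathbb R^m)$ is the set of $w\in L^p(\Omega;\mathbb R^m)$ with $|w|^p_{W^{s,p}}:=\int_{\Omega\times\Omega}\frac{|w(x)-w(y)|^p}{|x-y|^{n+ps}}\,d(x,y)<\infty$, with norm $\|w\|_{W^{s,p}}=(\|w\|_{L^p}^p+|w|_{W^{s,p}}^p)^{1/p}$. $W^{s,p}(\Omega;K)$ is the set of $w\in W^{s,p}(\Omega;\mathbb R^m)$ with $w(x)\in K$ for a.e. $x\in\Omega$. Transforms: functions on $\Omega$ are extended by $0$ outside $\Omega$. $\Sigma=\{(r,\varphi): r\ge0,\ \varphi\in\mathbb S^{n-1}\}$ with the product of Lebesgue measure and surface measure. For $(r,\varphi)\in\Sigma$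 let $H^{n-1}_{r,\varphi}=\{x\in\mathbb R^n:x\cdot\varphi=r\}$, and let $d\sigma$ be $(n-1)$-dimensional Hausdorff measure. The Radon transform is $\mathcal R[w](r,\varphi)=\int_{H^{n-1}_{r,\varphi}}w(x)\,d\sigma(x)\in\mathbb R^m$ (componentwise). For $n=m=2$, identifying points of $\mathbb S^1$ with angles $\varphi$, and with $\theta=(\cos\varphi,\sin\varphi)^T$, $\theta^\perp=(-\sin\varphi,\cos\varphi)^T$, the 2D ray transform is $\mathcal D[w](r,\varphi)=\int_{-\infty}^\infty w(r\theta+t\theta^\perp)\cdot\theta^\perp\,dt\in\mathbb R$. Functional: for $\alpha>0$ and $v\in L^p(\Sigma;\mathbb R^M)$, $$\mathcal F^{\alpha,v}_{[d]}(w)=\int_\Sigma|\mathrm F[w](r,\varphi)-v(r,\varphi)|^p\,d(r,\varphi)+\alpha\Phi^l_{[d]}(w),\qquad \Phi^l_{[d]}(w)=\int_{\Omega\times\Omega}\frac{d^p(w(x),w(y))}{|x-y|^{n+ps}}\rho^l(x-y)\,d(x,y),$$ where $\rho^0\equiv1$ and $\rho^1=\rho$. A $\Phi^l_{[d]}$-minimizing solution of $\mathrm F[w]=v^0$ is an element $w^*\in W^{s,p}(\Omega;K)$ with $\mathrm F[w^*]=v^0$ and $\Phi^l_{[d]}(w^* )=\inf\{\Phi^l_{[d]}(w):w\in W^{s,p}(\Omega;K),\ \mathrm F[w]=v^0\}$. *)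

theory Defs
  imports "HOL-Analysis.Analysis" "HOL-Probability.Essential_Supremum"
begin

section \<open>Hausdorff measure\<close>

text \<open>The normalisation by the volume of the Euclidean unit ball makes the \<open>k\<close>-dimensional
  Hausdorff measure agree with Lebesgue measure on \<open>k\<close>-planes; for \<open>k = 0\<close> it is counting measure.\<close>

definition hausdorff_content :: "nat \<Rightarrow> 'a::metric_space set \<Rightarrow> ennreal" where
  "hausdorff_content k U =
     (if U = {} then 0 else ennreal (unit_ball_vol (real k) * (diameter U / 2) ^ k))"

definition delta_covers :: "real \<Rightarrow> 'a::metric_space set \<Rightarrow> (nat \<Rightarrow> 'a set) set" where
  "delta_covers \<delta> A = {U. A \<subseteq> (\<Union>i. U i) \<and> (\<forall>i. bounded (U i) \<and> diameter (U i) \<le> \<delta>)}"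

definition hausdorff_outer :: "nat \<Rightarrow> 'a::metric_space set \<Rightarrow> ennreal" where
  "hausdorff_outer k A =
     (SUP \<delta>\<in>{0<..}. INF U\<in>delta_covers \<delta> A. \<Sum>i. hausdorff_content k (U i))"

text \<open>The measure lives on all Caratheodory-measurable sets, so it is complete; in particular a
  Lebesgue measurable function on the whole space is measurable on almost every hyperplane.\<close>

definition hausdorff_measure :: "nat \<Rightarrow> 'a::metric_space measure" where
  "hausdorff_measure k =
     measure_of UNIV (lambda_system UNIV (Pow UNIV) (hausdorff_outer k)) (hausdorff_outer k)"

lemma hausdorff_outer_le_covers:
  assumes "\<And>\<delta>. 0 < \<delta> \<Longrightarrow> (INF U\<in>delta_covers \<delta> A. \<Sum>i. hausdorff_content k (U i)) \<le> c"
  shows "hausdorff_outer k A \<le> c"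
  unfolding hausdorff_outer_def using assms by (intro SUP_least) auto

lemma covers_le_hausdorff_outer:
  assumes "0 < \<delta>"
  shows "(INF U\<in>delta_covers \<delta> A. \<Sum>i. hausdorff_content k (U i)) \<le> hausdorff_outer k A"
  unfolding hausdorff_outer_def using assms by (intro SUP_upper) auto

lemma hausdorff_outer_empty: "hausdorff_outer k {} = 0"
proof -
  have "hausdorff_outer k ({} :: 'a set) \<le> 0"
  proof (rule hausdorff_outer_le_covers)
    fix \<delta> :: real assume "0 < \<delta>"
    then have "(\<lambda>i. {}) \<in> delta_covers \<delta> ({} :: 'a set)"
      by (simp add: delta_covers_def)
    then have "(INF U\<in>delta_covers \<delta> ({} :: 'a set). \<Sum>i. hausdorff_content k (U i))
        \<le> (\<Sum>i. hausdorff_content k ({} :: 'a set))"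
      by (rule INF_lower)
    then show "(INF U\<in>delta_covers \<delta> ({} :: 'a set). \<Sum>i. hausdorff_content k (U i)) \<le> 0"
      by (simp add: hausdorff_content_def)
  qed
  then show ?thesis by simp
qed

lemma hausdorff_outer_mono: "A \<subseteq> B \<Longrightarrow> hausdorff_outer k A \<le> hausdorff_outer k B"
  unfolding hausdorff_outer_def
  by (intro SUP_mono bexI[of _ "\<delta>" for \<delta>] INF_superset_mono) (auto simp: delta_covers_def)

lemma hausdorff_outer_UN_le:
  fixes A :: "nat \<Rightarrow> 'a::metric_space set"
  shows "hausdorff_outer k (\<Union>i. A i) \<le> (\<Sum>i. hausdorff_outer k (A i))"
proof (rule hausdorff_outer_le_covers)
  fix \<delta> :: real assume \<delta>: "0 < \<delta>"
  let ?c = "hausdorff_content k" and ?O = "hausdorff_outer k"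
  show "(INF U\<in>delta_covers \<delta> (\<Union>i. A i). \<Sum>i. ?c (U i)) \<le> (\<Sum>i. ?O (A i))"
  proof (rule ennreal_le_epsilon)
    fix e :: real assume e: "0 < e" and fin: "(\<Sum>i. ?O (A i)) < top"
    have "\<exists>U\<in>delta_covers \<delta> (A n). (\<Sum>i. ?c (U i)) \<le> ?O (A n) + e * (1/2) ^ Suc n" for n
    proof -
      have "?O (A n) < top"
        using fin ennreal_suminf_lessD by blast
      then have "?O (A n) < ?O (A n) + e * (1/2) ^ Suc n"
        using e by (auto simp: less_top)
      then have "(INF U\<in>delta_covers \<delta> (A n). \<Sum>i. ?c (U i)) < ?O (A n) + e * (1/2) ^ Suc n"
        using covers_le_hausdorff_outer[OF \<delta>] le_less_trans by blast
      then show ?thesis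
        by (auto simp: INF_less_iff intro: less_imp_le)
    qed
    then obtain B where B: "\<And>n. B n \<in> delta_covers \<delta> (A n)"
      and Ble: "\<And>n. (\<Sum>i. ?c (B n i)) \<le> ?O (A n) + e * (1/2) ^ Suc n"
      by metis
    define C where "C = case_prod B \<circ> prod_decode"
    have "(\<Union>i. A i) \<subseteq> (\<Union>i. C i)"
    proof
      fix x assume "x \<in> (\<Union>i. A i)"
      then obtain n m where "x \<in> B n m"
        using B unfolding delta_covers_def by blast
      then have "x \<in> C (prod_encode (n, m))"
        by (simp add: C_def)
      then show "x \<in> (\<Union>i. C i)" by blast
    qed
    then have "C \<in> delta_covers \<delta> (\<Union>i. A i)"
      using B by (auto simp: delta_covers_def C_def split_beta)
    then have "(INF U\<in>delta_covers \<delta> (\<Union>i. A i). \<Sum>i. ?c (U i)) \<le> (\<Sum>i. ?c (C i))"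
      by (rule INF_lower)
    also have "\<dots> = (\<Sum>n. \<Sum>i. ?c (B n i))"
      using suminf_ennreal_2dimen[of "\<lambda>n. \<Sum>i. ?c (B n i)" "\<lambda>(n, i). ?c (B n i)"]
      by (simp add: C_def split_beta)
    also have "\<dots> \<le> (\<Sum>n. ?O (A n) + e * (1/2) ^ Suc n)"
      by (intro suminf_le Ble) auto
    also have "\<dots> = (\<Sum>n. ?O (A n)) + (\<Sum>n. ennreal e * ennreal ((1/2) ^ Suc n))"
      using e by (subst suminf_add[symmetric])
        (auto simp del: ennreal_suminf_cmult simp add: ennreal_mult[symmetric])
    also have "\<dots> = (\<Sum>n. ?O (A n)) + e"
      unfolding ennreal_suminf_cmult
      by (subst suminf_ennreal_eq[OF zero_le_power power_half_series]) auto
    finally show "(INF U\<in>delta_covers \<delta> (\<Union>i. A i). \<Sum>i. ?c (U i)) \<le> (\<Sum>i. ?O (A i)) + e" .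
  qed
qed

lemma outer_measure_space_hausdorff:
  "outer_measure_space (Pow UNIV) (hausdorff_outer k :: 'a::metric_space set \<Rightarrow> ennreal)"
  by (auto simp: outer_measure_space_def positive_def increasing_def countably_subadditive_def
      hausdorff_outer_empty hausdorff_outer_mono hausdorff_outer_UN_le)

lemma hausdorff_outer_Un_le:
  "hausdorff_outer k (A \<union> B) \<le> hausdorff_outer k A + hausdorff_outer k B"
proof -
  have "hausdorff_outer k (A \<union> B) = hausdorff_outer k (\<Union>i. binaryset A B i)"
    by (simp add: UN_binaryset_eq)
  also have "\<dots> \<le> (\<Sum>i. hausdorff_outer k (binaryset A B i))"
    by (rule hausdorff_outer_UN_le)
  also have "\<dots> = hausdorff_outer k A + hausdorff_outer k B"
    by (rule suminf_binaryset_eq) (rule hausdorff_outer_empty)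
  finally show ?thesis .
qed

text \<open>The outer measure is additive on sets of positive distance.\<close>

lemma hausdorff_outer_separated:
  fixes A B :: "'a::metric_space set"
  assumes e: "0 < e" and sep: "\<And>x y. x \<in> A \<Longrightarrow> y \<in> B \<Longrightarrow> e \<le> dist x y"
  shows "hausdorff_outer k A + hausdorff_outer k B \<le> hausdorff_outer k (A \<union> B)"
proof -
  let ?c = "hausdorff_content k"
  let ?pre = "\<lambda>\<delta> A. INF U\<in>delta_covers \<delta> A. \<Sum>i. ?c (U i)"
  have pre: "?pre a A + ?pre b B \<le> hausdorff_outer k (A \<union> B)" if "0 < a" "0 < b" for a b
  proof -
    define \<delta> where "\<delta> = min (min a b) (e / 2)"
    have \<delta>: "0 < \<delta>" "\<delta> \<le> a" "\<delta> \<le> b" "\<delta> < e"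
      using that e by (auto simp: \<delta>_def)
    have "?pre a A + ?pre b B \<le> (\<Sum>i. ?c (U i))" if U: "U \<in> delta_covers \<delta> (A \<union> B)" for U
    proof -
      define V where "V i = (if U i \<inter> A = {} then {} else U i)" for i
      define W where "W i = (if U i \<inter> A = {} then U i else {})" for i
      have bd: "bounded (U i)" "diameter (U i) \<le> \<delta>" for i
        using U by (auto simp: delta_covers_def)
      have V: "V \<in> delta_covers a A"
        using U \<delta> bd(2) by (fastforce simp: delta_covers_def V_def intro: order_trans)
      have "y \<notin> U i" if "y \<in> B" "x \<in> U i" "x \<in> A" for x y i
        using sep[of x y] that diameter_bounded_bound[OF bd(1), of x i y] bd(2)[of i] \<delta> by force
      then have "y \<in> (\<Union>i. W i)" if y: "y \<in> B" for y
      proof -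
        obtain i where i: "y \<in> U i"
          using U y unfolding delta_covers_def by blast
        then have "U i \<inter> A = {}"
          using \<open>\<And>y x i. y \<in> B \<Longrightarrow> x \<in> U i \<Longrightarrow> x \<in> A \<Longrightarrow> y \<notin> U i\<close> y by blast
        then have "y \<in> W i" using i by (simp add: W_def)
        then show ?thesis by blast
      qed
      then have W: "W \<in> delta_covers b B"
        using \<delta> bd by (fastforce simp: delta_covers_def W_def intro: order_trans)
      have "?pre a A + ?pre b B \<le> (\<Sum>i. ?c (V i)) + (\<Sum>i. ?c (W i))"
        by (intro add_mono INF_lower V W)
      also have "\<dots> = (\<Sum>i. ?c (V i) + ?c (W i))"
        by (rule suminf_add) auto
      also have "(\<lambda>i. ?c (V i) + ?c (W i)) = (\<lambda>i. ?c (U i))"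
        by (auto simp: V_def W_def hausdorff_content_def)
      finally show ?thesis .
    qed
    then have "?pre a A + ?pre b B \<le> ?pre \<delta> (A \<union> B)"
      by (rule INF_greatest)
    also have "\<dots> \<le> hausdorff_outer k (A \<union> B)"
      using \<delta>(1) by (rule covers_le_hausdorff_outer)
    finally show ?thesis .
  qed
  have ne: "{0<..} \<noteq> ({} :: real set)"
    by (auto intro: exI[of _ 1])
  have "hausdorff_outer k A + ?pre b B \<le> hausdorff_outer k (A \<union> B)" if "0 < b" for b
    unfolding hausdorff_outer_def[of k A] ennreal_SUP_add_left[OF ne, symmetric]
    using pre that by (intro SUP_least) auto
  then show ?thesis
    unfolding hausdorff_outer_def[of k B] ennreal_SUP_add_right[OF ne]
    by (intro SUP_least) auto
qed

lemma closed_in_hausdorff_lambda_system: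
  fixes F :: "'a::metric_space set"
  assumes "closed F"
  shows "F \<in> lambda_system UNIV (Pow UNIV) (hausdorff_outer k)"
proof -
  let ?O = "hausdorff_outer k :: 'a set \<Rightarrow> ennreal"
  have "?O (S \<inter> F) + ?O (S - F) \<le> ?O S" for S
  proof (cases "F = {} \<or> ?O S = top")
    case True
    then show ?thesis by (auto simp: hausdorff_outer_empty)
  next
    case False
    then have ne: "F \<noteq> {}" and fin: "?O S < top"
      by (auto simp: less_top)
    define A where "A n = {x \<in> S. 1 / real (n + 1) \<le> infdist x F}" for n
    define E where "E n = A (n + 1) - A n" for n
    have dist_F: "infdist x F - infdist y F \<le> dist x y" for x y
      using infdist_triangle[of x F y] by simp
    have sum_step: "(\<Sum>i<N. ?O (E (2 * i + c))) \<le> ?O (\<Union>i<N. E (2 * i + c))" for N c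
    proof (induction N)
      case (Suc N)
      define e where "e = 1 / real (2 * N + c) - 1 / real (2 * N + c + 1)"
      show ?case
      proof (cases N)
        case 0
        then show ?thesis by (simp add: hausdorff_outer_empty lessThan_Suc)
      next
        case (Suc M)
        have "0 < e"
          unfolding e_def diff_gt_0_iff_gt using Suc by (intro divide_strict_left_mono) auto
        moreover have "e \<le> dist x y" if x: "x \<in> (\<Union>i<N. E (2 * i + c))" and y: "y \<in> E (2 * N + c)" for x y
        proof -
          obtain i where i: "i < N" "x \<in> E (2 * i + c)" using x by auto
          then have "1 / real (2 * i + c + 2) \<le> infdist x F"
            by (simp add: E_def A_def add.commute)
          moreover have "1 / real (2 * N + c) \<le> 1 / real (2 * i + c + 2)"
            using i(1) by (intro divide_left_mono) auto
          moreover have "infdist y F < 1 / real (2 * N + c + 1)"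
            using y by (auto simp: E_def A_def)
          ultimately show ?thesis
            using dist_F[of x y] by (simp add: e_def)
        qed
        ultimately have "?O (\<Union>i<N. E (2 * i + c)) + ?O (E (2 * N + c))
            \<le> ?O ((\<Union>i<N. E (2 * i + c)) \<union> E (2 * N + c))"
          by (rule hausdorff_outer_separated)
        moreover have "(\<Union>i<N. E (2 * i + c)) \<union> E (2 * N + c) = (\<Union>i<Suc N. E (2 * i + c))"
          by (simp add: lessThan_Suc Un_commute)
        ultimately show ?thesis
          using add_right_mono[OF Suc.IH, of "?O (E (2 * N + c))"]
          by (simp only: sum.lessThan_Suc)
      qed
    qed simp
    have half: "(\<Sum>i<N. ?O (E (2 * i + c))) \<le> ?O S" for N c
      using sum_step[where N = N and c = c]
      by (rule order_trans) (intro hausdorff_outer_mono, auto simp: E_def A_def)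
    have "(\<Sum>i<n. ?O (E i)) \<le> ?O S + ?O S" for n
    proof -
      have "(\<Sum>i<n. ?O (E i)) \<le> (\<Sum>i<2 * n. ?O (E i))"
        by (intro sum_mono2) auto
      also have "\<dots> = (\<Sum>i<n. ?O (E (2 * i + 0))) + (\<Sum>i<n. ?O (E (2 * i + 1)))"
        by (induction n) (auto simp: algebra_simps)
      also have "\<dots> \<le> ?O S + ?O S"
        by (intro add_mono half)
      finally show ?thesis .
    qed
    then have "(\<Sum>i. ?O (E i)) \<le> ?O S + ?O S"
      unfolding suminf_eq_SUP by (intro SUP_least)
    with fin have finE: "(\<Sum>i. ?O (E i)) < top"
      by (metis ennreal_add_less_top le_less_trans)
    have main: "?O (S \<inter> F) + ?O (S - F) + (\<Sum>i<n. ?O (E i)) \<le> ?O S + (\<Sum>i. ?O (E i))" for n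
    proof -
      have "S - F \<subseteq> A n \<union> (\<Union>i. E (i + n))"
      proof
        fix x assume x: "x \<in> S - F"
        then have "0 < infdist x F"
          using assms ne by (metis Diff_iff in_closed_iff_infdist_zero infdist_nonneg less_eq_real_def)
        then obtain m where m: "1 / real (m + 1) < infdist x F"
          using nat_approx_posE by (metis Suc_eq_plus1)
        define j where "j = (LEAST m. x \<in> A m)"
        have "x \<in> A m" using m x by (simp add: A_def)
        then have j: "x \<in> A j" unfolding j_def by (rule LeastI)
        show "x \<in> A n \<union> (\<Union>i. E (i + n))"
        proof (cases "j \<le> n")
          case True
          then have "1 / real (n + 1) \<le> 1 / real (j + 1)"
            by (simp add: field_simps)
          with j show ?thesis by (auto simp: A_def)
        next
          case False
          then have "x \<notin> A (j - 1)"
            unfolding j_def by (intro not_less_Least) auto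
          with j False have "x \<in> E ((j - 1 - n) + n)"
            by (auto simp: E_def)
          then show ?thesis by blast
        qed
      qed
      then have "?O (S - F) \<le> ?O (A n \<union> (\<Union>i. E (i + n)))"
        by (rule hausdorff_outer_mono)
      also have "\<dots> \<le> ?O (A n) + (\<Sum>i. ?O (E (i + n)))"
        using hausdorff_outer_Un_le hausdorff_outer_UN_le add_left_mono order_trans by blast
      finally have 1: "?O (S - F) \<le> ?O (A n) + (\<Sum>i. ?O (E (i + n)))" .
      have "?O (S \<inter> F) + ?O (A n) \<le> ?O (S \<inter> F \<union> A n)"
      proof (rule hausdorff_outer_separated)
        show "0 < 1 / real (n + 1)" by simp
        fix x y assume "x \<in> S \<inter> F" "y \<in> A n"
        then show "1 / real (n + 1) \<le> dist x y"
          using infdist_le[of x F y] by (auto simp: A_def dist_commute)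
      qed
      also have "\<dots> \<le> ?O S"
        by (intro hausdorff_outer_mono) (auto simp: A_def)
      finally have 2: "?O (S \<inter> F) + ?O (A n) \<le> ?O S" .
      have "?O (S \<inter> F) + ?O (S - F) + (\<Sum>i<n. ?O (E i))
          \<le> ?O (S \<inter> F) + (?O (A n) + (\<Sum>i. ?O (E (i + n)))) + (\<Sum>i<n. ?O (E i))"
        using 1 by (intro add_mono) auto
      also have "\<dots> = (?O (S \<inter> F) + ?O (A n)) + ((\<Sum>i. ?O (E (i + n))) + (\<Sum>i<n. ?O (E i)))"
        by (simp add: ac_simps)
      also have "(\<Sum>i. ?O (E (i + n))) + (\<Sum>i<n. ?O (E i)) = (\<Sum>i. ?O (E i))"
        by (subst suminf_offset[where i = n, symmetric]) (auto simp: ac_simps)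
      finally show ?thesis
        by (rule order_trans) (rule add_right_mono[OF 2])
    qed
    let ?T = "\<Sum>i. ?O (E i)"
    have "?O (S \<inter> F) + ?O (S - F) + ?T = (SUP n. ?O (S \<inter> F) + ?O (S - F) + (\<Sum>i<n. ?O (E i)))"
      by (simp only: suminf_eq_SUP ennreal_SUP_add_right[OF UNIV_not_empty])
    also have "\<dots> \<le> ?O S + ?T"
      by (rule SUP_least) (rule main)
    finally have "?T + (?O (S \<inter> F) + ?O (S - F)) \<le> ?T + ?O S"
      unfolding add.commute[of ?T] .
    then show ?thesis
      unfolding ennreal_add_left_cancel_le using finE by auto
  qed
  moreover have "?O S \<le> ?O (S \<inter> F) + ?O (S - F)" for S
    using hausdorff_outer_Un_le[of k "S \<inter> F" "S - F"] by (simp add: Int_Diff_Un)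
  ultimately show ?thesis
    unfolding algebra.lambda_system_eq[OF algebra_Pow] by (auto intro: antisym)
qed

lemma measure_space_hausdorff:
  "measure_space UNIV (lambda_system UNIV (Pow UNIV) (hausdorff_outer k)) (hausdorff_outer k)"
  using sigma_algebra.caratheodory_lemma[OF sigma_algebra_Pow outer_measure_space_hausdorff] .

lemma space_hausdorff_measure [simp]: "space (hausdorff_measure k) = UNIV"
  unfolding hausdorff_measure_def by (simp add: space_measure_of_conv)

lemma sets_hausdorff_measure:
  "sets (hausdorff_measure k :: 'a::metric_space measure) =
     lambda_system UNIV (Pow UNIV) (hausdorff_outer k)"
proof -
  have "sigma_algebra UNIV (lambda_system UNIV (Pow UNIV) (hausdorff_outer k :: 'a set \<Rightarrow> ennreal))"
    using measure_space_hausdorff[where 'a = 'a, of k] by (simp add: measure_space_def)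
  then show ?thesis
    unfolding hausdorff_measure_def by (rule sigma_algebra.sets_measure_of_eq)
qed

lemma emeasure_hausdorff_measure:
  fixes A :: "'a::metric_space set"
  assumes "A \<in> sets (hausdorff_measure k)"
  shows "emeasure (hausdorff_measure k) A = hausdorff_outer k A"
proof -
  let ?L = "lambda_system UNIV (Pow UNIV) (hausdorff_outer k :: 'a set \<Rightarrow> ennreal)"
  have "sigma_algebra UNIV ?L" "positive ?L (hausdorff_outer k)"
    "countably_additive ?L (hausdorff_outer k)"
    using measure_space_hausdorff[where 'a = 'a, of k] by (simp_all add: measure_space_def)
  then show ?thesis
    using assms unfolding sets_hausdorff_measure unfolding hausdorff_measure_def
    by (rule emeasure_measure_of_sigma)
qed

lemma borel_subset_sets_hausdorff_measure:
  "sets (borel :: 'a::metric_space measure) \<subseteq> sets (hausdorff_measure k)"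
proof -
  have "Collect closed \<subseteq> sets (hausdorff_measure k :: 'a measure)"
    unfolding sets_hausdorff_measure using closed_in_hausdorff_lambda_system by blast
  then have "sigma_sets UNIV (Collect closed) \<subseteq> sets (hausdorff_measure k :: 'a measure)"
    by (metis sets.sigma_sets_subset space_hausdorff_measure)
  then show ?thesis
    by (simp add: borel_eq_closed)
qed

section \<open>Domains, target sets and mollifiers\<close>

text \<open>Locally, after a rotation of the coordinate axes, the domain is the strict epigraph of a
  Lipschitz function over a hyperplane \<open>\<nu>\<^sup>\<bottom>\<close>.\<close>

definition lipschitz_boundary :: "'a::euclidean_space set \<Rightarrow> bool" where
  "lipschitz_boundary \<Omega> \<longleftrightarrow>
     (\<forall>x\<in>frontier \<Omega>. \<exists>\<nu> r (\<gamma> :: 'a \<Rightarrow> real) L.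
        norm \<nu> = 1 \<and> 0 < r \<and> lipschitz_on L {y. y \<bullet> \<nu> = 0} \<gamma> \<and>
        \<Omega> \<inter> ball x r = {y \<in> ball x r. \<gamma> (y - (y \<bullet> \<nu>) *\<^sub>R \<nu>) < y \<bullet> \<nu>})"

primrec continuously_differentiable :: "nat \<Rightarrow> (real^'n \<Rightarrow> real) \<Rightarrow> bool" where
  "continuously_differentiable 0 f \<longleftrightarrow> continuous_on UNIV f"
| "continuously_differentiable (Suc k) f \<longleftrightarrow>
     (\<forall>x. f differentiable (at x)) \<and>
     (\<forall>i. continuously_differentiable k (\<lambda>x. frechet_derivative f (at x) (axis i 1)))"

definition mollifier :: "(real^'n \<Rightarrow> real) \<Rightarrow> bool" where
  "mollifier \<rho> \<longleftrightarrow>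
     (\<forall>k. continuously_differentiable k \<rho>) \<and> compact (closure {x. \<rho> x \<noteq> 0}) \<and>
     (\<forall>x. 0 \<le> \<rho> x) \<and> (\<forall>x y. norm x = norm y \<longrightarrow> \<rho> x = \<rho> y) \<and>
     (\<integral>x. \<rho> x \<partial>lebesgue) = 1"

definition separation_property :: "(real^'n \<Rightarrow> real) \<Rightarrow> bool" where
  "separation_property \<rho> \<longleftrightarrow>
     (\<forall>\<tau>>0. ereal \<tau> < esssup lebesgue (\<lambda>z. ereal \<bar>\<rho> z\<bar>) \<longrightarrow>
        (\<exists>\<eta>>0. {z. \<tau> \<le> \<rho> z} = {z. norm z \<le> \<eta>}))"

text \<open>Only the values of \<open>d\<close> on \<open>K \<times> K\<close> matter: \<open>d\<close> is evaluated at \<open>(w x, w y)\<close> where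
  \<open>w\<close> is \<open>K\<close>-valued almost everywhere.\<close>

locale regularization_setting =
  fixes p s :: real and l :: nat
    and \<Omega> :: "(real^'n) set" and R :: real
    and K :: "(real^'m) set" and d :: "real^'m \<Rightarrow> real^'m \<Rightarrow> real"
    and \<rho> :: "real^'n \<Rightarrow> real"
  assumes p: "1 < p"
    and s: "0 < s" "s < 1"
    and l: "l \<in> {0, 1}"
    and domain: "\<Omega> \<noteq> {}" "bounded \<Omega>" "connected \<Omega>" "open \<Omega>" "lipschitz_boundary \<Omega>"
      "closure \<Omega> \<subseteq> ball 0 R"
    and target: "K \<noteq> {}" "closed K"
    and metric: "Metric_space K d"
    and equivalent: "\<exists>C>0. \<forall>a\<in>K. \<forall>b\<in>K. norm (a - b) \<le> d a b \<and> d a b \<le> C * norm (a - b)"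
    and rho: "mollifier \<rho>" "separation_property \<rho>"

section \<open>Function spaces\<close>

text \<open>Elements of Lebesgue and Sobolev spaces are represented by functions; functions that agree
  almost everywhere represent the same element, and the values of \<open>w\<close> outside \<open>\<Omega>\<close> are irrelevant.\<close>

definition Lp_space :: "'a measure \<Rightarrow> real \<Rightarrow> ('a \<Rightarrow> 'b::euclidean_space) set" where
  "Lp_space M p = {f \<in> borel_measurable M. (\<integral>\<^sup>+x. ennreal (norm (f x) powr p) \<partial>M) < \<infinity>}"

definition Lp_norm :: "'a measure \<Rightarrow> real \<Rightarrow> ('a \<Rightarrow> 'b::euclidean_space) \<Rightarrow> real" where
  "Lp_norm M p f = enn2real (\<integral>\<^sup>+x. ennreal (norm (f x) powr p) \<partial>M) powr (1 / p)"

text \<open>The \<open>p\<close>-th power of the Sobolev seminorm.\<close>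

definition sobolev_energy ::
  "real \<Rightarrow> real \<Rightarrow> (real^'n) set \<Rightarrow> (real^'n \<Rightarrow> real^'m) \<Rightarrow> ennreal" where
  "sobolev_energy s p \<Omega> w =
     (\<integral>\<^sup>+(x, y). ennreal (norm (w x - w y) powr p / norm (x - y) powr (real CARD('n) + p * s))
        \<partial>lebesgue_on (\<Omega> \<times> \<Omega>))"

definition sobolev ::
  "real \<Rightarrow> real \<Rightarrow> (real^'n) set \<Rightarrow> (real^'n \<Rightarrow> real^'m) set" where
  "sobolev s p \<Omega> = {w \<in> Lp_space (lebesgue_on \<Omega>) p. sobolev_energy s p \<Omega> w < \<infinity>}"

definition sobolev_norm ::
  "real \<Rightarrow> real \<Rightarrow> (real^'n) set \<Rightarrow> (real^'n \<Rightarrow> real^'m) \<Rightarrow> real" where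
  "sobolev_norm s p \<Omega> w =
     (Lp_norm (lebesgue_on \<Omega>) p w powr p + enn2real (sobolev_energy s p \<Omega> w)) powr (1 / p)"

definition sobolev_into ::
  "real \<Rightarrow> real \<Rightarrow> (real^'n) set \<Rightarrow> (real^'m) set \<Rightarrow> (real^'n \<Rightarrow> real^'m) set" where
  "sobolev_into s p \<Omega> K = {w \<in> sobolev s p \<Omega>. AE x in lebesgue_on \<Omega>. w x \<in> K}"

text \<open>Boundedness forces a functional to take equal values on functions that agree almost
  everywhere in \<open>\<Omega>\<close>, so these are exactly the elements of the dual space.\<close>

definition sobolev_dual ::
  "real \<Rightarrow> real \<Rightarrow> (real^'n) set \<Rightarrow> ((real^'n \<Rightarrow> real^'m) \<Rightarrow> real) set" where
  "sobolev_dual s p \<Omega> = {f.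
     (\<forall>u\<in>sobolev s p \<Omega>. \<forall>v\<in>sobolev s p \<Omega>. f (\<lambda>x. u x + v x) = f u + f v) \<and>
     (\<forall>c. \<forall>u\<in>sobolev s p \<Omega>. f (\<lambda>x. c *\<^sub>R u x) = c * f u) \<and>
     (\<exists>C. \<forall>u\<in>sobolev s p \<Omega>. \<bar>f u\<bar> \<le> C * sobolev_norm s p \<Omega> u)}"

definition weakly_converges ::
  "real \<Rightarrow> real \<Rightarrow> (real^'n) set \<Rightarrow> (nat \<Rightarrow> real^'n \<Rightarrow> real^'m) \<Rightarrow> (real^'n \<Rightarrow> real^'m) \<Rightarrow> bool" where
  "weakly_converges s p \<Omega> w w0 \<longleftrightarrow>
     (\<forall>k. w k \<in> sobolev s p \<Omega>) \<and> w0 \<in> sobolev s p \<Omega> \<and>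
     (\<forall>f\<in>sobolev_dual s p \<Omega>. (\<lambda>k. f (w k)) \<longlonglongrightarrow> f w0)"

section \<open>Transforms\<close>

text \<open>The (completed) product of Lebesgue measure on \<open>[0, \<infinity>)\<close> and surface measure on the sphere.\<close>

definition Sigma_measure :: "(real \<times> (real^'n)) measure" where
  "Sigma_measure =
     completion (lebesgue_on {0..} \<Otimes>\<^sub>M
       restrict_space (hausdorff_measure (CARD('n) - 1)) (sphere 0 1))"

definition zero_extension :: "'a set \<Rightarrow> ('a \<Rightarrow> 'b::zero) \<Rightarrow> 'a \<Rightarrow> 'b" where
  "zero_extension \<Omega> w x = (if x \<in> \<Omega> then w x else 0)"

definition radon_transform ::
  "(real^'n) set \<Rightarrow> (real^'n \<Rightarrow> real^'m) \<Rightarrow> real \<times> (real^'n) \<Rightarrow> real^'m" where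
  "radon_transform \<Omega> w = (\<lambda>(r, \<phi>). \<chi> i.
     (LINT x : {x. x \<bullet> \<phi> = r} | hausdorff_measure (CARD('n) - 1). zero_extension \<Omega> w x $ i))"

text \<open>A point \<open>\<theta> = (cos \<phi>, sin \<phi>)\<close> of the circle stands for its angle \<open>\<phi>\<close>.\<close>

definition perp :: "real^2 \<Rightarrow> real^2" where
  "perp \<theta> = vector [- (\<theta> $ 2), \<theta> $ 1]"

definition ray_transform ::
  "(real^2) set \<Rightarrow> (real^2 \<Rightarrow> real^2) \<Rightarrow> real \<times> (real^2) \<Rightarrow> real" where
  "ray_transform \<Omega> w = (\<lambda>(r, \<theta>).
     (LINT t | lebesgue. zero_extension \<Omega> w (r *\<^sub>R \<theta> + t *\<^sub>R perp \<theta>) \<bullet> perp \<theta>))"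

section \<open>Regularization\<close>

definition regularizer ::
  "real \<Rightarrow> real \<Rightarrow> nat \<Rightarrow> (real^'n) set \<Rightarrow> (real^'m \<Rightarrow> real^'m \<Rightarrow> real) \<Rightarrow> (real^'n \<Rightarrow> real)
    \<Rightarrow> (real^'n \<Rightarrow> real^'m) \<Rightarrow> ennreal" where
  "regularizer s p l \<Omega> d \<rho> w =
     (\<integral>\<^sup>+(x, y). ennreal (d (w x) (w y) powr p / norm (x - y) powr (real CARD('n) + p * s)
          * \<rho> (x - y) ^ l) \<partial>lebesgue_on (\<Omega> \<times> \<Omega>))"

text \<open>Below, \<open>D\<close> is the admissible set, \<open>F\<close> the forward operator and \<open>\<Phi>\<close> the regularizer.\<close>

definition tikhonov ::
  "real \<Rightarrow> ((real^'n \<Rightarrow> real^'m) \<Rightarrow> real \<times> (real^'n) \<Rightarrow> 'b::euclidean_space)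
    \<Rightarrow> ((real^'n \<Rightarrow> real^'m) \<Rightarrow> ennreal) \<Rightarrow> real \<Rightarrow> (real \<times> (real^'n) \<Rightarrow> 'b)
    \<Rightarrow> (real^'n \<Rightarrow> real^'m) \<Rightarrow> ennreal" where
  "tikhonov p F \<Phi> \<alpha> v w =
     (\<integral>\<^sup>+z. ennreal (norm (F w z - v z) powr p) \<partial>Sigma_measure) + ennreal \<alpha> * \<Phi> w"

definition minimizers :: "'a set \<Rightarrow> ('a \<Rightarrow> ennreal) \<Rightarrow> 'a set" where
  "minimizers D J = {w \<in> D. \<forall>u\<in>D. J w \<le> J u}"

definition solutions ::
  "(real^'n \<Rightarrow> real^'m) set \<Rightarrow> ((real^'n \<Rightarrow> real^'m) \<Rightarrow> real \<times> (real^'n) \<Rightarrow> 'b::euclidean_space)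
    \<Rightarrow> (real \<times> (real^'n) \<Rightarrow> 'b) \<Rightarrow> (real^'n \<Rightarrow> real^'m) set" where
  "solutions D F v = {w \<in> D. AE z in Sigma_measure. F w z = v z}"

definition minimizing_solutions ::
  "(real^'n \<Rightarrow> real^'m) set \<Rightarrow> ((real^'n \<Rightarrow> real^'m) \<Rightarrow> real \<times> (real^'n) \<Rightarrow> 'b::euclidean_space)
    \<Rightarrow> ((real^'n \<Rightarrow> real^'m) \<Rightarrow> ennreal) \<Rightarrow> (real \<times> (real^'n) \<Rightarrow> 'b) \<Rightarrow> (real^'n \<Rightarrow> real^'m) set" where
  "minimizing_solutions D F \<Phi> v =
     {w \<in> solutions D F v. \<Phi> w = (INF u\<in>solutions D F v. \<Phi> u)}"

text \<open>The first conjunct says that the functional is finite on \<open>D\<close>, i.e. \<open>[0, \<infinity>)\<close>-valued.\<close>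

definition tikhonov_existence ::
  "real \<Rightarrow> (real^'n \<Rightarrow> real^'m) set
    \<Rightarrow> ((real^'n \<Rightarrow> real^'m) \<Rightarrow> real \<times> (real^'n) \<Rightarrow> 'b::euclidean_space)
    \<Rightarrow> ((real^'n \<Rightarrow> real^'m) \<Rightarrow> ennreal) \<Rightarrow> bool" where
  "tikhonov_existence p D F \<Phi> \<longleftrightarrow>
     (\<forall>v\<in>Lp_space Sigma_measure p. \<forall>\<alpha>>0.
        (\<forall>w\<in>D. tikhonov p F \<Phi> \<alpha> v w < \<infinity>) \<and> minimizers D (tikhonov p F \<Phi> \<alpha> v) \<noteq> {})"

definition tikhonov_stability ::
  "real \<Rightarrow> real \<Rightarrow> (real^'n) set \<Rightarrow> (real^'n \<Rightarrow> real^'m) set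
    \<Rightarrow> ((real^'n \<Rightarrow> real^'m) \<Rightarrow> real \<times> (real^'n) \<Rightarrow> 'b::euclidean_space)
    \<Rightarrow> ((real^'n \<Rightarrow> real^'m) \<Rightarrow> ennreal) \<Rightarrow> bool" where
  "tikhonov_stability s p \<Omega> D F \<Phi> \<longleftrightarrow>
     (\<forall>\<alpha>>0. \<forall>v\<delta>\<in>Lp_space Sigma_measure p. \<forall>v w.
        (\<forall>k. v k \<in> Lp_space Sigma_measure p) \<and>
        (\<lambda>k. Lp_norm Sigma_measure p (\<lambda>z. v\<delta> z - v k z)) \<longlonglongrightarrow> 0 \<and>
        (\<forall>k. w k \<in> minimizers D (tikhonov p F \<Phi> \<alpha> (v k))) \<longrightarrow>
        (\<exists>j w'. strict_mono j \<and> weakly_converges s p \<Omega> (w \<circ> j) w') \<and>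
        (\<forall>j w'. strict_mono j \<and> weakly_converges s p \<Omega> (w \<circ> j) w' \<longrightarrow>
           w' \<in> minimizers D (tikhonov p F \<Phi> \<alpha> v\<delta>) \<and> (\<lambda>i. \<Phi> (w (j i))) \<longlonglongrightarrow> \<Phi> w'))"

definition tikhonov_convergence ::
  "real \<Rightarrow> real \<Rightarrow> (real^'n) set \<Rightarrow> (real^'n \<Rightarrow> real^'m) set
    \<Rightarrow> ((real^'n \<Rightarrow> real^'m) \<Rightarrow> real \<times> (real^'n) \<Rightarrow> 'b::euclidean_space)
    \<Rightarrow> ((real^'n \<Rightarrow> real^'m) \<Rightarrow> ennreal) \<Rightarrow> (real \<times> (real^'n) \<Rightarrow> 'b) \<Rightarrow> bool" where
  "tikhonov_convergence s p \<Omega> D F \<Phi> v0 \<longleftrightarrow>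
     (\<forall>\<alpha> :: real \<Rightarrow> real. \<forall>\<delta> v w.
        (\<forall>t>0. 0 < \<alpha> t) \<and> (\<alpha> \<longlongrightarrow> 0) (at_right 0) \<and>
        ((\<lambda>t. t powr p / \<alpha> t) \<longlongrightarrow> 0) (at_right 0) \<and>
        (\<forall>k. 0 < \<delta> k) \<and> \<delta> \<longlonglongrightarrow> 0 \<and>
        (\<forall>k. v k \<in> Lp_space Sigma_measure p) \<and>
        (\<forall>k. Lp_norm Sigma_measure p (\<lambda>z. v0 z - v k z) \<le> \<delta> k) \<and>
        (\<forall>k. w k \<in> minimizers D (tikhonov p F \<Phi> (\<alpha> (\<delta> k)) (v k))) \<longrightarrow>
        (\<exists>j w'. strict_mono j \<and> weakly_converges s p \<Omega> (w \<circ> j) w' \<and>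
           w' \<in> minimizing_solutions D F \<Phi> v0 \<and> (\<lambda>i. \<Phi> (w (j i))) \<longlonglongrightarrow> \<Phi> w') \<and>
        (\<forall>w'\<in>minimizing_solutions D F \<Phi> v0.
           (\<forall>u\<in>minimizing_solutions D F \<Phi> v0. AE x in lebesgue_on \<Omega>. u x = w' x) \<longrightarrow>
           weakly_converges s p \<Omega> w w' \<and> (\<lambda>k. \<Phi> (w k)) \<longlonglongrightarrow> \<Phi> w'))"

end

theory Submission
  imports Defs "HOL-Complex_Analysis.Great_Picard"
begin

text \<open>Both transforms average \<open>w\<close> over the slices \<open>x \<bullet> \<phi> = r\<close>: integrating the slice measures over \<open>r\<close> gives at most
  a constant times Lebesgue measure, so by Jensen's inequality they are Lipschitz from \<open>L\<^sup>p(\<Omega>)\<close> to \<open>L\<^sup>p(\<Sigma>)\<close>, and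
  only the zero constant is mapped to zero. The separation property bounds \<open>\<Phi>\<close> from below by the Sobolev energy of
  near pairs, hence by the full energy up to the \<open>L\<^sup>p\<close> norm. If the \<open>L\<^sup>p\<close> norms of a sequence with bounded values
  of the functional were unbounded, its normalisations would converge to a nonzero constant function in the kernel of
  the operator; so such sequences are bounded. Bounded sequences in \<open>W\<^sup>s\<^sup>,\<^sup>p(\<Omega>)\<close> are relatively
  compact in \<open>L\<^sup>p(\<Omega>)\<close>, and a bounded sequence that converges in \<open>L\<^sup>p\<close> converges weakly in \<open>W\<^sup>s\<^sup>,\<^sup>p\<close>. Since \<open>\<Phi>\<close> is
  lower semicontinuous under \<open>L\<^sup>p\<close> convergence by Fatou's lemma, the direct method applies.\<close>

section \<open>Uniform convexity\<close>

text \<open>The target set \<open>K\<close> need not be convex, so convexity cannot provide lower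
  semicontinuity of the regularizer: limits are taken along almost everywhere convergent
  subsequences, and weak convergence is recovered afterwards. Elements of
  \<open>sobolev_dual\<close> are bounded functionals without a representation formula; weak
  convergence is therefore extracted from the geometry of the norm, by a Mazur-type argument with
  midpoints. For the transforms, comparisons up to constants suffice. A cube of side h is met by
  slices only for r in an interval of length proportional to h, and each slice of it has measure at
  most a constant times the appropriate power of h. Hence the integrated slice measures are
  dominated by Lebesgue measure on cubes, and then on Borel sets. In particular a null set meets
  almost every slice in a null set, so functions may be replaced by Borel representatives.
  Conversely, thickening a set by a unit segment shows that hyperplane slices and spherical caps cut
  out by open sets have positive measure, which is needed to detect nonzero constants.\<close>

lemma powr_above_tangent_strict:
  fixes p s t :: real
  assumes p: "1 < p" and "0 \<le> s" "0 \<le> t" "s \<noteq> t"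
  shows "s powr p + p * s powr (p - 1) * (t - s) < t powr p"
proof -
  have D: "((\<lambda>x. x powr p) has_real_derivative p * x powr (p - 1)) (at x)" if "0 < x" for x :: real
    using that by (auto intro!: derivative_eq_intros)
  consider "s = 0" | "0 < s" "t = 0" | "0 < s" "s < t" | "0 < t" "t < s"
    using assms by linarith
  then show ?thesis
  proof cases
    case 1
    then show ?thesis using assms by simp
  next
    case 2
    have "s powr p = s powr (p - 1) * s" using 2 powr_add[of s "p - 1" 1] by simp
    then have "s powr p + p * s powr (p - 1) * (t - s) = - ((p - 1) * s powr p)"
      using 2 by (simp add: algebra_simps)
    also have "\<dots> < 0" using p 2 by simp
    finally show ?thesis using 2 by simp
  next
    case 3
    obtain x where x: "s < x" "x < t" "t powr p - s powr p = (t - s) * (p * x powr (p - 1))"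
      using MVT2[OF 3(2), of "\<lambda>x. x powr p" "\<lambda>x. p * x powr (p - 1)"] D 3(1) by auto
    have "s powr (p - 1) < x powr (p - 1)" using x 3 p by (intro powr_less_mono2) auto
    then have "(t - s) * (p * s powr (p - 1)) < (t - s) * (p * x powr (p - 1))"
      using 3 p by simp
    with x(3) show ?thesis by (simp add: algebra_simps)
  next
    case 4
    obtain x where x: "t < x" "x < s" "s powr p - t powr p = (s - t) * (p * x powr (p - 1))"
      using MVT2[OF 4(2), of "\<lambda>x. x powr p" "\<lambda>x. p * x powr (p - 1)"] D 4(1) by auto
    have "x powr (p - 1) < s powr (p - 1)" using x 4 p by (intro powr_less_mono2) auto
    then have "(s - t) * (p * x powr (p - 1)) < (s - t) * (p * s powr (p - 1))"
      using 4 p by simp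
    with x(3) show ?thesis by (simp add: algebra_simps)
  qed
qed

lemma powr_above_tangent:
  fixes p s t :: real
  assumes "1 < p" "0 \<le> s" "0 \<le> t"
  shows "s powr p + p * s powr (p - 1) * (t - s) \<le> t powr p"
  using powr_above_tangent_strict[OF assms] by (cases "s = t") auto

lemma powr_convex_combination:
  fixes p t x y :: real
  assumes p: "1 < p" and "0 \<le> x" "0 \<le> y" "0 \<le> t" "t \<le> 1"
  shows "((1 - t) * x + t * y) powr p \<le> (1 - t) * x powr p + t * y powr p"
proof -
  define s where "s = (1 - t) * x + t * y"
  define q where "q = p * s powr (p - 1)"
  have "0 \<le> s" using assms by (simp add: s_def)
  have "(1 - t) * (s powr p + q * (x - s)) + t * (s powr p + q * (y - s))
      \<le> (1 - t) * x powr p + t * y powr p"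
    using assms \<open>0 \<le> s\<close> powr_above_tangent[OF p] unfolding q_def
    by (intro add_mono mult_left_mono) auto
  also have "(1 - t) * (s powr p + q * (x - s)) + t * (s powr p + q * (y - s)) = s powr p"
    by (simp add: s_def algebra_simps)
  finally show ?thesis by (simp add: s_def)
qed

text \<open>Convexity applied to \<open>a + b\<close> as a combination of \<open>a / (1 - t)\<close>
  and \<open>b / t\<close>. The weight \<open>t\<close> stays free because the coefficient of
  \<open>a\<close> tends to \<open>1\<close> as \<open>t\<close> tends to \<open>0\<close>; this
  replaces the triangle inequality in limits of \<open>p\<close>-th powers.\<close>

lemma norm_add_powr_le:
  fixes a b :: "'a::real_normed_vector"
  assumes p: "1 < p" and t: "0 < t" "t < 1"
  shows "norm (a + b) powr p \<le> (1 - t) powr (1 - p) * norm a powr p + t powr (1 - p) * norm b powr p"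
proof -
  have "norm (a + b) \<le> (1 - t) * (norm a / (1 - t)) + t * (norm b / t)"
    using t norm_triangle_ineq[of a b] by simp
  then have "norm (a + b) powr p \<le> ((1 - t) * (norm a / (1 - t)) + t * (norm b / t)) powr p"
    using p by (intro powr_mono2) auto
  also have "\<dots> \<le> (1 - t) * (norm a / (1 - t)) powr p + t * (norm b / t) powr p"
    using p t by (intro powr_convex_combination) auto
  also have "\<dots> = (1 - t) powr (1 - p) * norm a powr p + t powr (1 - p) * norm b powr p"
    using t by (simp add: powr_divide powr_diff)
  finally show ?thesis .
qed

lemma norm_add_powr_le2:
  fixes a b :: "'a::real_normed_vector"
  assumes p: "1 < p"
  shows "norm (a + b) powr p \<le> 2 powr p * (norm a powr p + norm b powr p)"
proof -
  have "(1/2::real) powr (1 - p) \<le> 2 powr p"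
    using p by (simp add: powr_divide powr_minus_divide[symmetric] powr_mono)
  then have "(1/2) powr (1 - p) * (norm a powr p + norm b powr p) \<le> 2 powr p * (norm a powr p + norm b powr p)"
    by (intro mult_right_mono) auto
  then show ?thesis
    using norm_add_powr_le[OF p, of "1/2" a b] by (simp add: algebra_simps)
qed

lemma norm_diff_powr_le2:
  fixes a b :: "'a::real_normed_vector"
  assumes p: "1 < p"
  shows "norm (a - b) powr p \<le> 2 powr p * (norm a powr p + norm b powr p)"
  using norm_add_powr_le2[OF p, of a "-b"] by simp

text \<open>For equal norms the triangle inequality is strict, since equality would force
  \<open>a = b\<close>. For different norms the strictness comes from the power function, through
  its tangent at the mean \<open>s\<close> of the norms.\<close>

lemma norm_midpoint_powr_less:
  fixes a b :: "'a::real_inner"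
  assumes p: "1 < p" and "a \<noteq> b"
  shows "norm ((1/2) *\<^sub>R (a + b)) powr p < (norm a powr p + norm b powr p) / 2"
proof (cases "norm a = norm b")
  case True
  have "norm (a + b) \<noteq> norm a + norm b"
    using assms(2) True norm_triangle_eq[of a b] by auto
  then have "norm (a + b) < norm a + norm b"
    using norm_triangle_ineq[of a b] by linarith
  then have "norm ((1/2) *\<^sub>R (a + b)) < norm a"
    using True by simp
  then have "norm ((1/2) *\<^sub>R (a + b)) powr p < norm a powr p"
    using p by (intro powr_less_mono2) auto
  then show ?thesis using True by simp
next
  case False
  define s where "s = (norm a + norm b) / 2"
  define q where "q = p * s powr (p - 1)"
  have "norm ((1/2) *\<^sub>R (a + b)) \<le> s"
    using norm_triangle_ineq[of a b] by (simp add: s_def)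
  then have "norm ((1/2) *\<^sub>R (a + b)) powr p \<le> s powr p"
    using p by (intro powr_mono2) auto
  moreover have "s powr p + q * (norm a - s) < norm a powr p" "s powr p + q * (norm b - s) < norm b powr p"
    using powr_above_tangent_strict[OF p, of s] False by (auto simp: s_def q_def)
  moreover have "q * (norm a - s) = - (q * (norm b - s))"
    by (simp add: s_def algebra_simps)
  ultimately show ?thesis by auto
qed

text \<open>Both sides are homogeneous of degree \<open>p\<close>, so compactness of the unit sphere of pairs turns
  strict convexity into a uniform estimate.\<close>

lemma uniform_convexity_powr:
  fixes \<eta> p :: real
  assumes p: "1 < p" and \<eta>: "0 < \<eta>"
  obtains c where "0 < c" "\<And>a b :: 'a::euclidean_space. norm (a - b) powr p
      \<le> \<eta> * (norm a powr p + norm b powr p)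
        + c * ((norm a powr p + norm b powr p) / 2 - norm ((1/2) *\<^sub>R (a + b)) powr p)"
proof -
  define \<psi> :: "'a \<times> 'a \<Rightarrow> real" where
    "\<psi> z = (norm (fst z) powr p + norm (snd z) powr p) / 2 - norm ((1/2) *\<^sub>R (fst z + snd z)) powr p" for z
  define \<beta> :: "'a \<times> 'a \<Rightarrow> real" where
    "\<beta> z = norm (fst z - snd z) powr p - \<eta> * (norm (fst z) powr p + norm (snd z) powr p)" for z
  have cont: "continuous_on UNIV \<psi>" "continuous_on UNIV \<beta>"
    unfolding \<psi>_def \<beta>_def using p by (auto intro!: continuous_intros continuous_on_powr')
  \<comment> \<open>Only pairs in \<open>S\<close> need a constant: elsewhere on the sphere
    \<open>\<beta>\<close> is negative while \<open>\<psi>\<close> is nonnegative.\<close>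
  define S where "S = sphere 0 1 \<inter> {z. 0 \<le> \<beta> z}"
  have "closed {z. 0 \<le> \<beta> z}"
    using cont by (intro closed_Collect_le) auto
  then have S: "compact S"
    unfolding S_def by (intro compact_Int_closed) auto
  have pos: "0 < \<psi> z" if "z \<in> S" for z
  proof -
    have "fst z \<noteq> snd z"
    proof
      assume e: "fst z = snd z"
      then have "\<eta> * (norm (fst z) powr p + norm (snd z) powr p) \<le> 0"
        using that p by (simp add: S_def \<beta>_def)
      then have "fst z = 0" using \<eta> e by (simp add: mult_le_0_iff)
      with e have "z = 0" by (simp add: prod_eq_iff)
      with that show False by (simp add: S_def)
    qed
    then show ?thesis
      using norm_midpoint_powr_less[OF p, of "fst z" "snd z"] by (simp add: \<psi>_def)
  qed
  obtain m where m: "0 < m" "\<And>z. z \<in> S \<Longrightarrow> m \<le> \<psi> z"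
  proof (cases "S = {}")
    case True
    then show ?thesis using that[of 1] by auto
  next
    case False
    obtain z where "z \<in> S" "\<And>y. y \<in> S \<Longrightarrow> \<psi> z \<le> \<psi> y"
      using continuous_attains_inf[OF S False] continuous_on_subset[OF cont(1)] by (metis top_greatest)
    with pos show ?thesis using that[of "\<psi> z"] by auto
  qed
  have \<psi>0: "0 \<le> \<psi> z" for z
    using norm_midpoint_powr_less[OF p, of "fst z" "snd z"]
    by (cases "fst z = snd z") (auto simp: \<psi>_def scaleR_2[symmetric])
  \<comment> \<open>On the unit sphere \<open>\<beta>\<close> is at most \<open>2 powr p\<close>,
    and on \<open>S\<close> the convexity defect \<open>\<psi>\<close> is at least
    \<open>m\<close>.\<close>
  define c where "c = 2 powr p / m"
  have c: "0 < c" using m by (simp add: c_def)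
  have sph: "\<beta> z \<le> c * \<psi> z" if z: "norm z = 1" for z
  proof (cases "z \<in> S")
    case True
    have "norm (fst z - snd z) \<le> norm (fst z) + norm (snd z)" by (rule norm_triangle_ineq4)
    also have "\<dots> \<le> 2" using norm_fst_le[of "fst z" "snd z"] norm_snd_le[of "snd z" "fst z"] z by simp
    finally have "norm (fst z - snd z) powr p \<le> 2 powr p" using p by (intro powr_mono2) auto
    moreover have "0 \<le> \<eta> * (norm (fst z) powr p + norm (snd z) powr p)"
      using \<eta> by (intro mult_nonneg_nonneg add_nonneg_nonneg) auto
    ultimately have "\<beta> z \<le> 2 powr p"
      unfolding \<beta>_def by linarith
    also have "\<dots> = c * m" using m by (simp add: c_def)
    also have "\<dots> \<le> c * \<psi> z" using m True c by (intro mult_left_mono) auto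
    finally show ?thesis .
  next
    case False
    then have "\<beta> z < 0" using z by (simp add: S_def)
    also have "0 \<le> c * \<psi> z" using c \<psi>0 by simp
    finally show ?thesis by simp
  qed
  have "\<beta> z \<le> c * \<psi> z" for z
  proof (cases "z = 0")
    case True
    then show ?thesis using p by (simp add: \<beta>_def \<psi>_def)
  next
    case False
    define r where "r = norm z"
    have r: "0 < r" using False by (simp add: r_def)
    define y where "y = (1/r) *\<^sub>R z"
    have y: "norm y = 1" "z = r *\<^sub>R y" using r by (auto simp: y_def r_def)
    have hom: "norm (r *\<^sub>R a) powr p = r powr p * norm a powr p" for a :: 'a
      using r by (simp add: powr_mult)
    have "norm (fst z - snd z) powr p = r powr p * norm (fst y - snd y) powr p"
      using hom[of "fst y - snd y"] by (simp add: y algebra_simps)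
    moreover have "norm ((1/2) *\<^sub>R (fst z + snd z)) powr p = r powr p * norm ((1/2) *\<^sub>R (fst y + snd y)) powr p"
      using hom[of "(1/2) *\<^sub>R (fst y + snd y)"] by (simp add: y algebra_simps)
    moreover have "norm (fst z) powr p = r powr p * norm (fst y) powr p" "norm (snd z) powr p = r powr p * norm (snd y) powr p"
      using hom[of "fst y"] hom[of "snd y"] by (simp_all add: y)
    ultimately have "\<beta> z = r powr p * \<beta> y" "\<psi> z = r powr p * \<psi> y"
      by (simp_all add: \<beta>_def \<psi>_def algebra_simps add_divide_distrib)
    then show ?thesis using sph[OF y(1)] r by (simp add: mult.left_commute)
  qed
  then have "norm (a - b) powr p \<le> \<eta> * (norm a powr p + norm b powr p)
        + c * ((norm a powr p + norm b powr p) / 2 - norm ((1/2) *\<^sub>R (a + b)) powr p)" for a b :: 'a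
    unfolding \<beta>_def \<psi>_def by (metis (no_types, lifting) diff_le_eq fst_conv snd_conv add.commute)
  with c show ?thesis by (rule that)
qed

section \<open>Spaces of p-integrable functions\<close>

text \<open>Keeping the \<open>p\<close>-th power in \<open>ennreal\<close> frees the estimates from
  finiteness hypotheses and from roots.\<close>

definition Lp_pow :: "'a measure \<Rightarrow> real \<Rightarrow> ('a \<Rightarrow> 'b::euclidean_space) \<Rightarrow> ennreal" where
  "Lp_pow M p f = (\<integral>\<^sup>+x. ennreal (norm (f x) powr p) \<partial>M)"

lemma Lp_space_iff: "f \<in> Lp_space M p \<longleftrightarrow> f \<in> borel_measurable M \<and> Lp_pow M p f < \<infinity>"
  by (simp add: Lp_space_def Lp_pow_def)

lemma Lp_pow_cong_AE: "AE x in M. f x = g x \<Longrightarrow> Lp_pow M p f = Lp_pow M p g"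
  unfolding Lp_pow_def by (rule nn_integral_cong_AE) auto

lemma Lp_pow_diff_commute: "Lp_pow M p (\<lambda>x. f x - g x) = Lp_pow M p (\<lambda>x. g x - f x)"
  unfolding Lp_pow_def by (simp add: norm_minus_commute)

lemma Lp_pow_scaleR: "Lp_pow M p (\<lambda>x. c *\<^sub>R f x) = ennreal (\<bar>c\<bar> powr p) * Lp_pow M p f"
  if "f \<in> borel_measurable M"
  unfolding Lp_pow_def using that
  by (subst nn_integral_cmult[symmetric]) (auto simp: powr_mult ennreal_mult intro!: nn_integral_cong)

lemma Lp_pow_zero_iff:
  assumes "f \<in> borel_measurable M"
  shows "Lp_pow M p f = 0 \<longleftrightarrow> (AE x in M. f x = 0)"
  unfolding Lp_pow_def using assms by (subst nn_integral_0_iff_AE) auto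

lemma Lp_pow_add_le:
  assumes p: "1 < p" and t: "0 < t" "t < 1"
    and [measurable]: "f \<in> borel_measurable M" "g \<in> borel_measurable M"
  shows "Lp_pow M p (\<lambda>x. f x + g x)
    \<le> ennreal ((1 - t) powr (1 - p)) * Lp_pow M p f + ennreal (t powr (1 - p)) * Lp_pow M p g"
proof -
  have "Lp_pow M p (\<lambda>x. f x + g x) \<le> (\<integral>\<^sup>+x. ennreal ((1 - t) powr (1 - p)) * ennreal (norm (f x) powr p)
      + ennreal (t powr (1 - p)) * ennreal (norm (g x) powr p) \<partial>M)"
    unfolding Lp_pow_def
  proof (rule nn_integral_mono)
    fix x
    show "ennreal (norm (f x + g x) powr p) \<le> ennreal ((1 - t) powr (1 - p)) * ennreal (norm (f x) powr p)
      + ennreal (t powr (1 - p)) * ennreal (norm (g x) powr p)"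
      using norm_add_powr_le[OF p t, of "f x" "g x"] t
      by (simp add: ennreal_mult[symmetric] ennreal_plus[symmetric] del: ennreal_plus)
  qed
  also have "\<dots> = ennreal ((1 - t) powr (1 - p)) * Lp_pow M p f + ennreal (t powr (1 - p)) * Lp_pow M p g"
    unfolding Lp_pow_def by (simp add: nn_integral_add nn_integral_cmult)
  finally show ?thesis .
qed

lemma Lp_pow_add_le2:
  assumes p: "1 < p"
    and [measurable]: "f \<in> borel_measurable M" "g \<in> borel_measurable M"
  shows "Lp_pow M p (\<lambda>x. f x + g x) \<le> ennreal (2 powr p) * (Lp_pow M p f + Lp_pow M p g)"
proof -
  have "Lp_pow M p (\<lambda>x. f x + g x)
      \<le> (\<integral>\<^sup>+x. ennreal (2 powr p) * (ennreal (norm (f x) powr p) + ennreal (norm (g x) powr p)) \<partial>M)"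
    unfolding Lp_pow_def
  proof (rule nn_integral_mono)
    fix x
    show "ennreal (norm (f x + g x) powr p)
        \<le> ennreal (2 powr p) * (ennreal (norm (f x) powr p) + ennreal (norm (g x) powr p))"
      using norm_add_powr_le2[OF p, of "f x" "g x"]
      by (simp add: ennreal_mult[symmetric] ennreal_plus[symmetric] del: ennreal_plus)
  qed
  also have "\<dots> = ennreal (2 powr p) * (Lp_pow M p f + Lp_pow M p g)"
    unfolding Lp_pow_def by (simp add: nn_integral_add nn_integral_cmult)
  finally show ?thesis .
qed

lemma Lp_pow_diff_le2:
  assumes p: "1 < p"
    and [measurable]: "f \<in> borel_measurable M" "g \<in> borel_measurable M"
  shows "Lp_pow M p (\<lambda>x. f x - g x) \<le> ennreal (2 powr p) * (Lp_pow M p f + Lp_pow M p g)"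
  using Lp_pow_add_le2[OF p, of f M "\<lambda>x. - g x"] by (simp add: Lp_pow_def)

lemma Lp_space_add:
  assumes "1 < p" "f \<in> Lp_space M p" "g \<in> Lp_space M p"
  shows "(\<lambda>x. f x + g x) \<in> Lp_space M p"
  using assms Lp_pow_add_le2[of p f M g]
  by (auto simp: Lp_space_iff ennreal_mult_less_top intro: le_less_trans)

lemma Lp_space_scaleR:
  assumes "f \<in> Lp_space M p"
  shows "(\<lambda>x. c *\<^sub>R f x) \<in> Lp_space M p"
  using assms by (auto simp: Lp_space_iff ennreal_mult_less_top Lp_pow_scaleR)

lemma Lp_space_diff:
  assumes "1 < p" "f \<in> Lp_space M p" "g \<in> Lp_space M p"
  shows "(\<lambda>x. f x - g x) \<in> Lp_space M p"
  using Lp_space_add[OF assms(1,2) Lp_space_scaleR[OF assms(3), of "-1"]] by simp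

lemma Lp_space_cong_AE:
  assumes "f \<in> Lp_space M p" "g \<in> borel_measurable M" "AE x in M. f x = g x"
  shows "g \<in> Lp_space M p"
  using assms Lp_pow_cong_AE[OF assms(3)] by (auto simp: Lp_space_iff)

section \<open>Limits, Jensen's inequality and completeness for \<open>p\<close>-th powers\<close>

text \<open>For fixed \<open>t\<close> the term \<open>b t * Y k\<close> vanishes as
  \<open>k\<close> grows, even if \<open>b\<close> blows up at \<open>0\<close>; only then does
  \<open>t\<close> tend to \<open>0\<close>, which brings the factor \<open>a t\<close> to
  \<open>1\<close>.\<close>

lemma tendsto_of_two_sided_bounds:
  fixes x :: real and X Y :: "nat \<Rightarrow> real" and a b :: "real \<Rightarrow> real"
  assumes Y: "Y \<longlonglongrightarrow> 0" and a: "(a \<longlongrightarrow> 1) (at_right 0)"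
    and pos: "\<And>t. 0 < t \<Longrightarrow> t < 1 \<Longrightarrow> 0 < a t"
    and up: "\<And>t. 0 < t \<Longrightarrow> t < 1 \<Longrightarrow> eventually (\<lambda>k. X k \<le> a t * x + b t * Y k) sequentially"
    and lo: "\<And>t. 0 < t \<Longrightarrow> t < 1 \<Longrightarrow> eventually (\<lambda>k. x \<le> a t * X k + b t * Y k) sequentially"
  shows "X \<longlonglongrightarrow> x"
proof (rule order_tendstoI)
  have small: "eventually (\<lambda>t. 0 < t \<and> t < 1) (at_right (0::real))"
    using eventually_at_right[of 0 "1::real"] by (auto intro: exI[of _ 1])
  fix c
  {
    assume "c < x"
    have "((\<lambda>t. x / a t) \<longlongrightarrow> x / 1) (at_right 0)"
      by (intro tendsto_intros a) auto
    then have "eventually (\<lambda>t. c < x / a t) (at_right 0)"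
      using \<open>c < x\<close> by (intro order_tendstoD) auto
    then have "eventually (\<lambda>t. c < x / a t \<and> 0 < t \<and> t < 1) (at_right 0)"
      using small by eventually_elim auto
    then obtain t where t: "c < x / a t" "0 < t" "t < 1"
      using eventually_happens'[OF trivial_limit_at_right_real] by blast
    have "(\<lambda>k. x / a t - b t * Y k / a t) \<longlonglongrightarrow> x / a t - b t * 0 / a t"
      using pos[OF t(2,3)] by (intro tendsto_intros Y) auto
    then have "eventually (\<lambda>k. c < x / a t - b t * Y k / a t) sequentially"
      using t by (intro order_tendstoD) auto
    then show "eventually (\<lambda>k. c < X k) sequentially"
      using lo[OF t(2,3)]
    proof eventually_elim
      case (elim k)
      have "(x - b t * Y k) / a t \<le> X k"
        using elim(2) pos[OF t(2,3)] by (simp add: divide_le_eq mult.commute)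
      with elim(1) show ?case by (simp add: diff_divide_distrib)
    qed
  }
  {
    assume "x < c"
    have "((\<lambda>t. a t * x) \<longlongrightarrow> 1 * x) (at_right 0)"
      by (intro tendsto_intros a)
    then have "eventually (\<lambda>t. a t * x < c) (at_right 0)"
      using \<open>x < c\<close> by (intro order_tendstoD) auto
    then have "eventually (\<lambda>t. a t * x < c \<and> 0 < t \<and> t < 1) (at_right 0)"
      using small by eventually_elim auto
    then obtain t where t: "a t * x < c" "0 < t" "t < 1"
      using eventually_happens'[OF trivial_limit_at_right_real] by blast
    have "(\<lambda>k. a t * x + b t * Y k) \<longlonglongrightarrow> a t * x + b t * 0"
      by (intro tendsto_intros Y)
    then have "eventually (\<lambda>k. a t * x + b t * Y k < c) sequentially"
      using t by (intro order_tendstoD) auto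
    then show "eventually (\<lambda>k. X k < c) sequentially"
      using up[OF t(2,3)] by eventually_elim auto
  }
qed

text \<open>Continuity of the norm without taking roots: the weighted inequality bounds each of the
  two powers by nearly \<open>1\<close> times the other, plus a multiple of the power of the
  difference.\<close>

lemma Lp_pow_tendsto:
  assumes p: "1 < p"
    and f[measurable]: "\<And>k. f k \<in> borel_measurable M" and g[measurable]: "g \<in> borel_measurable M"
    and fin: "Lp_pow M p g < \<infinity>"
    and conv: "(\<lambda>k. Lp_pow M p (\<lambda>x. f k x - g x)) \<longlonglongrightarrow> 0"
  shows "(\<lambda>k. Lp_pow M p (f k)) \<longlonglongrightarrow> Lp_pow M p g"
proof -
  define Y where "Y k = Lp_pow M p (\<lambda>x. f k x - g x)" for k
  have ev: "eventually (\<lambda>k. Y k < 1) sequentially"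
    using order_tendstoD(2)[OF conv, of 1] by (simp add: Y_def)
  have up: "Lp_pow M p (f k) \<le> ennreal ((1 - t) powr (1 - p)) * Lp_pow M p g + ennreal (t powr (1 - p)) * Y k"
    if "0 < t" "t < 1" for t k
    using Lp_pow_add_le[OF p that, of g M "\<lambda>x. f k x - g x"] by (simp add: Y_def)
  have lo: "Lp_pow M p g \<le> ennreal ((1 - t) powr (1 - p)) * Lp_pow M p (f k) + ennreal (t powr (1 - p)) * Y k"
    if "0 < t" "t < 1" for t k
    using Lp_pow_add_le[OF p that, of "f k" M "\<lambda>x. g x - f k x"]
    by (simp add: Y_def Lp_pow_diff_commute[of M p "f k" g])
  have Yfin: "Y k < \<infinity>" if "Y k < 1" for k
    using that less_trans[OF that, of \<infinity>] by simp
  have ffin: "Lp_pow M p (f k) < \<infinity>" if "Y k < 1" for k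
    using up[of "1/2" k] fin Yfin[OF that] by (auto simp: ennreal_mult_less_top intro: le_less_trans)
  have fin_ev: "eventually (\<lambda>k. Y k < \<infinity> \<and> Lp_pow M p (f k) < \<infinity>) sequentially"
    using ev by eventually_elim (use Yfin ffin in auto)
  have "(\<lambda>k. enn2real (Lp_pow M p (f k))) \<longlonglongrightarrow> enn2real (Lp_pow M p g)"
  proof (rule tendsto_of_two_sided_bounds)
    show "(\<lambda>k. enn2real (Y k)) \<longlonglongrightarrow> 0"
      using tendsto_enn2real[of Y 0 sequentially] conv[folded Y_def] by simp
    have "((\<lambda>t. (1 - t) powr (1 - p)) \<longlongrightarrow> (1 - 0) powr (1 - p)) (at_right (0::real))"
      by (intro tendsto_intros) auto
    then show "((\<lambda>t. (1 - t) powr (1 - p)) \<longlongrightarrow> 1) (at_right (0::real))" by simp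
    fix t :: real assume t: "0 < t" "t < 1"
    show "0 < (1 - t) powr (1 - p)" using t by simp
    show "eventually (\<lambda>k. enn2real (Lp_pow M p (f k))
        \<le> (1 - t) powr (1 - p) * enn2real (Lp_pow M p g) + t powr (1 - p) * enn2real (Y k)) sequentially"
      using fin_ev
    proof eventually_elim
      case (elim k)
      have "enn2real (Lp_pow M p (f k)) \<le> enn2real (ennreal ((1 - t) powr (1 - p)) * Lp_pow M p g + ennreal (t powr (1 - p)) * Y k)"
        using elim fin by (intro enn2real_mono up t) (auto simp: ennreal_mult_less_top)
      also have "\<dots> = (1 - t) powr (1 - p) * enn2real (Lp_pow M p g) + t powr (1 - p) * enn2real (Y k)"
        using elim fin by (subst enn2real_plus) (auto simp: ennreal_mult_less_top enn2real_mult)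
      finally show ?case .
    qed
    show "eventually (\<lambda>k. enn2real (Lp_pow M p g)
        \<le> (1 - t) powr (1 - p) * enn2real (Lp_pow M p (f k)) + t powr (1 - p) * enn2real (Y k)) sequentially"
      using fin_ev
    proof eventually_elim
      case (elim k)
      have "enn2real (Lp_pow M p g) \<le> enn2real (ennreal ((1 - t) powr (1 - p)) * Lp_pow M p (f k) + ennreal (t powr (1 - p)) * Y k)"
        using elim fin by (intro enn2real_mono lo t) (auto simp: ennreal_mult_less_top)
      also have "\<dots> = (1 - t) powr (1 - p) * enn2real (Lp_pow M p (f k)) + t powr (1 - p) * enn2real (Y k)"
        using elim fin by (subst enn2real_plus) (auto simp: ennreal_mult_less_top enn2real_mult)
      finally show ?case .
    qed
  qed
  then have "(\<lambda>k. ennreal (enn2real (Lp_pow M p (f k)))) \<longlonglongrightarrow> ennreal (enn2real (Lp_pow M p g))"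
    by (intro tendsto_ennrealI)
  also have "ennreal (enn2real (Lp_pow M p g)) = Lp_pow M p g" using fin by simp
  finally show ?thesis
    by (rule Lim_transform_eventually) (use fin_ev in eventually_elim, auto)
qed

text \<open>Jensen's inequality for a measure of mass at most \<open>m\<close>, by integrating the
  tangent inequality at \<open>s = I / m\<close>. An actual mass \<open>\<mu>\<close> below
  \<open>m\<close> does no harm, because the resulting gap
  \<open>(p - 1) * s powr p * (m - \<mu>)\<close> is nonnegative.\<close>

lemma norm_integral_powr_le:
  fixes f :: "'a \<Rightarrow> 'b::euclidean_space"
  assumes p: "1 < p" and m: "0 \<le> m" and N: "emeasure N (space N) \<le> ennreal m"
    and [measurable]: "f \<in> borel_measurable N"
  shows "ennreal (norm (\<integral>x. f x \<partial>N) powr p) \<le> ennreal (m powr (p - 1)) * Lp_pow N p f"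
proof -
  interpret finite_measure N
    using N by (intro finite_measureI) (auto simp: top_unique)
  consider "\<not> integrable N f" | "m = 0" | "Lp_pow N p f = \<infinity>" "0 < m" | "integrable N f" "0 < m" "Lp_pow N p f < \<infinity>"
    using m by (cases "m = 0"; cases "Lp_pow N p f = \<infinity>") (auto simp: less_top)
  then show ?thesis
  proof cases
    \<comment> \<open>The Bochner integral of a non-integrable function is \<open>0\<close> by
      convention.\<close>
    case 1
    then show ?thesis by (simp add: not_integrable_integral_eq)
  next
    case 2
    then have "AE x in N. False" using N emeasure_0_AE by fastforce
    then have "(\<integral>x. f x \<partial>N) = 0" by (intro integral_eq_zero_AE) auto
    then show ?thesis by simp
  next
    case 3
    then show ?thesis by (simp add: ennreal_mult_top)
  next
    case 4
    have int: "integrable N (\<lambda>x. norm (f x) powr p)"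
      using 4(3) by (intro integrableI_bounded) (auto simp: Lp_pow_def)
    define I where "I = (\<integral>x. norm (f x) \<partial>N)"
    define s where "s = I / m"
    define \<mu> where "\<mu> = measure N (space N)"
    have I: "0 \<le> I" "I = s * m" and s: "0 \<le> s" using 4 by (auto simp: I_def s_def)
    have \<mu>: "\<mu> \<le> m" using N m by (simp add: \<mu>_def emeasure_eq_measure)
    have spow: "s * s powr (p - 1) = s powr p"
      using s powr_mult_base[of s "p - 1"] by (cases "s = 0") (use p in auto)
    have "norm (\<integral>x. f x \<partial>N) powr p \<le> I powr p"
      using p by (intro powr_mono2) (auto simp: I_def)
    also have "I powr p = m powr (p - 1) * (s powr p * m)"
      using 4 s powr_mult_base[of m "p - 1"] by (simp add: I powr_mult mult_ac)
    also have "s powr p * m \<le> (\<integral>x. norm (f x) powr p \<partial>N)"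
    proof -
      have "(p - 1) * (s powr p * \<mu>) \<le> (p - 1) * (s powr p * m)"
        using p \<mu> by (intro mult_left_mono) auto
      then have "s powr p * m \<le> s powr p * \<mu> + p * (s powr p * m - s powr p * \<mu>)"
        by (simp add: algebra_simps)
      also have "\<dots> = s powr p * \<mu> + p * s powr (p - 1) * (I - s * \<mu>)"
        by (simp add: I spow[symmetric] algebra_simps)
      also have "\<dots> = (\<integral>x. s powr p + p * s powr (p - 1) * (norm (f x) - s) \<partial>N)"
        using 4(1) by (simp add: I_def \<mu>_def algebra_simps)
      also have "\<dots> \<le> (\<integral>x. norm (f x) powr p \<partial>N)"
        using 4(1) int s by (intro integral_mono powr_above_tangent[OF p]) auto
      finally show ?thesis .
    qed
    finally have "norm (\<integral>x. f x \<partial>N) powr p \<le> m powr (p - 1) * (\<integral>x. norm (f x) powr p \<partial>N)"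
      by (simp add: mult_left_mono)
    then have "ennreal (norm (\<integral>x. f x \<partial>N) powr p) \<le> ennreal (m powr (p - 1)) * ennreal (\<integral>x. norm (f x) powr p \<partial>N)"
      by (simp add: ennreal_mult[symmetric])
    also have "ennreal (\<integral>x. norm (f x) powr p \<partial>N) = Lp_pow N p f"
      unfolding Lp_pow_def using int by (intro nn_integral_eq_integral[symmetric]) auto
    finally show ?thesis .
  qed
qed

lemma nn_integral_fatou_le:
  assumes [measurable]: "\<And>k. h k \<in> borel_measurable M"
    and lim: "AE x in M. (\<lambda>k. h k x) \<longlonglongrightarrow> (H x :: ennreal)"
    and bd: "eventually (\<lambda>k. (\<integral>\<^sup>+x. h k x \<partial>M) \<le> c) sequentially"
  shows "(\<integral>\<^sup>+x. H x \<partial>M) \<le> c"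
proof -
  have "(\<integral>\<^sup>+x. H x \<partial>M) = (\<integral>\<^sup>+x. liminf (\<lambda>k. h k x) \<partial>M)"
    using lim by (intro nn_integral_cong_AE) (auto simp: lim_imp_Liminf)
  also have "\<dots> \<le> liminf (\<lambda>k. \<integral>\<^sup>+x. h k x \<partial>M)"
    by (rule nn_integral_liminf) simp
  also have "\<dots> \<le> c"
    using bd Liminf_mono[of "\<lambda>k. \<integral>\<^sup>+x. h k x \<partial>M" "\<lambda>_. c" sequentially]
    by (simp add: Liminf_const)
  finally show ?thesis .
qed

lemma tendsto_subseq_zeroD:
  "(f \<longlongrightarrow> l) sequentially \<Longrightarrow> strict_mono (r :: nat \<Rightarrow> nat) \<Longrightarrow> ((\<lambda>k. f (r k)) \<longlongrightarrow> l) sequentially"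
  using LIMSEQ_subseq_LIMSEQ[of f l r] by (simp add: o_def)

lemma Lp_pow_AE_subseq:
  fixes f :: "nat \<Rightarrow> 'a \<Rightarrow> 'b::euclidean_space"
  assumes p: "1 < p"
    and f[measurable]: "\<And>k. f k \<in> borel_measurable M"
    and conv: "(\<lambda>k. Lp_pow M p (f k)) \<longlonglongrightarrow> 0"
  obtains r where "strict_mono (r :: nat \<Rightarrow> nat)" "AE x in M. (\<lambda>k. f (r k) x) \<longlonglongrightarrow> 0"
proof -
  have "eventually (\<lambda>k. Lp_pow M p (f k) < 1) sequentially"
    using order_tendstoD(2)[OF conv, of 1] by simp
  then obtain k0 where k0: "\<And>k. k \<ge> k0 \<Longrightarrow> Lp_pow M p (f k) < 1"
    by (auto simp: eventually_sequentially)
  \<comment> \<open>The shift by \<open>k0\<close> discards the terms whose \<open>p\<close>-th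
    power may fail to be integrable; the remaining powers converge to \<open>0\<close> in
    mean.\<close>
  define u where "u k x = norm (f (k + k0) x) powr p" for k x
  have [measurable]: "u k \<in> borel_measurable M" for k
    unfolding u_def by measurable
  have int: "integrable M (u k)" for k
    using k0[of "k + k0"] by (intro integrableI_bounded) (auto simp: Lp_pow_def u_def intro: less_trans)
  have "(\<lambda>k. \<integral>x. norm (u k x) \<partial>M) = (\<lambda>k. enn2real (Lp_pow M p (f (k + k0))))"
    by (intro ext) (subst integral_eq_nn_integral, auto simp: u_def Lp_pow_def)
  moreover have "(\<lambda>k. Lp_pow M p (f (k + k0))) \<longlonglongrightarrow> 0"
    using conv by (rule LIMSEQ_ignore_initial_segment)
  ultimately have "(\<lambda>k. \<integral>x. norm (u k x) \<partial>M) \<longlonglongrightarrow> 0"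
    using tendsto_enn2real[of "\<lambda>k. Lp_pow M p (f (k + k0))" 0 sequentially] by simp
  then obtain r where r: "strict_mono r" "AE x in M. (\<lambda>k. u (r k) x) \<longlonglongrightarrow> 0"
    using tendsto_L1_AE_subseq[of M u, OF int] by blast
  show thesis
  proof (rule that[of "\<lambda>k. r k + k0"])
    show "strict_mono (\<lambda>k. r k + k0)" using r(1) by (auto simp: strict_mono_def)
    show "AE x in M. (\<lambda>k. f (r k + k0) x) \<longlonglongrightarrow> 0"
      using r(2)
    proof eventually_elim
      case (elim x)
      have "(\<lambda>k. u (r k) x powr (1 / p)) \<longlonglongrightarrow> 0 powr (1 / p)"
        using p elim by (intro tendsto_powr') (auto simp: u_def)
      then have "(\<lambda>k. norm (f (r k + k0) x)) \<longlonglongrightarrow> 0"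
        using p by (simp add: u_def powr_powr)
      then show ?case by (rule tendsto_norm_zero_cancel)
    qed
  qed
qed

lemma tendsto_norm_powr:
  fixes l :: "'a::real_normed_vector"
  assumes "(f \<longlongrightarrow> l) F" "0 < p"
  shows "((\<lambda>x. norm (f x) powr p) \<longlongrightarrow> norm l powr p) F"
  using assms by (intro tendsto_powr' tendsto_norm tendsto_const) auto

lemma ennreal_pos_real_below:
  assumes "0 < (a :: ennreal)"
  obtains e :: real where "0 < e" "ennreal e < a"
proof (cases a)
  case (real r)
  then show thesis using assms by (intro that[of "r / 2"]) (auto simp: ennreal_less_iff)
next
  case top
  then show thesis by (intro that[of 1]) auto
qed

text \<open>Above the threshold \<open>e\<close> the factor \<open>t powr (1 - p)\<close> is at most
  \<open>e powr (1 - p)\<close>. On a finite measure space this converts bounds on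
  \<open>p\<close>-th powers into bounds on first powers.\<close>

lemma powr_le_add_powr:
  fixes t e p :: real
  assumes "0 \<le> t" "0 < e" "1 \<le> p"
  shows "t \<le> e + e powr (1 - p) * t powr p"
proof (cases "t \<le> e")
  case True
  then show ?thesis by (simp add: add_increasing2)
next
  case False
  have "t = t powr (1 - p) * t powr p" using False assms by (simp flip: powr_add)
  also have "\<dots> \<le> e powr (1 - p) * t powr p"
    using False assms by (intro mult_right_mono powr_mono2') auto
  finally show ?thesis using assms by simp
qed

text \<open>The Riesz-Fischer argument: along a fast subsequence the increments are summable in
  mean, hence almost everywhere, which produces \<open>g\<close>; Fatou then transfers the Cauchy
  estimate to the distance from \<open>g\<close>.\<close>

lemma (in finite_measure) Lp_complete:
  fixes f :: "nat \<Rightarrow> 'a \<Rightarrow> 'b::euclidean_space"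
  assumes p: "1 < p"
    and f[measurable]: "\<And>k. f k \<in> borel_measurable M"
    and cauchy: "\<And>\<epsilon>::real. 0 < \<epsilon> \<Longrightarrow> \<exists>N. \<forall>a\<ge>N. \<forall>b\<ge>N. Lp_pow M p (\<lambda>x. f a x - f b x) \<le> ennreal \<epsilon>"
  obtains g where "g \<in> borel_measurable M" "(\<lambda>k. Lp_pow M p (\<lambda>x. f k x - g x)) \<longlonglongrightarrow> 0"
proof -
  define \<epsilon> where "\<epsilon> i = (1/2::real) ^ i" for i :: nat
  have \<epsilon>: "0 < \<epsilon> i" for i by (simp add: \<epsilon>_def)
  have "\<exists>N. \<forall>a\<ge>N. \<forall>b\<ge>N. Lp_pow M p (\<lambda>x. f a x - f b x) \<le> ennreal (\<epsilon> i powr p)" for i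
    by (rule cauchy) (simp add: \<epsilon>_def)
  then obtain N where N: "\<And>i a b. N i \<le> a \<Longrightarrow> N i \<le> b \<Longrightarrow> Lp_pow M p (\<lambda>x. f a x - f b x) \<le> ennreal (\<epsilon> i powr p)"
    by metis
  \<comment> \<open>The summand \<open>i\<close> makes \<open>r\<close> strictly increasing, and the
    sum makes it exceed \<open>N i\<close>.\<close>
  define r where "r i = i + (\<Sum>j\<le>i. N j)" for i
  have r: "strict_mono r" by (auto simp: strict_mono_Suc_iff r_def)
  have rN: "N i \<le> r i" for i
    unfolding r_def by (rule trans_le_add2) (rule member_le_sum, auto)
  have rN': "N i \<le> r (Suc i)" for i
    using rN[of i] r by (meson less_imp_le lessI order_trans strict_mono_less)
  define D where "D i x = norm (f (r (Suc i)) x - f (r i) x)" for i x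
  have [measurable]: "D i \<in> borel_measurable M" for i unfolding D_def by measurable
  have D0: "0 \<le> D i x" for i x by (simp add: D_def)
  \<comment> \<open>With threshold \<open>\<epsilon> i\<close> both parts are of order
    \<open>\<epsilon> i\<close>: the second is \<open>\<epsilon> i powr (1 - p)\<close> times
    \<open>\<epsilon> i powr p\<close>.\<close>
  have Dint: "(\<integral>\<^sup>+x. ennreal (D i x) \<partial>M) \<le> ennreal (\<epsilon> i * (measure M (space M) + 1))" for i
  proof -
    have "(\<integral>\<^sup>+x. ennreal (D i x) \<partial>M)
        \<le> (\<integral>\<^sup>+x. ennreal (\<epsilon> i) + ennreal (\<epsilon> i powr (1 - p)) * ennreal (norm (f (r (Suc i)) x - f (r i) x) powr p) \<partial>M)"
    proof (intro nn_integral_mono)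
      fix x
      have "D i x \<le> \<epsilon> i + \<epsilon> i powr (1 - p) * D i x powr p"
        using D0 \<epsilon> p by (intro powr_le_add_powr) auto
      then show "ennreal (D i x) \<le> ennreal (\<epsilon> i) + ennreal (\<epsilon> i powr (1 - p)) * ennreal (norm (f (r (Suc i)) x - f (r i) x) powr p)"
        using \<epsilon>[of i] by (simp add: D_def ennreal_mult[symmetric] ennreal_plus[symmetric] del: ennreal_plus)
    qed
    also have "\<dots> = ennreal (\<epsilon> i) * emeasure M (space M) + ennreal (\<epsilon> i powr (1 - p)) * Lp_pow M p (\<lambda>x. f (r (Suc i)) x - f (r i) x)"
      by (simp add: nn_integral_add nn_integral_cmult Lp_pow_def)
    also have "\<dots> \<le> ennreal (\<epsilon> i) * emeasure M (space M) + ennreal (\<epsilon> i powr (1 - p)) * ennreal (\<epsilon> i powr p)"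
      by (intro add_left_mono mult_left_mono N rN rN') auto
    also have "\<dots> = ennreal (\<epsilon> i * (measure M (space M) + 1))"
      using \<epsilon>[of i] by (simp add: emeasure_eq_measure ennreal_mult[symmetric] ennreal_plus[symmetric]
          powr_add[symmetric] distrib_left del: ennreal_plus)
    finally show ?thesis .
  qed
  have "(\<integral>\<^sup>+x. (\<Sum>i. ennreal (D i x)) \<partial>M) = (\<Sum>i. \<integral>\<^sup>+x. ennreal (D i x) \<partial>M)"
    by (rule nn_integral_suminf) simp
  also have "\<dots> \<le> (\<Sum>i. ennreal (\<epsilon> i * (measure M (space M) + 1)))"
    by (intro suminf_le Dint) auto
  also have "\<dots> < \<infinity>"
  proof -
    have "summable (\<lambda>i. \<epsilon> i * (measure M (space M) + 1))"
      unfolding \<epsilon>_def by (intro summable_mult2 summable_geometric) auto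
    then show ?thesis
      by (subst suminf_ennreal2) (auto simp: \<epsilon>_def)
  qed
  finally have "AE x in M. (\<Sum>i. ennreal (D i x)) \<noteq> \<infinity>"
    by (intro nn_integral_PInf_AE) auto
  then have conv: "AE x in M. convergent (\<lambda>i. f (r i) x)"
  proof eventually_elim
    case (elim x)
    then have "summable (\<lambda>i. D i x)"
      using D0 by (intro summable_suminf_not_top) auto
    then have "summable (\<lambda>i. f (r (Suc i)) x - f (r i) x)"
      unfolding D_def by (rule summable_norm_cancel)
    then have "convergent (\<lambda>n. (\<Sum>i<n. f (r (Suc i)) x - f (r i) x) + f (r 0) x)"
      by (intro convergent_add convergent_const) (simp add: summable_iff_convergent)
    then show ?case using sum_lessThan_telescope[of "\<lambda>i. f (r i) x"] by simp
  qed
  define g where "g x = lim (\<lambda>i. f (r i) x)" for x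
  have g[measurable]: "g \<in> borel_measurable M"
    unfolding g_def by (rule borel_measurable_lim_metric) simp
  have lim: "AE x in M. (\<lambda>i. f (r i) x) \<longlonglongrightarrow> g x"
    using conv by eventually_elim (simp add: g_def convergent_LIMSEQ_iff)
  have bound: "Lp_pow M p (\<lambda>x. f a x - g x) \<le> ennreal e"
    if N': "\<forall>a\<ge>n. \<forall>b\<ge>n. Lp_pow M p (\<lambda>x. f a x - f b x) \<le> ennreal e" and a: "n \<le> a" for n a e
    unfolding Lp_pow_def
  proof (rule nn_integral_fatou_le[where h = "\<lambda>i x. ennreal (norm (f a x - f (r i) x) powr p)"])
    show "AE x in M. (\<lambda>i. ennreal (norm (f a x - f (r i) x) powr p)) \<longlonglongrightarrow> ennreal (norm (f a x - g x) powr p)"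
      using lim
    proof eventually_elim
      case (elim x)
      then have "(\<lambda>i. f a x - f (r i) x) \<longlonglongrightarrow> f a x - g x"
        by (intro tendsto_diff tendsto_const)
      then show ?case using p by (intro tendsto_ennrealI tendsto_norm_powr) simp_all
    qed
    show "eventually (\<lambda>i. (\<integral>\<^sup>+x. ennreal (norm (f a x - f (r i) x) powr p) \<partial>M) \<le> ennreal e) sequentially"
      using eventually_ge_at_top[of n]
    proof eventually_elim
      case (elim i)
      then have "n \<le> r i" using seq_suble[OF r, of i] by linarith
      with N' a show ?case unfolding Lp_pow_def by blast
    qed
  qed simp
  have "(\<lambda>k. Lp_pow M p (\<lambda>x. f k x - g x)) \<longlonglongrightarrow> 0"
  proof (rule order_tendstoI)
    fix a :: ennreal assume "0 < a"
    then obtain e :: real where e: "0 < e" "ennreal e < a"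
      by (rule ennreal_pos_real_below)
    obtain n where "\<forall>a\<ge>n. \<forall>b\<ge>n. Lp_pow M p (\<lambda>x. f a x - f b x) \<le> ennreal e"
      using cauchy e by blast
    then have "\<forall>k\<ge>n. Lp_pow M p (\<lambda>x. f k x - g x) < a"
      using bound e(2) by (meson le_less_trans)
    then show "eventually (\<lambda>k. Lp_pow M p (\<lambda>x. f k x - g x) < a) sequentially"
      by (auto simp: eventually_sequentially)
  qed auto
  with g show thesis by (rule that)
qed

section \<open>Lebesgue measure on products\<close>

lemma sigma_finite_lebesgue: "sigma_finite_measure (lebesgue :: 'a::euclidean_space measure)"
proof -
  obtain A :: "'a set set" where A: "countable A" "A \<subseteq> sets lborel" "\<Union>A = space lborel" "\<forall>a\<in>A. emeasure lborel a \<noteq> \<infinity>"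
    using lborel.sigma_finite_countable by blast
  then have "countable A \<and> A \<subseteq> sets lebesgue \<and> \<Union>A = space lebesgue \<and> (\<forall>a\<in>A. emeasure lebesgue a \<noteq> \<infinity>)"
    by (auto simp: subset_eq)
  then show ?thesis
    by (intro sigma_finite_measure.intro exI[of _ A])
qed

lemma null_sets_lborel_Times:
  fixes N :: "'a::euclidean_space set"
  assumes "N \<in> null_sets lborel"
  shows "N \<times> (UNIV :: 'b::euclidean_space set) \<in> null_sets lborel" "(UNIV :: 'b set) \<times> N \<in> null_sets lborel"
proof -
  have [measurable]: "N \<in> sets borel" and 0: "emeasure lborel N = 0" using assms by auto
  have "emeasure (lborel \<Otimes>\<^sub>M lborel) (N \<times> (UNIV :: 'b set)) = 0"
    by (subst lborel.emeasure_pair_measure_Times) (auto simp: 0)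
  moreover have "emeasure (lborel \<Otimes>\<^sub>M lborel) ((UNIV :: 'b set) \<times> N) = 0"
    by (subst lborel.emeasure_pair_measure_Times) (auto simp: 0)
  ultimately show "N \<times> (UNIV :: 'b set) \<in> null_sets lborel" "(UNIV :: 'b set) \<times> N \<in> null_sets lborel"
    unfolding lborel_prod by (auto simp: null_sets_def borel_prod[symmetric])
qed

text \<open>The preimage of a null set is a null cylinder, so measurability of the projections
  survives completion on both sides.\<close>

lemma measurable_fst_snd_lebesgue:
  "fst \<in> (lebesgue :: ('a::euclidean_space \<times> 'b::euclidean_space) measure) \<rightarrow>\<^sub>M lebesgue"
  "snd \<in> (lebesgue :: ('a::euclidean_space \<times> 'b::euclidean_space) measure) \<rightarrow>\<^sub>M lebesgue"
proof -
  have b: "fst \<in> (lebesgue :: ('a \<times> 'b) measure) \<rightarrow>\<^sub>M lborel" "snd \<in> (lebesgue :: ('a \<times> 'b) measure) \<rightarrow>\<^sub>M lborel"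
    by (auto intro!: measurable_completion simp: borel_prod[symmetric])
  have e: "fst -` A = A \<times> UNIV" for A :: "'a set" by auto
  have e': "snd -` A = UNIV \<times> A" for A :: "'b set" by auto
  show "fst \<in> (lebesgue :: ('a \<times> 'b) measure) \<rightarrow>\<^sub>M lebesgue"
  proof (rule completion.measurable_completion2[OF b(1)], rule subsetI)
    fix N :: "'a set" assume N: "N \<in> null_sets lborel"
    then have "fst -` N \<inter> space lebesgue \<in> null_sets (lebesgue :: ('a \<times> 'b) measure)"
      using null_sets_completionI[OF null_sets_lborel_Times(1)[OF N]] by (simp add: e)
    then show "N \<in> null_sets (distr (lebesgue :: ('a \<times> 'b) measure) lborel fst)"
      using N b(1) null_setsD2[OF N] by (simp add: null_sets_distr_iff)
  qed
  show "snd \<in> (lebesgue :: ('a \<times> 'b) measure) \<rightarrow>\<^sub>M lebesgue"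
  proof (rule completion.measurable_completion2[OF b(2)], rule subsetI)
    fix N :: "'b set" assume N: "N \<in> null_sets lborel"
    then have "snd -` N \<inter> space lebesgue \<in> null_sets (lebesgue :: ('a \<times> 'b) measure)"
      using null_sets_completionI[OF null_sets_lborel_Times(2)[OF N]] by (simp add: e')
    then show "N \<in> null_sets (distr (lebesgue :: ('a \<times> 'b) measure) lborel snd)"
      using N b(2) null_setsD2[OF N] by (simp add: null_sets_distr_iff)
  qed
qed

lemma sets_lebesgue_Times:
  fixes A :: "'a::euclidean_space set" and B :: "'b::euclidean_space set"
  assumes "A \<in> sets lebesgue" "B \<in> sets lebesgue"
  shows "A \<times> B \<in> sets lebesgue"
proof -
  have "fst -` A \<inter> space lebesgue \<in> sets (lebesgue :: ('a \<times> 'b) measure)"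
    "snd -` B \<inter> space lebesgue \<in> sets (lebesgue :: ('a \<times> 'b) measure)"
    using measurable_sets[OF measurable_fst_snd_lebesgue(1) assms(1)]
      measurable_sets[OF measurable_fst_snd_lebesgue(2) assms(2)] by auto
  moreover have "A \<times> B = (fst -` A \<inter> space lebesgue) \<inter> (snd -` B \<inter> space lebesgue)" by auto
  ultimately show ?thesis by (metis sets.Int)
qed

text \<open>Each factor agrees with a Borel set off a null set; the exceptional points of the
  product lie in two null cylinders, and the Borel case is the product formula.\<close>

lemma emeasure_lebesgue_Times:
  fixes A :: "'a::euclidean_space set" and B :: "'b::euclidean_space set"
  assumes A: "A \<in> sets lebesgue" and B: "B \<in> sets lebesgue"
  shows "emeasure lebesgue (A \<times> B) = emeasure lebesgue A * emeasure lebesgue B"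
proof -
  have main: "\<exists>S. S \<in> sets lborel \<and> emeasure lborel S = emeasure lebesgue X \<and> (\<exists>N\<in>null_sets lborel. S - N = X - N)"
    if "X \<in> sets lebesgue" for X :: "'c::euclidean_space set"
  proof -
    obtain S N N' where *: "S \<in> sets lborel" "N' \<in> null_sets lborel" "N \<subseteq> N'" "X = S \<union> N"
      using \<open>X \<in> sets lebesgue\<close> by (elim sets_completionE) auto
    have "AE x in lborel. x \<notin> N'" using * by (intro AE_not_in)
    then have "emeasure lebesgue X = emeasure lebesgue S"
      using * that by (intro emeasure_eq_AE AE_completion) (auto elim: eventually_mono)
    with * show ?thesis by (intro exI[of _ S]) (auto intro: bexI[of _ N'])
  qed
  obtain S N where S: "S \<in> sets lborel" "emeasure lborel S = emeasure lebesgue A" "N \<in> null_sets lborel" "S - N = A - N"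
    using main[OF A] by blast
  obtain T N' where T: "T \<in> sets lborel" "emeasure lborel T = emeasure lebesgue B" "N' \<in> null_sets lborel" "T - N' = B - N'"
    using main[OF B] by blast
  have AB: "A \<times> B \<in> sets lebesgue"
    using A B by (rule sets_lebesgue_Times)
  have ST: "S \<times> T \<in> sets borel" using S T by (simp add: borel_prod[symmetric] pair_measureI)
  have "AE z in lborel. z \<notin> N \<times> UNIV" "AE z in lborel. z \<notin> UNIV \<times> N'"
    using S T by (auto intro!: AE_not_in null_sets_lborel_Times)
  then have "AE z in lborel. z \<in> A \<times> B \<longleftrightarrow> z \<in> S \<times> T"
    by eventually_elim (use S(4) T(4) in auto)
  then have "emeasure lebesgue (A \<times> B) = emeasure lebesgue (S \<times> T)"
    using AB ST by (intro emeasure_eq_AE AE_completion) auto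
  also have "\<dots> = emeasure (lborel \<Otimes>\<^sub>M lborel) (S \<times> T)"
    using ST by (simp add: lborel_prod)
  also have "\<dots> = emeasure lborel S * emeasure lborel T"
    using S T by (intro lborel.emeasure_pair_measure_Times) auto
  finally show ?thesis using S T by simp
qed

lemma measurable_fst_snd_lebesgue_on:
  fixes \<Omega> :: "'a::euclidean_space set" and \<Omega>' :: "'b::euclidean_space set"
  shows "fst \<in> lebesgue_on (\<Omega> \<times> \<Omega>') \<rightarrow>\<^sub>M lebesgue_on \<Omega>" "snd \<in> lebesgue_on (\<Omega> \<times> \<Omega>') \<rightarrow>\<^sub>M lebesgue_on \<Omega>'"
  by (rule measurable_restrict_space3[OF measurable_fst_snd_lebesgue(1)], force)
     (rule measurable_restrict_space3[OF measurable_fst_snd_lebesgue(2)], force)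

text \<open>Lebesgue measure on the product set lives on a larger sigma-algebra than the product of
  the two restrictions; the identity map pushes it forward to that product. Integrals of
  product-measurable functions therefore agree, which opens the way to Fubini.\<close>

lemma distr_lebesgue_on_Times:
  fixes \<Omega> :: "'a::euclidean_space set" and \<Omega>' :: "'b::euclidean_space set"
  assumes \<Omega>: "\<Omega> \<in> sets lebesgue" "\<Omega>' \<in> sets lebesgue"
  shows "lebesgue_on \<Omega> \<Otimes>\<^sub>M lebesgue_on \<Omega>' = distr (lebesgue_on (\<Omega> \<times> \<Omega>')) (lebesgue_on \<Omega> \<Otimes>\<^sub>M lebesgue_on \<Omega>') (\<lambda>z. z)"
proof (rule pair_measure_eqI)
  show "sigma_finite_measure (lebesgue_on \<Omega>)" "sigma_finite_measure (lebesgue_on \<Omega>')"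
    using \<Omega> by (auto intro!: sigma_finite_measure_restrict_space sigma_finite_lebesgue)
  have m: "(\<lambda>z. z) \<in> lebesgue_on (\<Omega> \<times> \<Omega>') \<rightarrow>\<^sub>M lebesgue_on \<Omega> \<Otimes>\<^sub>M lebesgue_on \<Omega>'"
    using measurable_Pair[OF measurable_fst_snd_lebesgue_on] by simp
  fix A B assume A: "A \<in> sets (lebesgue_on \<Omega>)" and B: "B \<in> sets (lebesgue_on \<Omega>')"
  have A': "A \<in> sets lebesgue" "A \<subseteq> \<Omega>" and B': "B \<in> sets lebesgue" "B \<subseteq> \<Omega>'"
    using A B \<Omega> by (auto simp: sets_restrict_space_iff)
  have O: "\<Omega> \<times> \<Omega>' \<in> sets lebesgue"
    using \<Omega> by (rule sets_lebesgue_Times)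
  have "emeasure (distr (lebesgue_on (\<Omega> \<times> \<Omega>')) (lebesgue_on \<Omega> \<Otimes>\<^sub>M lebesgue_on \<Omega>') (\<lambda>z. z)) (A \<times> B)
      = emeasure (lebesgue_on (\<Omega> \<times> \<Omega>')) (A \<times> B)"
    using A B A' B' m by (subst emeasure_distr) (auto simp: pair_measureI Int_absorb2 intro!: arg_cong2[where f = emeasure])
  also have "\<dots> = emeasure lebesgue (A \<times> B)"
    using A' B' O by (intro emeasure_restrict_space) auto
  also have "\<dots> = emeasure (lebesgue_on \<Omega>) A * emeasure (lebesgue_on \<Omega>') B"
    using A' B' \<Omega> by (simp add: emeasure_lebesgue_Times emeasure_restrict_space)
  finally show "emeasure (lebesgue_on \<Omega>) A * emeasure (lebesgue_on \<Omega>') B =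
      emeasure (distr (lebesgue_on (\<Omega> \<times> \<Omega>')) (lebesgue_on \<Omega> \<Otimes>\<^sub>M lebesgue_on \<Omega>') (\<lambda>z. z)) (A \<times> B)" ..
qed simp

lemma nn_integral_lebesgue_on_Times:
  fixes \<Omega> :: "'a::euclidean_space set" and \<Omega>' :: "'b::euclidean_space set"
  assumes \<Omega>: "\<Omega> \<in> sets lebesgue" "\<Omega>' \<in> sets lebesgue"
    and f: "f \<in> borel_measurable (lebesgue_on \<Omega> \<Otimes>\<^sub>M lebesgue_on \<Omega>')"
  shows "(\<integral>\<^sup>+z. f z \<partial>lebesgue_on (\<Omega> \<times> \<Omega>')) = (\<integral>\<^sup>+z. f z \<partial>(lebesgue_on \<Omega> \<Otimes>\<^sub>M lebesgue_on \<Omega>'))"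
proof -
  have m: "(\<lambda>z. z) \<in> lebesgue_on (\<Omega> \<times> \<Omega>') \<rightarrow>\<^sub>M lebesgue_on \<Omega> \<Otimes>\<^sub>M lebesgue_on \<Omega>'"
    using measurable_Pair[OF measurable_fst_snd_lebesgue_on] by simp
  show ?thesis
    by (subst distr_lebesgue_on_Times[OF \<Omega>]) (simp add: nn_integral_distr[OF m] f)
qed

lemma AE_lebesgue_on_Times_fst_snd:
  fixes \<Omega> :: "'a::euclidean_space set" and \<Omega>' :: "'b::euclidean_space set"
  assumes \<Omega>: "\<Omega> \<in> sets lebesgue" "\<Omega>' \<in> sets lebesgue"
    and P: "AE x in lebesgue_on \<Omega>. P x" and Q: "AE y in lebesgue_on \<Omega>'. Q y"
  shows "AE z in lebesgue_on (\<Omega> \<times> \<Omega>'). P (fst z) \<and> Q (snd z)"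
proof -
  interpret A: sigma_finite_measure "lebesgue_on \<Omega>"
    using \<Omega> by (auto intro!: sigma_finite_measure_restrict_space sigma_finite_lebesgue)
  interpret B: sigma_finite_measure "lebesgue_on \<Omega>'"
    using \<Omega> by (auto intro!: sigma_finite_measure_restrict_space sigma_finite_lebesgue)
  obtain N where N: "N \<in> null_sets (lebesgue_on \<Omega>)" "{x\<in>\<Omega>. \<not> P x} \<subseteq> N"
    using P by (auto elim!: AE_E simp: null_sets_def)
  obtain N' where N': "N' \<in> null_sets (lebesgue_on \<Omega>')" "{x\<in>\<Omega>'. \<not> Q x} \<subseteq> N'"
    using Q by (auto elim!: AE_E simp: null_sets_def)
  have "N \<times> \<Omega>' \<in> sets (lebesgue_on \<Omega> \<Otimes>\<^sub>M lebesgue_on \<Omega>')" "\<Omega> \<times> N' \<in> sets (lebesgue_on \<Omega> \<Otimes>\<^sub>M lebesgue_on \<Omega>')"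
    using N N' by (auto intro!: pair_measureI)
  moreover have "emeasure (lebesgue_on \<Omega> \<Otimes>\<^sub>M lebesgue_on \<Omega>') (N \<times> \<Omega>') = 0" "emeasure (lebesgue_on \<Omega> \<Otimes>\<^sub>M lebesgue_on \<Omega>') (\<Omega> \<times> N') = 0"
    using N N' by (auto simp: B.emeasure_pair_measure_Times null_sets_def)
  ultimately have n: "N \<times> \<Omega>' \<union> \<Omega> \<times> N' \<in> null_sets (lebesgue_on \<Omega> \<Otimes>\<^sub>M lebesgue_on \<Omega>')"
    by (intro null_sets.Un) (auto simp: null_sets_def)
  have m: "(\<lambda>z. z) \<in> lebesgue_on (\<Omega> \<times> \<Omega>') \<rightarrow>\<^sub>M lebesgue_on \<Omega> \<Otimes>\<^sub>M lebesgue_on \<Omega>'"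
    using measurable_Pair[OF measurable_fst_snd_lebesgue_on] by simp
  have "AE z in distr (lebesgue_on (\<Omega> \<times> \<Omega>')) (lebesgue_on \<Omega> \<Otimes>\<^sub>M lebesgue_on \<Omega>') (\<lambda>z. z). z \<notin> N \<times> \<Omega>' \<union> \<Omega> \<times> N'"
    using n unfolding distr_lebesgue_on_Times[OF \<Omega>, symmetric] by (rule AE_not_in)
  then have "AE z in lebesgue_on (\<Omega> \<times> \<Omega>'). z \<notin> N \<times> \<Omega>' \<union> \<Omega> \<times> N'"
    by (rule AE_distrD[OF m])
  moreover have "AE z in lebesgue_on (\<Omega> \<times> \<Omega>'). z \<in> \<Omega> \<times> \<Omega>'"
    by (rule AE_I2) simp
  ultimately show ?thesis
    by eventually_elim (use N(2) N'(2) in auto)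
qed

lemma (in pair_sigma_finite) AE_fst_snd:
  assumes P: "AE x in M1. P x" and Q: "AE y in M2. Q y"
  shows "AE z in M1 \<Otimes>\<^sub>M M2. P (fst z) \<and> Q (snd z)"
proof -
  obtain N where N: "N \<in> null_sets M1" "{x\<in>space M1. \<not> P x} \<subseteq> N"
    using P by (auto elim!: AE_E simp: null_sets_def)
  obtain N' where N': "N' \<in> null_sets M2" "{x\<in>space M2. \<not> Q x} \<subseteq> N'"
    using Q by (auto elim!: AE_E simp: null_sets_def)
  have "N \<times> space M2 \<in> sets (M1 \<Otimes>\<^sub>M M2)" "space M1 \<times> N' \<in> sets (M1 \<Otimes>\<^sub>M M2)"
    using N N' by (auto intro!: pair_measureI)
  moreover have "emeasure (M1 \<Otimes>\<^sub>M M2) (N \<times> space M2) = 0" "emeasure (M1 \<Otimes>\<^sub>M M2) (space M1 \<times> N') = 0"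
    using N N' by (auto simp: M2.emeasure_pair_measure_Times null_sets_def)
  ultimately have n: "N \<times> space M2 \<union> space M1 \<times> N' \<in> null_sets (M1 \<Otimes>\<^sub>M M2)"
    by (intro null_sets.Un) (auto simp: null_sets_def)
  have "AE z in M1 \<Otimes>\<^sub>M M2. z \<notin> N \<times> space M2 \<union> space M1 \<times> N'"
    using n by (rule AE_not_in)
  moreover have "AE z in M1 \<Otimes>\<^sub>M M2. z \<in> space M1 \<times> space M2"
    by (rule AE_I2) (simp add: space_pair_measure)
  ultimately show ?thesis
    by eventually_elim (use N(2) N'(2) in auto)
qed

section \<open>Weak convergence in Sobolev spaces\<close>

definition increment :: "('a \<Rightarrow> 'b::real_vector) \<Rightarrow> 'a \<times> 'a \<Rightarrow> 'b" where
  "increment u z = u (fst z) - u (snd z)"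

text \<open>With this weighted measure the energy is the \<open>p\<close>-th power of the norm of
  \<open>increment u\<close>, so the Sobolev space sits isometrically in a sum of two spaces of
  \<open>p\<close>-integrable functions. Division by zero gives density \<open>0\<close> on the
  diagonal, where increments vanish anyway.\<close>

definition sobolev_pair :: "real \<Rightarrow> real \<Rightarrow> (real^'n) set \<Rightarrow> ((real^'n) \<times> (real^'n)) measure" where
  "sobolev_pair s p \<Omega> = density (lebesgue_on \<Omega> \<Otimes>\<^sub>M lebesgue_on \<Omega>)
     (\<lambda>z. ennreal (1 / norm (fst z - snd z) powr (real CARD('n) + p * s)))"

lemma measurable_lebesgue_on_id [measurable]: "(\<lambda>x. x) \<in> borel_measurable (lebesgue_on \<Omega>)"
  using id_borel_measurable_lebesgue_on[of \<Omega>] by (simp add: id_def)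

lemma measurable_fst_lebesgue_on_pair [measurable]:
  "(\<lambda>z. fst z) \<in> borel_measurable (lebesgue_on \<Omega> \<Otimes>\<^sub>M lebesgue_on \<Omega>')"
  "(\<lambda>z. snd z) \<in> borel_measurable (lebesgue_on \<Omega> \<Otimes>\<^sub>M lebesgue_on \<Omega>')"
  using measurable_compose[OF measurable_fst measurable_lebesgue_on_id] 
    measurable_compose[OF measurable_snd measurable_lebesgue_on_id] by auto

lemma borel_measurable_increment [measurable]:
  fixes u :: "'a \<Rightarrow> 'b::euclidean_space"
  assumes [measurable]: "u \<in> borel_measurable M"
  shows "increment u \<in> borel_measurable (M \<Otimes>\<^sub>M M)"
  unfolding increment_def by measurable

lemma borel_measurable_sobolev_kernel [measurable]:
  fixes \<Omega> :: "(real^'n) set"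
  shows "(\<lambda>z. 1 / norm (fst z - snd z) powr (real CARD('n) + p * s)) \<in> borel_measurable (lebesgue_on \<Omega> \<Otimes>\<^sub>M lebesgue_on \<Omega>)"
  by measurable

lemma sets_sobolev_pair [measurable_cong]: "sets (sobolev_pair s p \<Omega>) = sets (lebesgue_on \<Omega> \<Otimes>\<^sub>M lebesgue_on \<Omega>)"
  by (simp add: sobolev_pair_def)

lemma increment_add: "increment (\<lambda>x. u x + v x) = (\<lambda>z. increment u z + increment v z)"
  and increment_diff: "increment (\<lambda>x. u x - v x) = (\<lambda>z. increment u z - increment v z)"
  and increment_scaleR: "increment (\<lambda>x. c *\<^sub>R u x) = (\<lambda>z. c *\<^sub>R increment u z)"
  by (auto simp: increment_def algebra_simps)

lemma sobolev_energy_eq: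
  fixes u :: "real^'n \<Rightarrow> real^'m"
  assumes [measurable]: "u \<in> borel_measurable (lebesgue_on \<Omega>)" and \<Omega>: "\<Omega> \<in> sets lebesgue"
  shows "sobolev_energy s p \<Omega> u = Lp_pow (sobolev_pair s p \<Omega>) p (increment u)"
proof -
  have "sobolev_energy s p \<Omega> u = (\<integral>\<^sup>+z. ennreal (norm (increment u z) powr p / norm (fst z - snd z) powr (real CARD('n) + p * s))
        \<partial>lebesgue_on (\<Omega> \<times> \<Omega>))"
    unfolding sobolev_energy_def increment_def by (intro nn_integral_cong) (simp add: split_beta)
  also have "\<dots> = (\<integral>\<^sup>+z. ennreal (norm (increment u z) powr p / norm (fst z - snd z) powr (real CARD('n) + p * s))
        \<partial>(lebesgue_on \<Omega> \<Otimes>\<^sub>M lebesgue_on \<Omega>))"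
    by (intro nn_integral_lebesgue_on_Times \<Omega>) measurable
  also have "\<dots> = (\<integral>\<^sup>+z. ennreal (1 / norm (fst z - snd z) powr (real CARD('n) + p * s)) * ennreal (norm (increment u z) powr p)
        \<partial>(lebesgue_on \<Omega> \<Otimes>\<^sub>M lebesgue_on \<Omega>))"
    by (intro nn_integral_cong) (simp add: ennreal_mult[symmetric])
  also have "\<dots> = Lp_pow (sobolev_pair s p \<Omega>) p (increment u)"
    unfolding Lp_pow_def sobolev_pair_def by (intro nn_integral_density[symmetric]) measurable
  finally show ?thesis .
qed

lemma pair_sigma_finite_lebesgue_on:
  assumes "\<Omega> \<in> sets lebesgue"
  shows "pair_sigma_finite (lebesgue_on \<Omega>) (lebesgue_on \<Omega>)"
  using assms by (auto intro!: pair_sigma_finite.intro sigma_finite_measure_restrict_space sigma_finite_lebesgue)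

lemma AE_sobolev_pairI:
  assumes \<Omega>: "\<Omega> \<in> sets lebesgue" and "AE x in lebesgue_on \<Omega>. P x"
  shows "AE z in sobolev_pair s p \<Omega>. P (fst z) \<and> P (snd z)"
proof -
  interpret pair_sigma_finite "lebesgue_on \<Omega>" "lebesgue_on \<Omega>"
    by (rule pair_sigma_finite_lebesgue_on[OF \<Omega>])
  show ?thesis
    unfolding sobolev_pair_def using AE_fst_snd[OF assms(2) assms(2)]
    by (subst AE_density) auto
qed

lemma Lp_space_zero: "0 < p \<Longrightarrow> (\<lambda>x. 0) \<in> Lp_space M p"
  by (simp add: Lp_space_iff Lp_pow_def)

lemma Lp_pow_midpoint:
  fixes f g :: "'a \<Rightarrow> 'b::euclidean_space"
  assumes p: "1 < p"
    and [measurable]: "f \<in> borel_measurable M" "g \<in> borel_measurable M"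
  shows "2 * Lp_pow M p (\<lambda>x. (1/2) *\<^sub>R (f x + g x)) \<le> Lp_pow M p f + Lp_pow M p g"
proof -
  have "2 * Lp_pow M p (\<lambda>x. (1/2) *\<^sub>R (f x + g x)) = (\<integral>\<^sup>+x. 2 * ennreal (norm ((1/2) *\<^sub>R (f x + g x)) powr p) \<partial>M)"
    unfolding Lp_pow_def by (rule nn_integral_cmult[symmetric]) measurable
  also have "\<dots> \<le> (\<integral>\<^sup>+x. ennreal (norm (f x) powr p) + ennreal (norm (g x) powr p) \<partial>M)"
  proof (rule nn_integral_mono)
    fix x
    have "norm ((1/2) *\<^sub>R (f x + g x)) powr p \<le> (norm (f x) powr p + norm (g x) powr p) / 2"
      using norm_midpoint_powr_less[OF p, of "f x" "g x"]
      by (cases "f x = g x") (auto simp: scaleR_2[symmetric])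
    then have "2 * (norm ((1/2) *\<^sub>R (f x + g x)) powr p) \<le> norm (f x) powr p + norm (g x) powr p" by simp
    then have "ennreal (2 * (norm ((1/2) *\<^sub>R (f x + g x)) powr p)) \<le> ennreal (norm (f x) powr p + norm (g x) powr p)"
      by (rule ennreal_leI)
    then show "2 * ennreal (norm ((1/2) *\<^sub>R (f x + g x)) powr p) \<le> ennreal (norm (f x) powr p) + ennreal (norm (g x) powr p)"
      by (simp add: ennreal_mult)
  qed
  also have "\<dots> = Lp_pow M p f + Lp_pow M p g"
    unfolding Lp_pow_def by (simp add: nn_integral_add)
  finally show ?thesis .
qed

text \<open>The pointwise inequality is integrated, so \<open>c\<close> depends neither on the
  functions nor on the measure. The last bracket is the midpoint defect, which is small for two
  almost minimal elements.\<close>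

lemma Lp_pow_uniformly_convex:
  fixes \<eta> p :: real and M :: "'a measure"
  assumes p: "1 < p" and \<eta>: "0 < \<eta>"
  shows "\<exists>c>0. \<forall>f\<in>Lp_space M p. \<forall>g\<in>Lp_space M p.
     enn2real (Lp_pow M p (\<lambda>x. f x - g x :: 'b::euclidean_space))
       \<le> \<eta> * (enn2real (Lp_pow M p f) + enn2real (Lp_pow M p g))
       + c * ((enn2real (Lp_pow M p f) + enn2real (Lp_pow M p g)) / 2
           - enn2real (Lp_pow M p (\<lambda>x. (1/2) *\<^sub>R (f x + g x))))"
proof -
  obtain c where c: "0 < c" and ineq: "\<And>a b :: 'b. norm (a - b) powr p
      \<le> \<eta> * (norm a powr p + norm b powr p)
        + c * ((norm a powr p + norm b powr p) / 2 - norm ((1/2) *\<^sub>R (a + b)) powr p)"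
    using uniform_convexity_powr[OF p \<eta>] by blast
  show ?thesis
  proof (intro exI[of _ c] conjI ballI c)
    fix f g :: "'a \<Rightarrow> 'b"
    assume f: "f \<in> Lp_space M p" and g: "g \<in> Lp_space M p"
    have int: "integrable M (\<lambda>x. norm (h x) powr p)" "enn2real (Lp_pow M p h) = (\<integral>x. norm (h x) powr p \<partial>M)"
      if "h \<in> Lp_space M p" for h :: "'a \<Rightarrow> 'b"
    proof -
      show "integrable M (\<lambda>x. norm (h x) powr p)"
        using that by (intro integrableI_bounded) (auto simp: Lp_space_iff Lp_pow_def)
      show "enn2real (Lp_pow M p h) = (\<integral>x. norm (h x) powr p \<partial>M)"
        using that unfolding Lp_pow_def by (intro integral_eq_nn_integral[symmetric]) (auto simp: Lp_space_iff)
    qed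
    note mem = f g Lp_space_diff[OF p f g] Lp_space_scaleR[OF Lp_space_add[OF p f g], of "1/2"]
    have "(\<integral>x. norm (f x - g x) powr p \<partial>M) \<le> (\<integral>x. \<eta> * (norm (f x) powr p + norm (g x) powr p)
        + c * ((norm (f x) powr p + norm (g x) powr p) / 2 - norm ((1/2) *\<^sub>R (f x + g x)) powr p) \<partial>M)"
      using int(1)[OF mem(1)] int(1)[OF mem(2)] int(1)[OF mem(3)] int(1)[OF mem(4)] ineq
      by (intro integral_mono integrable_add integrable_mult_right integrable_diff integrable_divide) auto
    also have "\<dots> = \<eta> * ((\<integral>x. norm (f x) powr p \<partial>M) + (\<integral>x. norm (g x) powr p \<partial>M))
        + c * (((\<integral>x. norm (f x) powr p \<partial>M) + (\<integral>x. norm (g x) powr p \<partial>M)) / 2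
          - (\<integral>x. norm ((1/2) *\<^sub>R (f x + g x)) powr p \<partial>M))"
      using int(1)[OF mem(1)] int(1)[OF mem(2)] int(1)[OF mem(3)] int(1)[OF mem(4)] by simp
    finally show "enn2real (Lp_pow M p (\<lambda>x. f x - g x)) \<le> \<eta> * (enn2real (Lp_pow M p f) + enn2real (Lp_pow M p g))
       + c * ((enn2real (Lp_pow M p f) + enn2real (Lp_pow M p g)) / 2
           - enn2real (Lp_pow M p (\<lambda>x. (1/2) *\<^sub>R (f x + g x))))"
      using int(2)[OF mem(1)] int(2)[OF mem(2)] int(2)[OF mem(3)] int(2)[OF mem(4)] by simp
  qed
qed

section \<open>Sobolev functions and their bounded functionals\<close>

lemma sobolev_iff:
  fixes u :: "real^'n \<Rightarrow> real^'m"
  assumes \<Omega>: "\<Omega> \<in> sets lebesgue"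
  shows "u \<in> sobolev s p \<Omega> \<longleftrightarrow> u \<in> Lp_space (lebesgue_on \<Omega>) p \<and> increment u \<in> Lp_space (sobolev_pair s p \<Omega>) p"
  unfolding sobolev_def using sobolev_energy_eq[OF _ \<Omega>, of u s p]
  by (auto simp: Lp_space_iff)

lemma sobolev_add:
  assumes "\<Omega> \<in> sets lebesgue" "1 < p" "u \<in> sobolev s p \<Omega>" "v \<in> sobolev s p \<Omega>"
  shows "(\<lambda>x. u x + v x) \<in> sobolev s p \<Omega>"
  using assms by (auto simp: sobolev_iff increment_add intro: Lp_space_add)

lemma sobolev_diff:
  assumes "\<Omega> \<in> sets lebesgue" "1 < p" "u \<in> sobolev s p \<Omega>" "v \<in> sobolev s p \<Omega>"
  shows "(\<lambda>x. u x - v x) \<in> sobolev s p \<Omega>"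
  using assms by (auto simp: sobolev_iff increment_diff intro: Lp_space_diff)

lemma sobolev_scaleR:
  assumes "\<Omega> \<in> sets lebesgue" "u \<in> sobolev s p \<Omega>"
  shows "(\<lambda>x. c *\<^sub>R u x) \<in> sobolev s p \<Omega>"
  using assms by (auto simp: sobolev_iff increment_scaleR intro: Lp_space_scaleR)

lemma sobolev_dual_addD:
  "f \<in> sobolev_dual s p \<Omega> \<Longrightarrow> u \<in> sobolev s p \<Omega> \<Longrightarrow> v \<in> sobolev s p \<Omega> \<Longrightarrow> f (\<lambda>x. u x + v x) = f u + f v"
  and sobolev_dual_scaleRD:
  "f \<in> sobolev_dual s p \<Omega> \<Longrightarrow> u \<in> sobolev s p \<Omega> \<Longrightarrow> f (\<lambda>x. c *\<^sub>R u x) = c * f u"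
  unfolding sobolev_dual_def by blast+

lemma sobolev_dual_diff:
  assumes "\<Omega> \<in> sets lebesgue" "f \<in> sobolev_dual s p \<Omega>" "u \<in> sobolev s p \<Omega>" "v \<in> sobolev s p \<Omega>"
  shows "f (\<lambda>x. u x - v x) = f u - f v"
proof -
  have "f (\<lambda>x. (- 1) *\<^sub>R v x) = (- 1) * f v"
    using assms unfolding sobolev_dual_def by blast
  moreover have "f (\<lambda>x. u x + (- 1) *\<^sub>R v x) = f u + f (\<lambda>x. (- 1) *\<^sub>R v x)"
    by (rule sobolev_dual_addD[OF assms(2,3) sobolev_scaleR[OF assms(1,4)]])
  ultimately show ?thesis by simp
qed

lemma sobolev_norm_powr:
  assumes "u \<in> sobolev s p \<Omega>" "\<Omega> \<in> sets lebesgue" "1 < p"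
  shows "sobolev_norm s p \<Omega> u
    = (enn2real (Lp_pow (lebesgue_on \<Omega>) p u) + enn2real (Lp_pow (sobolev_pair s p \<Omega>) p (increment u))) powr (1 / p)"
proof -
  have "u \<in> borel_measurable (lebesgue_on \<Omega>)" using assms(1) by (auto simp: sobolev_def Lp_space_def)
  then show ?thesis
    unfolding sobolev_norm_def Lp_norm_def using assms
    by (simp add: sobolev_energy_eq powr_powr Lp_pow_def[symmetric])
qed

lemma sobolev_dual_tendsto_zero:
  assumes \<Omega>: "\<Omega> \<in> sets lebesgue" and p: "1 < p" and f: "f \<in> sobolev_dual s p \<Omega>"
    and u: "\<And>k. u k \<in> sobolev s p \<Omega>"
    and 1: "(\<lambda>k. Lp_pow (lebesgue_on \<Omega>) p (u k)) \<longlonglongrightarrow> 0"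
    and 2: "(\<lambda>k. Lp_pow (sobolev_pair s p \<Omega>) p (increment (u k))) \<longlonglongrightarrow> 0"
  shows "(\<lambda>k. f (u k)) \<longlonglongrightarrow> 0"
proof -
  obtain C where C: "\<And>u. u \<in> sobolev s p \<Omega> \<Longrightarrow> \<bar>f u\<bar> \<le> C * sobolev_norm s p \<Omega> u"
    using f unfolding sobolev_dual_def by blast
  have "(\<lambda>k. C * sobolev_norm s p \<Omega> (u k)) \<longlonglongrightarrow> C * (0 + 0) powr (1 / p)"
    unfolding sobolev_norm_powr[OF u \<Omega> p]
    using tendsto_enn2real[of _ 0, simplified, OF 1] tendsto_enn2real[of _ 0, simplified, OF 2] p
    by (intro tendsto_mult tendsto_const tendsto_powr' tendsto_add) auto
  then have "(\<lambda>k. C * sobolev_norm s p \<Omega> (u k)) \<longlonglongrightarrow> 0" using p by simp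
  then show ?thesis
    by (rule Lim_null_comparison[rotated]) (use C u in auto)
qed

lemma sobolev_dual_cong_AE:
  assumes \<Omega>: "\<Omega> \<in> sets lebesgue" and p: "1 < p" and f: "f \<in> sobolev_dual s p \<Omega>"
    and u: "u \<in> sobolev s p \<Omega>" "v \<in> sobolev s p \<Omega>" "AE x in lebesgue_on \<Omega>. u x = v x"
  shows "f u = f v"
proof -
  define w where "w x = u x - v x" for x
  have w: "w \<in> sobolev s p \<Omega>" unfolding w_def using \<Omega> p u(1,2) by (rule sobolev_diff)
  have "Lp_pow (lebesgue_on \<Omega>) p w = Lp_pow (lebesgue_on \<Omega>) p (\<lambda>x. 0 :: real^'b)"
    using u(3) by (intro Lp_pow_cong_AE) (auto simp: w_def)
  moreover have "Lp_pow (sobolev_pair s p \<Omega>) p (increment w) = Lp_pow (sobolev_pair s p \<Omega>) p (\<lambda>x. 0 :: real^'b)"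
    using AE_sobolev_pairI[OF \<Omega> u(3), of s p] by (intro Lp_pow_cong_AE) (auto simp: w_def increment_def)
  \<comment> \<open>A difference of norm zero is treated as a constant sequence tending to
    zero.\<close>
  ultimately have "(\<lambda>k :: nat. f w) \<longlonglongrightarrow> 0"
    using w by (intro sobolev_dual_tendsto_zero[OF \<Omega> p f]) (auto simp: Lp_pow_def)
  then have "f w = 0" by (simp add: LIMSEQ_const_iff)
  then show ?thesis
    using sobolev_dual_diff[OF \<Omega> f u(1,2)] by (simp add: w_def[abs_def])
qed

section \<open>Weak convergence of bounded strongly convergent sequences\<close>

text \<open>Repeated midpoints take the place of convex combinations in Mazur's lemma: uniform
  convexity speaks about midpoints only, and bounds that survive midpoints follow by
  induction.\<close>

inductive_set midpoint_hull :: "('a \<Rightarrow> 'b::real_vector) set \<Rightarrow> ('a \<Rightarrow> 'b) set" for S where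
  base: "u \<in> S \<Longrightarrow> u \<in> midpoint_hull S"
| mid: "u \<in> midpoint_hull S \<Longrightarrow> v \<in> midpoint_hull S \<Longrightarrow> (\<lambda>x. (1/2) *\<^sub>R (u x + v x)) \<in> midpoint_hull S"

lemma midpoint_hull_mono: "S \<subseteq> T \<Longrightarrow> midpoint_hull S \<subseteq> midpoint_hull T"
proof
  fix u assume "u \<in> midpoint_hull S" "S \<subseteq> T"
  then show "u \<in> midpoint_hull T" by (induction) (auto intro: midpoint_hull.intros)
qed

lemma Lp_pow_midpoint_le:
  fixes f g :: "'a \<Rightarrow> 'b::euclidean_space"
  assumes "1 < p" "f \<in> borel_measurable M" "g \<in> borel_measurable M" "Lp_pow M p f \<le> c" "Lp_pow M p g \<le> c"
  shows "Lp_pow M p (\<lambda>x. (1/2) *\<^sub>R (f x + g x)) \<le> c"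
proof -
  have "2 * Lp_pow M p (\<lambda>x. (1/2) *\<^sub>R (f x + g x)) \<le> c + c"
    using Lp_pow_midpoint[OF assms(1-3)] add_mono[OF assms(4,5)] by (rule order_trans)
  then have "2 * Lp_pow M p (\<lambda>x. (1/2) *\<^sub>R (f x + g x)) \<le> 2 * c" by (simp add: mult_2)
  then show ?thesis by (subst (asm) ennreal_mult_le_mult_iff) auto
qed

text \<open>Elements of almost minimal energy in the midpoint hulls of the tails form, by uniform convexity,
  a Cauchy sequence for the energy. They tend to zero in \<open>L\<^sup>p\<close>, so by Fatou their energy tends to zero
  as well. A functional that stays above \<open>\<epsilon>\<close> on the sequence stays above \<open>\<epsilon>\<close> on these hulls.\<close>

lemma sobolev_dual_eventually_less:
  fixes u :: "nat \<Rightarrow> real^'n \<Rightarrow> real^'m" and C \<epsilon> :: real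
  assumes \<Omega>: "\<Omega> \<in> sets lebesgue" and p: "1 < p" and f: "f \<in> sobolev_dual s p \<Omega>"
    and u: "\<And>k. u k \<in> sobolev s p \<Omega>"
    and bd: "\<And>k. Lp_pow (sobolev_pair s p \<Omega>) p (increment (u k)) \<le> ennreal C"
    and lim: "(\<lambda>k. Lp_pow (lebesgue_on \<Omega>) p (u k)) \<longlonglongrightarrow> 0"
    and \<epsilon>: "0 < \<epsilon>" and C: "0 \<le> C"
  shows "eventually (\<lambda>k. f (u k) < \<epsilon>) sequentially"
proof (rule ccontr)
  let ?M = "lebesgue_on \<Omega>" and ?P = "sobolev_pair s p \<Omega>"
  assume "\<not> ?thesis"
  then have freq: "\<exists>k\<ge>n. \<epsilon> \<le> f (u k)" for n
    by (auto simp: eventually_sequentially not_less)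
  define T where "T n = {u k | k. n \<le> k \<and> \<epsilon> \<le> f (u k)}" for n
  define H where "H n = midpoint_hull (T n)" for n
  have Hmono: "H m \<subseteq> H n" if "n \<le> m" for n m
    unfolding H_def using that by (intro midpoint_hull_mono) (auto simp: T_def)
  have Hne: "H n \<noteq> {}" for n
    using freq[of n] midpoint_hull.base[of _ "T n"] by (force simp: H_def T_def)
  have Hsob: "w \<in> sobolev s p \<Omega>" if "w \<in> H n" for w n
    using that unfolding H_def
    by induction (auto simp: T_def intro!: u sobolev_scaleR sobolev_add \<Omega> p)
  then have Hmeas: "w \<in> borel_measurable ?M" "increment w \<in> borel_measurable ?P" if "w \<in> H n" for w n
    using that \<Omega> by (auto simp: sobolev_iff Lp_space_iff)
  have Hf: "\<epsilon> \<le> f w" if "w \<in> H n" for w n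
    using that unfolding H_def
  proof induction
    case (mid w v)
    have m: "w \<in> sobolev s p \<Omega>" "v \<in> sobolev s p \<Omega>" using mid Hsob[unfolded H_def] by auto
    have "f (\<lambda>x. (1/2) *\<^sub>R (w x + v x)) = (1/2) * (f w + f v)"
      using sobolev_dual_scaleRD[OF f sobolev_add[OF \<Omega> p m], of "1/2"] sobolev_dual_addD[OF f m] by simp
    then show ?case using mid by simp
  qed (auto simp: T_def)
  have incmid: "increment (\<lambda>x. (1/2) *\<^sub>R (w x + v x)) = (\<lambda>z. (1/2) *\<^sub>R (increment w z + increment v z))"
    for w v :: "real^'n \<Rightarrow> real^'m"
    by (auto simp: increment_def algebra_simps)
  have HE: "Lp_pow ?P p (increment w) \<le> ennreal C" if "w \<in> H n" for w n
    using that unfolding H_def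
  proof induction
    case (mid w v)
    then show ?case
      unfolding incmid using Hmeas[unfolded H_def] by (intro Lp_pow_midpoint_le p) auto
  qed (auto simp: T_def bd)
  have HL: "Lp_pow ?M p w \<le> c" if "w \<in> H n" "\<And>k. n \<le> k \<Longrightarrow> Lp_pow ?M p (u k) \<le> c" for w n c
    using that(1) unfolding H_def
  proof induction
    case (mid w v)
    then show ?case
      using Hmeas[unfolded H_def] by (intro Lp_pow_midpoint_le p) auto
  qed (auto simp: T_def that(2))
  define E where "E w = enn2real (Lp_pow ?P p (increment w))" for w :: "real^'n \<Rightarrow> real^'m"
  have E0: "0 \<le> E w" for w by (simp add: E_def)
  have EC: "E w \<le> C" if "w \<in> H n" for w n
    using enn2real_mono[OF HE[OF that]] C by (simp add: E_def)
  \<comment> \<open>Later tails have smaller hulls, so \<open>e\<close> is increasing; it is bounded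
    by \<open>C\<close> and hence convergent. This makes elements chosen nearly minimal in late
    hulls nearly minimal in each other's hulls.\<close>
  define e where "e n = Inf (E ` H n)" for n
  have bb: "bdd_below (E ` A)" for A using E0 by (auto intro!: bdd_belowI[of _ 0])
  have eE: "e n \<le> E w" if "w \<in> H n" for w n
    unfolding e_def using that by (intro cInf_lower bb) auto
  have emono: "e n \<le> e m" if "n \<le> m" for n m
    unfolding e_def using Hne Hmono[OF that] by (intro cInf_superset_mono bb) auto
  have eC: "e n \<le> C" for n using Hne[of n] eE EC by (metis ex_in_conv order_trans)
  have "\<exists>w\<in>H n. E w < e n + 1 / real (Suc n)" for n
    using cInf_lessD[of "E ` H n" "e n + 1 / real (Suc n)"] Hne[of n] by (auto simp: e_def)
  then obtain x where x: "\<And>n. x n \<in> H n" "\<And>n. E (x n) < e n + 1 / real (Suc n)" by metis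
  define el where "el = Sup (range e)"
  have bda: "bdd_above (range e)" using eC by (auto intro!: bdd_aboveI[of _ C])
  have elim: "e \<longlonglongrightarrow> el"
    unfolding el_def using bda emono by (intro LIMSEQ_incseq_SUP) (auto simp: incseq_def)
  have eel: "e n \<le> el" for n unfolding el_def using bda by (intro cSUP_upper) auto
  have xsob: "x n \<in> sobolev s p \<Omega>" for n using Hsob x(1) by blast
  have xmeas: "x n \<in> borel_measurable ?M" "increment (x n) \<in> borel_measurable ?P" for n
    using Hmeas x(1) by blast+
  have xL: "(\<lambda>n. Lp_pow ?M p (x n)) \<longlonglongrightarrow> 0"
  proof (rule order_tendstoI)
    fix a :: ennreal assume "0 < a"
    then obtain r :: real where r: "0 < r" "ennreal r < a" by (rule ennreal_pos_real_below)
    have "eventually (\<lambda>k. Lp_pow ?M p (u k) < ennreal r) sequentially"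
      using r by (intro order_tendstoD[OF lim]) auto
    then obtain N where "\<And>k. N \<le> k \<Longrightarrow> Lp_pow ?M p (u k) < ennreal r" by (auto simp: eventually_sequentially)
    then have "Lp_pow ?M p (x n) \<le> ennreal r" if "N \<le> n" for n
      using that by (intro HL[OF x(1)[of n]]) (meson less_imp_le order_trans)
    then show "eventually (\<lambda>n. Lp_pow ?M p (x n) < a) sequentially"
      unfolding eventually_sequentially using r(2) by (meson le_less_trans)
  qed auto
  obtain r where r: "strict_mono r" "AE y in ?M. (\<lambda>k. x (r k) y) \<longlonglongrightarrow> 0"
    using Lp_pow_AE_subseq[OF p xmeas(1) xL] by blast
  have Elim: "(\<lambda>n. E (x n)) \<longlonglongrightarrow> 0"
  proof (rule order_tendstoI)
    fix a :: real assume a: "0 < a"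
    \<comment> \<open>Two energies add up to at most \<open>2 * (C + 1)\<close>, so the first term
      of the convexity estimate contributes \<open>a / 2\<close>; the added \<open>1\<close> keeps
      the denominator positive.\<close>
    define \<eta> where "\<eta> = a / (4 * (C + 1))"
    have \<eta>: "0 < \<eta>" using a C by (simp add: \<eta>_def)
    obtain c where c: "0 < c" and uc: "\<forall>f\<in>Lp_space ?P p. \<forall>g\<in>Lp_space ?P p.
       enn2real (Lp_pow ?P p (\<lambda>x. f x - g x :: real^'m))
         \<le> \<eta> * (enn2real (Lp_pow ?P p f) + enn2real (Lp_pow ?P p g))
         + c * ((enn2real (Lp_pow ?P p f) + enn2real (Lp_pow ?P p g)) / 2
             - enn2real (Lp_pow ?P p (\<lambda>x. (1/2) *\<^sub>R (f x + g x))))"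
      using Lp_pow_uniformly_convex[OF p \<eta>] by blast
    have "(\<lambda>n. c * ((el - e n) + 1 / real (Suc n))) \<longlonglongrightarrow> c * ((el - el) + 0)"
      by (intro tendsto_intros elim LIMSEQ_inverse_real_of_nat[unfolded inverse_eq_divide])
    then have "eventually (\<lambda>n. c * ((el - e n) + 1 / real (Suc n)) < a / 4) sequentially"
      using a by (intro order_tendstoD) auto
    then obtain N where N: "\<And>n. N \<le> n \<Longrightarrow> c * ((el - e n) + 1 / real (Suc n)) < a / 4" by (auto simp: eventually_sequentially)
    \<comment> \<open>Both \<open>x n\<close> and \<open>x m\<close> lie in \<open>H n\<close>,
      hence so does their midpoint, whose energy is at least \<open>e n\<close>. The defect is thus
      at most \<open>el - e n\<close> plus the error allowed in the choice of
      \<open>x n\<close>.\<close>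
    have diff: "Lp_pow ?P p (increment (\<lambda>y. x n y - x m y)) \<le> ennreal (3 * a / 4)" if "N \<le> n" "n \<le> m" for n m
    proof -
      have mem: "increment (x n) \<in> Lp_space ?P p" "increment (x m) \<in> Lp_space ?P p"
        using xsob \<Omega> by (auto simp: sobolev_iff)
      have "E (\<lambda>y. x n y - x m y) \<le> \<eta> * (E (x n) + E (x m)) + c * ((E (x n) + E (x m)) / 2
           - E (\<lambda>y. (1/2) *\<^sub>R (x n y + x m y)))"
        unfolding E_def incmid increment_diff by (rule bspec[OF bspec[OF uc mem(1)] mem(2)])
      also have "\<dots> \<le> \<eta> * (2 * (C + 1)) + c * ((el - e n) + 1 / real (Suc n))"
      proof (intro add_mono mult_left_mono)
        show "E (x n) + E (x m) \<le> 2 * (C + 1)" using EC[OF x(1), of n] EC[OF x(1), of m] by simp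
        have "x m \<in> H n" using Hmono[OF that(2)] x(1) by blast
        then have "(\<lambda>y. (1/2) *\<^sub>R (x n y + x m y)) \<in> H n"
          using x(1)[of n] unfolding H_def by (intro midpoint_hull.mid)
        then have "e n \<le> E (\<lambda>y. (1/2) *\<^sub>R (x n y + x m y))" by (rule eE)
        moreover have "1 / real (Suc m) \<le> 1 / real (Suc n)" using that(2) by (intro divide_left_mono) auto
        ultimately show "(E (x n) + E (x m)) / 2 - E (\<lambda>y. (1/2) *\<^sub>R (x n y + x m y)) \<le> (el - e n) + 1 / real (Suc n)"
          using x(2)[of n] x(2)[of m] eel[of n] eel[of m] by argo
      qed (use \<eta> c in auto)
      also have "\<eta> * (2 * (C + 1)) = a / 2" using C by (simp add: \<eta>_def field_simps)
      also have "a / 2 + c * ((el - e n) + 1 / real (Suc n)) \<le> a / 2 + a / 4"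
        by (intro add_left_mono less_imp_le N that(1))
      also have "a / 2 + a / 4 = 3 * a / 4" by simp
      finally have "E (\<lambda>y. x n y - x m y) \<le> 3 * a / 4" .
      moreover have "Lp_pow ?P p (increment (\<lambda>y. x n y - x m y)) < \<infinity>"
        using sobolev_diff[OF \<Omega> p xsob[of n] xsob[of m]] \<Omega> by (simp add: sobolev_iff Lp_space_iff)
      then have "Lp_pow ?P p (increment (\<lambda>y. x n y - x m y)) = ennreal (E (\<lambda>y. x n y - x m y))"
        by (simp add: E_def less_top)
      ultimately show ?thesis by (simp only: ennreal_leI)
    qed
    \<comment> \<open>Along \<open>r\<close> the second function tends to \<open>0\<close> almost
      everywhere, so Fatou turns the distance estimate into a bound on the energy of
      \<open>x n\<close> itself.\<close>
    have "Lp_pow ?P p (increment (x n)) \<le> ennreal (3 * a / 4)" if n: "N \<le> n" for n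
      unfolding Lp_pow_def
    proof (rule nn_integral_fatou_le[where h = "\<lambda>k z. ennreal (norm (increment (\<lambda>y. x n y - x (r k) y) z) powr p)"])
      show "(\<lambda>z. ennreal (norm (increment (\<lambda>y. x n y - x (r k) y) z) powr p)) \<in> borel_measurable ?P" for k
        using xmeas(2)[of n] xmeas(2)[of "r k"] by (simp add: increment_diff)
      show "AE z in ?P. (\<lambda>k. ennreal (norm (increment (\<lambda>y. x n y - x (r k) y) z) powr p)) \<longlonglongrightarrow> ennreal (norm (increment (x n) z) powr p)"
        using AE_sobolev_pairI[OF \<Omega> r(2), of s p]
      proof eventually_elim
        case (elim z)
        then have "(\<lambda>k. (x n (fst z) - x (r k) (fst z)) - (x n (snd z) - x (r k) (snd z)))
            \<longlonglongrightarrow> (x n (fst z) - 0) - (x n (snd z) - 0)"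
          by (intro tendsto_intros) auto
        then show ?case
          using p by (intro tendsto_ennrealI tendsto_norm_powr) (auto simp: increment_def)
      qed
      show "eventually (\<lambda>k. (\<integral>\<^sup>+z. ennreal (norm (increment (\<lambda>y. x n y - x (r k) y) z) powr p) \<partial>?P) \<le> ennreal (3 * a / 4)) sequentially"
        using eventually_ge_at_top[of n]
      proof eventually_elim
        case (elim k)
        then have "n \<le> r k" using seq_suble[OF r(1), of k] by linarith
        then show ?case using diff[OF n, of "r k"] by (simp add: Lp_pow_def)
      qed
    qed
    then have "E (x n) \<le> 3 * a / 4" if n: "N \<le> n" for n
      using enn2real_mono[of "Lp_pow ?P p (increment (x n))" "ennreal (3 * a / 4)"] that a by (simp add: E_def)
    then have "E (x n) < a" if n: "N \<le> n" for n using that a by fastforce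
    then show "eventually (\<lambda>n. E (x n) < a) sequentially" by (auto simp: eventually_sequentially)
  qed (auto intro!: always_eventually order.strict_trans2[OF _ E0])
  have Efin: "Lp_pow ?P p (increment (x n)) = ennreal (E (x n))" for n
    using xsob[of n] \<Omega> by (auto simp: E_def sobolev_iff Lp_space_iff less_top)
  have "(\<lambda>n. f (x n)) \<longlonglongrightarrow> 0"
    using tendsto_ennrealI[OF Elim] by (intro sobolev_dual_tendsto_zero[OF \<Omega> p f xsob xL]) (simp add: Efin)
  then have "eventually (\<lambda>n. f (x n) < \<epsilon>) sequentially" using \<epsilon> by (rule order_tendstoD)
  then show False using Hf[OF x(1)] by (auto simp: eventually_sequentially not_less[symmetric])
qed

text \<open>The one-sided lemma is applied to the differences \<open>w k - w0\<close> and to their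
  negatives; \<open>C'\<close> bounds the energy of both.\<close>

lemma weakly_convergesI:
  fixes w :: "nat \<Rightarrow> real^'n \<Rightarrow> real^'m" and C :: real
  assumes \<Omega>: "\<Omega> \<in> sets lebesgue" and p: "1 < p"
    and w: "\<And>k. w k \<in> sobolev s p \<Omega>" and w0: "w0 \<in> sobolev s p \<Omega>"
    and bd: "\<And>k. Lp_pow (sobolev_pair s p \<Omega>) p (increment (w k)) \<le> ennreal C"
    and lim: "(\<lambda>k. Lp_pow (lebesgue_on \<Omega>) p (\<lambda>x. w k x - w0 x)) \<longlonglongrightarrow> 0"
  shows "weakly_converges s p \<Omega> w w0"
  unfolding weakly_converges_def
proof (intro conjI allI ballI w w0)
  fix f :: "(real^'n \<Rightarrow> real^'m) \<Rightarrow> real" assume f: "f \<in> sobolev_dual s p \<Omega>"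
  let ?P = "sobolev_pair s p \<Omega>"
  define u where "u k x = w k x - w0 x" for k x
  have u: "u k \<in> sobolev s p \<Omega>" for k
    unfolding u_def by (rule sobolev_diff[OF \<Omega> p w w0])
  have fu: "f (u k) = f (w k) - f w0" for k
    unfolding u_def by (rule sobolev_dual_diff[OF \<Omega> f w w0])
  have fin: "Lp_pow ?P p (increment w0) < \<infinity>" using w0 \<Omega> by (simp add: sobolev_iff Lp_space_iff)
  define C' where "C' = 2 powr p * (\<bar>C\<bar> + enn2real (Lp_pow ?P p (increment w0)))"
  have bdu: "Lp_pow ?P p (increment (u k)) \<le> ennreal C'" for k
  proof -
    have "Lp_pow ?P p (increment (u k)) \<le> ennreal (2 powr p) * (Lp_pow ?P p (increment (w k)) + Lp_pow ?P p (increment w0))"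
      unfolding u_def increment_diff using w w0 \<Omega> by (intro Lp_pow_diff_le2 p) (auto simp: sobolev_iff Lp_space_iff)
    also have "\<dots> \<le> ennreal (2 powr p) * (ennreal \<bar>C\<bar> + ennreal (enn2real (Lp_pow ?P p (increment w0))))"
      using fin bd by (intro mult_left_mono add_mono) (auto intro: order_trans[OF bd] ennreal_leI)
    also have "\<dots> = ennreal C'" by (simp add: C'_def ennreal_mult ennreal_plus)
    finally show ?thesis .
  qed
  have limu: "(\<lambda>k. Lp_pow (lebesgue_on \<Omega>) p (u k)) \<longlonglongrightarrow> 0"
    using lim by (simp add: u_def[abs_def])
  have C': "0 \<le> C'" by (simp add: C'_def)
  have "(\<lambda>k. f (u k)) \<longlonglongrightarrow> 0"
  proof (rule order_tendstoI)
    fix a :: real assume "0 < a"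
    then show "eventually (\<lambda>k. f (u k) < a) sequentially"
      by (intro sobolev_dual_eventually_less[OF \<Omega> p f u bdu limu _ C'])
  next
    fix a :: real assume a: "a < 0"
    have inc: "increment (\<lambda>x. (-1) *\<^sub>R u k x) = (\<lambda>z. (-1) *\<^sub>R increment (u k) z)" for k by (rule increment_scaleR)
    have "eventually (\<lambda>k. f (\<lambda>x. (-1) *\<^sub>R u k x) < - a) sequentially"
    proof (rule sobolev_dual_eventually_less[OF \<Omega> p f])
      show "(\<lambda>x. (-1) *\<^sub>R u k x) \<in> sobolev s p \<Omega>" for k by (rule sobolev_scaleR[OF \<Omega> u])
      show "Lp_pow ?P p (increment (\<lambda>x. (-1) *\<^sub>R u k x)) \<le> ennreal C'" for k
        using bdu unfolding inc by (simp add: Lp_pow_def)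
      show "(\<lambda>k. Lp_pow (lebesgue_on \<Omega>) p (\<lambda>x. (-1) *\<^sub>R u k x)) \<longlonglongrightarrow> 0"
        using limu by (simp add: Lp_pow_def)
    qed (use a C' in simp_all)
    then show "eventually (\<lambda>k. a < f (u k)) sequentially"
      unfolding sobolev_dual_scaleRD[OF f u] by eventually_elim simp
  qed
  then show "(\<lambda>k. f (w k)) \<longlonglongrightarrow> f w0"
    unfolding fu by (simp add: LIM_zero_iff)
qed

section \<open>Compact embedding\<close>

text \<open>Moving \<open>x\<close> by \<open>h/2\<close> along \<open>\<nu>\<close> raises it by
  \<open>h/2\<close> above its previous height. A further displacement \<open>u\<close> changes the
  height by at most \<open>norm u\<close> and the boundary function by at most
  \<open>L * norm u\<close>; the factor \<open>1 / (2 * (L + 2))\<close> keeps the sum below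
  \<open>h/2\<close> and the point inside \<open>ball x h\<close>.\<close>

lemma epigraph_interior_ball:
  fixes \<nu> x0 :: "'a::euclidean_space" and \<gamma> :: "'a \<Rightarrow> real"
  assumes \<nu>: "norm \<nu> = 1" and r: "0 < r" and L: "lipschitz_on L {y. y \<bullet> \<nu> = 0} \<gamma>"
    and eq: "\<Omega> \<inter> ball x0 r = {y \<in> ball x0 r. \<gamma> (y - (y \<bullet> \<nu>) *\<^sub>R \<nu>) < y \<bullet> \<nu>}"
    and x: "x \<in> \<Omega> \<inter> ball x0 (r/2)" and h: "0 < h" "h \<le> r/2"
  shows "ball (x + (h/2) *\<^sub>R \<nu>) (1 / (2 * (L + 2)) * h) \<subseteq> \<Omega> \<inter> ball x h"
proof
  have L0: "0 \<le> L" using L by (rule lipschitz_on_nonneg)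
  define \<kappa> where "\<kappa> = 1 / (2 * (L + 2))"
  have \<kappa>: "0 < \<kappa>" "\<kappa> \<le> 1/4" "(L + 1) * \<kappa> < 1 / 2" using L0 by (auto simp: \<kappa>_def field_simps)
  fix y assume "y \<in> ball (x + (h/2) *\<^sub>R \<nu>) (1 / (2 * (L + 2)) * h)"
  then have y: "norm (y - (x + (h/2) *\<^sub>R \<nu>)) < \<kappa> * h" by (simp add: dist_norm norm_minus_commute \<kappa>_def)
  define u where "u = y - (x + (h/2) *\<^sub>R \<nu>)"
  have yx: "y = x + ((h/2) *\<^sub>R \<nu> + u)" by (simp add: u_def)
  have u: "norm u < \<kappa> * h" using y by (simp add: u_def)
  have "norm (y - x) \<le> h/2 + norm u"
    using norm_triangle_ineq[of "(h/2) *\<^sub>R \<nu>" u] \<nu> h by (simp add: yx)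
  also have "\<dots> < h/2 + \<kappa> * h" using u by simp
  also have "\<dots> \<le> h / 2 + 1 / 4 * h" using \<kappa>(2) h by (intro add_left_mono mult_right_mono) auto
  also have "\<dots> \<le> h" using h by simp
  finally have yh: "y \<in> ball x h" by (simp add: dist_norm norm_minus_commute)
  have y_r: "y \<in> ball x0 r"
    using yh x h dist_triangle[of x0 y x] by (auto simp: dist_commute)
  define P where "P y = y - (y \<bullet> \<nu>) *\<^sub>R \<nu>" for y
  have P0: "P z \<bullet> \<nu> = 0" for z using \<nu> by (simp add: P_def inner_diff_left power2_norm_eq_inner[symmetric])
  have Py: "P y - P x = P u"
    using \<nu> by (simp add: P_def yx inner_add_left algebra_simps power2_norm_eq_inner[symmetric])
  have "norm (P u) \<le> norm u"
  proof -
    have "(norm (P u))\<^sup>2 = (norm u)\<^sup>2 - (u \<bullet> \<nu>)\<^sup>2"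
      unfolding power2_norm_eq_inner using \<nu>
      by (simp add: P_def inner_diff_left inner_diff_right inner_commute power2_eq_square norm_eq_1)
    then have "(norm (P u))\<^sup>2 \<le> (norm u)\<^sup>2" by simp
    then show ?thesis by (rule power2_le_imp_le) simp
  qed
  moreover have "\<bar>\<gamma> (P y) - \<gamma> (P x)\<bar> \<le> L * norm (P y - P x)"
    using lipschitz_onD[OF L, of "P y" "P x"] P0 by (simp add: dist_norm)
  ultimately have "\<gamma> (P y) \<le> \<gamma> (P x) + L * norm u"
    unfolding Py using mult_left_mono[of "norm (P u)" "norm u" L] L0 by linarith
  also have "\<gamma> (P x) < x \<bullet> \<nu>"
  proof -
    have "x \<in> \<Omega> \<inter> ball x0 r" using x r by auto
    then show ?thesis unfolding eq by (simp add: P_def)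
  qed
  finally have 1: "\<gamma> (P y) < x \<bullet> \<nu> + L * norm u" by simp
  have "\<bar>u \<bullet> \<nu>\<bar> \<le> norm u" using Cauchy_Schwarz_ineq2[of u \<nu>] \<nu> by simp
  moreover have "y \<bullet> \<nu> = x \<bullet> \<nu> + h/2 + u \<bullet> \<nu>"
    using \<nu> by (simp add: yx inner_add_left norm_eq_1)
  moreover have "L * norm u + norm u \<le> h / 2"
  proof -
    have "(L + 1) * norm u \<le> (L + 1) * (\<kappa> * h)" using u L0 by (intro mult_left_mono) auto
    also have "\<dots> \<le> 1/2 * h" using mult_right_mono[OF less_imp_le[OF \<kappa>(3)], of h] h by (simp add: mult.assoc)
    finally show ?thesis by (simp add: algebra_simps)
  qed
  ultimately have "\<gamma> (P y) < y \<bullet> \<nu>" using 1 by linarith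
  then have "y \<in> {y \<in> ball x0 r. \<gamma> (y - (y \<bullet> \<nu>) *\<^sub>R \<nu>) < y \<bullet> \<nu>}"
    using y_r by (simp add: P_def)
  then have "y \<in> \<Omega>" unfolding eq[symmetric] by blast
  with yh show "y \<in> \<Omega> \<inter> ball x h" by blast
qed

text \<open>Points inside the domain have a ball around them, boundary points the epigraph estimate;
  compactness of the closure makes the proportion \<open>\<kappa>\<close> and the range
  \<open>h0\<close> uniform. This corkscrew condition is how boundary regularity enters the
  compactness proof.\<close>

lemma lipschitz_domain_interior_balls:
  fixes \<Omega> :: "'a::euclidean_space set"
  assumes "open \<Omega>" "bounded \<Omega>" "lipschitz_boundary \<Omega>"
  obtains \<kappa> h0 where "0 < \<kappa>" "0 < h0"
    "\<And>x h. x \<in> \<Omega> \<Longrightarrow> 0 < h \<Longrightarrow> h \<le> h0 \<Longrightarrow> \<exists>c. ball c (\<kappa> * h) \<subseteq> \<Omega> \<inter> ball x h"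
proof -
  have loc: "\<exists>r \<kappa> h0. 0 < r \<and> 0 < \<kappa> \<and> 0 < h0 \<and>
      (\<forall>x\<in>\<Omega> \<inter> ball x0 r. \<forall>h. 0 < h \<and> h \<le> h0 \<longrightarrow> (\<exists>c. ball c (\<kappa> * h) \<subseteq> \<Omega> \<inter> ball x h))"
    if "x0 \<in> closure \<Omega>" for x0
  proof (cases "x0 \<in> \<Omega>")
    case True
    then obtain e where e: "0 < e" "ball x0 e \<subseteq> \<Omega>" using assms(1) open_contains_ball by blast
    have "ball x h \<subseteq> \<Omega> \<inter> ball x h" if "x \<in> ball x0 (e/2)" "h \<le> e/2" for x h
    proof -
      have "ball x h \<subseteq> ball x0 e"
        using that by (simp add: ball_subset_ball_iff dist_commute)
      then show ?thesis using e by blast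
    qed
    then show ?thesis using e
      by (rule_tac exI[of _ "e/2"], rule_tac exI[of _ 1], rule_tac exI[of _ "e/2"]) fastforce
  next
    case False
    then have "x0 \<in> frontier \<Omega>" using that assms(1) by (simp add: frontier_def interior_open)
    then obtain \<nu> r \<gamma> L where *: "norm \<nu> = 1" "0 < r" "lipschitz_on L {y. y \<bullet> \<nu> = 0} \<gamma>"
        "\<Omega> \<inter> ball x0 r = {y \<in> ball x0 r. \<gamma> (y - (y \<bullet> \<nu>) *\<^sub>R \<nu>) < y \<bullet> \<nu>}"
      using assms(3) unfolding lipschitz_boundary_def by blast
    have "0 < 1 / (2 * (L + 2))" using lipschitz_on_nonneg[OF *(3)] by simp
    moreover have "\<exists>c. ball c (1 / (2 * (L + 2)) * h) \<subseteq> \<Omega> \<inter> ball x h"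
      if "x \<in> \<Omega> \<inter> ball x0 (r/2)" "0 < h" "h \<le> r/2" for x h
      using epigraph_interior_ball[OF * that] by blast
    ultimately show ?thesis using *(2)
      by (intro exI[of _ "r/2"] exI[of _ "1 / (2 * (L + 2))"]) auto
  qed
  then obtain r \<kappa> h0 where pos: "\<And>x. x \<in> closure \<Omega> \<Longrightarrow> 0 < r x \<and> 0 < \<kappa> x \<and> 0 < h0 x"
    and ball: "\<And>x0 x h. x0 \<in> closure \<Omega> \<Longrightarrow> x \<in> \<Omega> \<inter> ball x0 (r x0) \<Longrightarrow> 0 < h \<Longrightarrow> h \<le> h0 x0 \<Longrightarrow>
      \<exists>c. ball c (\<kappa> x0 * h) \<subseteq> \<Omega> \<inter> ball x h"
    by metis
  have "compact (closure \<Omega>)" using assms(2) by simp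
  moreover have "closure \<Omega> \<subseteq> (\<Union>x\<in>closure \<Omega>. ball x (r x))" using pos by force
  ultimately obtain T where T: "T \<subseteq> closure \<Omega>" "finite T" "closure \<Omega> \<subseteq> (\<Union>x\<in>T. ball x (r x))"
    using compactE_image[of "closure \<Omega>" "closure \<Omega>" "\<lambda>x. ball x (r x)"] by auto
  \<comment> \<open>Inserting \<open>1\<close> keeps the minimum meaningful when \<open>T\<close> is
    empty.\<close>
  define k where "k = Min (insert 1 (\<kappa> ` T))"
  define h1 where "h1 = Min (insert 1 (h0 ` T))"
  show thesis
  proof (rule that[of k h1])
    show "0 < k" "0 < h1" using T(1,2) pos by (auto simp: k_def h1_def)
    fix x h assume x: "x \<in> \<Omega>" and h: "0 < h" "h \<le> h1"
    have "x \<in> (\<Union>x\<in>T. ball x (r x))" using x closure_subset[of \<Omega>] T(3) by blast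
    then obtain t where t: "t \<in> T" "x \<in> ball t (r t)" by blast
    have "h \<le> h0 t" using h(2) t(1) T(2) by (auto simp: h1_def)
    then obtain c where c: "ball c (\<kappa> t * h) \<subseteq> \<Omega> \<inter> ball x h"
      using ball[of t x h] t T(1) x h by auto
    have "k \<le> \<kappa> t" using t(1) T(2) by (auto simp: k_def)
    then have "ball c (k * h) \<subseteq> ball c (\<kappa> t * h)" using h by (intro subset_ball mult_right_mono) auto
    with c show "\<exists>c. ball c (k * h) \<subseteq> \<Omega> \<inter> ball x h" by blast
  qed
qed

section \<open>Control by mean values on small balls\<close>

text \<open>The centres are taken in \<open>\<Omega>\<close> itself, because interior balls are
  available at points of \<open>\<Omega>\<close>; they still cover the compact closure.\<close>

lemma finite_net:
  fixes \<Omega> :: "'a::euclidean_space set"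
  assumes "bounded \<Omega>" "0 < h"
  obtains X where "finite X" "X \<subseteq> \<Omega>" "\<Omega> \<subseteq> (\<Union>q\<in>X. ball q h)"
proof -
  have "closure \<Omega> \<subseteq> (\<Union>q\<in>\<Omega>. ball q h)"
    using assms(2) by (auto simp: closure_approachable dist_commute)
  moreover have "compact (closure \<Omega>)" using assms(1) by simp
  ultimately obtain T where "T \<subseteq> \<Omega>" "finite T" "closure \<Omega> \<subseteq> (\<Union>q\<in>T. ball q h)"
    using compactE_image[of "closure \<Omega>" \<Omega> "\<lambda>q. ball q h"] by auto
  then show thesis using closure_subset[of \<Omega>] by (intro that[of T]) blast+
qed

text \<open>The deviation of \<open>a\<close> from the mean is the mean of the deviations, to which
  Jensen's inequality applies; the powers of \<open>m\<close> combine to \<open>1/m\<close>.\<close>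

lemma mean_deviation_powr_le:
  fixes u :: "'a \<Rightarrow> 'b::euclidean_space"
  assumes p: "1 < p" and fin: "finite_measure N" and m: "m = measure N (space N)" "0 < m"
    and u: "integrable N u"
  shows "ennreal (norm (a - (1/m) *\<^sub>R (\<integral>y. u y \<partial>N)) powr p)
    \<le> ennreal (1/m) * (\<integral>\<^sup>+y. ennreal (norm (a - u y) powr p) \<partial>N)"
proof -
  interpret finite_measure N by fact
  have [measurable]: "u \<in> borel_measurable N" using u by auto
  have "(\<integral>y. a - u y \<partial>N) = m *\<^sub>R a - (\<integral>y. u y \<partial>N)"
    using u by (simp add: m)
  then have "a - (1/m) *\<^sub>R (\<integral>y. u y \<partial>N) = (1/m) *\<^sub>R (\<integral>y. a - u y \<partial>N)"
    using m(2) by (simp add: scaleR_diff_right)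
  then have "ennreal (norm (a - (1/m) *\<^sub>R (\<integral>y. u y \<partial>N)) powr p)
      = ennreal ((1/m) powr p) * ennreal (norm (\<integral>y. a - u y \<partial>N) powr p)"
    using m(2) powr_mult[of "1/m" "norm (\<integral>y. a - u y \<partial>N)" p] by (simp add: ennreal_mult[symmetric])
  also have "\<dots> \<le> ennreal ((1/m) powr p) * (ennreal (m powr (p - 1)) * Lp_pow N p (\<lambda>y. a - u y))"
    using m by (intro mult_left_mono norm_integral_powr_le p) (auto simp: emeasure_eq_measure)
  also have "\<dots> = ennreal (1/m) * Lp_pow N p (\<lambda>y. a - u y)"
  proof -
    have "(1/m) powr p * m powr (p - 1) = 1 / m"
      using m(2) by (simp add: powr_divide powr_diff)
    then show ?thesis by (simp add: mult.assoc[symmetric] ennreal_mult[symmetric])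
  qed
  finally show ?thesis by (simp add: Lp_pow_def)
qed

lemma finite_measure_lebesgue_on_bounded:
  fixes \<Omega> :: "'a::euclidean_space set"
  assumes "open \<Omega>" "bounded \<Omega>"
  shows "finite_measure (lebesgue_on \<Omega>)"
  using assms by (intro finite_measure_lebesgue_on bounded_set_imp_lmeasurable) auto

lemma (in finite_measure) Lp_space_integrable:
  fixes f :: "'a \<Rightarrow> 'b::euclidean_space"
  assumes p: "1 < p" and f: "f \<in> Lp_space M p"
  shows "integrable M f" "(\<integral>\<^sup>+x. ennreal (norm (f x)) \<partial>M) \<le> emeasure M (space M) + Lp_pow M p f"
proof -
  have [measurable]: "f \<in> borel_measurable M" using f by (simp add: Lp_space_iff)
  have "(\<integral>\<^sup>+x. ennreal (norm (f x)) \<partial>M) \<le> (\<integral>\<^sup>+x. 1 + ennreal (norm (f x) powr p) \<partial>M)"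
  proof (rule nn_integral_mono)
    fix x
    have "norm (f x) \<le> 1 + norm (f x) powr p" using powr_le_add_powr[of "norm (f x)" 1 p] p by simp
    then have "ennreal (norm (f x)) \<le> ennreal (1 + norm (f x) powr p)" by (rule ennreal_leI)
    then show "ennreal (norm (f x)) \<le> 1 + ennreal (norm (f x) powr p)" by simp
  qed
  also have "\<dots> = emeasure M (space M) + Lp_pow M p f"
    by (simp add: nn_integral_add Lp_pow_def)
  finally show *: "(\<integral>\<^sup>+x. ennreal (norm (f x)) \<partial>M) \<le> emeasure M (space M) + Lp_pow M p f" .
  have "emeasure M (space M) + Lp_pow M p f < \<infinity>"
    using f by (simp add: Lp_space_iff less_top[symmetric])
  then show "integrable M f"
    using * by (intro integrableI_bounded) (auto intro: le_less_trans)
qed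

lemma Lp_pow_sobolev_pair:
  fixes u :: "real^'n \<Rightarrow> real^'m"
  assumes [measurable]: "u \<in> borel_measurable (lebesgue_on \<Omega>)" and \<Omega>: "\<Omega> \<in> sets lebesgue"
  shows "Lp_pow (sobolev_pair s p \<Omega>) p (increment u)
    = (\<integral>\<^sup>+x. (\<integral>\<^sup>+y. ennreal (norm (u x - u y) powr p / norm (x - y) powr (real CARD('n) + p * s)) \<partial>lebesgue_on \<Omega>) \<partial>lebesgue_on \<Omega>)"
proof -
  have sf: "sigma_finite_measure (lebesgue_on \<Omega>)"
    using \<Omega> by (intro sigma_finite_measure_restrict_space sigma_finite_lebesgue)
  have mz: "(\<lambda>z. ennreal (norm (u (fst z) - u (snd z)) powr p / norm (fst z - snd z) powr (real CARD('n) + p * s)))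
      \<in> borel_measurable (lebesgue_on \<Omega> \<Otimes>\<^sub>M lebesgue_on \<Omega>)"
    by measurable
  have "Lp_pow (sobolev_pair s p \<Omega>) p (increment u)
     = (\<integral>\<^sup>+z. ennreal (1 / norm (fst z - snd z) powr (real CARD('n) + p * s)) * ennreal (norm (increment u z) powr p)
        \<partial>(lebesgue_on \<Omega> \<Otimes>\<^sub>M lebesgue_on \<Omega>))"
    unfolding Lp_pow_def sobolev_pair_def by (intro nn_integral_density) measurable
  also have "\<dots> = (\<integral>\<^sup>+z. ennreal (norm (u (fst z) - u (snd z)) powr p / norm (fst z - snd z) powr (real CARD('n) + p * s))
        \<partial>(lebesgue_on \<Omega> \<Otimes>\<^sub>M lebesgue_on \<Omega>))"
    by (intro nn_integral_cong) (simp add: ennreal_mult[symmetric] increment_def)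
  also have "\<dots> = (\<integral>\<^sup>+x. (\<integral>\<^sup>+y. ennreal (norm (u x - u y) powr p / norm (x - y) powr (real CARD('n) + p * s)) \<partial>lebesgue_on \<Omega>) \<partial>lebesgue_on \<Omega>)"
    using sigma_finite_measure.nn_integral_fst[OF sf mz] by simp
  finally show ?thesis .
qed

lemma measure_lebesgue_on_ball_ge:
  fixes \<Omega> :: "(real^'n) set"
  assumes \<Omega>: "open \<Omega>" "bounded \<Omega>" and c: "ball c r \<subseteq> \<Omega> \<inter> ball x h" and r: "0 \<le> r"
  shows "unit_ball_vol (real CARD('n)) * r ^ CARD('n) \<le> measure lebesgue (\<Omega> \<inter> ball x h)"
proof -
  have "measure lebesgue (ball c r) = unit_ball_vol (real CARD('n)) * r ^ CARD('n)"
    using r content_ball[of r c] by simp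
  moreover have "measure lebesgue (ball c r) \<le> measure lebesgue (\<Omega> \<inter> ball x h)"
    using \<Omega> by (intro measure_mono_fmeasurable c bounded_set_imp_lmeasurable) auto
  ultimately show ?thesis by simp
qed

text \<open>Every point of \<open>\<Omega>\<close> lies in some ball \<open>ball q h\<close> of a finite net, and \<open>u x\<close> differs from the mean of \<open>u\<close>
  over \<open>\<Omega> \<inter> ball q h\<close> by at most \<open>h powr s\<close> times the energy density at \<open>x\<close>.\<close>

lemma Lp_pow_le_energy_plus_means:
  fixes \<Omega> :: "(real^'n) set"
  assumes \<Omega>: "open \<Omega>" "bounded \<Omega>" "lipschitz_boundary \<Omega>" and p: "1 < p" and s: "0 < s"
  obtains A h0 where "0 \<le> A" "0 < h0"
    "\<And>h. 0 < h \<Longrightarrow> h \<le> h0 \<Longrightarrow> \<exists>X D. finite X \<and> 0 \<le> D \<and>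
      (\<forall>u :: real^'n \<Rightarrow> real^'m. u \<in> Lp_space (lebesgue_on \<Omega>) p \<longrightarrow>
        Lp_pow (lebesgue_on \<Omega>) p u \<le> ennreal (A * h powr (p * s)) * Lp_pow (sobolev_pair s p \<Omega>) p (increment u)
          + ennreal D * (\<Sum>q\<in>X. ennreal (norm (\<integral>y\<in>ball q h. u y \<partial>lebesgue_on \<Omega>) powr p)))"
proof -
  let ?n = "real CARD('n)" and ?M = "lebesgue_on \<Omega>"
  interpret finite_measure ?M using \<Omega> by (intro finite_measure_lebesgue_on_bounded)
  have \<Omega>m: "\<Omega> \<in> sets lebesgue" using \<Omega> by auto
  obtain \<kappa> h0 where \<kappa>: "0 < \<kappa>" "0 < h0"
    and balls: "\<And>x h. x \<in> \<Omega> \<Longrightarrow> 0 < h \<Longrightarrow> h \<le> h0 \<Longrightarrow> \<exists>c. ball c (\<kappa> * h) \<subseteq> \<Omega> \<inter> ball x h"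
    using lipschitz_domain_interior_balls[OF \<Omega>] by blast
  define c0 where "c0 = unit_ball_vol ?n * \<kappa> powr ?n"
  have c0: "0 < c0" using \<kappa> by (simp add: c0_def)
  define A where "A = 2 powr p * (2 powr (?n + p * s) / c0)"
  have "0 \<le> A" using c0 by (simp add: A_def)
  moreover have "\<exists>X D. finite X \<and> 0 \<le> D \<and>
      (\<forall>u :: real^'n \<Rightarrow> real^'m. u \<in> Lp_space ?M p \<longrightarrow>
        Lp_pow ?M p u \<le> ennreal (A * h powr (p * s)) * Lp_pow (sobolev_pair s p \<Omega>) p (increment u)
          + ennreal D * (\<Sum>q\<in>X. ennreal (norm (\<integral>y\<in>ball q h. u y \<partial>?M) powr p)))" if h: "0 < h" "h \<le> h0" for h
  proof -
    obtain X where X: "finite X" "X \<subseteq> \<Omega>" "\<Omega> \<subseteq> (\<Union>q\<in>X. ball q h)"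
      using finite_net[OF \<Omega>(2) h(1)] by blast
    \<comment> \<open>A common lower bound for the volumes of
      \<open>\<Omega> \<inter> ball q h\<close>, supplied by a ball of radius
      \<open>\<kappa> * h\<close> inside.\<close>
    define v where "v = c0 * h powr ?n"
    have v: "0 < v" using c0 h by (simp add: v_def)
    define D where "D = 2 powr p * (1/v) powr p * measure ?M (space ?M)"
    have vol: "v \<le> measure lebesgue (\<Omega> \<inter> ball q h)" if qX: "q \<in> X" for q
    proof -
      obtain c where c: "ball c (\<kappa> * h) \<subseteq> \<Omega> \<inter> ball q h" using balls[of q h] qX X(2) h by blast
      have "v = unit_ball_vol ?n * (\<kappa> * h) ^ CARD('n)"
        using \<kappa> h by (simp add: v_def c0_def powr_realpow power_mult_distrib)
      then show ?thesis
        using measure_lebesgue_on_ball_ge[OF \<Omega>(1,2) c] \<kappa> h by simp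
    qed
    have main: "Lp_pow ?M p u \<le> ennreal (A * h powr (p * s)) * Lp_pow (sobolev_pair s p \<Omega>) p (increment u)
          + ennreal D * (\<Sum>q\<in>X. ennreal (norm (\<integral>y\<in>ball q h. u y \<partial>?M) powr p))"
      if u: "u \<in> Lp_space ?M p" for u :: "real^'n \<Rightarrow> real^'m"
    proof -
      have um[measurable]: "u \<in> borel_measurable ?M" using u by (simp add: Lp_space_iff)
      have ui: "integrable ?M u" using Lp_space_integrable[OF p u] by simp
      define e where "e x = (\<integral>\<^sup>+y. ennreal (norm (u x - u y) powr p / norm (x - y) powr (?n + p * s)) \<partial>?M)" for x
      define I where "I q = (\<integral>y\<in>ball q h. u y \<partial>?M)" for q
      have em: "e \<in> borel_measurable ?M"
        unfolding e_def by measurable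
      have pw: "ennreal (norm (u x) powr p) \<le> ennreal (A * h powr (p * s)) * e x
          + ennreal (2 powr p * (1/v) powr p) * (\<Sum>q\<in>X. ennreal (norm (I q) powr p))" if x: "x \<in> \<Omega>" for x
      proof -
        obtain q where q: "q \<in> X" "x \<in> ball q h" using X(3) x by blast
        define Bq where "Bq = \<Omega> \<inter> ball q h"
        define N where "N = restrict_space ?M Bq"
        have Bq: "Bq \<in> sets ?M" "Bq \<in> sets lebesgue" "Bq \<subseteq> \<Omega>"
          using \<Omega> \<Omega>m by (auto simp: sets_restrict_space_iff Bq_def)
        have Bqs: "Bq \<inter> space ?M \<in> sets ?M" using Bq by (simp add: Int_absorb2)
        have spN: "space N = Bq" using Bq by (auto simp: N_def space_restrict_space)
        have finN: "finite_measure N" unfolding N_def using Bq(1) finite_measure_axioms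
          by (rule finite_measure_restrict_space[rotated])
        define m where "m = measure N (space N)"
        have "m = measure ?M Bq"
          unfolding m_def spN unfolding N_def using Bq by (intro measure_restrict_space) auto
        also have "\<dots> = measure lebesgue Bq"
          using Bq \<Omega>m by (intro measure_restrict_space) auto
        finally have m_eq: "m = measure lebesgue (\<Omega> \<inter> ball q h)" by (simp add: Bq_def)
        have vm: "v \<le> m" using vol[OF q(1)] by (simp add: m_eq)
        have m0: "0 < m" using v vm by simp
        have "integrable ?M (\<lambda>y. indicator Bq y *\<^sub>R u y)"
          using Bq(1) ui by (rule integrable_mult_indicator)
        then have uN: "integrable N u"
          using integrable_restrict_space[OF Bqs, of u] unfolding N_def by simp
        have "(\<integral>y. u y \<partial>N) = (\<integral>y. indicator Bq y *\<^sub>R u y \<partial>?M)"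
          using integral_restrict_space[OF Bqs, of u] unfolding N_def by simp
        also have "\<dots> = I q"
          unfolding I_def set_lebesgue_integral_def
          by (intro Bochner_Integration.integral_cong) (auto simp: Bq_def indicator_def)
        finally have IN: "(\<integral>y. u y \<partial>N) = I q" .
        have "ennreal (norm (u x - (1/m) *\<^sub>R I q) powr p) \<le> ennreal (1/m) * (\<integral>\<^sup>+y. ennreal (norm (u x - u y) powr p) \<partial>N)"
          using mean_deviation_powr_le[OF p finN m_def m0 uN, of "u x"] by (simp add: IN)
        also have "(\<integral>\<^sup>+y. ennreal (norm (u x - u y) powr p) \<partial>N)
            = (\<integral>\<^sup>+y. ennreal (norm (u x - u y) powr p) * indicator Bq y \<partial>?M)"
          unfolding N_def using Bq(1) by (intro nn_integral_restrict_space) auto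
        \<comment> \<open>Points of one ball of radius \<open>h\<close> are at distance at most
          \<open>2 * h\<close>, so the singular kernel can be inserted at the cost of
          \<open>(2 * h) powr (?n + p * s)\<close>. Division by the volume, of order
          \<open>h powr ?n\<close>, will leave \<open>h powr (p * s)\<close>.\<close>
        also have "\<dots> \<le> (\<integral>\<^sup>+y. ennreal ((2 * h) powr (?n + p * s))
            * ennreal (norm (u x - u y) powr p / norm (x - y) powr (?n + p * s)) \<partial>?M)"
        proof (rule nn_integral_mono)
          fix y
          show "ennreal (norm (u x - u y) powr p) * indicator Bq y
            \<le> ennreal ((2 * h) powr (?n + p * s)) * ennreal (norm (u x - u y) powr p / norm (x - y) powr (?n + p * s))"
          proof (cases "y \<in> Bq \<and> x \<noteq> y")
            case True
            have "norm (x - y) \<le> 2 * h"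
              using True q(2) dist_triangle[of x y q] by (auto simp: Bq_def dist_norm norm_minus_commute)
            then have "norm (x - y) powr (?n + p * s) \<le> (2 * h) powr (?n + p * s)"
              using p s by (intro powr_mono2) auto
            then have "norm (u x - u y) powr p * norm (x - y) powr (?n + p * s)
                \<le> (2 * h) powr (?n + p * s) * norm (u x - u y) powr p"
              by (simp add: mult.commute mult_left_mono)
            then have "norm (u x - u y) powr p \<le> (2 * h) powr (?n + p * s) * (norm (u x - u y) powr p / norm (x - y) powr (?n + p * s))"
              using True by (simp add: pos_le_divide_eq)
            then show ?thesis using True by (simp add: ennreal_mult[symmetric])
          qed (auto simp: indicator_def)
        qed
        also have "\<dots> = ennreal ((2 * h) powr (?n + p * s)) * e x"
          unfolding e_def by (rule nn_integral_cmult) (use x in measurable)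
        finally have "ennreal (norm (u x - (1/m) *\<^sub>R I q) powr p) \<le> ennreal (1/m) * (ennreal ((2 * h) powr (?n + p * s)) * e x)"
          by (simp add: mult_left_mono)
        also have "\<dots> = ennreal ((2 * h) powr (?n + p * s) / m) * e x"
          using m0 by (simp add: mult.assoc[symmetric] ennreal_mult[symmetric])
        also have "\<dots> \<le> ennreal (2 powr (?n + p * s) / c0 * h powr (p * s)) * e x"
        proof (intro mult_right_mono ennreal_leI)
          have "(2 * h) powr (?n + p * s) / m \<le> (2 * h) powr (?n + p * s) / v"
            using v vm by (intro divide_left_mono) auto
          also have "\<dots> = 2 powr (?n + p * s) / c0 * h powr (p * s)"
            using h by (simp add: v_def powr_mult powr_add field_simps)
          finally show "(2 * h) powr (?n + p * s) / m \<le> 2 powr (?n + p * s) / c0 * h powr (p * s)" .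
        qed simp
        finally have 1: "ennreal (norm (u x - (1/m) *\<^sub>R I q) powr p) \<le> ennreal (2 powr (?n + p * s) / c0 * h powr (p * s)) * e x" .
        have "norm ((1/m) *\<^sub>R I q) \<le> (1/v) * norm (I q)"
          using m0 v vm by (simp add: divide_right_mono divide_left_mono)
        then have "norm ((1/m) *\<^sub>R I q) powr p \<le> ((1/v) * norm (I q)) powr p"
          using p by (intro powr_mono2) auto
        also have "\<dots> = (1/v) powr p * norm (I q) powr p" by (rule powr_mult)
        finally have "ennreal (norm ((1/m) *\<^sub>R I q) powr p) \<le> ennreal ((1/v) powr p) * ennreal (norm (I q) powr p)"
          by (simp add: ennreal_mult[symmetric])
        also have "\<dots> \<le> ennreal ((1/v) powr p) * (\<Sum>q\<in>X. ennreal (norm (I q) powr p))"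
          using q(1) X(1) by (intro mult_left_mono member_le_sum) auto
        finally have 2: "ennreal (norm ((1/m) *\<^sub>R I q) powr p) \<le> ennreal ((1/v) powr p) * (\<Sum>q\<in>X. ennreal (norm (I q) powr p))" .
        have "norm (u x) powr p \<le> 2 powr p * (norm (u x - (1/m) *\<^sub>R I q) powr p + norm ((1/m) *\<^sub>R I q) powr p)"
          using norm_add_powr_le2[OF p, of "u x - (1/m) *\<^sub>R I q" "(1/m) *\<^sub>R I q"] by simp
        then have "ennreal (norm (u x) powr p) \<le> ennreal (2 powr p) * (ennreal (norm (u x - (1/m) *\<^sub>R I q) powr p) + ennreal (norm ((1/m) *\<^sub>R I q) powr p))"
          by (simp add: ennreal_mult[symmetric] ennreal_plus[symmetric] del: ennreal_plus)
        also have "\<dots> \<le> ennreal (2 powr p) * (ennreal (2 powr (?n + p * s) / c0 * h powr (p * s)) * e x + ennreal ((1/v) powr p) * (\<Sum>q\<in>X. ennreal (norm (I q) powr p)))"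
          by (intro mult_left_mono add_mono 1 2) auto
        also have "\<dots> = ennreal (A * h powr (p * s)) * e x + ennreal (2 powr p * (1/v) powr p) * (\<Sum>q\<in>X. ennreal (norm (I q) powr p))"
          using c0 v by (simp add: A_def distrib_left mult.assoc[symmetric] ennreal_mult[symmetric])
        finally show ?thesis .
      qed
      have "Lp_pow ?M p u \<le> (\<integral>\<^sup>+x. ennreal (A * h powr (p * s)) * e x
          + ennreal (2 powr p * (1/v) powr p) * (\<Sum>q\<in>X. ennreal (norm (I q) powr p)) \<partial>?M)"
        unfolding Lp_pow_def using pw by (intro nn_integral_mono) auto
      also have "\<dots> = ennreal (A * h powr (p * s)) * (\<integral>\<^sup>+x. e x \<partial>?M)
          + ennreal (2 powr p * (1/v) powr p) * (\<Sum>q\<in>X. ennreal (norm (I q) powr p)) * emeasure ?M (space ?M)"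
        using em by (subst nn_integral_add) (auto simp: nn_integral_cmult)
      also have "ennreal (2 powr p * (1/v) powr p) * (\<Sum>q\<in>X. ennreal (norm (I q) powr p)) * emeasure ?M (space ?M)
          = ennreal D * (\<Sum>q\<in>X. ennreal (norm (I q) powr p))"
        using v by (simp add: D_def emeasure_eq_measure ennreal_mult mult_ac)
      also have "(\<integral>\<^sup>+x. e x \<partial>?M) = Lp_pow (sobolev_pair s p \<Omega>) p (increment u)"
        unfolding e_def by (rule Lp_pow_sobolev_pair[OF um \<Omega>m, symmetric])
      finally show ?thesis unfolding I_def .
    qed
    have "0 \<le> D" by (simp add: D_def)
    with X(1) main show ?thesis by blast
  qed
  ultimately show thesis using \<kappa>(2) that by blast
qed

section \<open>Extraction of strongly convergent subsequences\<close>

lemma finite_net_Cauchy: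
  fixes g :: "nat \<Rightarrow> 'a \<Rightarrow> 'b::real_normed_vector"
  assumes "finite X" and "\<And>q. q \<in> X \<Longrightarrow> \<exists>l. (\<lambda>n. g n q) \<longlonglongrightarrow> l" and "0 < \<delta>"
  shows "\<exists>N. \<forall>a\<ge>N. \<forall>b\<ge>N. \<forall>q\<in>X. norm (g a q - g b q) < \<delta>"
proof -
  have "\<exists>N. \<forall>a\<ge>N. \<forall>b\<ge>N. norm (g a q - g b q) < \<delta>" if "q \<in> X" for q
  proof -
    have "Cauchy (\<lambda>n. g n q)" using assms(2)[OF that] by (auto intro: LIMSEQ_imp_Cauchy)
    then show ?thesis using assms(3) by (auto simp: Cauchy_def dist_norm)
  qed
  then obtain N where N: "\<And>q a b. q \<in> X \<Longrightarrow> N q \<le> a \<Longrightarrow> N q \<le> b \<Longrightarrow> norm (g a q - g b q) < \<delta>"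
    by metis
  \<comment> \<open>The sum serves as a common upper bound for the finitely many thresholds.\<close>
  have "\<forall>a\<ge>sum N X. \<forall>b\<ge>sum N X. \<forall>q\<in>X. norm (g a q - g b q) < \<delta>"
  proof (intro allI impI ballI)
    fix a b q assume *: "sum N X \<le> a" "sum N X \<le> b" "q \<in> X"
    have "N q \<le> sum N X" using assms(1) *(3) by (intro member_le_sum) auto
    with * show "norm (g a q - g b q) < \<delta>" by (intro N) auto
  qed
  then show ?thesis by blast
qed

text \<open>At a small scale the energy term is uniformly small, and what remains are finitely many
  bounded vectors, the integrals over the balls of the net. A diagonal subsequence makes these
  converge at every scale, so it is Cauchy in the \<open>p\<close>-th power norm.\<close>

theorem sobolev_compact_embedding:
  fixes \<Omega> :: "(real^'n) set" and w :: "nat \<Rightarrow> real^'n \<Rightarrow> real^'m" and C :: real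
  assumes \<Omega>: "open \<Omega>" "bounded \<Omega>" "lipschitz_boundary \<Omega>" and p: "1 < p" and s: "0 < s"
    and w: "\<And>k. w k \<in> borel_measurable (lebesgue_on \<Omega>)"
    and bd: "\<And>k. Lp_pow (lebesgue_on \<Omega>) p (w k) \<le> ennreal C"
      "\<And>k. Lp_pow (sobolev_pair s p \<Omega>) p (increment (w k)) \<le> ennreal C"
  obtains r g where "strict_mono (r :: nat \<Rightarrow> nat)" "g \<in> borel_measurable (lebesgue_on \<Omega>)"
    "(\<lambda>k. Lp_pow (lebesgue_on \<Omega>) p (\<lambda>x. w (r k) x - g x)) \<longlonglongrightarrow> 0"
proof -
  let ?M = "lebesgue_on \<Omega>"
  interpret finite_measure ?M using \<Omega> by (intro finite_measure_lebesgue_on_bounded)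
  have \<Omega>m: "\<Omega> \<in> sets lebesgue" using \<Omega> by auto
  have wL: "w k \<in> Lp_space ?M p" for k
    using w bd(1)[of k] by (auto simp: Lp_space_iff less_top[symmetric] top_unique)
  have wi: "integrable ?M (w k)" for k using Lp_space_integrable[OF p wL] by simp
  obtain A h0 where A: "0 \<le> A" "0 < h0" and est: "\<And>h. 0 < h \<Longrightarrow> h \<le> h0 \<Longrightarrow> \<exists>X D. finite X \<and> 0 \<le> D \<and>
      (\<forall>u :: real^'n \<Rightarrow> real^'m. u \<in> Lp_space ?M p \<longrightarrow>
        Lp_pow ?M p u \<le> ennreal (A * h powr (p * s)) * Lp_pow (sobolev_pair s p \<Omega>) p (increment u)
          + ennreal D * (\<Sum>q\<in>X. ennreal (norm (\<integral>y\<in>ball q h. u y \<partial>?M) powr p)))"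
    using Lp_pow_le_energy_plus_means[OF \<Omega> p s, where 'm = 'm] by blast
  define h where "h i = h0 / real (Suc i)" for i
  have h: "0 < h i" "h i \<le> h0" for i
    using A(2) by (auto simp: h_def field_simps)
  define Q where "Q i X D \<longleftrightarrow> finite X \<and> 0 \<le> D \<and>
      (\<forall>u :: real^'n \<Rightarrow> real^'m. u \<in> Lp_space ?M p \<longrightarrow>
        Lp_pow ?M p u \<le> ennreal (A * h i powr (p * s)) * Lp_pow (sobolev_pair s p \<Omega>) p (increment u)
          + ennreal D * (\<Sum>q\<in>X. ennreal (norm (\<integral>y\<in>ball q (h i). u y \<partial>?M) powr p)))" for i X D
  have "\<exists>X D. Q i X D" for i unfolding Q_def by (rule est[OF h])
  then obtain X D where Q: "\<And>i. Q i (X i) (D i)" by metis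
  have X: "finite (X i)" and D: "0 \<le> D i" for i using Q[of i] by (auto simp: Q_def)
  have XD: "Lp_pow ?M p u \<le> ennreal (A * h i powr (p * s)) * Lp_pow (sobolev_pair s p \<Omega>) p (increment u)
          + ennreal (D i) * (\<Sum>q\<in>X i. ennreal (norm (\<integral>y\<in>ball q (h i). u y \<partial>?M) powr p))"
    if "u \<in> Lp_space ?M p" for i and u :: "real^'n \<Rightarrow> real^'m"
    using Q[of i] that unfolding Q_def by blast
  define J where "J u z = (\<integral>y\<in>ball (fst z) (h (snd z)). u y \<partial>?M)" for u :: "real^'n \<Rightarrow> real^'m" and z
  have bq: "ball q r \<inter> space ?M \<in> sets ?M" for q r
    using \<Omega> by (auto simp: sets_restrict_space)
  have bset: "set_integrable ?M (ball q r) (w k)" for k q r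
  proof -
    have "integrable ?M (\<lambda>x. indicator (ball q r \<inter> space ?M) x *\<^sub>R w k x)"
      by (rule integrable_mult_indicator[OF bq wi])
    then show ?thesis
      unfolding set_integrable_def
      by (rule Bochner_Integration.integrable_cong[OF refl, THEN iffD1, rotated]) (auto simp: indicator_def)
  qed
  have Jdiff: "J (\<lambda>x. w a x - w b x) z = J (w a) z - J (w b) z" for a b z
    unfolding J_def using bset by (intro set_integral_diff) auto
  have Jbd: "norm (J (w k) z) \<le> enn2real (emeasure ?M (space ?M) + ennreal C)" for k z
  proof -
    have "norm (J (w k) z) \<le> (\<integral>x. norm (indicator (ball (fst z) (h (snd z))) x *\<^sub>R w k x) \<partial>?M)"
      unfolding J_def set_lebesgue_integral_def by (rule integral_norm_bound)
    also have "\<dots> \<le> (\<integral>x. norm (w k x) \<partial>?M)"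
      using bset[unfolded set_integrable_def] wi
      by (intro integral_mono integrable_norm) (auto simp: indicator_def)
    also have "\<dots> = enn2real (\<integral>\<^sup>+x. ennreal (norm (w k x)) \<partial>?M)"
      using w by (intro integral_eq_nn_integral) auto
    also have "\<dots> \<le> enn2real (emeasure ?M (space ?M) + ennreal C)"
      using Lp_space_integrable(2)[OF p wL[of k]] bd(1)[of k]
      by (intro enn2real_mono) (auto simp: less_top[symmetric] intro: order_trans add_left_mono)
    finally show ?thesis .
  qed
  \<comment> \<open>Over all scales only countably many balls occur, which is what the diagonal
    argument requires.\<close>
  have cnt: "countable (\<Union>i. X i \<times> {i})"
    by (rule countable_UN) (auto simp: X intro!: countable_finite)
  obtain r where r: "strict_mono r"
    and conv: "\<And>z. z \<in> (\<Union>i. X i \<times> {i}) \<Longrightarrow> \<exists>l. (\<lambda>n. J (w (r n)) z) \<longlonglongrightarrow> l"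
    using function_convergent_subsequence[where f = "\<lambda>n. J (w n)", OF cnt Jbd] by blast
  define B where "B = 2 powr p * (2 * \<bar>C\<bar>)"
  have B: "0 \<le> B" by (simp add: B_def)
  have hlim: "(\<lambda>i. A * h i powr (p * s) * B) \<longlonglongrightarrow> A * 0 powr (p * s) * B"
  proof (intro tendsto_intros tendsto_powr')
    have "(\<lambda>i. h0 * (1 / real (Suc i))) \<longlonglongrightarrow> h0 * 0"
      by (intro tendsto_intros LIMSEQ_inverse_real_of_nat[unfolded inverse_eq_divide])
    then show "h \<longlonglongrightarrow> 0" by (simp add: h_def[abs_def])
  qed (use p s h in \<open>auto simp: less_imp_le\<close>)
  have cauchy: "\<exists>N. \<forall>a\<ge>N. \<forall>b\<ge>N. Lp_pow ?M p (\<lambda>x. w (r a) x - w (r b) x) \<le> ennreal \<epsilon>" if \<epsilon>: "0 < \<epsilon>" for \<epsilon> :: real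
  proof -
    have "eventually (\<lambda>i. A * h i powr (p * s) * B < \<epsilon> / 2) sequentially"
      using hlim \<epsilon> p s by (intro order_tendstoD) auto
    then obtain i where i: "A * h i powr (p * s) * B < \<epsilon> / 2" by (auto simp: eventually_sequentially)
    \<comment> \<open>The added \<open>1\<close> makes \<open>c\<close> positive, and
      \<open>\<delta>\<close> is chosen so that \<open>c * \<delta> powr p\<close> equals
      \<open>\<epsilon> / 2\<close>.\<close>
    define c where "c = D i * real (card (X i)) + 1"
    have c: "0 < c" using D by (simp add: c_def add_nonneg_pos)
    define \<delta> where "\<delta> = (\<epsilon> / (2 * c)) powr (1 / p)"
    have \<delta>: "0 < \<delta>" "\<delta> powr p = \<epsilon> / (2 * c)" using \<epsilon> c p by (auto simp: \<delta>_def powr_powr)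
    obtain N where N: "\<And>a b q. N \<le> a \<Longrightarrow> N \<le> b \<Longrightarrow> q \<in> X i \<Longrightarrow> norm (J (w (r a)) (q, i) - J (w (r b)) (q, i)) < \<delta>"
      using finite_net_Cauchy[OF X[of i], of "\<lambda>n q. J (w (r n)) (q, i)" \<delta>] conv \<delta>(1) by blast
    have "Lp_pow ?M p (\<lambda>x. w (r a) x - w (r b) x) \<le> ennreal \<epsilon>" if ab: "N \<le> a" "N \<le> b" for a b
    proof -
      let ?u = "\<lambda>x. w (r a) x - w (r b) x"
      have "Lp_pow (sobolev_pair s p \<Omega>) p (increment ?u)
          \<le> ennreal (2 powr p) * (Lp_pow (sobolev_pair s p \<Omega>) p (increment (w (r a))) + Lp_pow (sobolev_pair s p \<Omega>) p (increment (w (r b))))"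
        unfolding increment_diff
        by (intro Lp_pow_diff_le2 p) (simp_all add: measurable_cong_sets[OF sets_sobolev_pair refl] borel_measurable_increment w)
      also have "\<dots> \<le> ennreal (2 powr p) * (ennreal \<bar>C\<bar> + ennreal \<bar>C\<bar>)"
        by (intro mult_left_mono add_mono order_trans[OF bd(2)] ennreal_leI) auto
      also have "\<dots> = ennreal B" by (simp add: B_def ennreal_mult[symmetric] ennreal_plus[symmetric] del: ennreal_plus)
      finally have 1: "Lp_pow (sobolev_pair s p \<Omega>) p (increment ?u) \<le> ennreal B" .
      have 2: "(\<Sum>q\<in>X i. ennreal (norm (J ?u (q, i)) powr p)) \<le> ennreal (real (card (X i)) * \<delta> powr p)"
      proof -
        have "(\<Sum>q\<in>X i. ennreal (norm (J ?u (q, i)) powr p)) \<le> (\<Sum>q\<in>X i. ennreal (\<delta> powr p))"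
          using N[OF ab] p by (intro sum_mono ennreal_leI powr_mono2) (auto simp: Jdiff less_imp_le)
        also have "\<dots> = ennreal (real (card (X i)) * \<delta> powr p)"
          by (simp add: ennreal_of_nat_eq_real_of_nat ennreal_mult)
        finally show ?thesis .
      qed
      have "Lp_pow ?M p ?u \<le> ennreal (A * h i powr (p * s)) * Lp_pow (sobolev_pair s p \<Omega>) p (increment ?u)
          + ennreal (D i) * (\<Sum>q\<in>X i. ennreal (norm (J ?u (q, i)) powr p))"
        using XD[OF Lp_space_diff[OF p wL[of "r a"] wL[of "r b"]], of i] unfolding J_def by simp
      also have "\<dots> \<le> ennreal (A * h i powr (p * s)) * ennreal B + ennreal (D i) * ennreal (real (card (X i)) * \<delta> powr p)"
        by (intro add_mono mult_left_mono 1 2) auto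
      also have "\<dots> = ennreal (A * h i powr (p * s) * B + D i * (real (card (X i)) * \<delta> powr p))"
        using A B D by (simp add: ennreal_mult ennreal_plus)
      also have "\<dots> \<le> ennreal \<epsilon>"
      proof (rule ennreal_leI)
        have "D i * (real (card (X i)) * \<delta> powr p) \<le> c * \<delta> powr p" by (simp add: c_def algebra_simps)
        also have "\<dots> = \<epsilon> / 2" using c by (simp add: \<delta>(2))
        finally show "A * h i powr (p * s) * B + D i * (real (card (X i)) * \<delta> powr p) \<le> \<epsilon>" using i by simp
      qed
      finally show ?thesis .
    qed
    then show ?thesis by blast
  qed
  show thesis
  proof (rule Lp_complete[OF p, of "\<lambda>k. w (r k)"])
    fix g assume "g \<in> borel_measurable ?M" "(\<lambda>k. Lp_pow ?M p (\<lambda>x. w (r k) x - g x)) \<longlonglongrightarrow> 0"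
    with r show thesis by (rule that)
  qed (use w cauchy in auto)
qed

section \<open>Energy of near pairs\<close>

text \<open>For \<open>l = 1\<close> the weight is bounded below only near the origin, so the energy
  of pairs at distance at most \<open>\<eta>\<close> is the part that the regularizer controls
  directly.\<close>

definition near_pair :: "real \<Rightarrow> real \<Rightarrow> (real^'n) set \<Rightarrow> real \<Rightarrow> ((real^'n) \<times> (real^'n)) measure" where
  "near_pair s p \<Omega> \<eta> = density (lebesgue_on \<Omega> \<Otimes>\<^sub>M lebesgue_on \<Omega>)
     (\<lambda>z. ennreal (if norm (fst z - snd z) \<le> \<eta> then 1 / norm (fst z - snd z) powr (real CARD('n) + p * s) else 0))"

lemma sets_near_pair [measurable_cong]: "sets (near_pair s p \<Omega> \<eta>) = sets (lebesgue_on \<Omega> \<Otimes>\<^sub>M lebesgue_on \<Omega>)"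
  by (simp add: near_pair_def)

lemma Lp_pow_near_pair:
  fixes u :: "real^'n \<Rightarrow> real^'m"
  assumes [measurable]: "u \<in> borel_measurable (lebesgue_on \<Omega>)"
  shows "Lp_pow (near_pair s p \<Omega> \<eta>) p (increment u)
    = (\<integral>\<^sup>+z. ennreal (if norm (fst z - snd z) \<le> \<eta> then norm (increment u z) powr p / norm (fst z - snd z) powr (real CARD('n) + p * s) else 0)
        \<partial>(lebesgue_on \<Omega> \<Otimes>\<^sub>M lebesgue_on \<Omega>))"
proof -
  have "Lp_pow (near_pair s p \<Omega> \<eta>) p (increment u)
     = (\<integral>\<^sup>+z. ennreal (if norm (fst z - snd z) \<le> \<eta> then 1 / norm (fst z - snd z) powr (real CARD('n) + p * s) else 0)
         * ennreal (norm (increment u z) powr p) \<partial>(lebesgue_on \<Omega> \<Otimes>\<^sub>M lebesgue_on \<Omega>))"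
    unfolding Lp_pow_def near_pair_def by (intro nn_integral_density) measurable
  also have "\<dots> = (\<integral>\<^sup>+z. ennreal (if norm (fst z - snd z) \<le> \<eta> then norm (increment u z) powr p / norm (fst z - snd z) powr (real CARD('n) + p * s) else 0)
        \<partial>(lebesgue_on \<Omega> \<Otimes>\<^sub>M lebesgue_on \<Omega>))"
    by (intro nn_integral_cong) (simp add: ennreal_mult[symmetric])
  finally show ?thesis .
qed

lemma AE_near_pairI:
  assumes \<Omega>: "\<Omega> \<in> sets lebesgue" and "AE x in lebesgue_on \<Omega>. P x"
  shows "AE z in near_pair s p \<Omega> \<eta>. P (fst z) \<and> P (snd z)"
proof -
  interpret pair_sigma_finite "lebesgue_on \<Omega>" "lebesgue_on \<Omega>"
    by (rule pair_sigma_finite_lebesgue_on[OF \<Omega>])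
  show ?thesis
    unfolding near_pair_def using AE_fst_snd[OF assms(2) assms(2)]
    by (subst AE_density) auto
qed

text \<open>For far pairs the kernel is at most \<open>1 / \<eta> powr ?N\<close> and the increment
  is split into its two values; integrating out the other variable costs the volume \<open>V\<close>
  of the domain, once for each value.\<close>

lemma Lp_pow_sobolev_pair_le_near:
  fixes \<Omega> :: "(real^'n) set"
  assumes \<Omega>: "open \<Omega>" "bounded \<Omega>" and p: "1 < p" and s: "0 < s" and \<eta>: "0 < \<eta>"
  obtains C where "0 \<le> C" "\<And>u :: real^'n \<Rightarrow> real^'m. u \<in> borel_measurable (lebesgue_on \<Omega>) \<Longrightarrow>
    Lp_pow (sobolev_pair s p \<Omega>) p (increment u)
      \<le> Lp_pow (near_pair s p \<Omega> \<eta>) p (increment u) + ennreal C * Lp_pow (lebesgue_on \<Omega>) p u"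
proof -
  let ?M = "lebesgue_on \<Omega>" and ?N = "real CARD('n) + p * s"
  interpret finite_measure ?M using \<Omega> by (intro finite_measure_lebesgue_on_bounded)
  have \<Omega>m: "\<Omega> \<in> sets lebesgue" using \<Omega> by auto
  have sf: "sigma_finite_measure ?M" ..
  define V where "V = measure ?M (space ?M)"
  define c where "c = 2 powr p / \<eta> powr ?N"
  have c: "0 \<le> c" by (simp add: c_def)
  show thesis
  proof (rule that[of "c * (2 * V)"])
    show "0 \<le> c * (2 * V)" using c by (simp add: V_def)
    fix u :: "real^'n \<Rightarrow> real^'m" assume [measurable]: "u \<in> borel_measurable ?M"
    have "Lp_pow (sobolev_pair s p \<Omega>) p (increment u)
      = (\<integral>\<^sup>+z. ennreal (1 / norm (fst z - snd z) powr ?N) * ennreal (norm (increment u z) powr p) \<partial>(?M \<Otimes>\<^sub>M ?M))"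
      unfolding Lp_pow_def sobolev_pair_def by (intro nn_integral_density) measurable
    also have "\<dots> \<le> (\<integral>\<^sup>+z. ennreal (if norm (fst z - snd z) \<le> \<eta> then norm (increment u z) powr p / norm (fst z - snd z) powr ?N else 0)
        + ennreal c * (ennreal (norm (u (fst z)) powr p) + ennreal (norm (u (snd z)) powr p)) \<partial>(?M \<Otimes>\<^sub>M ?M))"
    proof (rule nn_integral_mono)
      fix z
      show "ennreal (1 / norm (fst z - snd z) powr ?N) * ennreal (norm (increment u z) powr p)
        \<le> ennreal (if norm (fst z - snd z) \<le> \<eta> then norm (increment u z) powr p / norm (fst z - snd z) powr ?N else 0)
        + ennreal c * (ennreal (norm (u (fst z)) powr p) + ennreal (norm (u (snd z)) powr p))"
      proof (cases "norm (fst z - snd z) \<le> \<eta>")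
        case True
        then show ?thesis by (simp add: ennreal_mult[symmetric])
      next
        case False
        have "norm (increment u z) powr p / norm (fst z - snd z) powr ?N \<le> (2 powr p * (norm (u (fst z)) powr p + norm (u (snd z)) powr p)) / \<eta> powr ?N"
          using False \<eta> p s norm_diff_powr_le2[OF p, of "u (fst z)" "u (snd z)"]
          by (intro frac_le) (auto simp: increment_def intro!: powr_mono2)
        also have "\<dots> = c * (norm (u (fst z)) powr p + norm (u (snd z)) powr p)" by (simp add: c_def)
        finally show ?thesis
          using False c by (simp add: ennreal_mult[symmetric] ennreal_plus[symmetric] del: ennreal_plus)
      qed
    qed
    also have "\<dots> = Lp_pow (near_pair s p \<Omega> \<eta>) p (increment u)
        + ennreal c * ((\<integral>\<^sup>+z. ennreal (norm (u (fst z)) powr p) \<partial>(?M \<Otimes>\<^sub>M ?M)) + (\<integral>\<^sup>+z. ennreal (norm (u (snd z)) powr p) \<partial>(?M \<Otimes>\<^sub>M ?M)))"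
      by (subst nn_integral_add, measurable, subst nn_integral_cmult, measurable, subst nn_integral_add, measurable)
         (simp add: Lp_pow_near_pair)
    also have "(\<integral>\<^sup>+z. ennreal (norm (u (fst z)) powr p) \<partial>(?M \<Otimes>\<^sub>M ?M)) = ennreal V * Lp_pow ?M p u"
      using sigma_finite_measure.nn_integral_fst[OF sf, of "\<lambda>z. ennreal (norm (u (fst z)) powr p)" ?M]
      by (simp add: Lp_pow_def V_def emeasure_eq_measure nn_integral_multc mult.commute)
    also have "(\<integral>\<^sup>+z. ennreal (norm (u (snd z)) powr p) \<partial>(?M \<Otimes>\<^sub>M ?M)) = ennreal V * Lp_pow ?M p u"
      using sigma_finite_measure.nn_integral_fst[OF sf, of "\<lambda>z. ennreal (norm (u (snd z)) powr p)" ?M]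
      by (simp add: Lp_pow_def V_def emeasure_eq_measure mult.commute)
    also have "ennreal c * (ennreal V * Lp_pow ?M p u + ennreal V * Lp_pow ?M p u) = ennreal (c * (2 * V)) * Lp_pow ?M p u"
    proof -
      have "0 \<le> V" by (simp add: V_def)
      then have "ennreal (c * (2 * V)) = ennreal c * (2 * ennreal V)" using c by (simp add: ennreal_mult)
      then show ?thesis by (simp only: mult_2[symmetric] mult.assoc)
    qed
    finally show "Lp_pow (sobolev_pair s p \<Omega>) p (increment u)
      \<le> Lp_pow (near_pair s p \<Omega> \<eta>) p (increment u) + ennreal (c * (2 * V)) * Lp_pow ?M p u" .
  qed
qed

section \<open>Functions without near energy\<close>

lemma emeasure_lebesgue_on_open_pos:
  fixes \<Omega> :: "'a::euclidean_space set"
  assumes "open \<Omega>" "open U" "U \<subseteq> \<Omega>" "U \<noteq> {}"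
  shows "\<not> (AE x in lebesgue_on \<Omega>. x \<notin> U)"
proof
  assume "AE x in lebesgue_on \<Omega>. x \<notin> U"
  then have "AE x in lebesgue. x \<in> \<Omega> \<longrightarrow> x \<notin> U"
    using assms(1) by (subst (asm) AE_restrict_space_iff) auto
  then have "AE x in lebesgue. x \<notin> U" using assms(3) by (auto elim: eventually_mono)
  then have "U \<in> null_sets lebesgue" by (simp add: completion.null_sets_iff_AE)
  then have "negligible U" by (simp add: negligible_iff_null_sets)
  then show False using open_not_negligible[OF assms(2,4)] by simp
qed

text \<open>By Fubini almost every \<open>x\<close> agrees with almost all points near it, so
  \<open>u\<close> is almost everywhere constant on small balls. The resulting local value
  \<open>c\<close> is locally constant, hence constant by connectedness.\<close>

lemma near_energy_zero_imp_constant: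
  fixes \<Omega> :: "(real^'n) set" and u :: "real^'n \<Rightarrow> real^'m"
  assumes \<Omega>: "open \<Omega>" "connected \<Omega>" and \<eta>: "0 < \<eta>" and p: "1 < p"
    and u: "u \<in> borel_measurable (lebesgue_on \<Omega>)"
    and zero: "Lp_pow (near_pair s p \<Omega> \<eta>) p (increment u) = 0"
  obtains a where "AE x in lebesgue_on \<Omega>. u x = a"
proof -
  let ?M = "lebesgue_on \<Omega>"
  note [measurable] = u
  have \<Omega>m: "\<Omega> \<in> sets lebesgue" using \<Omega> by auto
  interpret pair_sigma_finite ?M ?M by (rule pair_sigma_finite_lebesgue_on[OF \<Omega>m])
  have "AE z in ?M \<Otimes>\<^sub>M ?M. norm (fst z - snd z) \<le> \<eta> \<longrightarrow> u (fst z) = u (snd z)"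
  proof -
    have "AE z in ?M \<Otimes>\<^sub>M ?M. ennreal (if norm (fst z - snd z) \<le> \<eta> then norm (increment u z) powr p / norm (fst z - snd z) powr (real CARD('n) + p * s) else 0) = 0"
      using zero unfolding Lp_pow_near_pair[OF u] by (subst (asm) nn_integral_0_iff_AE) measurable
    then show ?thesis
    proof eventually_elim
      case (elim z)
      show ?case
      proof
        assume "norm (fst z - snd z) \<le> \<eta>"
        then have "norm (increment u z) powr p / norm (fst z - snd z) powr (real CARD('n) + p * s) \<le> 0"
          using elim by (simp only: if_True ennreal_eq_0_iff)
        then show "u (fst z) = u (snd z)"
          by (cases "fst z = snd z") (auto simp: increment_def divide_le_0_iff)
      qed
    qed
  qed
  then have good: "AE x in ?M. AE y in ?M. norm (x - y) \<le> \<eta> \<longrightarrow> u x = u y"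
    by (rule AE_pair[where Q = "\<lambda>z. norm (fst z - snd z) \<le> \<eta> \<longrightarrow> u (fst z) = u (snd z)", simplified])
  define Q where "Q x0 c r \<longleftrightarrow> 0 < r \<and> ball x0 r \<subseteq> \<Omega> \<and> (AE y in ?M. y \<in> ball x0 r \<longrightarrow> u y = c)" for x0 c r
  have loc: "\<exists>c r. Q x0 c r" if x0: "x0 \<in> \<Omega>" for x0
  proof -
    obtain e where e: "0 < e" "ball x0 e \<subseteq> \<Omega>" using \<Omega>(1) x0 open_contains_ball by blast
    \<comment> \<open>Any two points of a ball of radius at most \<open>\<eta> / 2\<close> form a
      near pair.\<close>
    define r where "r = min e (\<eta> / 2)"
    have r: "0 < r" "ball x0 r \<subseteq> \<Omega>" using e \<eta> by (auto simp: r_def)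
    have "\<exists>x1\<in>ball x0 r. AE y in ?M. norm (x1 - y) \<le> \<eta> \<longrightarrow> u x1 = u y"
    proof (rule ccontr)
      assume "\<not> ?thesis"
      with good have "AE x in ?M. x \<notin> ball x0 r" by (auto elim!: eventually_mono)
      then show False using emeasure_lebesgue_on_open_pos[OF \<Omega>(1) open_ball r(2)] r(1) by simp
    qed
    then obtain x1 where x1: "x1 \<in> ball x0 r" "AE y in ?M. norm (x1 - y) \<le> \<eta> \<longrightarrow> u x1 = u y" by blast
    have "AE y in ?M. y \<in> ball x0 r \<longrightarrow> u y = u x1"
      using x1(2)
    proof eventually_elim
      case (elim y)
      show ?case
      proof
        assume y: "y \<in> ball x0 r"
        have "dist x1 y \<le> dist x1 x0 + dist x0 y" by (rule dist_triangle)
        also have "\<dots> \<le> \<eta> / 2 + \<eta> / 2" using x1(1) y by (intro add_mono) (auto simp: r_def dist_commute)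
        finally show "u y = u x1" using elim by (simp add: dist_norm)
      qed
    qed
    with r show ?thesis unfolding Q_def by blast
  qed
  then obtain c r where Q: "\<And>x. x \<in> \<Omega> \<Longrightarrow> Q x (c x) (r x)" by metis
  have c: "0 < r x" "ball x (r x) \<subseteq> \<Omega>" "AE y in ?M. y \<in> ball x (r x) \<longrightarrow> u y = c x" if "x \<in> \<Omega>" for x
    using Q[OF that] by (simp_all add: Q_def)
  have "c constant_on \<Omega>"
  proof (rule locally_constant_imp_constant[OF \<Omega>(2)])
    fix a assume a: "a \<in> \<Omega>"
    have "c x = c a" if x: "x \<in> ball a (r a)" for x
    proof (rule ccontr)
      assume ne: "c x \<noteq> c a"
      have xo: "x \<in> \<Omega>" using c(2)[OF a] x by blast
      \<comment> \<open>Two different values on overlapping balls would make their nonempty open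
        intersection a null set.\<close>
      have "AE y in ?M. y \<notin> ball x (r x) \<inter> ball a (r a)"
        using c(3)[OF xo] c(3)[OF a] by eventually_elim (use ne in auto)
      moreover have "x \<in> ball x (r x) \<inter> ball a (r a)"
        using c(1)[OF xo] x by simp
      moreover have "open (ball x (r x) \<inter> ball a (r a))" "ball x (r x) \<inter> ball a (r a) \<subseteq> \<Omega>"
        using c(2)[OF xo] by auto
      ultimately show False using emeasure_lebesgue_on_open_pos[OF \<Omega>(1)] by blast
    qed
    moreover have "openin (top_of_set \<Omega>) (ball a (r a))" by (rule open_subset[OF c(2)[OF a] open_ball])
    moreover have "a \<in> ball a (r a)" using c(1)[OF a] by simp
    ultimately show "\<exists>T. openin (top_of_set \<Omega>) T \<and> a \<in> T \<and> (\<forall>x\<in>T. c x = c a)" by blast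
  qed
  then obtain k where k: "\<And>x. x \<in> \<Omega> \<Longrightarrow> c x = k" by (auto simp: constant_on_def)
  \<comment> \<open>A countable subcover keeps the union of the exceptional sets null.\<close>
  obtain F where F: "F \<subseteq> (\<lambda>x. ball x (r x)) ` \<Omega>" "countable F" "\<Union>F = \<Union>((\<lambda>x. ball x (r x)) ` \<Omega>)"
    by (rule Lindelof[of "(\<lambda>x. ball x (r x)) ` \<Omega>"]) auto
  have "\<forall>B\<in>F. AE y in ?M. y \<in> B \<longrightarrow> u y = k"
  proof
    fix B assume "B \<in> F"
    then obtain x where x: "x \<in> \<Omega>" "B = ball x (r x)" using F(1) by blast
    show "AE y in ?M. y \<in> B \<longrightarrow> u y = k" using c(3)[OF x(1)] unfolding x(2) k[OF x(1)] .
  qed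
  then have "AE y in ?M. \<forall>B\<in>F. y \<in> B \<longrightarrow> u y = k"
    by (subst AE_ball_countable[OF F(2)])
  moreover have "AE y in ?M. y \<in> \<Omega>" by (rule AE_I2) simp
  ultimately have "AE y in ?M. u y = k"
  proof eventually_elim
    case (elim y)
    then have "y \<in> ball y (r y)" using c(1)[of y] by simp
    then have "y \<in> \<Union>F" unfolding F(3) using elim(2) by blast
    then show ?case using elim by blast
  qed
  then show thesis by (rule that)
qed

section \<open>The regularizer\<close>

context regularization_setting
begin

abbreviation "M \<equiv> lebesgue_on \<Omega>"
abbreviation "\<Phi> \<equiv> regularizer s p l \<Omega> d \<rho>"
abbreviation "adm \<equiv> sobolev_into s p \<Omega> K"

lemma sets_domain: "\<Omega> \<in> sets lebesgue"
  using domain by auto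

lemma finite_measure_domain: "finite_measure M"
  using domain by (intro finite_measure_lebesgue_on_bounded)

lemma rho_nonneg: "0 \<le> \<rho> x"
  and rho_integral: "(\<integral>x. \<rho> x \<partial>lebesgue) = 1"
  and rho_support: "compact (closure {x. \<rho> x \<noteq> 0})"
  and rho_smooth: "continuously_differentiable k \<rho>"
  using rho(1) unfolding mollifier_def by blast+

lemma continuous_rho: "continuous_on UNIV \<rho>"
  using rho_smooth[of 0] by simp

lemma measurable_rho [measurable]: "\<rho> \<in> borel_measurable borel"
  using continuous_rho by (rule borel_measurable_continuous_onI)

lemma rho_bounded: "\<exists>C>0. \<forall>x. \<rho> x ^ l \<le> C"
proof -
  have "compact (\<rho> ` closure {x. \<rho> x \<noteq> 0})"
    using rho_support continuous_on_subset[OF continuous_rho]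
    by (intro compact_continuous_image) auto
  then obtain B where B: "\<And>x. x \<in> closure {x. \<rho> x \<noteq> 0} \<Longrightarrow> norm (\<rho> x) \<le> B"
    by (meson bounded_iff compact_imp_bounded imageI)
  have "\<rho> x \<le> \<bar>B\<bar>" for x
  proof (cases "\<rho> x = 0")
    case False
    then have "x \<in> closure {x. \<rho> x \<noteq> 0}" using closure_subset by fast
    then show ?thesis using B[of x] by simp
  qed simp
  \<comment> \<open>The added \<open>1\<close> covers \<open>l = 0\<close>, where the weight is
    identically \<open>1\<close>.\<close>
  then have "\<forall>x. \<rho> x ^ l \<le> \<bar>B\<bar> + 1" using l by (auto intro: add_increasing2)
  then show ?thesis by (intro exI[of _ "\<bar>B\<bar> + 1"]) auto
qed

text \<open>The separation property enters only through this lower bound near the origin.\<close>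

lemma rho_lower_bound: "\<exists>\<tau>>0. \<exists>\<eta>>0. \<forall>z. norm z \<le> \<eta> \<longrightarrow> \<tau> \<le> \<rho> z ^ l"
proof -
  have "0 < esssup lebesgue (\<lambda>z. ereal \<bar>\<rho> z\<bar>)"
  proof (rule ccontr)
    assume "\<not> ?thesis"
    then have le: "esssup lebesgue (\<lambda>z. ereal \<bar>\<rho> z\<bar>) \<le> 0" by simp
    have "AE z in lebesgue. \<rho> z = 0"
      using esssup_AE[of "\<lambda>z. ereal \<bar>\<rho> z\<bar>" lebesgue]
    proof eventually_elim
      case (elim z)
      from order_trans[OF elim le] show ?case by (simp add: zero_ereal_def)
    qed
    then have "(\<integral>z. \<rho> z \<partial>lebesgue) = 0" by (rule integral_eq_zero_AE)
    then show False using rho_integral by simp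
  qed
  then obtain \<tau> where \<tau>: "0 < ereal \<tau>" "ereal \<tau> < esssup lebesgue (\<lambda>z. ereal \<bar>\<rho> z\<bar>)"
    using ereal_dense2 by blast
  then obtain \<eta> where \<eta>: "0 < \<eta>" "{z. \<tau> \<le> \<rho> z} = {z. norm z \<le> \<eta>}"
    using rho(2) unfolding separation_property_def by (auto simp: zero_ereal_def)
  \<comment> \<open>The minimum with \<open>1\<close> treats both values of \<open>l\<close> at
    once.\<close>
  have "min 1 \<tau> \<le> \<rho> z ^ l" if "norm z \<le> \<eta>" for z
  proof -
    have "\<tau> \<le> \<rho> z" using \<eta>(2) that by auto
    then show ?thesis using l by auto
  qed
  then show ?thesis using \<tau>(1) \<eta>(1) by (intro exI[of _ "min 1 \<tau>"] exI[of _ \<eta>] conjI) (auto simp: zero_ereal_def)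
qed

section \<open>The metric on the target set and lower semicontinuity\<close>

text \<open>Nothing is known about the measurability of \<open>d\<close> off
  \<open>K \<times> K\<close>. The cut-off is Borel on the whole space and agrees with
  \<open>d\<close> at almost all values that occur.\<close>

definition dK :: "(real^'m) \<times> (real^'m) \<Rightarrow> real" where
  "dK z = indicator (K \<times> K) z *\<^sub>R d (fst z) (snd z)"

lemma dK_eq: "a \<in> K \<Longrightarrow> b \<in> K \<Longrightarrow> dK (a, b) = d a b"
  by (simp add: dK_def)

lemma d_nonneg: "0 \<le> d a b"
  using metric by (simp add: Metric_space_def)

lemma dK_nonneg: "0 \<le> dK z"
  by (simp add: dK_def d_nonneg)

text \<open>Two triangle inequalities in the metric, with the upper bound by a multiple of the
  Euclidean distance, give Lipschitz continuity in both arguments.\<close>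

lemma continuous_d: "continuous_on (K \<times> K) (\<lambda>z. d (fst z) (snd z))"
proof -
  interpret Metric_space K d by (rule metric)
  obtain C where C: "0 < C" "\<And>a b. a \<in> K \<Longrightarrow> b \<in> K \<Longrightarrow> d a b \<le> C * norm (a - b)"
    using equivalent by blast
  have one: "d (fst z) (snd z) - d (fst z') (snd z') \<le> (2 * C) * dist z z'" if z: "z \<in> K \<times> K" "z' \<in> K \<times> K" for z z'
  proof -
    have m: "fst z \<in> K" "snd z \<in> K" "fst z' \<in> K" "snd z' \<in> K" using z by auto
    have "d (fst z) (snd z) \<le> d (fst z) (fst z') + d (fst z') (snd z)" by (rule triangle) (use m in auto)
    also have "d (fst z') (snd z) \<le> d (fst z') (snd z') + d (snd z') (snd z)" by (rule triangle) (use m in auto)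
    also have "d (fst z) (fst z') \<le> C * dist z z'"
      using C(1) dist_fst_le[of z z'] by (intro order_trans[OF C(2)[OF m(1,3)]] mult_left_mono) (auto simp: dist_norm)
    also have "d (snd z') (snd z) \<le> C * dist z z'"
      using C(1) dist_snd_le[of z z'] by (intro order_trans[OF C(2)[OF m(4,2)]] mult_left_mono) (auto simp: dist_norm norm_minus_commute)
    finally show ?thesis by simp
  qed
  have "lipschitz_on (2 * C) (K \<times> K) (\<lambda>z. d (fst z) (snd z))"
  proof (rule lipschitz_onI)
    fix z z' assume "z \<in> K \<times> K" "z' \<in> K \<times> K"
    then show "dist (d (fst z) (snd z)) (d (fst z') (snd z')) \<le> 2 * C * dist z z'"
      using one[of z z'] one[of z' z] by (simp add: dist_real_def dist_commute abs_le_iff)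
  qed (use C in simp)
  then show ?thesis by (rule lipschitz_on_continuous_on)
qed

lemma measurable_dK [measurable]: "dK \<in> borel_measurable borel"
  unfolding dK_def using target by (intro borel_measurable_continuous_on_indicator continuous_d) (auto intro!: borel_closed closed_Times)

definition \<phi>K :: "(real^'n \<Rightarrow> real^'m) \<Rightarrow> (real^'n) \<times> (real^'n) \<Rightarrow> ennreal" where
  "\<phi>K w z = ennreal (dK (w (fst z), w (snd z)) powr p / norm (fst z - snd z) powr (real CARD('n) + p * s)
          * \<rho> (fst z - snd z) ^ l)"

lemma measurable_\<phi>K [measurable]:
  assumes [measurable]: "w \<in> borel_measurable M"
  shows "\<phi>K w \<in> borel_measurable (M \<Otimes>\<^sub>M M)"
  unfolding \<phi>K_def by measurable

lemma regularizer_eq: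
  assumes w: "w \<in> borel_measurable M" "AE x in M. w x \<in> K"
  shows "\<Phi> w = (\<integral>\<^sup>+z. \<phi>K w z \<partial>(M \<Otimes>\<^sub>M M))"
proof -
  have "\<Phi> w = (\<integral>\<^sup>+z. \<phi>K w z \<partial>lebesgue_on (\<Omega> \<times> \<Omega>))"
    unfolding regularizer_def
  proof (rule nn_integral_cong_AE)
    show "AE z in lebesgue_on (\<Omega> \<times> \<Omega>). (case z of (x, y) \<Rightarrow> ennreal (d (w x) (w y) powr p / norm (x - y) powr (real CARD('n) + p * s)
          * \<rho> (x - y) ^ l)) = \<phi>K w z"
      using AE_lebesgue_on_Times_fst_snd[OF sets_domain sets_domain w(2) w(2)]
      by eventually_elim (auto simp: \<phi>K_def dK_eq split_beta)
  qed
  also have "\<dots> = (\<integral>\<^sup>+z. \<phi>K w z \<partial>(M \<Otimes>\<^sub>M M))"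
    by (intro nn_integral_lebesgue_on_Times sets_domain measurable_\<phi>K w)
  finally show ?thesis .
qed

lemma admD:
  assumes "w \<in> adm"
  shows "w \<in> sobolev s p \<Omega>" "w \<in> Lp_space M p" "w \<in> borel_measurable M" "AE x in M. w x \<in> K"
  using assms by (auto simp: sobolev_into_def sobolev_def Lp_space_def)

lemma AE_pairK:
  assumes "AE x in M. P x"
  shows "AE z in M \<Otimes>\<^sub>M M. P (fst z) \<and> P (snd z)"
proof -
  interpret pair_sigma_finite M M by (rule pair_sigma_finite_lebesgue_on[OF sets_domain])
  show ?thesis using AE_fst_snd[OF assms assms] .
qed

lemma regularizer_finite:
  assumes w: "w \<in> adm"
  shows "\<Phi> w < \<infinity>"
proof -
  note wm[measurable] = admD(3)[OF w]
  obtain C where C: "0 < C" "\<And>a b. a \<in> K \<Longrightarrow> b \<in> K \<Longrightarrow> d a b \<le> C * norm (a - b)"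
    using equivalent by blast
  obtain B where B: "0 < B" "\<And>x. \<rho> x ^ l \<le> B" using rho_bounded by blast
  have "\<Phi> w = (\<integral>\<^sup>+z. \<phi>K w z \<partial>(M \<Otimes>\<^sub>M M))" by (rule regularizer_eq[OF admD(3,4)[OF w]])
  also have "\<dots> \<le> (\<integral>\<^sup>+z. ennreal (C powr p * B) * (ennreal (1 / norm (fst z - snd z) powr (real CARD('n) + p * s)) * ennreal (norm (increment w z) powr p)) \<partial>(M \<Otimes>\<^sub>M M))"
  proof (rule nn_integral_mono_AE)
    show "AE z in M \<Otimes>\<^sub>M M. \<phi>K w z \<le> ennreal (C powr p * B) * (ennreal (1 / norm (fst z - snd z) powr (real CARD('n) + p * s)) * ennreal (norm (increment w z) powr p))"
      using AE_pairK[OF admD(4)[OF w]]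
    proof eventually_elim
      case (elim z)
      let ?k = "norm (fst z - snd z) powr (real CARD('n) + p * s)"
      have "dK (w (fst z), w (snd z)) powr p \<le> (C * norm (increment w z)) powr p"
        using elim C p d_nonneg by (intro powr_mono2) (auto simp: dK_eq increment_def)
      also have "\<dots> = C powr p * norm (increment w z) powr p" by (rule powr_mult)
      finally have "dK (w (fst z), w (snd z)) powr p / ?k * \<rho> (fst z - snd z) ^ l
          \<le> C powr p * norm (increment w z) powr p / ?k * B"
        using B rho_nonneg by (intro mult_mono divide_right_mono) auto
      also have "\<dots> = (C powr p * B) * ((1 / ?k) * norm (increment w z) powr p)" by simp
      finally show ?case
        using C(1) B(1) unfolding \<phi>K_def by (simp add: ennreal_mult[symmetric] del: ennreal_mult)
    qed
  qed
  also have "\<dots> = ennreal (C powr p * B) * Lp_pow (sobolev_pair s p \<Omega>) p (increment w)"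
    unfolding Lp_pow_def sobolev_pair_def by (subst nn_integral_density, measurable) (rule nn_integral_cmult, measurable)
  also have "\<dots> < \<infinity>"
    using admD(1)[OF w] sets_domain by (simp add: sobolev_iff Lp_space_iff ennreal_mult_less_top)
  finally show ?thesis .
qed

text \<open>On near pairs the weight is at least \<open>\<tau>\<close>, and on \<open>K\<close> the
  metric dominates the Euclidean distance; hence \<open>c = 1 / \<tau>\<close>.\<close>

lemma regularizer_lower_bound:
  "\<exists>c>0. \<exists>\<eta>>0. \<forall>w\<in>adm. Lp_pow (near_pair s p \<Omega> \<eta>) p (increment w) \<le> ennreal c * \<Phi> w"
proof -
  obtain \<tau> \<eta> where \<tau>: "0 < \<tau>" and \<eta>: "0 < \<eta>" and low: "\<And>z. norm z \<le> \<eta> \<Longrightarrow> \<tau> \<le> \<rho> z ^ l"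
    using rho_lower_bound by blast
  have "Lp_pow (near_pair s p \<Omega> \<eta>) p (increment w) \<le> ennreal (1 / \<tau>) * \<Phi> w" if w: "w \<in> adm" for w
  proof -
    note wm[measurable] = admD(3)[OF w]
    have "Lp_pow (near_pair s p \<Omega> \<eta>) p (increment w) \<le> (\<integral>\<^sup>+z. ennreal (1 / \<tau>) * \<phi>K w z \<partial>(M \<Otimes>\<^sub>M M))"
      unfolding Lp_pow_near_pair[OF wm]
    proof (rule nn_integral_mono_AE)
      show "AE z in M \<Otimes>\<^sub>M M. ennreal (if norm (fst z - snd z) \<le> \<eta> then norm (increment w z) powr p / norm (fst z - snd z) powr (real CARD('n) + p * s) else 0)
          \<le> ennreal (1 / \<tau>) * \<phi>K w z"
        using AE_pairK[OF admD(4)[OF w]]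
      proof eventually_elim
        case (elim z)
        let ?k = "norm (fst z - snd z) powr (real CARD('n) + p * s)"
        show ?case
        proof (cases "norm (fst z - snd z) \<le> \<eta>")
          case True
          have "norm (increment w z) \<le> dK (w (fst z), w (snd z))"
            using elim equivalent by (auto simp: dK_eq increment_def)
          then have "norm (increment w z) powr p \<le> dK (w (fst z), w (snd z)) powr p"
            using p by (intro powr_mono2) auto
          then have "norm (increment w z) powr p / ?k * \<tau> \<le> dK (w (fst z), w (snd z)) powr p / ?k * \<rho> (fst z - snd z) ^ l"
            using \<tau> low[OF True] by (intro mult_mono divide_right_mono) auto
          then have "norm (increment w z) powr p / ?k \<le> 1 / \<tau> * (dK (w (fst z), w (snd z)) powr p / ?k * \<rho> (fst z - snd z) ^ l)"
          proof -
            have "A \<le> 1 / \<tau> * B" if "A * \<tau> \<le> B" for A B using \<tau> that by (simp add: pos_le_divide_eq)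
            then show ?thesis using \<open>_ * \<tau> \<le> _\<close> by blast
          qed
          then have "ennreal (norm (increment w z) powr p / ?k) \<le> ennreal (1 / \<tau> * (dK (w (fst z), w (snd z)) powr p / ?k * \<rho> (fst z - snd z) ^ l))"
            by (rule ennreal_leI)
          also have "\<dots> = ennreal (1 / \<tau>) * \<phi>K w z"
            unfolding \<phi>K_def using \<tau> by (intro ennreal_mult') simp
          finally show ?thesis using True by simp
        qed simp
      qed
    qed
    also have "\<dots> = ennreal (1 / \<tau>) * \<Phi> w"
      unfolding regularizer_eq[OF admD(3,4)[OF w]] by (rule nn_integral_cmult) measurable
    finally show ?thesis .
  qed
  then show ?thesis using \<tau> \<eta> by (intro exI[of _ "1 / \<tau>"] conjI exI[of _ \<eta>]) auto
qed

lemma AE_limit_in_K: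
  assumes "\<And>k. AE x in M. w k x \<in> K" and "AE x in M. (\<lambda>k. w k x) \<longlonglongrightarrow> u x"
  shows "AE x in M. u x \<in> K"
proof -
  have "AE x in M. \<forall>k. w k x \<in> K" using assms(1) by (simp add: AE_all_countable)
  then show ?thesis using assms(2)
    by eventually_elim (use target in \<open>auto intro: closed_sequentially\<close>)
qed

text \<open>Closedness of \<open>K\<close> keeps the limit in the set on which \<open>d\<close> is
  continuous, so the integrands converge almost everywhere and Fatou applies.\<close>

lemma regularizer_lsc:
  assumes w: "\<And>k. w k \<in> adm" and u: "u \<in> borel_measurable M"
    and lim: "AE x in M. (\<lambda>k. w k x) \<longlonglongrightarrow> u x"
    and bd: "eventually (\<lambda>k. \<Phi> (w k) \<le> c) sequentially"
  shows "\<Phi> u \<le> c"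
proof -
  have allK: "AE x in M. \<forall>k. w k x \<in> K" using admD(4)[OF w] by (simp add: AE_all_countable)
  have uK: "AE x in M. u x \<in> K" by (rule AE_limit_in_K[OF admD(4)[OF w] lim])
  have "(\<integral>\<^sup>+z. \<phi>K u z \<partial>(M \<Otimes>\<^sub>M M)) \<le> c"
  proof (rule nn_integral_fatou_le[where h = "\<lambda>k. \<phi>K (w k)"])
    show "\<phi>K (w k) \<in> borel_measurable (M \<Otimes>\<^sub>M M)" for k using admD(3)[OF w] by measurable
    have "AE x in M. (\<forall>k. w k x \<in> K) \<and> u x \<in> K \<and> (\<lambda>k. w k x) \<longlonglongrightarrow> u x"
      using allK uK lim by eventually_elim auto
    from AE_pairK[OF this] show "AE z in M \<Otimes>\<^sub>M M. (\<lambda>k. \<phi>K (w k) z) \<longlonglongrightarrow> \<phi>K u z"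
    proof eventually_elim
      case (elim z)
      have "(\<lambda>k. (w k (fst z), w k (snd z))) \<longlonglongrightarrow> (u (fst z), u (snd z))"
        using elim by (intro tendsto_Pair) auto
      then have "(\<lambda>k. d (fst (w k (fst z), w k (snd z))) (snd (w k (fst z), w k (snd z))))
          \<longlonglongrightarrow> d (fst (u (fst z), u (snd z))) (snd (u (fst z), u (snd z)))"
        using elim by (intro continuous_on_tendsto_compose[OF continuous_d]) auto
      then have *: "(\<lambda>k. dK (w k (fst z), w k (snd z))) \<longlonglongrightarrow> dK (u (fst z), u (snd z))"
        using elim by (simp add: dK_eq)
      have "(\<lambda>k. dK (w k (fst z), w k (snd z)) powr p) \<longlonglongrightarrow> dK (u (fst z), u (snd z)) powr p"
        using tendsto_norm_powr[OF *, of p] p by (simp add: dK_nonneg)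
      then show ?case
        unfolding \<phi>K_def by (intro tendsto_ennrealI tendsto_mult_right tendsto_mult tendsto_const) (simp add: divide_inverse tendsto_mult_right)
    qed
    show "eventually (\<lambda>k. (\<integral>\<^sup>+z. \<phi>K (w k) z \<partial>(M \<Otimes>\<^sub>M M)) \<le> c) sequentially"
      using bd by eventually_elim (simp add: regularizer_eq[OF admD(3,4)[OF w]])
  qed
  then show ?thesis by (simp add: regularizer_eq[OF u uK])
qed

end

section \<open>Tikhonov regularization\<close>

text \<open>By compactness of \<open>ennreal\<close>, the indices outside a neighbourhood of
  \<open>a\<close>, if infinite in number, would carry a convergent subsequence with a limit other
  than \<open>a\<close>. No boundedness has to be checked in advance.\<close>

lemma ennreal_tendstoI_subseq:
  fixes X :: "nat \<Rightarrow> ennreal"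
  assumes "\<And>r L. strict_mono (r :: nat \<Rightarrow> nat) \<Longrightarrow> (\<lambda>k. X (r k)) \<longlonglongrightarrow> L \<Longrightarrow> L = a"
  shows "X \<longlonglongrightarrow> a"
proof (rule ccontr)
  assume "\<not> ?thesis"
  then obtain U where U: "open U" "a \<in> U" "\<not> eventually (\<lambda>k. X k \<in> U) sequentially"
    by (auto simp: tendsto_def)
  then have "\<exists>\<^sub>F k in sequentially. X k \<notin> U" by (simp add: not_eventually)
  then have inf: "infinite {k. X k \<notin> U}" by (simp add: frequently_cofinite[symmetric] cofinite_eq_sequentially)
  define q where "q = enumerate {k. X k \<notin> U}"
  have q: "strict_mono q" "\<And>k. X (q k) \<notin> U"
    using inf enumerate_in_set[OF inf] strict_mono_enumerate[OF inf] by (auto simp: q_def)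
  obtain L r where r: "strict_mono r" "((X \<circ> q) \<circ> r) \<longlonglongrightarrow> L"
    using compact_complete_linorder[of "X \<circ> q"] by blast
  have "L = a"
    using r(2) by (intro assms[of "q \<circ> r"] strict_mono_o q(1) r(1)) (simp add: o_def)
  then have "eventually (\<lambda>k. ((X \<circ> q) \<circ> r) k \<in> U) sequentially"
    using r(2) U(1,2) by (auto simp: tendsto_def)
  then show False using q(2) by (auto simp: eventually_sequentially)
qed

lemma ennreal_tendsto_zero_le:
  fixes X Y :: "nat \<Rightarrow> ennreal"
  assumes "\<And>k. X k \<le> Y k" "Y \<longlonglongrightarrow> 0"
  shows "X \<longlonglongrightarrow> 0"
  using assms by (intro tendsto_sandwich[of "\<lambda>_. 0" X sequentially Y]) auto

section \<open>Separation of weak limits\<close>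

text \<open>Pairing with a function bounded by \<open>1\<close> supplies concrete elements of the
  dual. The constant \<open>m powr ((p - 1) / p)\<close> is the one from Hoelder's inequality,
  obtained here as the \<open>p\<close>-th root of the Jensen bound.\<close>

lemma integral_sgn_dual:
  fixes g :: "real^'n \<Rightarrow> real^'m"
  assumes \<Omega>: "open \<Omega>" "bounded \<Omega>" and p: "1 < p"
    and g[measurable]: "g \<in> borel_measurable (lebesgue_on \<Omega>)" and g1: "\<And>x. norm (g x) \<le> 1"
  shows "(\<lambda>u :: real^'n \<Rightarrow> real^'m. \<integral>x. u x \<bullet> g x \<partial>lebesgue_on \<Omega>) \<in> sobolev_dual s p \<Omega>"
proof -
  let ?M = "lebesgue_on \<Omega>"
  interpret finite_measure ?M using \<Omega> by (intro finite_measure_lebesgue_on_bounded)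
  have \<Omega>m: "\<Omega> \<in> sets lebesgue" using \<Omega> by auto
  have int: "integrable ?M (\<lambda>x. u x \<bullet> g x)" "integrable ?M u" "u \<in> borel_measurable ?M" "u \<in> Lp_space ?M p"
    if "u \<in> sobolev s p \<Omega>" for u :: "real^'n \<Rightarrow> real^'m"
  proof -
    show L: "u \<in> Lp_space ?M p" using that \<Omega>m by (simp add: sobolev_iff)
    show u: "integrable ?M u" using Lp_space_integrable(1)[OF p L] .
    then show [measurable]: "u \<in> borel_measurable ?M" by auto
    show "integrable ?M (\<lambda>x. u x \<bullet> g x)"
    proof (rule Bochner_Integration.integrable_bound[OF u])
      show "AE x in ?M. norm (u x \<bullet> g x) \<le> norm (u x)"
      proof (rule AE_I2)
        fix x
        have "norm (u x \<bullet> g x) \<le> norm (u x) * norm (g x)" by (simp add: Cauchy_Schwarz_ineq2)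
        also have "\<dots> \<le> norm (u x) * 1" by (intro mult_left_mono g1) auto
        finally show "norm (u x \<bullet> g x) \<le> norm (u x)" by simp
      qed
    qed measurable
  qed
  define m where "m = measure ?M (space ?M)"
  have m: "0 \<le> m" by (simp add: m_def)
  have bound: "\<bar>\<integral>x. u x \<bullet> g x \<partial>?M\<bar> \<le> m powr ((p - 1) / p) * sobolev_norm s p \<Omega> u"
    if u: "u \<in> sobolev s p \<Omega>" for u :: "real^'n \<Rightarrow> real^'m"
  proof -
    note [measurable] = int(3)[OF u]
    have fin: "Lp_pow ?M p u < \<infinity>" using int(4)[OF u] by (simp add: Lp_space_iff)
    have "ennreal (norm (\<integral>x. u x \<bullet> g x \<partial>?M) powr p) \<le> ennreal (m powr (p - 1)) * Lp_pow ?M p (\<lambda>x. u x \<bullet> g x)"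
      using m by (intro norm_integral_powr_le p) (auto simp: m_def emeasure_eq_measure)
    also have "\<dots> \<le> ennreal (m powr (p - 1)) * Lp_pow ?M p u"
      unfolding Lp_pow_def
    proof (intro mult_left_mono nn_integral_mono ennreal_leI powr_mono2)
      fix x
      have "norm (u x \<bullet> g x) \<le> norm (u x) * norm (g x)" by (simp add: Cauchy_Schwarz_ineq2)
      also have "\<dots> \<le> norm (u x) * 1" by (intro mult_left_mono g1) auto
      finally show "norm (u x \<bullet> g x) \<le> norm (u x)" by simp
    qed (use p in auto)
    also have "\<dots> = ennreal (m powr (p - 1) * enn2real (Lp_pow ?M p u))"
      using fin by (simp add: ennreal_mult)
    finally have "\<bar>\<integral>x. u x \<bullet> g x \<partial>?M\<bar> powr p \<le> m powr (p - 1) * enn2real (Lp_pow ?M p u)"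
      by simp
    then have "(\<bar>\<integral>x. u x \<bullet> g x \<partial>?M\<bar> powr p) powr (1 / p) \<le> (m powr (p - 1) * enn2real (Lp_pow ?M p u)) powr (1 / p)"
      using p by (intro powr_mono2) auto
    then have "\<bar>\<integral>x. u x \<bullet> g x \<partial>?M\<bar> \<le> m powr ((p - 1) / p) * enn2real (Lp_pow ?M p u) powr (1 / p)"
      using p by (simp add: powr_powr powr_mult)
    also have "\<dots> \<le> m powr ((p - 1) / p) * sobolev_norm s p \<Omega> u"
      unfolding sobolev_norm_powr[OF u \<Omega>m p] using p by (intro mult_left_mono powr_mono2) auto
    finally show ?thesis .
  qed
  show ?thesis
    unfolding sobolev_dual_def
  proof (safe, goal_cases)
    case (1 u v)
    then show ?case using int by (simp add: inner_add_left)
  next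
    case (2 c u)
    then show ?case by simp
  next
    case 3
    then show ?case using bound by blast
  qed
qed

lemma weakly_convergesD:
  "weakly_converges s p \<Omega> w u \<Longrightarrow> f \<in> sobolev_dual s p \<Omega> \<Longrightarrow> (\<lambda>k. f (w k)) \<longlonglongrightarrow> f u"
  unfolding weakly_converges_def by blast

text \<open>Testing with the sign of \<open>u - v\<close> makes the functional of the difference
  equal to the integral of its norm, which must vanish.\<close>

lemma weak_limit_unique:
  fixes u v :: "real^'n \<Rightarrow> real^'m"
  assumes \<Omega>: "open \<Omega>" "bounded \<Omega>" and p: "1 < p"
    and "weakly_converges s p \<Omega> w u" "weakly_converges s p \<Omega> w v"
  shows "AE x in lebesgue_on \<Omega>. u x = v x"
proof -
  let ?M = "lebesgue_on \<Omega>"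
  interpret finite_measure ?M using \<Omega> by (intro finite_measure_lebesgue_on_bounded)
  have \<Omega>m: "\<Omega> \<in> sets lebesgue" using \<Omega> by auto
  have uv: "u \<in> sobolev s p \<Omega>" "v \<in> sobolev s p \<Omega>" using assms by (auto simp: weakly_converges_def)
  have L: "(\<lambda>x. u x - v x) \<in> Lp_space ?M p" using sobolev_diff[OF \<Omega>m p uv] \<Omega>m by (simp add: sobolev_iff)
  then have [measurable]: "(\<lambda>x. u x - v x) \<in> borel_measurable ?M" by (simp add: Lp_space_iff)
  define g where "g x = sgn (u x - v x)" for x
  have gm: "g \<in> borel_measurable ?M"
    unfolding g_def sgn_div_norm by measurable
  have g1: "norm (g x) \<le> 1" for x by (simp add: g_def norm_sgn)
  let ?f = "\<lambda>u :: real^'n \<Rightarrow> real^'m. \<integral>x. u x \<bullet> g x \<partial>?M"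
  have f: "?f \<in> sobolev_dual s p \<Omega>" by (rule integral_sgn_dual[OF \<Omega> p gm g1])
  have "(\<lambda>k. ?f (w k)) \<longlonglongrightarrow> ?f u" "(\<lambda>k. ?f (w k)) \<longlonglongrightarrow> ?f v"
    using weakly_convergesD[OF assms(4) f] weakly_convergesD[OF assms(5) f] by simp_all
  then have "?f u = ?f v" by (rule LIMSEQ_unique)
  then have "?f (\<lambda>x. u x - v x) = 0" using sobolev_dual_diff[OF \<Omega>m f uv] by simp
  moreover have "(u x - v x) \<bullet> g x = norm (u x - v x)" for x
    by (cases "u x = v x") (simp_all add: g_def sgn_div_norm power2_norm_eq_inner[symmetric] power2_eq_square)
  ultimately have "(\<integral>x. norm (u x - v x) \<partial>?M) = 0" by simp
  then have "AE x in ?M. norm (u x - v x) = 0"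
    using Lp_space_integrable(1)[OF p L] by (subst (asm) integral_nonneg_eq_0_iff_AE) auto
  then show ?thesis by eventually_elim simp
qed

section \<open>Forward operators and coercivity\<close>

text \<open>The interface through which both transforms enter the regularization theory.
  \<open>F_const\<close> excludes nonzero constants from the kernel, and constants are exactly the
  functions invisible to the near energy.\<close>

locale tikhonov_operator = regularization_setting p s l \<Omega> R K d \<rho>
  for p s :: real and l :: nat and \<Omega> :: "(real^'n) set" and R :: real
    and K :: "(real^'m) set" and d :: "real^'m \<Rightarrow> real^'m \<Rightarrow> real" and \<rho> :: "real^'n \<Rightarrow> real" +
  fixes F :: "(real^'n \<Rightarrow> real^'m) \<Rightarrow> real \<times> (real^'n) \<Rightarrow> 'b::euclidean_space"
  assumes F_measurable: "w \<in> Lp_space (lebesgue_on \<Omega>) p \<Longrightarrow> F w \<in> borel_measurable Sigma_measure"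
    and F_bounded: "\<exists>C\<ge>0. \<forall>u\<in>Lp_space (lebesgue_on \<Omega>) p. \<forall>v\<in>Lp_space (lebesgue_on \<Omega>) p.
      Lp_pow Sigma_measure p (\<lambda>z. F u z - F v z) \<le> ennreal C * Lp_pow (lebesgue_on \<Omega>) p (\<lambda>x. u x - v x)"
    and F_scaleR: "w \<in> Lp_space (lebesgue_on \<Omega>) p \<Longrightarrow> F (\<lambda>x. c *\<^sub>R w x) z = c *\<^sub>R F w z"
    and F_const: "(AE z in Sigma_measure. F (\<lambda>x. a) z = 0) \<Longrightarrow> a = 0"
begin

abbreviation "S \<equiv> Sigma_measure :: (real \<times> (real^'n)) measure"
abbreviation "P \<equiv> sobolev_pair s p \<Omega>"

lemma F_diff_Lp:
  assumes "u \<in> Lp_space M p" "v \<in> Lp_space M p"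
  shows "Lp_pow S p (\<lambda>z. F u z - F v z) < \<infinity>"
proof -
  obtain C where C: "Lp_pow S p (\<lambda>z. F u z - F v z) \<le> ennreal C * Lp_pow M p (\<lambda>x. u x - v x)"
    using F_bounded assms by blast
  have "Lp_pow M p (\<lambda>x. u x - v x) < \<infinity>"
    using Lp_space_diff[OF p assms] by (simp add: Lp_space_iff)
  then show ?thesis using C by (auto simp: ennreal_mult_less_top intro: le_less_trans)
qed

lemma F_Lp:
  assumes "w \<in> Lp_space M p"
  shows "F w \<in> Lp_space S p"
proof -
  have "F (\<lambda>x. 0) z = 0" for z using F_scaleR[OF assms, of 0 z] by simp
  then have "Lp_pow S p (F w) < \<infinity>" using F_diff_Lp[OF assms Lp_space_zero, of ] p by simp
  then show ?thesis using F_measurable[OF assms] by (simp add: Lp_space_iff)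
qed

lemma F_tendsto:
  assumes w: "\<And>k. w k \<in> Lp_space M p" and u: "u \<in> Lp_space M p"
    and lim: "(\<lambda>k. Lp_pow M p (\<lambda>x. w k x - u x)) \<longlonglongrightarrow> 0"
  shows "(\<lambda>k. Lp_pow S p (\<lambda>z. F (w k) z - F u z)) \<longlonglongrightarrow> 0"
proof -
  obtain C where C: "\<And>u v. u \<in> Lp_space M p \<Longrightarrow> v \<in> Lp_space M p \<Longrightarrow>
      Lp_pow S p (\<lambda>z. F u z - F v z) \<le> ennreal C * Lp_pow M p (\<lambda>x. u x - v x)"
    using F_bounded by blast
  have "(\<lambda>k. ennreal C * Lp_pow M p (\<lambda>x. w k x - u x)) \<longlonglongrightarrow> ennreal C * 0"
    by (intro ennreal_tendsto_cmult lim) auto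
  then have "(\<lambda>k. ennreal C * Lp_pow M p (\<lambda>x. w k x - u x)) \<longlonglongrightarrow> 0" by simp
  then show ?thesis by (rule ennreal_tendsto_zero_le[OF C[OF w u]])
qed

lemma data_tendsto:
  assumes w: "\<And>k. w k \<in> Lp_space M p" and u: "u \<in> Lp_space M p"
    and lim: "(\<lambda>k. Lp_pow M p (\<lambda>x. w k x - u x)) \<longlonglongrightarrow> 0"
    and v: "\<And>k. v k \<in> Lp_space S p" and v': "v' \<in> Lp_space S p"
    and limv: "(\<lambda>k. Lp_pow S p (\<lambda>z. v' z - v k z)) \<longlonglongrightarrow> 0"
  shows "(\<lambda>k. Lp_pow S p (\<lambda>z. F (w k) z - v k z)) \<longlonglongrightarrow> Lp_pow S p (\<lambda>z. F u z - v' z)"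
proof (rule Lp_pow_tendsto[OF p])
  note L = Lp_space_diff[OF p F_Lp[OF w] v] Lp_space_diff[OF p F_Lp[OF u] v']
  show "(\<lambda>z. F (w k) z - v k z) \<in> borel_measurable S" for k using L(1) by (simp add: Lp_space_iff)
  show "(\<lambda>z. F u z - v' z) \<in> borel_measurable S" "Lp_pow S p (\<lambda>z. F u z - v' z) < \<infinity>"
    using L(2) by (simp_all add: Lp_space_iff)
  have [measurable]: "F (w k) \<in> borel_measurable S" "v k \<in> borel_measurable S" "F u \<in> borel_measurable S" "v' \<in> borel_measurable S" for k
    using F_Lp[OF w] F_Lp[OF u] v v' by (auto simp: Lp_space_iff)
  have "(\<lambda>k. ennreal (2 powr p) * (Lp_pow S p (\<lambda>z. F (w k) z - F u z) + Lp_pow S p (\<lambda>z. v' z - v k z))) \<longlonglongrightarrow> ennreal (2 powr p) * (0 + 0)"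
    by (intro ennreal_tendsto_cmult tendsto_add F_tendsto w u lim limv) auto
  then have "(\<lambda>k. ennreal (2 powr p) * (Lp_pow S p (\<lambda>z. F (w k) z - F u z) + Lp_pow S p (\<lambda>z. v' z - v k z))) \<longlonglongrightarrow> 0" by simp
  moreover have "Lp_pow S p (\<lambda>z. (F (w k) z - v k z) - (F u z - v' z))
      \<le> ennreal (2 powr p) * (Lp_pow S p (\<lambda>z. F (w k) z - F u z) + Lp_pow S p (\<lambda>z. v' z - v k z))" for k
    using Lp_pow_add_le2[OF p, of "\<lambda>z. F (w k) z - F u z" S "\<lambda>z. v' z - v k z"] by (simp add: algebra_simps)
  ultimately show "(\<lambda>k. Lp_pow S p (\<lambda>z. (F (w k) z - v k z) - (F u z - v' z))) \<longlonglongrightarrow> 0"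
    by (rule ennreal_tendsto_zero_le[rotated])
qed

text \<open>Rescaling an unbounded sequence to unit norm would produce in the limit a constant function in the kernel of \<open>F\<close>.\<close>

lemma coercive_Lp:
  fixes B :: real
  assumes B: "0 \<le> B"
  shows "\<exists>C\<ge>0. \<forall>w\<in>adm. \<Phi> w \<le> ennreal B \<longrightarrow> Lp_pow S p (F w) \<le> ennreal B \<longrightarrow> Lp_pow M p w \<le> ennreal C"
proof (rule ccontr)
  assume neg: "\<not> ?thesis"
  define Q where "Q k w \<longleftrightarrow> w \<in> adm \<and> \<Phi> w \<le> ennreal B \<and> Lp_pow S p (F w) \<le> ennreal B \<and> ennreal (real (Suc k)) < Lp_pow M p w"
    for k :: nat and w
  have "\<exists>w. Q k w" for k
  proof (rule ccontr)
    assume "\<not> ?thesis"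
    then have "\<forall>w\<in>adm. \<Phi> w \<le> ennreal B \<longrightarrow> Lp_pow S p (F w) \<le> ennreal B \<longrightarrow> Lp_pow M p w \<le> ennreal (real (Suc k))"
      unfolding Q_def by (blast intro: leI)
    then show False using neg of_nat_0_le_iff[of "Suc k"] by blast
  qed
  then obtain w where Q: "\<And>k. Q k (w k)" by metis
  have w: "w k \<in> adm" and wB: "\<Phi> (w k) \<le> ennreal B" "Lp_pow S p (F (w k)) \<le> ennreal B"
    and big: "ennreal (real (Suc k)) < Lp_pow M p (w k)" for k
    using Q[of k] by (simp_all only: Q_def)
  interpret finite_measure M by (rule finite_measure_domain)
  note wL = admD(2)[OF w] and wm[measurable] = admD(3)[OF w]
  define N where "N k = enn2real (Lp_pow M p (w k))" for k
  have N: "Lp_pow M p (w k) = ennreal (N k)" for k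
    using wL[of k] by (simp add: N_def Lp_space_iff less_top)
  have Nbig: "real (Suc k) < N k" for k
    using big[of k] unfolding N by (subst (asm) ennreal_less_iff) auto
  have N0: "0 < N k" for k using Nbig[of k] by (meson less_trans of_nat_0_less_iff zero_less_Suc)
  \<comment> \<open>\<open>t k\<close> is the reciprocal of the norm of \<open>w k\<close>; after
    scaling by it, every quantity homogeneous of degree \<open>p\<close> is divided by
    \<open>N k\<close>.\<close>
  define t where "t k = N k powr (- 1 / p)" for k
  have t: "\<bar>t k\<bar> powr p = 1 / N k" for k
  proof -
    have "\<bar>t k\<bar> powr p = N k powr ((- 1 / p) * p)"
      unfolding t_def by (simp only: abs_of_nonneg powr_ge_zero powr_powr)
    also have "(- 1 / p) * p = - 1" using p by simp
    finally show ?thesis using N0[of k] by (simp add: powr_minus_divide)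
  qed
  have Ninv: "(\<lambda>k. 1 / N k) \<longlonglongrightarrow> 0"
  proof (rule tendsto_sandwich[OF _ _ tendsto_const LIMSEQ_inverse_real_of_nat])
    show "eventually (\<lambda>k. 1 / N k \<le> inverse (real (Suc k))) sequentially"
      using Nbig N0 by (intro always_eventually allI) (simp add: inverse_eq_divide less_imp_le frac_le)
    show "eventually (\<lambda>k. 0 \<le> 1 / N k) sequentially"
      using N0 by (intro always_eventually allI) (simp add: less_imp_le)
  qed
  have Ninv1: "1 / N k \<le> 1" for k
    using Nbig[of k] N0[of k] by simp
  define u where "u k x = t k *\<^sub>R w k x" for k x
  have uL: "u k \<in> Lp_space M p" for k unfolding u_def by (rule Lp_space_scaleR[OF wL])
  have um[measurable]: "u k \<in> borel_measurable M" for k using uL by (simp add: Lp_space_iff)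
  have u1: "Lp_pow M p (u k) = 1" for k
    unfolding u_def using N0[of k] by (simp add: Lp_pow_scaleR t N ennreal_mult[symmetric] del: ennreal_mult)
  obtain c \<eta> where c: "0 < c" and \<eta>: "0 < \<eta>"
    and near: "\<And>w. w \<in> adm \<Longrightarrow> Lp_pow (near_pair s p \<Omega> \<eta>) p (increment w) \<le> ennreal c * \<Phi> w"
    using regularizer_lower_bound by blast
  let ?N = "near_pair s p \<Omega> \<eta>"
  have incu: "increment (u k) = (\<lambda>z. t k *\<^sub>R increment (w k) z)" for k
    unfolding u_def by (rule increment_scaleR)
  have incm: "increment (w k) \<in> borel_measurable ?N" "increment (u k) \<in> borel_measurable ?N" for k
    by (simp_all add: measurable_cong_sets[OF sets_near_pair refl] borel_measurable_increment)
  have nearu: "Lp_pow ?N p (increment (u k)) \<le> ennreal (1 / N k * (c * B))" for k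
  proof -
    have "Lp_pow ?N p (increment (u k)) = ennreal (1 / N k) * Lp_pow ?N p (increment (w k))"
      unfolding incu by (simp add: Lp_pow_scaleR incm t)
    also have "\<dots> \<le> ennreal (1 / N k) * (ennreal c * ennreal B)"
      by (intro mult_left_mono order_trans[OF near[OF w]] wB) auto
    also have "\<dots> = ennreal (1 / N k * (c * B))"
      using c B N0[of k] by (simp add: ennreal_mult[symmetric] del: ennreal_mult)
    finally show ?thesis .
  qed
  obtain C where C: "0 \<le> C" and far: "\<And>u :: real^'n \<Rightarrow> real^'m. u \<in> borel_measurable M \<Longrightarrow>
    Lp_pow P p (increment u) \<le> Lp_pow ?N p (increment u) + ennreal C * Lp_pow M p u"
    using Lp_pow_sobolev_pair_le_near[OF domain(4,2) p s(1) \<eta>, where 'm = 'm] by blast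
  define B' where "B' = max 1 (c * B + C)"
  have enu: "Lp_pow P p (increment (u k)) \<le> ennreal B'" for k
  proof -
    have "Lp_pow P p (increment (u k)) \<le> ennreal (1 / N k * (c * B)) + ennreal C * 1"
      using far[OF um[of k]] add_right_mono[OF nearu[of k]] unfolding u1 by (rule order_trans)
    also have "\<dots> \<le> ennreal (1 * (c * B)) + ennreal C * 1"
      using Ninv1 c B by (intro add_right_mono ennreal_leI mult_right_mono) auto
    also have "\<dots> \<le> ennreal B'" using c B C by (simp add: B'_def ennreal_plus[symmetric] ennreal_leI del: ennreal_plus)
    finally show ?thesis .
  qed
  have u1': "Lp_pow M p (u k) \<le> ennreal B'" for k by (simp add: u1 B'_def ennreal_1[symmetric] ennreal_leI del: ennreal_1)
  obtain r g where r: "strict_mono r" and g[measurable]: "g \<in> borel_measurable M"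
    and lim: "(\<lambda>k. Lp_pow M p (\<lambda>x. u (r k) x - g x)) \<longlonglongrightarrow> 0"
    by (rule sobolev_compact_embedding[OF domain(4,2,5) p s(1) um u1' enu])
  \<comment> \<open>Strong convergence preserves the norm, so the limit cannot be zero; this is the
    fact to be contradicted.\<close>
  have g1: "Lp_pow M p g = 1"
  proof -
    obtain k where k: "Lp_pow M p (\<lambda>x. u (r k) x - g x) < 1"
      using order_tendstoD(2)[OF lim, of 1] by (auto simp: eventually_sequentially)
    have "Lp_pow M p (\<lambda>x. u (r k) x - (u (r k) x - g x)) \<le> ennreal (2 powr p) * (Lp_pow M p (u (r k)) + Lp_pow M p (\<lambda>x. u (r k) x - g x))"
      by (rule Lp_pow_diff_le2[OF p]) measurable
    also have "\<dots> < \<infinity>" using k by (auto simp: u1 ennreal_mult_less_top intro: less_trans)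
    finally have "Lp_pow M p g < \<infinity>" by simp
    then have "(\<lambda>k. Lp_pow M p (u (r k))) \<longlonglongrightarrow> Lp_pow M p g"
      by (intro Lp_pow_tendsto[OF p _ g _ lim]) auto
    then show ?thesis by (simp add: u1 LIMSEQ_const_iff)
  qed
  have gL: "g \<in> Lp_space M p" using g1 by (simp add: Lp_space_iff)
  have ugm: "(\<lambda>x. u (r k) x - g x) \<in> borel_measurable M" for k by measurable
  obtain q where q: "strict_mono q" "AE x in M. (\<lambda>k. u (r (q k)) x - g x) \<longlonglongrightarrow> 0"
    using Lp_pow_AE_subseq[OF p ugm lim] by blast
  \<comment> \<open>The near energies of the normalised functions are at most
    \<open>c * B / N k\<close> and tend to zero; Fatou passes this on to \<open>g\<close>.\<close>
  have near_le: "Lp_pow ?N p (increment g) \<le> ennreal e" if e: "0 < e" for e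
    unfolding Lp_pow_def
  proof (rule nn_integral_fatou_le[where h = "\<lambda>k z. ennreal (norm (increment (u (r (q k))) z) powr p)"])
    show "(\<lambda>z. ennreal (norm (increment (u (r (q k))) z) powr p)) \<in> borel_measurable ?N" for k
      using incm(2) by measurable
    show "AE z in ?N. (\<lambda>k. ennreal (norm (increment (u (r (q k))) z) powr p)) \<longlonglongrightarrow> ennreal (norm (increment g z) powr p)"
      using AE_near_pairI[OF sets_domain q(2), of s p \<eta>]
    proof eventually_elim
      case (elim z)
      then have "(\<lambda>k. (u (r (q k)) (fst z) - u (r (q k)) (snd z))) \<longlonglongrightarrow> g (fst z) - g (snd z)"
        by (intro tendsto_diff) (auto simp: LIM_zero_iff)
      then show ?case using p by (intro tendsto_ennrealI tendsto_norm_powr) (auto simp: increment_def)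
    qed
    have "(\<lambda>k. 1 / N k * (c * B)) \<longlonglongrightarrow> 0 * (c * B)" by (intro tendsto_intros Ninv)
    then have "(\<lambda>k. 1 / N (r (q k)) * (c * B)) \<longlonglongrightarrow> 0"
      using tendsto_subseq_zeroD[OF _ strict_mono_o[OF r q(1)], of "\<lambda>k. 1 / N k * (c * B)" 0] by (simp add: o_def)
    then have "eventually (\<lambda>k. 1 / N (r (q k)) * (c * B) < e) sequentially" using e by (rule order_tendstoD)
    then show "eventually (\<lambda>k. (\<integral>\<^sup>+z. ennreal (norm (increment (u (r (q k))) z) powr p) \<partial>?N) \<le> ennreal e) sequentially"
    proof eventually_elim
      case (elim k)
      have "Lp_pow ?N p (increment (u (r (q k)))) \<le> ennreal (1 / N (r (q k)) * (c * B))" by (rule nearu)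
      also have "\<dots> \<le> ennreal e" using elim by (intro ennreal_leI) simp
      finally show ?case by (simp add: Lp_pow_def)
    qed
  qed
  have near0: "Lp_pow ?N p (increment g) = 0"
  proof (rule ccontr)
    assume "\<not> ?thesis"
    then have pos: "0 < Lp_pow ?N p (increment g)" by (simp add: zero_less_iff_neq_zero)
    obtain e where "0 < e" "ennreal e < Lp_pow ?N p (increment g)" by (rule ennreal_pos_real_below[OF pos])
    then show False using near_le[of e] by simp
  qed
  obtain a where a: "AE x in M. g x = a"
    by (rule near_energy_zero_imp_constant[OF domain(4,3) \<eta> p g near0])
  have Fg: "Lp_pow S p (F g) = 0"
  proof -
    have Fm: "F (u k) \<in> borel_measurable S" "F g \<in> borel_measurable S" for k using F_measurable uL gL by auto
    have "Lp_pow S p (F (u k)) \<le> ennreal (1 / N k * B)" for k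
    proof -
      have "F (u k) = (\<lambda>z. t k *\<^sub>R F (w k) z)" unfolding u_def using F_scaleR[OF wL] by auto
      then have "Lp_pow S p (F (u k)) = ennreal (1 / N k) * Lp_pow S p (F (w k))"
        using F_measurable[OF wL] by (simp add: Lp_pow_scaleR t)
      also have "\<dots> \<le> ennreal (1 / N k) * ennreal B" by (intro mult_left_mono wB) auto
      finally show ?thesis using N0[of k] B by (simp add: ennreal_mult[symmetric] del: ennreal_mult)
    qed
    then have le: "Lp_pow S p (F g) \<le> ennreal (2 powr p) * (ennreal (1 / N (r k) * B) + Lp_pow S p (\<lambda>z. F (u (r k)) z - F g z))" for k
    proof -
      have "Lp_pow S p (\<lambda>z. F (u (r k)) z - (F (u (r k)) z - F g z))
          \<le> ennreal (2 powr p) * (Lp_pow S p (F (u (r k))) + Lp_pow S p (\<lambda>z. F (u (r k)) z - F g z))"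
        using Fm by (intro Lp_pow_diff_le2 p) auto
      also have "\<dots> \<le> ennreal (2 powr p) * (ennreal (1 / N (r k) * B) + Lp_pow S p (\<lambda>z. F (u (r k)) z - F g z))"
        by (intro mult_left_mono add_right_mono \<open>\<And>k. Lp_pow S p (F (u k)) \<le> ennreal (1 / N k * B)\<close>) auto
      finally show ?thesis by simp
    qed
    have "(\<lambda>k. 1 / N k * B) \<longlonglongrightarrow> 0 * B" by (intro tendsto_intros Ninv)
    then have "(\<lambda>k. ennreal (1 / N (r k) * B)) \<longlonglongrightarrow> ennreal 0"
      using tendsto_subseq_zeroD[OF _ r, of "\<lambda>k. 1 / N k * B" 0] by (intro tendsto_ennrealI) simp
    then have "(\<lambda>k. ennreal (2 powr p) * (ennreal (1 / N (r k) * B) + Lp_pow S p (\<lambda>z. F (u (r k)) z - F g z))) \<longlonglongrightarrow> ennreal (2 powr p) * (ennreal 0 + 0)"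
      by (intro ennreal_tendsto_cmult tendsto_add F_tendsto uL gL lim) auto
    then have "Lp_pow S p (F g) \<le> ennreal (2 powr p) * (ennreal 0 + 0)"
      by (rule tendsto_lowerbound) (rule always_eventually, rule allI, rule le, simp)
    then show ?thesis by simp
  qed
  have aL: "(\<lambda>x. a) \<in> Lp_space M p"
    using gL a by (intro Lp_space_cong_AE[OF gL]) auto
  \<comment> \<open>The Lipschitz bound shows that \<open>F\<close> sees its argument only up to
    null sets, so \<open>g\<close> may be replaced by the everywhere constant function required by
    \<open>F_const\<close>.\<close>
  have "Lp_pow S p (\<lambda>z. F (\<lambda>x. a) z - F g z) = 0"
  proof -
    obtain C where "Lp_pow S p (\<lambda>z. F (\<lambda>x. a) z - F g z) \<le> ennreal C * Lp_pow M p (\<lambda>x. a - g x)"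
      using F_bounded aL gL by blast
    moreover have "Lp_pow M p (\<lambda>x. a - g x) = 0" using a by (subst Lp_pow_zero_iff) auto
    ultimately show ?thesis by simp
  qed
  then have "AE z in S. F (\<lambda>x. a) z - F g z = 0"
    using F_measurable[OF aL] F_measurable[OF gL] by (subst (asm) Lp_pow_zero_iff) auto
  moreover have "AE z in S. F g z = 0"
    using Fg F_measurable[OF gL] by (subst (asm) Lp_pow_zero_iff) auto
  ultimately have "AE z in S. F (\<lambda>x. a) z = 0" by eventually_elim simp
  then have "a = 0" by (rule F_const)
  then have "Lp_pow M p g = 0" using a by (subst Lp_pow_zero_iff) auto
  then show False using g1 by simp
qed

end

context tikhonov_operator
begin

text \<open>Once the norm is bounded, far pairs cost only a multiple of its \<open>p\<close>-th
  power, while \<open>\<Phi>\<close> controls the near pairs.\<close>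

lemma coercive:
  fixes B :: real
  assumes B: "0 \<le> B"
  obtains C where "0 \<le> C" "\<And>w. w \<in> adm \<Longrightarrow> \<Phi> w \<le> ennreal B \<Longrightarrow> Lp_pow S p (F w) \<le> ennreal B \<Longrightarrow>
    Lp_pow M p w \<le> ennreal C \<and> Lp_pow P p (increment w) \<le> ennreal C"
proof -
  obtain C1 where C1: "0 \<le> C1" "\<And>w. w \<in> adm \<Longrightarrow> \<Phi> w \<le> ennreal B \<Longrightarrow> Lp_pow S p (F w) \<le> ennreal B \<Longrightarrow> Lp_pow M p w \<le> ennreal C1"
    using coercive_Lp[OF B] by blast
  obtain c \<eta> where c: "0 < c" and \<eta>: "0 < \<eta>"
    and near: "\<And>w. w \<in> adm \<Longrightarrow> Lp_pow (near_pair s p \<Omega> \<eta>) p (increment w) \<le> ennreal c * \<Phi> w"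
    using regularizer_lower_bound by blast
  obtain C2 where C2: "0 \<le> C2" and far: "\<And>u :: real^'n \<Rightarrow> real^'m. u \<in> borel_measurable M \<Longrightarrow>
    Lp_pow P p (increment u) \<le> Lp_pow (near_pair s p \<Omega> \<eta>) p (increment u) + ennreal C2 * Lp_pow M p u"
    using Lp_pow_sobolev_pair_le_near[OF domain(4,2) p s(1) \<eta>, where 'm = 'm] by blast
  define C where "C = max C1 (c * B + C2 * C1)"
  show thesis
  proof (rule that[of C])
    show "0 \<le> C" using C1(1) by (simp add: C_def)
    fix w assume w: "w \<in> adm" and b: "\<Phi> w \<le> ennreal B" "Lp_pow S p (F w) \<le> ennreal B"
    have 1: "Lp_pow M p w \<le> ennreal C1" by (rule C1(2)[OF w b])
    have "Lp_pow P p (increment w) \<le> ennreal c * ennreal B + ennreal C2 * ennreal C1"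
    proof (rule order_trans[OF far[OF admD(3)[OF w]]], intro add_mono mult_left_mono 1)
      show "Lp_pow (near_pair s p \<Omega> \<eta>) p (increment w) \<le> ennreal c * ennreal B"
        by (rule order_trans[OF near[OF w]]) (intro mult_left_mono b, simp)
    qed simp
    also have "\<dots> = ennreal (c * B + C2 * C1)" using c B C1(1) C2 by (simp add: ennreal_mult ennreal_plus)
    also have "\<dots> \<le> ennreal C" by (rule ennreal_leI) (simp add: C_def)
    finally have "Lp_pow P p (increment w) \<le> ennreal C" .
    moreover have "Lp_pow M p w \<le> ennreal C" by (rule order_trans[OF 1 ennreal_leI]) (simp add: C_def)
    ultimately show "Lp_pow M p w \<le> ennreal C \<and> Lp_pow P p (increment w) \<le> ennreal C" by simp
  qed
qed

section \<open>Limits of bounded admissible sequences\<close>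

text \<open>Along an almost everywhere convergent subsequence, closedness of \<open>K\<close> keeps
  the values in \<open>K\<close> and Fatou keeps the energy below \<open>C\<close>.\<close>

lemma adm_limit:
  fixes C :: real
  assumes w: "\<And>k. w k \<in> adm" and C: "\<And>k. Lp_pow P p (increment (w k)) \<le> ennreal C"
    and g: "g \<in> borel_measurable M"
    and lim: "(\<lambda>k. Lp_pow M p (\<lambda>x. w k x - g x)) \<longlonglongrightarrow> 0"
  shows "g \<in> adm"
proof -
  note [measurable] = g and wm[measurable] = admD(3)[OF w]
  have wgm: "(\<lambda>x. w k x - g x) \<in> borel_measurable M" for k by measurable
  obtain q where q: "strict_mono q" "AE x in M. (\<lambda>k. w (q k) x - g x) \<longlonglongrightarrow> 0"
    using Lp_pow_AE_subseq[OF p wgm lim] by blast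
  have conv: "AE x in M. (\<lambda>k. w (q k) x) \<longlonglongrightarrow> g x"
    using q(2) by eventually_elim (simp add: LIM_zero_iff)
  have gK: "AE x in M. g x \<in> K" by (rule AE_limit_in_K[OF admD(4)[OF w] conv])
  have gL: "Lp_pow M p g < \<infinity>"
  proof -
    obtain k where k: "Lp_pow M p (\<lambda>x. w k x - g x) < 1"
      using order_tendstoD(2)[OF lim, of 1] by (auto simp: eventually_sequentially)
    have "Lp_pow M p (\<lambda>x. w k x - (w k x - g x)) \<le> ennreal (2 powr p) * (Lp_pow M p (w k) + Lp_pow M p (\<lambda>x. w k x - g x))"
      by (rule Lp_pow_diff_le2[OF p]) measurable
    also have "\<dots> < \<infinity>"
      using k admD(2)[OF w, of k] by (auto simp: Lp_space_iff ennreal_mult_less_top intro: less_trans)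
    finally show ?thesis by simp
  qed
  have "Lp_pow P p (increment g) \<le> ennreal C"
    unfolding Lp_pow_def
  proof (rule nn_integral_fatou_le[where h = "\<lambda>k z. ennreal (norm (increment (w (q k)) z) powr p)"])
    have "increment (w (q k)) \<in> borel_measurable P" for k
      by (simp add: measurable_cong_sets[OF sets_sobolev_pair refl] borel_measurable_increment)
    then show "(\<lambda>z. ennreal (norm (increment (w (q k)) z) powr p)) \<in> borel_measurable P" for k
      by measurable
    show "AE z in P. (\<lambda>k. ennreal (norm (increment (w (q k)) z) powr p)) \<longlonglongrightarrow> ennreal (norm (increment g z) powr p)"
      using AE_sobolev_pairI[OF sets_domain conv, of s p]
    proof eventually_elim
      case (elim z)
      then have "(\<lambda>k. w (q k) (fst z) - w (q k) (snd z)) \<longlonglongrightarrow> g (fst z) - g (snd z)"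
        by (intro tendsto_diff) auto
      then show ?case using p by (intro tendsto_ennrealI tendsto_norm_powr) (auto simp: increment_def)
    qed
    show "eventually (\<lambda>k. (\<integral>\<^sup>+z. ennreal (norm (increment (w (q k)) z) powr p) \<partial>P) \<le> ennreal C) sequentially"
      using C by (intro always_eventually allI) (simp add: Lp_pow_def)
  qed
  then have "increment g \<in> Lp_space P p"
    using le_less_trans[of _ "ennreal C" \<infinity>]
    by (auto simp: Lp_space_iff measurable_cong_sets[OF sets_sobolev_pair refl] borel_measurable_increment)
  then show ?thesis using gL gK g by (simp add: sobolev_into_def sobolev_iff sets_domain Lp_space_iff)
qed

text \<open>Norm convergence gives almost everywhere convergence only along a subsequence, which has
  the same limit \<open>L\<close> of regularizer values. Working with each \<open>c\<close> above
  \<open>L\<close> provides the eventual bound needed for Fatou.\<close>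

lemma regularizer_le_limit:
  assumes w: "\<And>k. w k \<in> adm" and u: "u \<in> borel_measurable M"
    and lim: "(\<lambda>k. Lp_pow M p (\<lambda>x. w k x - u x)) \<longlonglongrightarrow> 0" and L: "(\<lambda>k. \<Phi> (w k)) \<longlonglongrightarrow> L"
  shows "\<Phi> u \<le> L"
proof (rule dense_ge)
  fix c assume c: "L < c"
  note [measurable] = u and wm[measurable] = admD(3)[OF w]
  have wum: "(\<lambda>x. w k x - u x) \<in> borel_measurable M" for k by measurable
  obtain q where q: "strict_mono q" "AE x in M. (\<lambda>k. w (q k) x - u x) \<longlonglongrightarrow> 0"
    using Lp_pow_AE_subseq[OF p wum lim] by blast
  show "\<Phi> u \<le> c"
  proof (rule regularizer_lsc[where w = "\<lambda>k. w (q k)"])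
    show "AE x in M. (\<lambda>k. w (q k) x) \<longlonglongrightarrow> u x"
      using q(2) by eventually_elim (simp add: LIM_zero_iff)
    have "eventually (\<lambda>k. \<Phi> (w (q k)) < c) sequentially"
      using tendsto_subseq_zeroD[OF L q(1)] c by (rule order_tendstoD)
    then show "eventually (\<lambda>k. \<Phi> (w (q k)) \<le> c) sequentially" by eventually_elim simp
  qed (use w u in auto)
qed

text \<open>Coercivity followed by compactness. The weak and the norm convergence are recorded
  together: the theorems speak of the first, the limit passages use the second.\<close>

lemma bounded_subseq:
  fixes B :: real and w :: "nat \<Rightarrow> real^'n \<Rightarrow> real^'m"
  assumes w: "\<And>k. w k \<in> adm" and B: "0 \<le> B" "\<And>k. \<Phi> (w k) \<le> ennreal B" "\<And>k. Lp_pow S p (F (w k)) \<le> ennreal B"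
  shows "\<exists>r u. strict_mono r \<and> u \<in> adm \<and> weakly_converges s p \<Omega> (w \<circ> r) u \<and>
    (\<lambda>k. Lp_pow M p (\<lambda>x. w (r k) x - u x)) \<longlonglongrightarrow> 0"
proof -
  obtain C where C: "0 \<le> C" "\<And>w. w \<in> adm \<Longrightarrow> \<Phi> w \<le> ennreal B \<Longrightarrow> Lp_pow S p (F w) \<le> ennreal B \<Longrightarrow>
    Lp_pow M p w \<le> ennreal C \<and> Lp_pow P p (increment w) \<le> ennreal C"
    by (rule coercive[OF B(1)]) blast
  have wC: "Lp_pow M p (w k) \<le> ennreal C" "Lp_pow P p (increment (w k)) \<le> ennreal C" for k
    using C(2)[OF w B(2,3)] by auto
  obtain r g where r: "strict_mono r" and g: "g \<in> borel_measurable M"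
    and lim: "(\<lambda>k. Lp_pow M p (\<lambda>x. w (r k) x - g x)) \<longlonglongrightarrow> 0"
    by (rule sobolev_compact_embedding[where w = w, OF domain(4,2,5) p s(1) admD(3)[OF w] wC])
  have "g \<in> adm" by (rule adm_limit[OF w wC(2) g lim])
  moreover have "weakly_converges s p \<Omega> (w \<circ> r) g"
    using admD(1)[OF w] admD(1)[OF \<open>g \<in> adm\<close>] wC(2) lim
    by (intro weakly_convergesI[OF sets_domain p]) (auto simp: o_def)
  ultimately show ?thesis using r lim by blast
qed

text \<open>Every subsequence has a further one that converges both weakly and in norm to some
  limit. Uniqueness of weak limits identifies that limit with \<open>u\<close>, so the whole
  sequence converges in norm.\<close>

lemma weak_limit_strong:
  fixes B :: real
  assumes w: "\<And>k. w k \<in> adm" and B: "0 \<le> B" "\<And>k. \<Phi> (w k) \<le> ennreal B" "\<And>k. Lp_pow S p (F (w k)) \<le> ennreal B"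
    and weak: "weakly_converges s p \<Omega> w u"
  shows "u \<in> adm" "(\<lambda>k. Lp_pow M p (\<lambda>x. w k x - u x)) \<longlonglongrightarrow> 0"
proof -
  have us: "u \<in> sobolev s p \<Omega>" using weak by (auto simp: weakly_converges_def)
  have um: "u \<in> borel_measurable M" using us by (auto simp: sobolev_def Lp_space_def)
  have sub: "\<exists>r'. strict_mono r' \<and> u \<in> adm \<and> (\<lambda>k. Lp_pow M p (\<lambda>x. w (q (r' k)) x - u x)) \<longlonglongrightarrow> 0"
    if q: "strict_mono q" for q :: "nat \<Rightarrow> nat"
  proof -
    obtain r g where r: "strict_mono r" "g \<in> adm" "weakly_converges s p \<Omega> ((\<lambda>k. w (q k)) \<circ> r) g"
      "(\<lambda>k. Lp_pow M p (\<lambda>x. w (q (r k)) x - g x)) \<longlonglongrightarrow> 0"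
      using bounded_subseq[of "\<lambda>k. w (q k)", OF w B(1) B(2) B(3)] by (elim exE conjE) (rule that)
    have "weakly_converges s p \<Omega> ((\<lambda>k. w (q k)) \<circ> r) u"
      unfolding weakly_converges_def
    proof (intro conjI ballI allI us)
      fix k show "((\<lambda>k. w (q k)) \<circ> r) k \<in> sobolev s p \<Omega>" using admD(1)[OF w] by simp
    next
      fix f :: "(real^'n \<Rightarrow> real^'m) \<Rightarrow> real" assume "f \<in> sobolev_dual s p \<Omega>"
      from tendsto_subseq_zeroD[OF weakly_convergesD[OF weak this] strict_mono_o[OF q r(1)]]
      show "(\<lambda>k. f (((\<lambda>k. w (q k)) \<circ> r) k)) \<longlonglongrightarrow> f u" by simp
    qed
    then have ae: "AE x in M. g x = u x" by (rule weak_limit_unique[OF domain(4,2) p r(3)])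
    have "AE x in M. u x \<in> K" using ae admD(4)[OF r(2)] by eventually_elim simp
    then have "u \<in> adm" using us by (simp add: sobolev_into_def)
    moreover have "Lp_pow M p (\<lambda>x. w (q (r k)) x - g x) = Lp_pow M p (\<lambda>x. w (q (r k)) x - u x)" for k
      by (rule Lp_pow_cong_AE) (use ae in eventually_elim, simp)
    ultimately show ?thesis using r(1,4) by auto
  qed
  show "u \<in> adm" using sub[of id] by (auto simp: strict_mono_def)
  show "(\<lambda>k. Lp_pow M p (\<lambda>x. w k x - u x)) \<longlonglongrightarrow> 0"
  proof (rule ennreal_tendstoI_subseq)
    fix q :: "nat \<Rightarrow> nat" and L assume q: "strict_mono q" "(\<lambda>k. Lp_pow M p (\<lambda>x. w (q k) x - u x)) \<longlonglongrightarrow> L"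
    obtain r' where r': "strict_mono r'" "(\<lambda>k. Lp_pow M p (\<lambda>x. w (q (r' k)) x - u x)) \<longlonglongrightarrow> 0"
      using sub[OF q(1)] by blast
    show "L = 0" by (rule LIMSEQ_unique[OF tendsto_subseq_zeroD[OF q(2) r'(1)] r'(2)])
  qed
qed

section \<open>The Tikhonov functional and its minimizers\<close>

lemma tikhonov_eq: "tikhonov p F \<Phi> \<alpha> v w = Lp_pow S p (\<lambda>z. F w z - v z) + ennreal \<alpha> * \<Phi> w"
  by (simp add: tikhonov_def Lp_pow_def)

lemma data_le:
  assumes w: "w \<in> Lp_space M p" and v: "v \<in> Lp_space S p"
  shows "Lp_pow S p (F w) \<le> ennreal (2 powr p) * (Lp_pow S p (\<lambda>z. F w z - v z) + Lp_pow S p v)"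
proof -
  have m: "F w \<in> borel_measurable S" "v \<in> borel_measurable S" using F_Lp[OF w] v by (auto simp: Lp_space_iff)
  show ?thesis using Lp_pow_add_le2[OF p borel_measurable_diff[OF m] m(2)] by simp
qed

lemma tikhonov_finite:
  assumes w: "w \<in> adm" and v: "v \<in> Lp_space S p"
  shows "tikhonov p F \<Phi> \<alpha> v w < \<infinity>"
  using Lp_space_diff[OF p F_Lp[OF admD(2)[OF w]] v] regularizer_finite[OF w]
  by (simp add: tikhonov_eq Lp_space_iff ennreal_mult_less_top)

text \<open>Misfit and \<open>\<alpha> * \<Phi> w\<close> are each at most the functional, and
  \<open>F w\<close> is the misfit function plus \<open>v\<close>. The bound is uniform over the
  data \<open>v\<close>, as required when the data vary.\<close>

lemma tikhonov_bounded:
  assumes \<alpha>: "0 < \<alpha>" and c: "0 \<le> c"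
  obtains B where "0 \<le> B" "\<And>w v. w \<in> adm \<Longrightarrow> v \<in> Lp_space S p \<Longrightarrow> Lp_pow S p v \<le> ennreal c \<Longrightarrow>
    tikhonov p F \<Phi> \<alpha> v w \<le> ennreal c \<Longrightarrow> \<Phi> w \<le> ennreal B \<and> Lp_pow S p (F w) \<le> ennreal B"
proof (rule that[of "max (c / \<alpha>) (2 powr p * (2 * c))"])
  show "0 \<le> max (c / \<alpha>) (2 powr p * (2 * c))" using \<alpha> c by (simp add: le_max_iff_disj)
  fix w v assume w: "w \<in> adm" and v: "v \<in> Lp_space S p" "Lp_pow S p v \<le> ennreal c"
    and T: "tikhonov p F \<Phi> \<alpha> v w \<le> ennreal c"
  have "\<Phi> w = ennreal (1 / \<alpha>) * (ennreal \<alpha> * \<Phi> w)"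
    using \<alpha> by (simp add: mult.assoc[symmetric] ennreal_mult[symmetric] del: ennreal_mult)
  also have "\<dots> \<le> ennreal (1 / \<alpha>) * ennreal c"
  proof (rule mult_left_mono)
    have "ennreal \<alpha> * \<Phi> w \<le> tikhonov p F \<Phi> \<alpha> v w" by (simp add: tikhonov_eq add_increasing)
    then show "ennreal \<alpha> * \<Phi> w \<le> ennreal c" using T by (rule order_trans)
  qed simp
  also have "\<dots> = ennreal (c / \<alpha>)" using \<alpha> c by (simp add: ennreal_mult[symmetric] del: ennreal_mult)
  also have "\<dots> \<le> ennreal (max (c / \<alpha>) (2 powr p * (2 * c)))" by (rule ennreal_leI) simp
  finally have 1: "\<Phi> w \<le> ennreal (max (c / \<alpha>) (2 powr p * (2 * c)))" .
  have "Lp_pow S p (F w) \<le> ennreal (2 powr p) * (ennreal c + ennreal c)"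
  proof (rule order_trans[OF data_le[OF admD(2)[OF w] v(1)]], intro mult_left_mono add_mono v(2))
    have "Lp_pow S p (\<lambda>z. F w z - v z) \<le> tikhonov p F \<Phi> \<alpha> v w" by (simp add: tikhonov_eq add_increasing2)
    then show "Lp_pow S p (\<lambda>z. F w z - v z) \<le> ennreal c" using T by (rule order_trans)
  qed simp
  also have "\<dots> = ennreal (2 powr p * (2 * c))" using c by (simp add: ennreal_mult[symmetric] ennreal_plus[symmetric] del: ennreal_plus ennreal_mult)
  also have "\<dots> \<le> ennreal (max (c / \<alpha>) (2 powr p * (2 * c)))" by (rule ennreal_leI) simp
  finally show "\<Phi> w \<le> ennreal (max (c / \<alpha>) (2 powr p * (2 * c))) \<and> Lp_pow S p (F w) \<le> ennreal (max (c / \<alpha>) (2 powr p * (2 * c)))"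
    using 1 by simp
qed

text \<open>Joint lower semicontinuity in the function and the data. The values
  \<open>\<Phi> (w k)\<close> need not converge, so a subsequence with limit \<open>L\<close> in the
  compact space \<open>ennreal\<close> is chosen, and the misfit converges along it.\<close>

lemma tikhonov_le_limit:
  assumes w: "\<And>k. w k \<in> adm" and u: "u \<in> adm"
    and lim: "(\<lambda>k. Lp_pow M p (\<lambda>x. w k x - u x)) \<longlonglongrightarrow> 0"
    and v: "\<And>k. v k \<in> Lp_space S p" and v': "v' \<in> Lp_space S p"
    and limv: "(\<lambda>k. Lp_pow S p (\<lambda>z. v' z - v k z)) \<longlonglongrightarrow> 0"
    and T: "\<And>k. tikhonov p F \<Phi> \<alpha> (v k) (w k) \<le> Y k" "Y \<longlonglongrightarrow> y"
  shows "tikhonov p F \<Phi> \<alpha> v' u \<le> y"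
proof -
  obtain L r where r: "strict_mono r" "((\<lambda>k. \<Phi> (w k)) \<circ> r) \<longlonglongrightarrow> L"
    using compact_complete_linorder[of "\<lambda>k. \<Phi> (w k)"] by blast
  note D = data_tendsto[OF admD(2)[OF w] admD(2)[OF u] lim v v' limv]
  have L: "\<Phi> u \<le> L"
    using r tendsto_subseq_zeroD[OF lim r(1)] by (intro regularizer_le_limit[where w = "\<lambda>k. w (r k)"] w admD(3)[OF u]) (simp_all add: o_def)
  have "(\<lambda>k. Lp_pow S p (\<lambda>z. F (w (r k)) z - v (r k) z) + ennreal \<alpha> * \<Phi> (w (r k)))
      \<longlonglongrightarrow> Lp_pow S p (\<lambda>z. F u z - v' z) + ennreal \<alpha> * L"
    using r by (intro tendsto_add ennreal_tendsto_cmult tendsto_subseq_zeroD[OF D r(1)]) (simp_all add: o_def)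
  moreover have "(\<lambda>k. Y (r k)) \<longlonglongrightarrow> y" by (rule tendsto_subseq_zeroD[OF T(2) r(1)])
  ultimately have "Lp_pow S p (\<lambda>z. F u z - v' z) + ennreal \<alpha> * L \<le> y"
    using T(1) unfolding tikhonov_eq by (intro LIMSEQ_le) auto
  moreover have "Lp_pow S p (\<lambda>z. F u z - v' z) + ennreal \<alpha> * \<Phi> u \<le> Lp_pow S p (\<lambda>z. F u z - v' z) + ennreal \<alpha> * L"
    by (intro add_left_mono mult_left_mono L) simp
  ultimately show ?thesis unfolding tikhonov_eq by (rule order_trans[rotated])
qed

lemma INF_sequence:
  fixes J :: "'c \<Rightarrow> ennreal"
  assumes "D \<noteq> {}"
  obtains w where "\<And>k. w k \<in> D" "(\<lambda>k. J (w k)) \<longlonglongrightarrow> (INF x\<in>D. J x)"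
proof -
  have "J ` D \<noteq> {}" using assms by simp
  then obtain X where X: "\<And>n :: nat. X n \<in> J ` D" "X \<longlonglongrightarrow> Inf (J ` D)"
    using Inf_as_limit[of "J ` D"] by blast
  then have "\<forall>n. \<exists>x\<in>D. X n = J x" by blast
  then obtain w where "\<And>n. w n \<in> D" "\<And>n. X n = J (w n)" by metis
  moreover from this have "X = (\<lambda>n. J (w n))" by blast
  ultimately show thesis using X(2) by (intro that[of w]) auto
qed

theorem existence:
  assumes ne: "adm \<noteq> {}"
  shows "tikhonov_existence p adm F \<Phi>"
  unfolding tikhonov_existence_def
proof (intro ballI allI impI conjI)
  fix v :: "real \<times> (real^'n) \<Rightarrow> 'b" and \<alpha> :: real assume v: "v \<in> Lp_space S p" and \<alpha>: "0 < \<alpha>"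
  let ?T = "tikhonov p F \<Phi> \<alpha> v"
  show "?T w < \<infinity>" if "w \<in> adm" for w using tikhonov_finite[OF that v] .
  obtain w where w: "\<And>k. w k \<in> adm" and lim: "(\<lambda>k. ?T (w k)) \<longlonglongrightarrow> (INF x\<in>adm. ?T x)"
    by (rule INF_sequence[OF ne, of ?T]) blast
  obtain w0 where w0: "w0 \<in> adm" using ne by blast
  have "(INF x\<in>adm. ?T x) < \<infinity>" using INF_lower[OF w0, of ?T] tikhonov_finite[OF w0 v] by (rule le_less_trans)
  then obtain c where c: "(INF x\<in>adm. ?T x) < ennreal c" "0 \<le> c" "Lp_pow S p v \<le> ennreal c"
  proof -
    define a where "a = enn2real (INF x\<in>adm. ?T x)"
    define b where "b = enn2real (Lp_pow S p v)"
    have ab: "(INF x\<in>adm. ?T x) = ennreal a" "Lp_pow S p v = ennreal b" "0 \<le> a" "0 \<le> b"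
      using \<open>_ < \<infinity>\<close> v by (auto simp: a_def b_def less_top Lp_space_iff)
    show thesis
    proof (rule that[of "a + b + 1"])
      show "(INF x\<in>adm. ?T x) < ennreal (a + b + 1)" unfolding ab(1) using ab(3,4) by (intro ennreal_lessI) auto
      show "0 \<le> a + b + 1" using ab(3,4) by simp
      show "Lp_pow S p v \<le> ennreal (a + b + 1)" unfolding ab(2) using ab(3,4) by (intro ennreal_leI) auto
    qed
  qed
  have "eventually (\<lambda>k. ?T (w k) < ennreal c) sequentially" using lim c(1) by (rule order_tendstoD)
  then obtain N where N: "\<And>k. N \<le> k \<Longrightarrow> ?T (w k) < ennreal c" by (auto simp: eventually_sequentially)
  obtain B where B: "0 \<le> B" and bd: "\<And>w v. w \<in> adm \<Longrightarrow> v \<in> Lp_space S p \<Longrightarrow> Lp_pow S p v \<le> ennreal c \<Longrightarrow>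
    tikhonov p F \<Phi> \<alpha> v w \<le> ennreal c \<Longrightarrow> \<Phi> w \<le> ennreal B \<and> Lp_pow S p (F w) \<le> ennreal B"
    by (rule tikhonov_bounded[OF \<alpha> c(2)]) blast
  \<comment> \<open>The bound \<open>c\<close> on the functional is available only from the index
    \<open>N\<close> on.\<close>
  define w' where "w' k = w (k + N)" for k
  have w': "w' k \<in> adm" "\<Phi> (w' k) \<le> ennreal B" "Lp_pow S p (F (w' k)) \<le> ennreal B" for k
    using w bd[OF w v c(3) less_imp_le[OF N], of "k + N"] by (auto simp: w'_def)
  have lim': "(\<lambda>k. ?T (w' k)) \<longlonglongrightarrow> (INF x\<in>adm. ?T x)"
    unfolding w'_def by (rule LIMSEQ_ignore_initial_segment[OF lim])
  obtain r u where r: "strict_mono r" "u \<in> adm" "(\<lambda>k. Lp_pow M p (\<lambda>x. w' (r k) x - u x)) \<longlonglongrightarrow> 0"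
    using bounded_subseq[where w = w', OF w'(1) B w'(2,3)] by (elim exE conjE) (rule that)
  have "?T u \<le> (INF x\<in>adm. ?T x)"
  proof (rule tikhonov_le_limit[where w = "\<lambda>k. w' (r k)" and v = "\<lambda>_. v" and Y = "\<lambda>k. ?T (w' (r k))"])
    show "(\<lambda>k. ?T (w' (r k))) \<longlonglongrightarrow> (INF x\<in>adm. ?T x)" by (rule tendsto_subseq_zeroD[OF lim' r(1)])
    show "(\<lambda>k. Lp_pow S p (\<lambda>z. v z - v z)) \<longlonglongrightarrow> 0" by (simp add: Lp_pow_def)
  qed (use w' r v in auto)
  then have "u \<in> minimizers adm ?T"
    using r(2) by (auto simp: minimizers_def le_INF_iff)
  then show "minimizers adm ?T \<noteq> {}" by blast
qed

end

lemma ennreal_convergent_bounded: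
  fixes X :: "nat \<Rightarrow> ennreal"
  assumes "\<And>k. X k < \<infinity>" "X \<longlonglongrightarrow> L" "L < \<infinity>"
  obtains c where "0 \<le> c" "\<And>k. X k \<le> ennreal c"
proof -
  have "(\<lambda>k. enn2real (X k)) \<longlonglongrightarrow> enn2real L"
    using assms by (intro tendsto_enn2real) auto
  then have "Bseq (\<lambda>k. enn2real (X k))" by (rule convergent_imp_Bseq[OF convergentI])
  then obtain c where c: "0 < c" "\<And>k. norm (enn2real (X k)) \<le> c" by (auto simp: Bseq_def)
  show thesis
  proof (rule that[of c])
    show "X k \<le> ennreal c" for k
      using c(2)[of k] assms(1)[of k] ennreal_leI[of "enn2real (X k)" c] by (simp add: less_top)
  qed (use c in simp)
qed

lemma Lp_pow_eq_Lp_norm: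
  assumes p: "1 < p" and f: "f \<in> Lp_space N p"
  shows "Lp_pow N p f = ennreal (Lp_norm N p f powr p)"
  using assms unfolding Lp_norm_def Lp_pow_def[symmetric] by (simp add: powr_powr Lp_space_iff less_top)

context tikhonov_operator
begin

section \<open>Exact solutions, stability and vanishing noise\<close>

lemma solution_limit:
  assumes w: "\<And>k. w k \<in> adm" and u: "u \<in> adm"
    and lim: "(\<lambda>k. Lp_pow M p (\<lambda>x. w k x - u x)) \<longlonglongrightarrow> 0"
    and v: "\<And>k. v k \<in> Lp_space S p" and v': "v' \<in> Lp_space S p"
    and limv: "(\<lambda>k. Lp_pow S p (\<lambda>z. v' z - v k z)) \<longlonglongrightarrow> 0"
    and data: "(\<lambda>k. Lp_pow S p (\<lambda>z. F (w k) z - v k z)) \<longlonglongrightarrow> 0"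
  shows "u \<in> solutions adm F v'"
proof -
  have "Lp_pow S p (\<lambda>z. F u z - v' z) = 0"
    using LIMSEQ_unique[OF data_tendsto[OF admD(2)[OF w] admD(2)[OF u] lim v v' limv] data] .
  moreover have "(\<lambda>z. F u z - v' z) \<in> borel_measurable S"
    using Lp_space_diff[OF p F_Lp[OF admD(2)[OF u]] v'] by (simp add: Lp_space_iff)
  ultimately have "AE z in S. F u z - v' z = 0" by (simp add: Lp_pow_zero_iff)
  then show ?thesis using u by (simp add: solutions_def)
qed

text \<open>On the solution set \<open>F w\<close> has the fixed norm of \<open>v0\<close>, so a
  minimizing sequence for \<open>\<Phi>\<close> alone is already bounded; the constraint survives
  the limit because the misfit is continuous.\<close>

theorem minimizing_solution_exists:
  assumes v0: "v0 \<in> Lp_space S p" and ne: "solutions adm F v0 \<noteq> {}"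
  shows "minimizing_solutions adm F \<Phi> v0 \<noteq> {}"
proof -
  obtain w where w: "\<And>k. w k \<in> solutions adm F v0" and lim: "(\<lambda>k. \<Phi> (w k)) \<longlonglongrightarrow> (INF u\<in>solutions adm F v0. \<Phi> u)"
    by (rule INF_sequence[OF ne, of \<Phi>]) blast
  have wa: "w k \<in> adm" and ws: "AE z in S. F (w k) z = v0 z" for k using w[of k] by (auto simp: solutions_def)
  obtain w0 where w0: "w0 \<in> solutions adm F v0" using ne by blast
  have "(INF u\<in>solutions adm F v0. \<Phi> u) \<le> \<Phi> w0" using w0 by (rule INF_lower)
  also have "\<dots> < \<infinity>" using w0 by (intro regularizer_finite) (simp add: solutions_def)
  finally obtain c where c: "0 \<le> c" "\<And>k. \<Phi> (w k) \<le> ennreal c"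
    using ennreal_convergent_bounded[OF regularizer_finite[OF wa] lim] by blast
  have data: "Lp_pow S p (F (w k)) = Lp_pow S p v0" for k by (rule Lp_pow_cong_AE[OF ws])
  define B where "B = c + enn2real (Lp_pow S p v0)"
  have B: "0 \<le> B" "\<Phi> (w k) \<le> ennreal B" "Lp_pow S p (F (w k)) \<le> ennreal B" for k
  proof -
    show "0 \<le> B" using c by (simp add: B_def)
    show "\<Phi> (w k) \<le> ennreal B" by (rule order_trans[OF c(2) ennreal_leI]) (simp add: B_def)
    have "Lp_pow S p v0 = ennreal (enn2real (Lp_pow S p v0))" using v0 by (simp add: Lp_space_iff less_top)
    also have "\<dots> \<le> ennreal B" using c by (intro ennreal_leI) (simp add: B_def)
    finally show "Lp_pow S p (F (w k)) \<le> ennreal B" unfolding data .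
  qed
  obtain r u where r: "strict_mono r" "u \<in> adm" "weakly_converges s p \<Omega> (w \<circ> r) u" "(\<lambda>k. Lp_pow M p (\<lambda>x. w (r k) x - u x)) \<longlonglongrightarrow> 0"
    using bounded_subseq[where w = w, OF wa B] by (elim exE conjE) (rule that)
  have "Lp_pow S p (\<lambda>z. F (w (r k)) z - v0 z) = Lp_pow S p (\<lambda>z. 0 :: 'b)" for k
    by (rule Lp_pow_cong_AE) (use ws[of "r k"] in eventually_elim, simp)
  then have "u \<in> solutions adm F v0"
    using wa r(2,4) v0 by (intro solution_limit[where w = "\<lambda>k. w (r k)" and v = "\<lambda>_. v0"]) (simp_all add: Lp_pow_def)
  moreover have "\<Phi> u \<le> (INF u\<in>solutions adm F v0. \<Phi> u)"
    by (rule regularizer_le_limit[where w = "\<lambda>k. w (r k)", OF wa admD(3)[OF r(2)] r(4) tendsto_subseq_zeroD[OF lim r(1)]])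
  ultimately have "u \<in> minimizing_solutions adm F \<Phi> v0"
    unfolding minimizing_solutions_def by (auto intro: antisym INF_lower)
  then show ?thesis by blast
qed

text \<open>Comparison with a fixed competitor bounds the minimal values. Lower semicontinuity on
  the left and convergence of the functional at each competitor on the right give minimality of the
  limit; since the misfits converge, the regularizer values have to converge as well.\<close>

theorem stability: "tikhonov_stability s p \<Omega> adm F \<Phi>"
  unfolding tikhonov_stability_def
proof (intro allI ballI impI, elim conjE)
  fix \<alpha> :: real and v' :: "real \<times> (real^'n) \<Rightarrow> 'b" and v w
  assume \<alpha>: "0 < \<alpha>" and v': "v' \<in> Lp_space S p" and "\<forall>k. v k \<in> Lp_space S p"
    and norm: "(\<lambda>k. Lp_norm S p (\<lambda>z. v' z - v k z)) \<longlonglongrightarrow> 0"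
    and "\<forall>k. w k \<in> minimizers adm (tikhonov p F \<Phi> \<alpha> (v k))"
  then have v: "v k \<in> Lp_space S p" and w: "w k \<in> adm"
    and min: "u \<in> adm \<Longrightarrow> tikhonov p F \<Phi> \<alpha> (v k) (w k) \<le> tikhonov p F \<Phi> \<alpha> (v k) u" for k u
    by (auto simp: minimizers_def)
  have "(\<lambda>k. ennreal (Lp_norm S p (\<lambda>z. v' z - v k z) powr p)) \<longlonglongrightarrow> ennreal (0 powr p)"
    using p by (intro tendsto_ennrealI tendsto_powr' norm tendsto_const) (auto simp: Lp_norm_def)
  then have limv: "(\<lambda>k. Lp_pow S p (\<lambda>z. v' z - v k z)) \<longlonglongrightarrow> 0"
    by (simp add: Lp_pow_eq_Lp_norm[OF p Lp_space_diff[OF p v' v]])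
  have const: "(\<lambda>k. Lp_pow S p (\<lambda>z. F u z - v k z)) \<longlonglongrightarrow> Lp_pow S p (\<lambda>z. F u z - v' z)" if "u \<in> adm" for u
    using admD(2)[OF that] by (intro data_tendsto[where w = "\<lambda>_. u"] v v' limv) (simp_all add: Lp_pow_def)
  have Tconst: "(\<lambda>k. tikhonov p F \<Phi> \<alpha> (v k) u) \<longlonglongrightarrow> tikhonov p F \<Phi> \<alpha> v' u" if "u \<in> adm" for u
    unfolding tikhonov_eq by (intro tendsto_add const that tendsto_const)
  \<comment> \<open>The first minimizer \<open>w 0\<close> is the fixed competitor for all
    \<open>k\<close>.\<close>
  obtain c1 where c1: "0 \<le> c1" "\<And>k. tikhonov p F \<Phi> \<alpha> (v k) (w 0) \<le> ennreal c1"
    using ennreal_convergent_bounded[OF tikhonov_finite[OF w v] Tconst[OF w] tikhonov_finite[OF w v']] by blast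
  have "(\<lambda>k. Lp_pow S p (v k)) \<longlonglongrightarrow> Lp_pow S p v'"
    using v v' limv by (intro Lp_pow_tendsto[OF p]) (auto simp: Lp_space_iff Lp_pow_diff_commute[of S p _ v'])
  then obtain c2 where c2: "0 \<le> c2" "\<And>k. Lp_pow S p (v k) \<le> ennreal c2"
    using ennreal_convergent_bounded[of "\<lambda>k. Lp_pow S p (v k)" "Lp_pow S p v'"] v v' by (auto simp: Lp_space_iff)
  define c where "c = max c1 c2"
  have c: "0 \<le> c" using c1 by (simp add: c_def le_max_iff_disj)
  have vc: "Lp_pow S p (v k) \<le> ennreal c" for k by (rule order_trans[OF c2(2) ennreal_leI]) (simp add: c_def)
  have Tc: "tikhonov p F \<Phi> \<alpha> (v k) (w k) \<le> ennreal c" for k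
    by (rule order_trans[OF min[OF w[of 0]] order_trans[OF c1(2) ennreal_leI]]) (simp add: c_def)
  obtain B where B: "0 \<le> B" and bd: "\<And>w v. w \<in> adm \<Longrightarrow> v \<in> Lp_space S p \<Longrightarrow> Lp_pow S p v \<le> ennreal c \<Longrightarrow>
    tikhonov p F \<Phi> \<alpha> v w \<le> ennreal c \<Longrightarrow> \<Phi> w \<le> ennreal B \<and> Lp_pow S p (F w) \<le> ennreal B"
    by (rule tikhonov_bounded[OF \<alpha> c]) blast
  have wB: "\<Phi> (w k) \<le> ennreal B" "Lp_pow S p (F (w k)) \<le> ennreal B" for k
    using bd[OF w v vc Tc] by auto
  show "(\<exists>j w'. strict_mono j \<and> weakly_converges s p \<Omega> (w \<circ> j) w') \<and>
        (\<forall>j w'. strict_mono j \<and> weakly_converges s p \<Omega> (w \<circ> j) w' \<longrightarrow>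
           w' \<in> minimizers adm (tikhonov p F \<Phi> \<alpha> v') \<and> (\<lambda>i. \<Phi> (w (j i))) \<longlonglongrightarrow> \<Phi> w')"
  proof (intro conjI allI impI)
    show "\<exists>j w'. strict_mono j \<and> weakly_converges s p \<Omega> (w \<circ> j) w'"
      using bounded_subseq[where w = w, OF w B wB] by (elim exE conjE) (intro exI conjI)
    fix j w' assume "strict_mono j \<and> weakly_converges s p \<Omega> (w \<circ> j) w'"
    then have j: "strict_mono j" and weak: "weakly_converges s p \<Omega> (w \<circ> j) w'" by auto
    have w': "w' \<in> adm" and lim: "(\<lambda>k. Lp_pow M p (\<lambda>x. w (j k) x - w' x)) \<longlonglongrightarrow> 0"
      using weak_limit_strong[OF _ B _ _ weak] w wB by auto
    have limvj: "(\<lambda>k. Lp_pow S p (\<lambda>z. v' z - v (j k) z)) \<longlonglongrightarrow> 0" by (rule tendsto_subseq_zeroD[OF limv j])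
    have "tikhonov p F \<Phi> \<alpha> v' w' \<le> tikhonov p F \<Phi> \<alpha> v' u" if u: "u \<in> adm" for u
    proof (rule tikhonov_le_limit[where w = "\<lambda>k. w (j k)" and v = "\<lambda>k. v (j k)"
          and Y = "\<lambda>k. tikhonov p F \<Phi> \<alpha> (v (j k)) u"])
      show "(\<lambda>k. tikhonov p F \<Phi> \<alpha> (v (j k)) u) \<longlonglongrightarrow> tikhonov p F \<Phi> \<alpha> v' u"
        by (rule tendsto_subseq_zeroD[OF Tconst[OF u] j])
    qed (use w w' lim v v' limvj min u in auto)
    then show "w' \<in> minimizers adm (tikhonov p F \<Phi> \<alpha> v')" using w' by (simp add: minimizers_def)
    show "(\<lambda>i. \<Phi> (w (j i))) \<longlonglongrightarrow> \<Phi> w'"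
    proof (rule ennreal_tendstoI_subseq)
      fix r :: "nat \<Rightarrow> nat" and L assume r: "strict_mono r" and L: "(\<lambda>k. \<Phi> (w (j (r k)))) \<longlonglongrightarrow> L"
      note limr = tendsto_subseq_zeroD[OF lim r] and limvr = tendsto_subseq_zeroD[OF limvj r]
      have 1: "\<Phi> w' \<le> L"
        by (rule regularizer_le_limit[where w = "\<lambda>k. w (j (r k))", OF w admD(3)[OF w'] limr L])
      define G where "G = Lp_pow S p (\<lambda>z. F w' z - v' z)"
      have Gfin: "G < \<infinity>" using Lp_space_diff[OF p F_Lp[OF admD(2)[OF w']] v'] by (simp add: G_def Lp_space_iff)
      have "(\<lambda>k. Lp_pow S p (\<lambda>z. F (w (j (r k))) z - v (j (r k)) z)) \<longlonglongrightarrow> G"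
        unfolding G_def by (rule data_tendsto[where w = "\<lambda>k. w (j (r k))", OF admD(2)[OF w] admD(2)[OF w'] limr v v' limvr])
      then have "(\<lambda>k. tikhonov p F \<Phi> \<alpha> (v (j (r k))) (w (j (r k)))) \<longlonglongrightarrow> G + ennreal \<alpha> * L"
        unfolding tikhonov_eq by (intro tendsto_add ennreal_tendsto_cmult L) auto
      moreover have "(\<lambda>k. tikhonov p F \<Phi> \<alpha> (v (j (r k))) w') \<longlonglongrightarrow> G + ennreal \<alpha> * \<Phi> w'"
        using tendsto_subseq_zeroD[OF tendsto_subseq_zeroD[OF Tconst[OF w'] j] r] by (simp add: tikhonov_eq G_def)
      \<comment> \<open>Minimality is used with the limit \<open>w'\<close> itself as competitor.
        The misfit limit \<open>G\<close> is finite and can be cancelled, leaving the inequality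
        opposite to lower semicontinuity.\<close>
      ultimately have "G + ennreal \<alpha> * L \<le> G + ennreal \<alpha> * \<Phi> w'"
        using min[OF w'] by (intro LIMSEQ_le) auto
      then have "ennreal \<alpha> * L \<le> ennreal \<alpha> * \<Phi> w'"
        using Gfin by (auto simp: ennreal_add_left_cancel_le)
      then have "L \<le> \<Phi> w'" using \<alpha> by (subst (asm) ennreal_mult_le_mult_iff) auto
      with 1 show "L = \<Phi> w'" by simp
    qed
  qed
qed

text \<open>Everything follows from comparing \<open>w k\<close> with an exact solution
  \<open>u\<close>, whose misfit is pure noise. The comparison drives the misfit of
  \<open>w k\<close> to zero, and after division by \<open>\<alpha> k\<close> it bounds the
  regularizer.\<close>

lemma convergence_subseq:
  assumes v0: "v0 \<in> Lp_space S p" and ne: "solutions adm F v0 \<noteq> {}"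
    and \<alpha>: "\<And>k. 0 < \<alpha> k" and \<alpha>0: "\<alpha> \<longlonglongrightarrow> 0" and \<delta>\<alpha>: "(\<lambda>k. \<delta> k powr p / \<alpha> k) \<longlonglongrightarrow> 0"
    and \<delta>: "\<And>k. 0 < \<delta> k" "\<delta> \<longlonglongrightarrow> (0::real)"
    and v: "\<And>k. v k \<in> Lp_space S p"
    and noise: "\<And>k. Lp_norm S p (\<lambda>z. v0 z - v k z) \<le> \<delta> k"
    and w: "\<And>k. w k \<in> minimizers adm (tikhonov p F \<Phi> (\<alpha> k) (v k))"
  shows "\<exists>j w'. strict_mono j \<and> weakly_converges s p \<Omega> (w \<circ> j) w' \<and>
           w' \<in> minimizing_solutions adm F \<Phi> v0 \<and> (\<lambda>i. \<Phi> (w (j i))) \<longlonglongrightarrow> \<Phi> w'"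
proof -
  have wa: "w k \<in> adm" and min: "u \<in> adm \<Longrightarrow> tikhonov p F \<Phi> (\<alpha> k) (v k) (w k) \<le> tikhonov p F \<Phi> (\<alpha> k) (v k) u" for k u
    using w[of k] by (auto simp: minimizers_def)
  have noise': "Lp_pow S p (\<lambda>z. v0 z - v k z) \<le> ennreal (\<delta> k powr p)" for k
    unfolding Lp_pow_eq_Lp_norm[OF p Lp_space_diff[OF p v0 v]]
    using p noise by (intro ennreal_leI powr_mono2) (auto simp: Lp_norm_def)
  have \<delta>p: "(\<lambda>k. \<delta> k powr p) \<longlonglongrightarrow> 0 powr p"
    using p \<delta> by (intro tendsto_powr' tendsto_const) (auto intro!: always_eventually less_imp_le)
  have limv: "(\<lambda>k. Lp_pow S p (\<lambda>z. v0 z - v k z)) \<longlonglongrightarrow> 0"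
    using tendsto_ennrealI[OF \<delta>p] p by (intro ennreal_tendsto_zero_le[OF noise']) simp
  have key: "Lp_pow S p (\<lambda>z. F (w k) z - v k z) + ennreal (\<alpha> k) * \<Phi> (w k) \<le> ennreal (\<delta> k powr p) + ennreal (\<alpha> k) * \<Phi> u"
    if u: "u \<in> solutions adm F v0" for u k
  proof -
    have ua: "u \<in> adm" "AE z in S. F u z = v0 z" using u by (auto simp: solutions_def)
    have eq: "Lp_pow S p (\<lambda>z. F u z - v k z) = Lp_pow S p (\<lambda>z. v0 z - v k z)"
      by (rule Lp_pow_cong_AE) (use ua(2) in eventually_elim, simp)
    have "Lp_pow S p (\<lambda>z. F (w k) z - v k z) + ennreal (\<alpha> k) * \<Phi> (w k)
        \<le> Lp_pow S p (\<lambda>z. F u z - v k z) + ennreal (\<alpha> k) * \<Phi> u"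
      using min[OF ua(1), of k] unfolding tikhonov_eq .
    also have "\<dots> \<le> ennreal (\<delta> k powr p) + ennreal (\<alpha> k) * \<Phi> u"
      unfolding eq by (intro add_right_mono noise')
    finally show ?thesis .
  qed
  \<comment> \<open>The noise contributes only \<open>\<delta> k powr p / \<alpha> k\<close>, which
    tends to zero, so no cluster value of \<open>\<Phi> (w k)\<close> exceeds the value at any exact
    solution.\<close>
  have \<Phi>le: "\<Phi> (w k) \<le> ennreal (\<delta> k powr p / \<alpha> k) + \<Phi> u" if u: "u \<in> solutions adm F v0" for u k
  proof -
    have inv: "ennreal (1 / \<alpha> k) * (ennreal (\<alpha> k) * x) = x" for x
      using \<alpha>[of k] by (simp add: mult.assoc[symmetric] ennreal_mult[symmetric] del: ennreal_mult)
    have "ennreal (\<alpha> k) * \<Phi> (w k) \<le> ennreal (\<delta> k powr p) + ennreal (\<alpha> k) * \<Phi> u"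
      using key[OF u, of k] by (rule order_trans[rotated]) (simp add: add_increasing)
    then have "ennreal (1 / \<alpha> k) * (ennreal (\<alpha> k) * \<Phi> (w k)) \<le> ennreal (1 / \<alpha> k) * (ennreal (\<delta> k powr p) + ennreal (\<alpha> k) * \<Phi> u)"
      by (rule mult_left_mono) simp
    also have "\<dots> = ennreal (1 / \<alpha> k) * ennreal (\<delta> k powr p) + \<Phi> u" by (simp only: distrib_left inv)
    also have "ennreal (1 / \<alpha> k) * ennreal (\<delta> k powr p) = ennreal (\<delta> k powr p / \<alpha> k)"
      using \<alpha>[of k] by (simp add: ennreal_mult[symmetric] del: ennreal_mult)
    finally show ?thesis unfolding inv .
  qed
  obtain u0 where u0: "u0 \<in> solutions adm F v0" using ne by blast
  have u0fin: "\<Phi> u0 < \<infinity>" using u0 by (intro regularizer_finite) (simp add: solutions_def)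
  have "(\<lambda>k. ennreal (\<delta> k powr p / \<alpha> k) + \<Phi> u0) \<longlonglongrightarrow> ennreal 0 + \<Phi> u0"
    by (intro tendsto_add tendsto_ennrealI \<delta>\<alpha> tendsto_const)
  then obtain c1 where c1: "0 \<le> c1" "\<And>k. ennreal (\<delta> k powr p / \<alpha> k) + \<Phi> u0 \<le> ennreal c1"
    using ennreal_convergent_bounded[of "\<lambda>k. ennreal (\<delta> k powr p / \<alpha> k) + \<Phi> u0" "ennreal 0 + \<Phi> u0"] u0fin by auto
  have "(\<lambda>k. ennreal (\<delta> k powr p) + \<Phi> u0 * ennreal (\<alpha> k)) \<longlonglongrightarrow> ennreal (0 powr p) + \<Phi> u0 * ennreal 0"
    using u0fin by (intro tendsto_add tendsto_ennrealI \<delta>p ennreal_tendsto_cmult \<alpha>0) auto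
  then have bnd0: "(\<lambda>k. ennreal (\<delta> k powr p) + ennreal (\<alpha> k) * \<Phi> u0) \<longlonglongrightarrow> 0" using p by (simp add: mult.commute)
  have data0: "(\<lambda>k. Lp_pow S p (\<lambda>z. F (w k) z - v k z)) \<longlonglongrightarrow> 0"
  proof (rule ennreal_tendsto_zero_le[OF _ bnd0])
    show "Lp_pow S p (\<lambda>z. F (w k) z - v k z) \<le> ennreal (\<delta> k powr p) + ennreal (\<alpha> k) * \<Phi> u0" for k
      using key[OF u0, of k] by (rule order_trans[rotated]) (simp add: add_increasing2)
  qed
  have dfin: "Lp_pow S p (\<lambda>z. F (w k) z - v k z) < \<infinity>" for k
    using Lp_space_diff[OF p F_Lp[OF admD(2)[OF wa]] v] by (simp add: Lp_space_iff)
  obtain c2 where c2: "0 \<le> c2" "\<And>k. Lp_pow S p (\<lambda>z. F (w k) z - v k z) \<le> ennreal c2"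
    using ennreal_convergent_bounded[OF dfin data0] by auto
  have "(\<lambda>k. Lp_pow S p (v k)) \<longlonglongrightarrow> Lp_pow S p v0"
    using v v0 limv by (intro Lp_pow_tendsto[OF p]) (auto simp: Lp_space_iff Lp_pow_diff_commute[of S p _ v0])
  then obtain c3 where c3: "0 \<le> c3" "\<And>k. Lp_pow S p (v k) \<le> ennreal c3"
    using ennreal_convergent_bounded[of "\<lambda>k. Lp_pow S p (v k)" "Lp_pow S p v0"] v v0 by (auto simp: Lp_space_iff)
  define B where "B = max c1 (2 powr p * (c2 + c3))"
  have B: "0 \<le> B" using c1 by (simp add: B_def le_max_iff_disj)
  have wB1: "\<Phi> (w k) \<le> ennreal B" for k
    by (rule order_trans[OF \<Phi>le[OF u0] order_trans[OF c1(2) ennreal_leI]]) (simp add: B_def)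
  have wB2: "Lp_pow S p (F (w k)) \<le> ennreal B" for k
  proof -
    have "Lp_pow S p (F (w k)) \<le> ennreal (2 powr p) * (ennreal c2 + ennreal c3)"
      by (rule order_trans[OF data_le[OF admD(2)[OF wa] v[of k]]]) (intro mult_left_mono add_mono c2 c3, simp)
    also have "\<dots> = ennreal (2 powr p * (c2 + c3))" using c2(1) c3(1) by (simp add: ennreal_mult[symmetric] ennreal_plus[symmetric] del: ennreal_plus ennreal_mult)
    also have "\<dots> \<le> ennreal B" by (rule ennreal_leI) (simp add: B_def)
    finally show ?thesis .
  qed
  obtain j u where j: "strict_mono j" "u \<in> adm" "weakly_converges s p \<Omega> (w \<circ> j) u" "(\<lambda>k. Lp_pow M p (\<lambda>x. w (j k) x - u x)) \<longlonglongrightarrow> 0"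
    using bounded_subseq[where w = w, OF wa B wB1 wB2] by (elim exE conjE) (rule that)
  have usol: "u \<in> solutions adm F v0"
    by (rule solution_limit[where w = "\<lambda>k. w (j k)" and v = "\<lambda>k. v (j k)", OF wa j(2,4) v v0
          tendsto_subseq_zeroD[OF limv j(1)] tendsto_subseq_zeroD[OF data0 j(1)]])
  have Lle: "L \<le> \<Phi> u'" if r: "strict_mono r" and L: "(\<lambda>k. \<Phi> (w (j (r k)))) \<longlonglongrightarrow> L" and u': "u' \<in> solutions adm F v0" for r L u'
  proof -
    have "(\<lambda>k. ennreal (\<delta> k powr p / \<alpha> k) + \<Phi> u') \<longlonglongrightarrow> ennreal 0 + \<Phi> u'"
      by (intro tendsto_add tendsto_ennrealI \<delta>\<alpha> tendsto_const)
    then have "(\<lambda>k. ennreal (\<delta> (j (r k)) powr p / \<alpha> (j (r k))) + \<Phi> u') \<longlonglongrightarrow> \<Phi> u'"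
      using tendsto_subseq_zeroD[OF tendsto_subseq_zeroD[OF _ j(1)] r, of "\<lambda>k. ennreal (\<delta> k powr p / \<alpha> k) + \<Phi> u'"] by simp
    then show ?thesis using L \<Phi>le[OF u'] by (intro LIMSEQ_le[of "\<lambda>k. \<Phi> (w (j (r k)))"]) auto
  qed
  have uL: "\<Phi> u \<le> L" if r: "strict_mono r" and L: "(\<lambda>k. \<Phi> (w (j (r k)))) \<longlonglongrightarrow> L" for r L
    by (rule regularizer_le_limit[where w = "\<lambda>k. w (j (r k))", OF wa admD(3)[OF j(2)] tendsto_subseq_zeroD[OF j(4) r] L])
  have conv: "(\<lambda>k. \<Phi> (w (j k))) \<longlonglongrightarrow> \<Phi> u"
    by (rule ennreal_tendstoI_subseq) (rule antisym[OF Lle[OF _ _ usol] uL])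
  have "\<Phi> u \<le> \<Phi> u'" if "u' \<in> solutions adm F v0" for u'
    using Lle[of "\<lambda>k. k", OF _ _ that] conv by (simp add: strict_mono_def)
  then have "u \<in> minimizing_solutions adm F \<Phi> v0"
    using usol unfolding minimizing_solutions_def by (auto intro!: antisym INF_lower INF_greatest)
  then show ?thesis using j(1,3) conv by blast
qed

text \<open>The subsequence result applies to every subsequence of the data. Under uniqueness all
  limits coincide up to null sets, to which bounded functionals are blind, and minimizing solutions
  share their regularizer value; hence the whole sequence converges.\<close>

theorem convergence:
  assumes v0: "v0 \<in> Lp_space S p" and ne: "solutions adm F v0 \<noteq> {}"
  shows "tikhonov_convergence s p \<Omega> adm F \<Phi> v0"
  unfolding tikhonov_convergence_def
proof (intro allI impI, elim conjE)
  fix a :: "real \<Rightarrow> real" and \<delta> v w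
  assume "\<forall>t>0. 0 < a t" and a0: "(a \<longlongrightarrow> 0) (at_right 0)" and da: "((\<lambda>t. t powr p / a t) \<longlongrightarrow> 0) (at_right 0)"
    and "\<forall>k. 0 < \<delta> k" and \<delta>0: "\<delta> \<longlonglongrightarrow> 0" and "\<forall>k. v k \<in> Lp_space S p"
    and "\<forall>k. Lp_norm S p (\<lambda>z. v0 z - v k z) \<le> \<delta> k"
    and "\<forall>k. w k \<in> minimizers adm (tikhonov p F \<Phi> (a (\<delta> k)) (v k))"
  then have apos: "\<And>t. 0 < t \<Longrightarrow> 0 < a t" and \<delta>: "\<And>k. 0 < \<delta> k" and v: "\<And>k. v k \<in> Lp_space S p"
    and noise: "\<And>k. Lp_norm S p (\<lambda>z. v0 z - v k z) \<le> \<delta> k"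
    and w: "\<And>k. w k \<in> minimizers adm (tikhonov p F \<Phi> (a (\<delta> k)) (v k))" by auto
  have wa: "w k \<in> adm" for k using w[of k] by (simp add: minimizers_def)
  have \<delta>r: "filterlim \<delta> (at_right 0) sequentially"
  proof -
    have "\<delta> k \<noteq> 0" for k using \<delta>[of k] by simp
    then show ?thesis using \<delta>0 \<delta> by (simp add: filterlim_at)
  qed
  have main: "\<exists>j w'. strict_mono j \<and> weakly_converges s p \<Omega> ((\<lambda>k. w (r k)) \<circ> j) w' \<and>
           w' \<in> minimizing_solutions adm F \<Phi> v0 \<and> (\<lambda>i. \<Phi> (w (r (j i)))) \<longlonglongrightarrow> \<Phi> w'"
    if r: "strict_mono r" for r :: "nat \<Rightarrow> nat"
  proof -
    have 1: "(\<lambda>k. a (\<delta> (r k))) \<longlonglongrightarrow> 0" by (rule tendsto_subseq_zeroD[OF filterlim_compose[OF a0 \<delta>r] r])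
    have 2: "(\<lambda>k. \<delta> (r k) powr p / a (\<delta> (r k))) \<longlonglongrightarrow> 0" by (rule tendsto_subseq_zeroD[OF filterlim_compose[OF da \<delta>r] r])
    show ?thesis
      by (rule convergence_subseq[where w = "\<lambda>k. w (r k)" and \<alpha> = "\<lambda>k. a (\<delta> (r k))" and \<delta> = "\<lambda>k. \<delta> (r k)" and v = "\<lambda>k. v (r k)",
            OF v0 ne apos[OF \<delta>] 1 2 \<delta> tendsto_subseq_zeroD[OF \<delta>0 r] v noise w])
  qed
  show "(\<exists>j w'. strict_mono j \<and> weakly_converges s p \<Omega> (w \<circ> j) w' \<and>
           w' \<in> minimizing_solutions adm F \<Phi> v0 \<and> (\<lambda>i. \<Phi> (w (j i))) \<longlonglongrightarrow> \<Phi> w') \<and>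
        (\<forall>w'\<in>minimizing_solutions adm F \<Phi> v0.
           (\<forall>u\<in>minimizing_solutions adm F \<Phi> v0. AE x in lebesgue_on \<Omega>. u x = w' x) \<longrightarrow>
           weakly_converges s p \<Omega> w w' \<and> (\<lambda>k. \<Phi> (w k)) \<longlonglongrightarrow> \<Phi> w')"
  proof (intro conjI ballI impI)
    show "\<exists>j w'. strict_mono j \<and> weakly_converges s p \<Omega> (w \<circ> j) w' \<and>
           w' \<in> minimizing_solutions adm F \<Phi> v0 \<and> (\<lambda>i. \<Phi> (w (j i))) \<longlonglongrightarrow> \<Phi> w'"
      using main[of "\<lambda>k. k"] by (simp add: strict_mono_def)
    fix w' assume w': "w' \<in> minimizing_solutions adm F \<Phi> v0"
      and uniq: "\<forall>u\<in>minimizing_solutions adm F \<Phi> v0. AE x in lebesgue_on \<Omega>. u x = w' x"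
    have ms: "u \<in> sobolev s p \<Omega>" if "u \<in> minimizing_solutions adm F \<Phi> v0" for u
      using that admD(1)[of u] by (simp add: minimizing_solutions_def solutions_def)
    show "weakly_converges s p \<Omega> w w'"
      unfolding weakly_converges_def
    proof (intro conjI allI ballI admD(1)[OF wa] ms[OF w'])
      fix f :: "(real^'n \<Rightarrow> real^'m) \<Rightarrow> real" assume f: "f \<in> sobolev_dual s p \<Omega>"
      show "(\<lambda>k. f (w k)) \<longlonglongrightarrow> f w'"
      proof (rule ccontr)
        assume "\<not> ?thesis"
        then obtain U where U: "open U" "f w' \<in> U" "\<not> eventually (\<lambda>k. f (w k) \<in> U) sequentially"
          by (auto simp: tendsto_def)
        then have "\<exists>\<^sub>F k in sequentially. f (w k) \<notin> U" by (simp add: not_eventually)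
        then have inf: "infinite {k. f (w k) \<notin> U}" by (simp add: frequently_cofinite[symmetric] cofinite_eq_sequentially)
        \<comment> \<open>\<open>q\<close> lists the infinitely many indices that violate
          convergence; a further subsequence of them would have to converge.\<close>
        define q where "q = enumerate {k. f (w k) \<notin> U}"
        have q: "strict_mono q" "\<And>k. f (w (q k)) \<notin> U"
          using inf enumerate_in_set[OF inf] strict_mono_enumerate[OF inf] by (auto simp: q_def)
        obtain j u where j: "strict_mono j" "weakly_converges s p \<Omega> ((\<lambda>k. w (q k)) \<circ> j) u" "u \<in> minimizing_solutions adm F \<Phi> v0"
          using main[OF q(1)] by (elim exE conjE) (rule that)
        have "f u = f w'"
          using uniq j(3) by (intro sobolev_dual_cong_AE[OF sets_domain p f ms[OF j(3)] ms[OF w']]) blast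
        then have "(\<lambda>k. f (w (q (j k)))) \<longlonglongrightarrow> f w'"
          using weakly_convergesD[OF j(2) f] by simp
        then have "eventually (\<lambda>k. f (w (q (j k))) \<in> U) sequentially" using U(1,2) by (rule topological_tendstoD)
        then show False using q(2) by (auto simp: eventually_sequentially)
      qed
    qed
    show "(\<lambda>k. \<Phi> (w k)) \<longlonglongrightarrow> \<Phi> w'"
    proof (rule ennreal_tendstoI_subseq)
      fix r :: "nat \<Rightarrow> nat" and L assume r: "strict_mono r" "(\<lambda>k. \<Phi> (w (r k))) \<longlonglongrightarrow> L"
      obtain j u where j: "strict_mono j" "u \<in> minimizing_solutions adm F \<Phi> v0" "(\<lambda>i. \<Phi> (w (r (j i)))) \<longlonglongrightarrow> \<Phi> u"
        using main[OF r(1)] by (elim exE conjE) (rule that)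
      have "L = \<Phi> u" by (rule LIMSEQ_unique[OF tendsto_subseq_zeroD[OF r(2) j(1)] j(3)])
      also have "\<dots> = \<Phi> w'" using j(2) w' by (simp add: minimizing_solutions_def)
      finally show "L = \<Phi> w'" .
    qed
  qed
qed

end

section \<open>Hausdorff measure on hyperplanes\<close>

text \<open>A finite cover is padded with empty sets, which have content \<open>0\<close> in every
  dimension, including dimension \<open>0\<close>.\<close>

lemma delta_covers_finite_family:
  fixes U :: "'i \<Rightarrow> 'a::metric_space set"
  assumes I: "finite I" and cov: "A \<subseteq> (\<Union>i\<in>I. U i)"
    and U: "\<And>i. i \<in> I \<Longrightarrow> bounded (U i)" "\<And>i. i \<in> I \<Longrightarrow> diameter (U i) \<le> \<delta>" and \<delta>: "0 \<le> \<delta>"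
  shows "(INF U\<in>delta_covers \<delta> A. \<Sum>i. hausdorff_content k (U i)) \<le> (\<Sum>i\<in>I. hausdorff_content k (U i))"
proof -
  obtain f where f: "bij_betw f {..<card I} I"
    using ex_bij_betw_nat_finite[OF I] by (auto simp: atLeast0LessThan)
  define V where "V n = (if n < card I then U (f n) else {})" for n
  have fI: "f n \<in> I" if "n < card I" for n using f that by (auto simp: bij_betw_def)
  have "A \<subseteq> (\<Union>n. V n)"
  proof
    fix x assume "x \<in> A"
    then obtain i where i: "i \<in> I" "x \<in> U i" using cov by blast
    then have "i \<in> f ` {..<card I}" using f by (simp add: bij_betw_def)
    then obtain n where "n < card I" "f n = i" by blast
    then have "x \<in> V n" using i by (simp add: V_def)
    then show "x \<in> (\<Union>n. V n)" by blast
  qed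
  moreover have "bounded (V n) \<and> diameter (V n) \<le> \<delta>" for n
    using U fI \<delta> by (simp add: V_def)
  ultimately have "V \<in> delta_covers \<delta> A" by (simp add: delta_covers_def)
  then have "(INF U\<in>delta_covers \<delta> A. \<Sum>i. hausdorff_content k (U i)) \<le> (\<Sum>n. hausdorff_content k (V n))"
    by (rule INF_lower)
  also have "\<dots> = (\<Sum>n<card I. hausdorff_content k (V n))"
    by (rule suminf_finite) (auto simp: V_def hausdorff_content_def)
  also have "\<dots> = (\<Sum>n<card I. hausdorff_content k (U (f n)))"
    by (rule sum.cong) (auto simp: V_def)
  also have "\<dots> = (\<Sum>i\<in>I. hausdorff_content k (U i))"
    using f by (rule sum.reindex_bij_betw)
  finally show ?thesis .
qed

section \<open>Upper bounds from Lipschitz graphs\<close>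

text \<open>With \<open>k = n - 1\<close> and \<open>D = 2 * (1 + c) * k * r\<close>, a grid of
  \<open>N ^ k\<close> cells covers a graph by sets of diameter at most \<open>2 * D / N\<close>.
  Their total content is bounded by the volume of the unit \<open>k\<close>-ball times
  \<open>D ^ k\<close>, whatever \<open>N\<close> is; this is the constant times
  \<open>r ^ k\<close>.\<close>

definition graph_const :: "'n::finite itself \<Rightarrow> real \<Rightarrow> real" where
  "graph_const _ c = unit_ball_vol (real (CARD('n) - 1)) * (2 * (1 + c) * real (CARD('n) - 1)) ^ (CARD('n) - 1)"

text \<open>A set satisfying the Lipschitz condition is a Lipschitz graph over the coordinates other than \<open>i\<close>,
  so a grid in these coordinates covers it efficiently.\<close>

lemma hausdorff_outer_graph_le:
  fixes S :: "(real^'n) set" and i :: 'n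
  assumes c: "0 \<le> c" and r: "0 \<le> r"
    and lip: "\<And>x y. x \<in> S \<Longrightarrow> y \<in> S \<Longrightarrow> \<bar>x $ i - y $ i\<bar> \<le> c * (\<Sum>j\<in>UNIV - {i}. \<bar>x $ j - y $ j\<bar>)"
    and cube: "\<And>x j. x \<in> S \<Longrightarrow> \<bar>x $ j - a $ j\<bar> \<le> r"
  shows "hausdorff_outer (CARD('n) - 1) S \<le> ennreal (graph_const TYPE('n) c * r ^ (CARD('n) - 1))"
proof (rule hausdorff_outer_le_covers)
  fix \<delta> :: real assume \<delta>: "0 < \<delta>"
  define k where "k = CARD('n) - 1"
  have k: "card (UNIV - {i}) = k" by (simp add: k_def card_Diff_singleton)
  define D where "D = (1 + c) * real k * (2 * r)"
  have D: "0 \<le> D" using c r by (simp add: D_def)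
  obtain N :: nat where N: "2 * D / \<delta> < real N" using reals_Archimedean2 by blast
  have N0: "0 < N"
  proof (rule ccontr)
    assume "\<not> ?thesis"
    then show False using N D \<delta> by (simp add: divide_less_0_iff)
  qed
  define I where "I = (UNIV - {i}) \<rightarrow>\<^sub>E {..<N}"
  \<comment> \<open>The cell condition is multiplied out, hence meaningful for \<open>r = 0\<close>
    as well.\<close>
  define U where "U g = {x \<in> S. \<forall>j\<in>UNIV - {i}. \<bar>(x $ j - a $ j + r) * real N - 2 * r * real (g j)\<bar> \<le> 2 * r}" for g :: "'n \<Rightarrow> nat"
  have fin: "finite I" and card: "card I = N ^ k"
    unfolding I_def using k by (auto simp: card_PiE intro!: finite_PiE)
  have cov: "S \<subseteq> (\<Union>g\<in>I. U g)"
  proof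
    fix x assume x: "x \<in> S"
    have "\<exists>m<N. \<bar>(x $ j - a $ j + r) * real N - 2 * r * real m\<bar> \<le> 2 * r" for j
    proof (cases "r = 0")
      case True
      then show ?thesis using cube[OF x, of j] N0 by auto
    next
      case False
      define y where "y = (x $ j - a $ j + r) / (2 * r)"
      have y: "0 \<le> y" "y \<le> 1" using cube[OF x, of j] r False by (auto simp: y_def abs_le_iff field_simps)
      have yN: "0 \<le> y * N" "y * N \<le> N" using y N0 mult_right_mono[OF y(2), of "real N"] by auto
      \<comment> \<open>The right end \<open>y = 1\<close> would receive the index \<open>N\<close>;
        the minimum assigns it to the last cell.\<close>
      define m where "m = min (N - 1) (nat \<lfloor>y * N\<rfloor>)"
      have "\<bar>y * N - m\<bar> \<le> 1"
      proof (cases "nat \<lfloor>y * N\<rfloor> \<le> N - 1")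
        case True
        then have "real m = of_int \<lfloor>y * N\<rfloor>" using yN by (simp add: m_def min_absorb2)
        then show ?thesis by linarith
      next
        case False
        then have "real N - 1 \<le> y * N" "real m = real N - 1" using N0 by (auto simp: m_def min_def of_nat_diff) linarith
        then show ?thesis using yN by linarith
      qed
      then have "2 * r * \<bar>y * N - m\<bar> \<le> 2 * r * 1" using r by (intro mult_left_mono) auto
      moreover have "2 * r * \<bar>y * N - m\<bar> = \<bar>(x $ j - a $ j + r) * real N - 2 * r * real m\<bar>"
      proof -
        have "2 * r * \<bar>y * N - m\<bar> = \<bar>2 * r * (y * N - m)\<bar>" using r by (simp add: abs_mult)
        also have "2 * r * (y * N - m) = (x $ j - a $ j + r) * real N - 2 * r * real m"
          using False by (simp add: y_def right_diff_distrib)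
        finally show ?thesis .
      qed
      moreover have "m < N" using N0 by (simp add: m_def)
      ultimately show ?thesis by auto
    qed
    then obtain g where g: "\<And>j. g j < N" "\<And>j. \<bar>(x $ j - a $ j + r) * real N - 2 * r * real (g j)\<bar> \<le> 2 * r" by metis
    have "restrict g (UNIV - {i}) \<in> I" using g(1) by (auto simp: I_def)
    moreover have "x \<in> U (restrict g (UNIV - {i}))" using x g(2) by (auto simp: U_def)
    ultimately show "x \<in> (\<Union>g\<in>I. U g)" by blast
  qed
  have dist: "dist x y \<le> (1 + c) * (\<Sum>j\<in>UNIV - {i}. \<bar>x $ j - y $ j\<bar>)" if "x \<in> S" "y \<in> S" for x y
  proof -
    have "dist x y \<le> (\<Sum>j\<in>UNIV. \<bar>(x - y) $ j\<bar>)" unfolding dist_norm by (rule norm_le_l1_cart)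
    also have "\<dots> = \<bar>x $ i - y $ i\<bar> + (\<Sum>j\<in>UNIV - {i}. \<bar>x $ j - y $ j\<bar>)"
      by (subst sum.remove[of UNIV i]) auto
    also have "\<dots> \<le> (1 + c) * (\<Sum>j\<in>UNIV - {i}. \<bar>x $ j - y $ j\<bar>)"
      using lip[OF that] by (simp add: algebra_simps)
    finally show ?thesis .
  qed
  have distU: "dist x y \<le> 2 * (D / N)" if "x \<in> U g" "y \<in> U g" for x y g
  proof -
    have j: "\<bar>x $ j - y $ j\<bar> \<le> 4 * r / N" if "j \<in> UNIV - {i}" for j
    proof -
      have "\<bar>(x $ j - a $ j + r) * real N - 2 * r * real (g j)\<bar> \<le> 2 * r" "\<bar>(y $ j - a $ j + r) * real N - 2 * r * real (g j)\<bar> \<le> 2 * r"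
        using \<open>x \<in> U g\<close> \<open>y \<in> U g\<close> that by (auto simp: U_def)
      then have "\<bar>(x $ j - a $ j + r) * real N - (y $ j - a $ j + r) * real N\<bar> \<le> 4 * r" by linarith
      also have "(x $ j - a $ j + r) * real N - (y $ j - a $ j + r) * real N = (x $ j - y $ j) * real N" by (simp add: algebra_simps)
      finally show ?thesis using N0 by (simp add: abs_mult pos_le_divide_eq)
    qed
    have "dist x y \<le> (1 + c) * (\<Sum>j\<in>UNIV - {i}. \<bar>x $ j - y $ j\<bar>)" using that by (intro dist) (auto simp: U_def)
    also have "\<dots> \<le> (1 + c) * (\<Sum>j\<in>UNIV - {i}. 4 * r / N)" using c j by (intro mult_left_mono sum_mono) auto
    also have "\<dots> = 2 * (D / N)" by (simp add: k D_def)
    finally show ?thesis .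
  qed
  show "(INF U\<in>delta_covers \<delta> S. \<Sum>i. hausdorff_content (CARD('n) - 1) (U i)) \<le> ennreal (graph_const TYPE('n) c * r ^ (CARD('n) - 1))"
  proof -
    have bd: "bounded (U g)" and diam: "diameter (U g) \<le> 2 * (D / N)" for g
    proof -
      show "diameter (U g) \<le> 2 * (D / N)"
        using distU[of _ g] D by (intro diameter_le) (auto simp: dist_norm)
      show "bounded (U g)"
      proof (cases "U g = {}")
        case False
        then obtain x where "x \<in> U g" by blast
        then show ?thesis using distU[of x g] unfolding bounded_def by blast
      qed simp
    qed
    have small: "2 * (D / N) \<le> \<delta>" using N N0 \<delta> by (simp add: field_simps)
    have "(INF U\<in>delta_covers \<delta> S. \<Sum>i. hausdorff_content (CARD('n) - 1) (U i)) \<le> (\<Sum>g\<in>I. hausdorff_content (CARD('n) - 1) (U g))"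
      using order_trans[OF diam small] bd \<delta> by (intro delta_covers_finite_family fin cov) auto
    also have "\<dots> \<le> (\<Sum>g\<in>I. ennreal (unit_ball_vol (real k) * (D / N) ^ k))"
    proof (rule sum_mono)
      fix g
      have "(diameter (U g) / 2) ^ k \<le> (D / N) ^ k"
        using diam[of g] diameter_ge_0[OF bd[of g]] by (intro power_mono) (simp_all add: mult.commute)
      then have "ennreal (unit_ball_vol (real k) * (diameter (U g) / 2) ^ k) \<le> ennreal (unit_ball_vol (real k) * (D / N) ^ k)"
        by (intro ennreal_leI mult_left_mono) simp_all
      then show "hausdorff_content (CARD('n) - 1) (U g) \<le> ennreal (unit_ball_vol (real k) * (D / N) ^ k)"
        unfolding hausdorff_content_def k_def[symmetric] by simp
    qed
    also have "\<dots> = ennreal (real (N ^ k) * (unit_ball_vol (real k) * (D / N) ^ k))"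
      using D by (simp add: card ennreal_mult ennreal_of_nat_eq_real_of_nat)
    also have "real (N ^ k) * (unit_ball_vol (real k) * (D / N) ^ k) = unit_ball_vol (real k) * D ^ k"
      using N0 by (simp add: power_divide)
    also have "\<dots> = graph_const TYPE('n) c * r ^ (CARD('n) - 1)"
      unfolding graph_const_def k_def[symmetric] D_def by (simp only: power_mult_distrib mult_ac)
    finally show ?thesis .
  qed
qed

lemma graph_const_nonneg: "0 \<le> c \<Longrightarrow> 0 \<le> graph_const TYPE('n::finite) c"
  by (simp add: graph_const_def)

lemma exists_large_component:
  fixes \<phi> :: "real^'n"
  assumes "norm \<phi> = 1"
  obtains i where "1 \<le> sqrt CARD('n) * \<bar>\<phi> $ i\<bar>"
proof -
  have "\<exists>i. 1 \<le> real CARD('n) * (\<phi> $ i)\<^sup>2"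
  proof (rule ccontr)
    assume "\<not> ?thesis"
    then have "\<And>i. (\<phi> $ i)\<^sup>2 < 1 / CARD('n)" by (auto simp: not_le field_simps)
    then have "(\<Sum>i\<in>UNIV. (\<phi> $ i)\<^sup>2) < (\<Sum>i\<in>(UNIV :: 'n set). 1 / real CARD('n))"
      by (intro sum_strict_mono) auto
    moreover have "(norm \<phi>)\<^sup>2 = (\<Sum>i\<in>UNIV. (\<phi> $ i)\<^sup>2)"
      by (simp add: norm_vec_def L2_set_def sum_nonneg)
    ultimately show False using assms by simp
  qed
  then obtain i where "1 \<le> real CARD('n) * (\<phi> $ i)\<^sup>2" by blast
  then have "sqrt 1 \<le> sqrt (real CARD('n) * (\<phi> $ i)\<^sup>2)" by (rule real_sqrt_le_mono)
  then have "1 \<le> sqrt CARD('n) * \<bar>\<phi> $ i\<bar>" by (simp add: real_sqrt_mult)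
  then show thesis by (rule that)
qed

text \<open>The equation of the hyperplane is solved for the coordinate \<open>i\<close>: the other
  coefficients are at most \<open>1\<close>, and the coefficient at \<open>i\<close> is at least
  \<open>1 / sqrt CARD('n)\<close>.\<close>

lemma hyperplane_graph_condition:
  fixes x y \<phi> :: "real^'n"
  assumes \<phi>: "norm \<phi> = 1" and i: "1 \<le> sqrt CARD('n) * \<bar>\<phi> $ i\<bar>" and eq: "x \<bullet> \<phi> = y \<bullet> \<phi>"
  shows "\<bar>x $ i - y $ i\<bar> \<le> sqrt CARD('n) * (\<Sum>j\<in>UNIV - {i}. \<bar>x $ j - y $ j\<bar>)"
proof -
  have "(\<Sum>j\<in>UNIV. (x $ j - y $ j) * \<phi> $ j) = 0"
    using eq by (simp add: inner_vec_def left_diff_distrib sum_subtractf)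
  then have "(x $ i - y $ i) * \<phi> $ i = - (\<Sum>j\<in>UNIV - {i}. (x $ j - y $ j) * \<phi> $ j)"
    by (simp add: sum.remove[of UNIV i])
  then have "\<bar>x $ i - y $ i\<bar> * \<bar>\<phi> $ i\<bar> = \<bar>\<Sum>j\<in>UNIV - {i}. (x $ j - y $ j) * \<phi> $ j\<bar>"
    by (metis abs_minus abs_mult)
  also have "\<dots> \<le> (\<Sum>j\<in>UNIV - {i}. \<bar>x $ j - y $ j\<bar> * 1)"
  proof (rule order_trans[OF sum_abs], rule sum_mono)
    fix j
    have "\<bar>\<phi> $ j\<bar> \<le> 1" using component_le_norm_cart[of \<phi> j] \<phi> by simp
    then show "\<bar>(x $ j - y $ j) * \<phi> $ j\<bar> \<le> \<bar>x $ j - y $ j\<bar> * 1"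
      unfolding abs_mult by (intro mult_left_mono) auto
  qed
  finally have le: "\<bar>x $ i - y $ i\<bar> * \<bar>\<phi> $ i\<bar> \<le> (\<Sum>j\<in>UNIV - {i}. \<bar>x $ j - y $ j\<bar>)" by simp
  have "\<bar>x $ i - y $ i\<bar> * 1 \<le> \<bar>x $ i - y $ i\<bar> * (sqrt CARD('n) * \<bar>\<phi> $ i\<bar>)"
    by (intro mult_left_mono i) simp
  also have "\<dots> = sqrt CARD('n) * (\<bar>x $ i - y $ i\<bar> * \<bar>\<phi> $ i\<bar>)" by simp
  also have "\<dots> \<le> sqrt CARD('n) * (\<Sum>j\<in>UNIV - {i}. \<bar>x $ j - y $ j\<bar>)"
    by (intro mult_left_mono le) simp
  finally show ?thesis by simp
qed

lemma hausdorff_outer_hyperplane_le: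
  fixes \<phi> :: "real^'n"
  assumes \<phi>: "norm \<phi> = 1" and r: "0 \<le> r" and cube: "\<And>x j. x \<in> S \<Longrightarrow> \<bar>x $ j - a $ j\<bar> \<le> r"
  shows "hausdorff_outer (CARD('n) - 1) (S \<inter> {x. x \<bullet> \<phi> = t}) \<le> ennreal (graph_const TYPE('n) (sqrt CARD('n)) * r ^ (CARD('n) - 1))"
proof -
  obtain i where i: "1 \<le> sqrt CARD('n) * \<bar>\<phi> $ i\<bar>" using exists_large_component[OF \<phi>] .
  show ?thesis
    by (rule hausdorff_outer_graph_le[where a = a and i = i])
       (use cube r hyperplane_graph_condition[OF \<phi> i] in auto)
qed

lemma hausdorff_outer_finite_UN_le:
  assumes "finite I"
  shows "hausdorff_outer k (\<Union>i\<in>I. A i) \<le> (\<Sum>i\<in>I. hausdorff_outer k (A i))"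
  using assms
proof induction
  case (insert i I)
  have "hausdorff_outer k (\<Union>i\<in>insert i I. A i) \<le> hausdorff_outer k (A i) + hausdorff_outer k (\<Union>i\<in>I. A i)"
    using hausdorff_outer_Un_le[of k "A i" "\<Union>i\<in>I. A i"] by simp
  also have "\<dots> \<le> hausdorff_outer k (A i) + (\<Sum>i\<in>I. hausdorff_outer k (A i))"
    by (intro add_left_mono insert.IH)
  finally show ?case using insert by simp
qed (simp add: hausdorff_outer_empty)

text \<open>The sphere is a finite union of caps on which one coordinate is large and has a fixed
  sign. On such a cap that coordinate is a Lipschitz function of the others, as one sees from the
  difference of the two equations of the sphere.\<close>

lemma hausdorff_outer_sphere_finite:
  "hausdorff_outer (CARD('n) - 1) (sphere (0 :: real^'n) 1) < \<infinity>"
proof -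
  define A where "A = (\<lambda>(i, \<sigma>). {x \<in> sphere (0 :: real^'n) 1. 1 \<le> sqrt CARD('n) * \<bar>x $ i\<bar> \<and> sgn (x $ i) = \<sigma>})"
  have cov: "sphere (0 :: real^'n) 1 \<subseteq> (\<Union>z\<in>UNIV \<times> {-1, 1}. A z)"
  proof
    fix x :: "real^'n" assume x: "x \<in> sphere 0 1"
    then obtain i where i: "1 \<le> sqrt CARD('n) * \<bar>x $ i\<bar>" using exists_large_component[of x] by auto
    then have "x $ i \<noteq> 0" by auto
    then have "sgn (x $ i) \<in> {-1, 1}" by (auto simp: sgn_if)
    moreover have "x \<in> A (i, sgn (x $ i))" using x i by (simp add: A_def)
    ultimately show "x \<in> (\<Union>z\<in>UNIV \<times> {-1, 1}. A z)" by blast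
  qed
  have fin: "hausdorff_outer (CARD('n) - 1) (A (i, \<sigma>)) < \<infinity>" if "\<sigma> \<in> {-1, 1}" for i \<sigma>
  proof -
    have "hausdorff_outer (CARD('n) - 1) (A (i, \<sigma>)) \<le> ennreal (graph_const TYPE('n) (sqrt CARD('n)) * 1 ^ (CARD('n) - 1))"
    proof (rule hausdorff_outer_graph_le[where a = 0 and i = i])
      fix x j assume "x \<in> A (i, \<sigma>)"
      then show "\<bar>x $ j - 0 $ j\<bar> \<le> 1" using component_le_norm_cart[of x j] by (simp add: A_def)
    next
      fix x y assume x: "x \<in> A (i, \<sigma>)" and y: "y \<in> A (i, \<sigma>)"
      have n: "norm x = 1" "norm y = 1" and s: "sgn (x $ i) = \<sigma>" "sgn (y $ i) = \<sigma>"
        and l: "1 \<le> sqrt CARD('n) * \<bar>x $ i\<bar>" "1 \<le> sqrt CARD('n) * \<bar>y $ i\<bar>" using x y by (auto simp: A_def)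
      have sq: "(norm z)\<^sup>2 = (\<Sum>j\<in>UNIV. (z $ j)\<^sup>2)" for z :: "real^'n"
        by (simp add: norm_vec_def L2_set_def sum_nonneg)
      have "(\<Sum>j\<in>UNIV. (x $ j)\<^sup>2) = (\<Sum>j\<in>UNIV. (y $ j)\<^sup>2)"
        using sq[of x] sq[of y] n by simp
      then have "(\<Sum>j\<in>UNIV. (x $ j)\<^sup>2 - (y $ j)\<^sup>2) = 0" by (simp add: sum_subtractf)
      then have "(x $ i)\<^sup>2 - (y $ i)\<^sup>2 = - (\<Sum>j\<in>UNIV - {i}. (x $ j)\<^sup>2 - (y $ j)\<^sup>2)"
        by (simp add: sum.remove[of UNIV i])
      then have "\<bar>(x $ i)\<^sup>2 - (y $ i)\<^sup>2\<bar> = \<bar>\<Sum>j\<in>UNIV - {i}. (x $ j)\<^sup>2 - (y $ j)\<^sup>2\<bar>"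
        by (simp only: abs_minus_cancel)
      also have "\<dots> \<le> (\<Sum>j\<in>UNIV - {i}. \<bar>(x $ j)\<^sup>2 - (y $ j)\<^sup>2\<bar>)" by (rule sum_abs)
      also have "(\<Sum>j\<in>UNIV - {i}. \<bar>(x $ j)\<^sup>2 - (y $ j)\<^sup>2\<bar>) \<le> (\<Sum>j\<in>UNIV - {i}. 2 * \<bar>x $ j - y $ j\<bar>)"
      proof (rule sum_mono)
        fix j
        have "\<bar>x $ j + y $ j\<bar> \<le> 2"
          using component_le_norm_cart[of x j] component_le_norm_cart[of y j] n by linarith
        then have "\<bar>x $ j + y $ j\<bar> * \<bar>x $ j - y $ j\<bar> \<le> 2 * \<bar>x $ j - y $ j\<bar>" by (intro mult_right_mono) auto
        then show "\<bar>(x $ j)\<^sup>2 - (y $ j)\<^sup>2\<bar> \<le> 2 * \<bar>x $ j - y $ j\<bar>"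
          by (simp add: power2_eq_square square_diff_square_factored abs_mult)
      qed
      also have "\<dots> = 2 * (\<Sum>j\<in>UNIV - {i}. \<bar>x $ j - y $ j\<bar>)" by (simp add: sum_distrib_left)
      finally have 1: "\<bar>x $ i + y $ i\<bar> * \<bar>x $ i - y $ i\<bar> \<le> 2 * (\<Sum>j\<in>UNIV - {i}. \<bar>x $ j - y $ j\<bar>)"
        by (simp add: power2_eq_square square_diff_square_factored abs_mult)
      \<comment> \<open>Equal signs prevent cancellation, so this factor of the difference of
        squares stays away from zero.\<close>
      have "\<bar>x $ i + y $ i\<bar> = \<bar>x $ i\<bar> + \<bar>y $ i\<bar>"
        using s that by (auto simp: sgn_if split: if_splits)
      then have "2 \<le> sqrt CARD('n) * \<bar>x $ i + y $ i\<bar>" using l by (simp add: distrib_left)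
      then have "2 * \<bar>x $ i - y $ i\<bar> \<le> sqrt CARD('n) * \<bar>x $ i + y $ i\<bar> * \<bar>x $ i - y $ i\<bar>" by (intro mult_right_mono) auto
      also have "\<dots> = sqrt CARD('n) * (\<bar>x $ i + y $ i\<bar> * \<bar>x $ i - y $ i\<bar>)" by simp
      also have "\<dots> \<le> sqrt CARD('n) * (2 * (\<Sum>j\<in>UNIV - {i}. \<bar>x $ j - y $ j\<bar>))" by (intro mult_left_mono 1) simp
      finally show "\<bar>x $ i - y $ i\<bar> \<le> sqrt CARD('n) * (\<Sum>j\<in>UNIV - {i}. \<bar>x $ j - y $ j\<bar>)" by simp
    qed auto
    then show ?thesis by (rule le_less_trans) simp
  qed
  have "hausdorff_outer (CARD('n) - 1) (sphere (0 :: real^'n) 1) \<le> (\<Sum>z\<in>UNIV \<times> {-1, 1}. hausdorff_outer (CARD('n) - 1) (A z))"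
    using hausdorff_outer_mono[OF cov] hausdorff_outer_finite_UN_le[of "UNIV \<times> {-1, 1}" "CARD('n) - 1" A]
    by (meson finite.emptyI finite.insertI finite_SigmaI finite order_trans)
  also have "\<dots> < \<infinity>"
  proof -
    have "hausdorff_outer (CARD('n) - 1) (A z) < \<infinity>" if "z \<in> UNIV \<times> {-1, 1}" for z
      using fin that by (cases z) auto
    then show ?thesis by (subst infinity_ennreal_def, subst ennreal_sum_less_top) auto
  qed
  finally show ?thesis .
qed

text \<open>Thickening in the direction \<open>i\<close> compares the \<open>(n - 1)\<close>-dimensional content of a cover with volumes.\<close>

lemma emeasure_le_hausdorff_outer:
  fixes S V :: "(real^'n) set"
  assumes V: "V \<in> sets borel" and sub: "\<And>y. y \<in> V \<Longrightarrow> \<exists>x\<in>S. \<exists>t\<in>{0..1}. y = x + t *\<^sub>R axis i 1"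
  shows "emeasure lborel V \<le> ennreal (3 * 4 ^ (CARD('n) - 1) / unit_ball_vol (real (CARD('n) - 1))) * hausdorff_outer (CARD('n) - 1) S"
proof -
  define k where "k = CARD('n) - 1"
  have k: "card (UNIV - {i}) = k" by (simp add: k_def card_Diff_singleton)
  \<comment> \<open>The ratio between the bound \<open>3 * (2 * dm m) ^ k\<close> for the volume of
    a thickened box and the content of the set it encloses.\<close>
  define C where "C = 3 * 4 ^ k / unit_ball_vol (real k)"
  have C: "0 < C" by (simp add: C_def)
  have one: "emeasure lborel V \<le> ennreal C * (\<Sum>m. hausdorff_content k (U m))" if U: "U \<in> delta_covers 1 S" for U
  proof -
    define dm where "dm m = diameter (U m)" for m
    have dm: "0 \<le> dm m" "dm m \<le> 1" for m using U by (auto simp: delta_covers_def dm_def diameter_ge_0)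
    define x where "x m = (SOME x. x \<in> U m)" for m
    \<comment> \<open>A box containing \<open>U m\<close> together with all its translates by at
      most one unit along the axis \<open>i\<close>; only the upper side in that direction is
      extended.\<close>
    define Bx where "Bx m = (if U m = {} then {} else cbox (x m - (\<chi> j. dm m)) (x m + (\<chi> j. if j = i then dm m + 1 else dm m)))" for m
    have VB: "V \<subseteq> (\<Union>m. Bx m)"
    proof
      fix y assume "y \<in> V"
      then obtain z t where z: "z \<in> S" "0 \<le> t" "t \<le> 1" "y = z + t *\<^sub>R axis i 1" using sub by fastforce
      then obtain m where m: "z \<in> U m" using U by (auto simp: delta_covers_def)
      have xm: "x m \<in> U m" using m unfolding x_def by (rule someI)
      have "dist z (x m) \<le> dm m"
        unfolding dm_def using U m xm by (intro diameter_bounded_bound) (auto simp: delta_covers_def)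
      then have "\<bar>z $ j - x m $ j\<bar> \<le> dm m" for j
        using component_le_norm_cart[of "z - x m" j] by (simp add: dist_norm)
      note b = this
      have "x m $ j - dm m \<le> y $ j \<and> y $ j \<le> x m $ j + (if j = i then dm m + 1 else dm m)" for j
        using b[of j] z(2,3) unfolding z(4) by (cases "j = i") (auto simp: axis_def abs_le_iff)
      then have "y \<in> Bx m" using m by (auto simp: Bx_def mem_box_cart)
      then show "y \<in> (\<Union>m. Bx m)" by blast
    qed
    have vol: "emeasure lborel (Bx m) \<le> ennreal C * hausdorff_content k (U m)" for m
    proof (cases "U m = {}")
      case False
      have "emeasure lborel (Bx m) = ennreal (\<Prod>j\<in>UNIV. (x m + (\<chi> j. if j = i then dm m + 1 else dm m)) $ j - (x m - (\<chi> j. dm m)) $ j)"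
      proof -
        have "\<forall>j. (x m - (\<chi> j. dm m)) $ j \<le> (x m + (\<chi> j. if j = i then dm m + 1 else dm m)) $ j"
          using dm(1)[of m] by auto
        then have "measure lborel (Bx m) = (\<Prod>j\<in>UNIV. (x m + (\<chi> j. if j = i then dm m + 1 else dm m)) $ j - (x m - (\<chi> j. dm m)) $ j)"
          using False unfolding Bx_def by (subst content_cbox_cart[symmetric]) (auto simp: interval_ne_empty_cart)
        moreover have "emeasure lborel (Bx m) = ennreal (measure lborel (Bx m))"
          using emeasure_lborel_cbox_finite by (intro emeasure_eq_ennreal_measure) (auto simp: Bx_def less_top)
        ultimately show ?thesis by simp
      qed
      also have "(\<Prod>j\<in>UNIV. (x m + (\<chi> j. if j = i then dm m + 1 else dm m)) $ j - (x m - (\<chi> j. dm m)) $ j) = (2 * dm m + 1) * (2 * dm m) ^ k"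
        by (subst prod.remove[of UNIV i]) (auto simp: k[symmetric])
      \<comment> \<open>Covers at scale \<open>1\<close> have diameters at most \<open>1\<close>, so
        the long side is at most \<open>3\<close>.\<close>
      also have "\<dots> \<le> 3 * (2 * dm m) ^ k" using dm[of m] by (intro mult_right_mono) auto
      also have "\<dots> = C * (unit_ball_vol (real k) * (dm m / 2) ^ k)"
      proof -
        have "4 ^ k * (dm m / 2) ^ k = (4 * (dm m / 2)) ^ k" by (rule power_mult_distrib[symmetric])
        also have "4 * (dm m / 2) = 2 * dm m" by simp
        finally have "4 ^ k * (dm m / 2) ^ k = (2 * dm m) ^ k" .
        moreover have "C * (unit_ball_vol (real k) * (dm m / 2) ^ k) = 3 * (4 ^ k * (dm m / 2) ^ k)"
        proof -
          have "unit_ball_vol (real k) \<noteq> 0" using C unfolding C_def by (metis div_by_0 less_irrefl)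
          then show ?thesis by (simp add: C_def)
        qed
        ultimately show ?thesis by simp
      qed
      finally have "emeasure lborel (Bx m) \<le> ennreal (C * (unit_ball_vol (real k) * (dm m / 2) ^ k))"
        by (simp add: ennreal_leI)
      also have "\<dots> = ennreal C * hausdorff_content k (U m)"
        using False C by (simp add: hausdorff_content_def dm_def ennreal_mult')
      finally show ?thesis .
    qed (simp add: Bx_def)
    have "emeasure lborel V \<le> emeasure lborel (\<Union>m. Bx m)"
      using VB by (intro emeasure_mono) (auto simp: Bx_def)
    also have "\<dots> \<le> (\<Sum>m. emeasure lborel (Bx m))"
      by (intro emeasure_subadditive_countably) (auto simp: Bx_def)
    also have "\<dots> \<le> (\<Sum>m. ennreal C * hausdorff_content k (U m))"
      by (intro suminf_le vol) auto
    also have "\<dots> = ennreal C * (\<Sum>m. hausdorff_content k (U m))" by simp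
    finally show ?thesis .
  qed
  have "ennreal (1 / C) * emeasure lborel V \<le> (INF U\<in>delta_covers 1 S. \<Sum>m. hausdorff_content k (U m))"
  proof (rule INF_greatest)
    fix U assume U: "U \<in> delta_covers 1 S"
    have "ennreal (1 / C) * emeasure lborel V \<le> ennreal (1 / C) * (ennreal C * (\<Sum>m. hausdorff_content k (U m)))"
      by (intro mult_left_mono one[OF U]) simp
    also have "\<dots> = (\<Sum>m. hausdorff_content k (U m))"
      using C by (simp add: mult.assoc[symmetric] ennreal_mult[symmetric] del: ennreal_mult)
    finally show "ennreal (1 / C) * emeasure lborel V \<le> (\<Sum>m. hausdorff_content k (U m))" .
  qed
  also have "\<dots> \<le> hausdorff_outer k S" by (rule covers_le_hausdorff_outer) simp
  finally have "ennreal C * (ennreal (1 / C) * emeasure lborel V) \<le> ennreal C * hausdorff_outer k S"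
    by (rule mult_left_mono) simp
  also have "ennreal C * (ennreal (1 / C) * emeasure lborel V) = emeasure lborel V"
    using C by (simp add: mult.assoc[symmetric] ennreal_mult[symmetric] del: ennreal_mult)
  finally show ?thesis unfolding C_def k_def .
qed

section \<open>Measurability of slice measures\<close>

definition open_delta_covers :: "real \<Rightarrow> 'a::metric_space set \<Rightarrow> (nat \<Rightarrow> 'a set) set" where
  "open_delta_covers \<delta> A = {U \<in> delta_covers \<delta> A. \<forall>i. open (U i)}"

text \<open>The content of the \<open>t\<close>-neighbourhood is at most \<open>q t\<close>, and
  \<open>q\<close> is continuous at \<open>0\<close>. The factor \<open>1/2\<close> in the diameter
  bound leaves room for the enlargement.\<close>

lemma open_thickening:
  fixes U :: "'a::metric_space set"
  assumes U: "bounded U" "diameter U \<le> \<delta> / 2" and \<delta>: "0 < \<delta>" and e: "0 < e"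
  obtains V where "U \<subseteq> V" "open V" "bounded V" "diameter V \<le> \<delta>" "hausdorff_content k V \<le> hausdorff_content k U + ennreal e"
proof (cases "U = {}")
  case True
  then show thesis using \<delta> by (intro that[of "{}"]) (auto simp: hausdorff_content_def)
next
  case False
  define dU where "dU = diameter U"
  have dU: "0 \<le> dU" "dU \<le> \<delta> / 2" using U by (auto simp: dU_def diameter_ge_0)
  define q where "q t = unit_ball_vol (real k) * ((dU + 2 * t) / 2) ^ k" for t :: real
  have "(q \<longlongrightarrow> q 0) (at_right 0)"
    unfolding q_def by (intro tendsto_intros) auto
  then have "eventually (\<lambda>t. q t < q 0 + e) (at_right 0)" using e by (intro order_tendstoD) auto
  moreover have "eventually (\<lambda>t. t \<in> {0<..<\<delta> / 4}) (at_right (0::real))"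
    using \<delta> by (intro eventually_at_right_real) auto
  ultimately have "eventually (\<lambda>t. q t < q 0 + e \<and> t \<in> {0<..<\<delta> / 4}) (at_right 0)"
    by eventually_elim auto
  then obtain t where t: "q t < q 0 + e" "0 < t" "t < \<delta> / 4"
    using eventually_happens'[OF trivial_limit_at_right_real] by fastforce
  define V where "V = (\<Union>x\<in>U. ball x t)"
  have UV: "U \<subseteq> V" using t by (auto simp: V_def)
  have dist: "dist y z \<le> dU + 2 * t" if yz: "y \<in> V" "z \<in> V" for y z
  proof -
    obtain x x' where x: "x \<in> U" "dist x y < t" "x' \<in> U" "dist x' z < t" using yz by (auto simp: V_def)
    have "dist x x' \<le> dU" unfolding dU_def using U x by (intro diameter_bounded_bound) auto
    moreover have "dist y z \<le> dist x y + dist x x' + dist x' z"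
      using dist_triangle[of y z x] dist_triangle[of x z x'] by (simp add: dist_commute)
    ultimately show ?thesis using x by linarith
  qed
  have bV: "bounded V"
  proof -
    obtain x where "x \<in> V" using False UV by blast
    then show ?thesis using dist unfolding bounded_def by blast
  qed
  have dV: "diameter V \<le> dU + 2 * t"
  proof -
    have "diameter V = (SUP (x, y)\<in>V \<times> V. dist x y)" using False UV by (auto simp: diameter_def)
    also have "\<dots> \<le> dU + 2 * t" using False UV dist by (intro cSUP_least) auto
    finally show ?thesis .
  qed
  show thesis
  proof (rule that[of V])
    show "U \<subseteq> V" "bounded V" by (fact UV, fact bV)
    show "open V" by (auto simp: V_def)
    show "diameter V \<le> \<delta>" using dV dU t by linarith
    have "V \<noteq> {}" using False UV by blast
    then have "hausdorff_content k V = ennreal (unit_ball_vol (real k) * (diameter V / 2) ^ k)" by (simp add: hausdorff_content_def)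
    also have "\<dots> \<le> ennreal (q t)"
      unfolding q_def using dV diameter_ge_0[OF bV] by (intro ennreal_leI mult_left_mono power_mono) auto
    also have "\<dots> \<le> ennreal (q 0 + e)" using t by (intro ennreal_leI) simp
    also have "\<dots> = ennreal (q 0) + ennreal e" using dU e by (intro ennreal_plus) (auto simp: q_def)
    also have "ennreal (q 0) = hausdorff_content k U" using False by (simp add: q_def hausdorff_content_def dU_def)
    finally show "hausdorff_content k V \<le> hausdorff_content k U + ennreal e" .
  qed
qed

text \<open>Open covers tolerate small changes of the slice, and a countable supremum preserves
  measurability; this form makes the measurability in the slice parameter accessible. The sets of a
  cover are thickened with errors that sum to \<open>e\<close>.\<close>

lemma hausdorff_outer_open_covers:
  "hausdorff_outer k A = (SUP n :: nat. INF U\<in>open_delta_covers (1 / real (Suc n)) A. \<Sum>i. hausdorff_content k (U i))"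
proof (rule antisym)
  let ?o = "\<lambda>n. INF U\<in>open_delta_covers (1 / real (Suc n)) A. \<Sum>i. hausdorff_content k (U i)"
  show "hausdorff_outer k A \<le> (SUP n. ?o n)"
  proof (rule hausdorff_outer_le_covers)
    fix \<delta> :: real assume "0 < \<delta>"
    then obtain n where n: "1 / real (Suc n) < \<delta>" using nat_approx_posE by blast
    have "(INF U\<in>delta_covers \<delta> A. \<Sum>i. hausdorff_content k (U i)) \<le> ?o n"
      by (rule INF_superset_mono) (use n in \<open>auto simp: open_delta_covers_def delta_covers_def intro: order_trans less_imp_le\<close>)
    also have "\<dots> \<le> (SUP n. ?o n)" by (rule SUP_upper) simp
    finally show "(INF U\<in>delta_covers \<delta> A. \<Sum>i. hausdorff_content k (U i)) \<le> (SUP n. ?o n)" .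
  qed
  show "(SUP n. ?o n) \<le> hausdorff_outer k A"
  proof (rule SUP_least)
    fix n :: nat
    define \<delta> where "\<delta> = 1 / real (Suc n)"
    have \<delta>: "0 < \<delta>" by (simp add: \<delta>_def)
    have "?o n \<le> (INF U\<in>delta_covers (\<delta> / 2) A. \<Sum>i. hausdorff_content k (U i))"
    proof (rule INF_greatest)
      fix U assume U: "U \<in> delta_covers (\<delta> / 2) A"
      show "?o n \<le> (\<Sum>i. hausdorff_content k (U i))"
      proof (rule ennreal_le_epsilon)
        fix e :: real assume e: "0 < e"
        define Q where "Q i V \<longleftrightarrow> U i \<subseteq> V \<and> open V \<and> bounded V \<and> diameter V \<le> \<delta>
            \<and> hausdorff_content k V \<le> hausdorff_content k (U i) + ennreal (e * (1/2) ^ Suc i)" for i V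
        have "\<exists>V. Q i V" for i
        proof -
          have Ui: "bounded (U i)" "diameter (U i) \<le> \<delta> / 2" "0 < e * (1/2) ^ Suc i" using U e by (auto simp: delta_covers_def)
          obtain V where "U i \<subseteq> V" "open V" "bounded V" "diameter V \<le> \<delta>"
            "hausdorff_content k V \<le> hausdorff_content k (U i) + ennreal (e * (1/2) ^ Suc i)"
            by (rule open_thickening[OF Ui(1,2) \<delta> Ui(3), of k])
          then have "Q i V" by (simp only: Q_def)
          then show ?thesis ..
        qed
        then obtain V where Q: "\<And>i. Q i (V i)" by metis
        have V: "U i \<subseteq> V i" "open (V i)" "bounded (V i)" "diameter (V i) \<le> \<delta>"
          "hausdorff_content k (V i) \<le> hausdorff_content k (U i) + ennreal (e * (1/2) ^ Suc i)" for i
          using Q[of i] by (simp_all only: Q_def)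
        have "A \<subseteq> (\<Union>i. V i)" using U V(1) by (fastforce simp: delta_covers_def)
        then have "V \<in> open_delta_covers (1 / real (Suc n)) A"
          using V unfolding \<delta>_def by (auto simp: open_delta_covers_def delta_covers_def)
        then have "?o n \<le> (\<Sum>i. hausdorff_content k (V i))" by (rule INF_lower)
        also have "\<dots> \<le> (\<Sum>i. hausdorff_content k (U i) + ennreal (e * (1/2) ^ Suc i))"
          by (intro suminf_le V(5)) auto
        also have "\<dots> = (\<Sum>i. hausdorff_content k (U i)) + (\<Sum>i. ennreal (e * (1/2) ^ Suc i))"
          by (rule suminf_add[symmetric]) auto
        also have "(\<Sum>i. ennreal (e * (1/2) ^ Suc i)) = ennreal e"
          using e sums_mult[OF power_half_series, of e] by (intro suminf_ennreal_eq) auto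
        finally show "?o n \<le> (\<Sum>i. hausdorff_content k (U i)) + ennreal e" .
      qed
    qed
    also have "\<dots> \<le> hausdorff_outer k A" using \<delta> by (intro covers_le_hausdorff_outer) simp
    finally show "?o n \<le> hausdorff_outer k A" .
  qed
qed

definition hyperplane :: "real \<times> 'a::real_inner \<Rightarrow> 'a set" where
  "hyperplane z = {x. x \<bullet> snd z = fst z}"

lemma closed_hyperplane_through: "closed (hyperplane (z :: real \<times> 'a::euclidean_space))"
  unfolding hyperplane_def by (intro closed_Collect_eq continuous_intros)

text \<open>Points of \<open>C\<close> on the hyperplanes accumulate by compactness, and the
  incidence equation passes to the limit.\<close>

lemma closed_hyperplanes_meeting_compact:
  fixes C :: "'a::euclidean_space set"
  assumes C: "compact C"
  shows "closed {z. C \<inter> hyperplane z \<noteq> {}}"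
  unfolding closed_sequential_limits
proof (intro allI impI, elim conjE)
  fix z and l :: "real \<times> 'a" assume z: "\<forall>n :: nat. z n \<in> {z. C \<inter> hyperplane z \<noteq> {}}" and lim: "z \<longlonglongrightarrow> l"
  have "\<exists>x. x \<in> C \<and> x \<bullet> snd (z n) = fst (z n)" for n
  proof -
    have "C \<inter> hyperplane (z n) \<noteq> {}" using z by blast
    then show ?thesis by (auto simp: hyperplane_def)
  qed
  then obtain x where x: "\<And>n. x n \<in> C" "\<And>n. x n \<bullet> snd (z n) = fst (z n)" by metis
  obtain y r where y: "y \<in> C" "strict_mono r" "(x \<circ> r) \<longlonglongrightarrow> y"
    using C x(1) unfolding compact_def by blast
  have zr: "(\<lambda>n. z (r n)) \<longlonglongrightarrow> l" using LIMSEQ_subseq_LIMSEQ[OF lim y(2)] by (simp add: o_def)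
  have "(\<lambda>n. x (r n) \<bullet> snd (z (r n))) \<longlonglongrightarrow> y \<bullet> snd l"
    using y(3) by (intro tendsto_inner tendsto_snd zr) (simp add: o_def)
  moreover have "(\<lambda>n. x (r n) \<bullet> snd (z (r n))) \<longlonglongrightarrow> fst l"
    unfolding x(2) by (intro tendsto_fst zr)
  ultimately have "y \<bullet> snd l = fst l" by (rule LIMSEQ_unique)
  then show "l \<in> {z. C \<inter> hyperplane z \<noteq> {}}" using y(1) by (auto simp: hyperplane_def)
qed

text \<open>For compact \<open>A\<close> an open cover of \<open>A \<inter> hyperplane z\<close> also covers the neighbouring slices.\<close>

lemma borel_measurable_hausdorff_slice_compact:
  fixes A :: "'a::euclidean_space set"
  assumes A: "compact A"
  shows "(\<lambda>z. hausdorff_outer k (A \<inter> hyperplane z)) \<in> borel_measurable borel"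
  unfolding hausdorff_outer_open_covers
proof (rule borel_measurable_SUP)
  fix n :: nat
  let ?o = "\<lambda>z. INF U\<in>open_delta_covers (1 / real (Suc n)) (A \<inter> hyperplane z). \<Sum>i. hausdorff_content k (U i)"
  show "?o \<in> borel_measurable borel"
  proof (rule borel_measurableI_less)
    fix y :: ennreal
    have "open {z. ?o z < y}"
    proof (subst open_subopen, intro ballI)
      fix z0 assume "z0 \<in> {z. ?o z < y}"
      then obtain U where U: "U \<in> open_delta_covers (1 / real (Suc n)) (A \<inter> hyperplane z0)" "(\<Sum>i. hausdorff_content k (U i)) < y"
        by (auto simp: INF_less_iff)
      define G where "G = (\<Union>i. U i)"
      have G: "open G" "A \<inter> hyperplane z0 \<subseteq> G" using U by (auto simp: open_delta_covers_def delta_covers_def G_def)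
      define W where "W = - {z. (A - G) \<inter> hyperplane z \<noteq> {}}"
      have "compact (A - G)" using A G(1) by (rule compact_diff)
      then have "open W" unfolding W_def by (intro open_Compl closed_hyperplanes_meeting_compact)
      moreover have "z0 \<in> W" using G by (auto simp: W_def)
      moreover have "W \<subseteq> {z. ?o z < y}"
      proof
        fix z assume "z \<in> W"
        then have "A \<inter> hyperplane z \<subseteq> G" by (auto simp: W_def)
        then have "U \<in> open_delta_covers (1 / real (Suc n)) (A \<inter> hyperplane z)"
          using U by (auto simp: open_delta_covers_def delta_covers_def G_def)
        then have "?o z \<le> (\<Sum>i. hausdorff_content k (U i))" by (rule INF_lower)
        then show "z \<in> {z. ?o z < y}" using U(2) by simp
      qed
      ultimately show "\<exists>T. open T \<and> z0 \<in> T \<and> T \<subseteq> {z. ?o z < y}" by blast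
    qed
    then show "{z \<in> space borel. ?o z < y} \<in> sets borel" by simp
  qed
qed simp

text \<open>A Dynkin argument from closed to Borel sets. Intersecting with the compact
  \<open>B\<close> makes the generators compact, finiteness of the slices of \<open>B\<close>
  permits complements by subtraction, and additivity holds because Borel sets are Caratheodory
  measurable.\<close>

lemma borel_measurable_hausdorff_slice:
  fixes A B :: "'a::euclidean_space set"
  assumes B: "compact B" and fin: "\<And>z. z \<in> Z \<Longrightarrow> hausdorff_outer k (B \<inter> hyperplane z) < \<infinity>" and A: "A \<in> sets borel"
  shows "(\<lambda>z. hausdorff_outer k (A \<inter> B \<inter> hyperplane z)) \<in> borel_measurable (restrict_space borel Z)"
proof -
  let ?H = "hausdorff_measure k :: 'a measure"
  have em: "hausdorff_outer k X = emeasure ?H X" if "X \<in> sets borel" for X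
    using that borel_subset_sets_hausdorff_measure by (intro emeasure_hausdorff_measure[symmetric]) auto
  have sets_H: "X \<in> sets ?H" if "X \<in> sets borel" for X
    using that borel_subset_sets_hausdorff_measure by auto
  have BH: "B \<inter> hyperplane z \<in> sets borel" for z
    using B closed_hyperplane_through[of z] by (intro sets.Int) (auto intro: borel_compact borel_closed)
  have "Int_stable (Collect closed :: 'a set set)" by (auto simp: Int_stable_def)
  moreover have "Collect closed \<subseteq> Pow (UNIV :: 'a set)" by simp
  moreover have "A \<in> sigma_sets UNIV (Collect closed)" using A by (simp add: borel_eq_closed)
  ultimately show ?thesis
  proof (induction rule: sigma_sets_induct_disjoint)
    case (basic A)
    then have "compact (A \<inter> B)" using B by (simp add: closed_Int_compact)
    then show ?case by (intro measurable_restrict_space1 borel_measurable_hausdorff_slice_compact)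
  next
    case empty
    then show ?case by (simp add: hausdorff_outer_empty)
  next
    case (compl A)
    have Ab: "A \<in> sets borel" using compl(1) by (simp add: borel_eq_closed)
    have "(\<lambda>z. hausdorff_outer k (B \<inter> hyperplane z) - hausdorff_outer k (A \<inter> B \<inter> hyperplane z)) \<in> borel_measurable (restrict_space borel Z)"
      by (intro borel_measurable_minus_ennreal compl.IH measurable_restrict_space1 borel_measurable_hausdorff_slice_compact B)
    moreover have "hausdorff_outer k (B \<inter> hyperplane z) - hausdorff_outer k (A \<inter> B \<inter> hyperplane z) = hausdorff_outer k ((UNIV - A) \<inter> B \<inter> hyperplane z)"
      if "z \<in> space (restrict_space borel Z)" for z
    proof -
      have z: "z \<in> Z" using that by (simp add: space_restrict_space)
      have AB: "A \<inter> B \<inter> hyperplane z \<in> sets borel" using Ab BH[of z] by (simp add: Int_assoc)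
      have "(UNIV - A) \<inter> B \<inter> hyperplane z = B \<inter> hyperplane z - A \<inter> B \<inter> hyperplane z" by blast
      moreover have "B \<inter> hyperplane z - A \<inter> B \<inter> hyperplane z \<in> sets borel" using AB BH[of z] by simp
      moreover have "emeasure ?H (B \<inter> hyperplane z - A \<inter> B \<inter> hyperplane z)
          = emeasure ?H (B \<inter> hyperplane z) - emeasure ?H (A \<inter> B \<inter> hyperplane z)"
      proof (rule emeasure_Diff)
        have "hausdorff_outer k (A \<inter> B \<inter> hyperplane z) \<le> hausdorff_outer k (B \<inter> hyperplane z)"
          by (rule hausdorff_outer_mono) blast
        then show "emeasure ?H (A \<inter> B \<inter> hyperplane z) \<noteq> \<infinity>"
          using fin[OF z] unfolding em[OF AB, symmetric] by (auto simp: top_unique)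
      qed (use sets_H[OF AB] sets_H[OF BH] in auto)
      ultimately show ?thesis using em[OF AB] em[OF BH[of z]] em by simp
    qed
    ultimately show ?case by (subst measurable_cong[symmetric]) auto
  next
    case (union A)
    have Ab: "A i \<in> sets borel" for i using union(2) by (auto simp: borel_eq_closed)
    have "(\<lambda>z. \<Sum>i. hausdorff_outer k (A i \<inter> B \<inter> hyperplane z)) \<in> borel_measurable (restrict_space borel Z)"
      by (intro borel_measurable_suminf_order union.IH) 
    moreover have "(\<Sum>i. hausdorff_outer k (A i \<inter> B \<inter> hyperplane z)) = hausdorff_outer k ((\<Union>i. A i) \<inter> B \<inter> hyperplane z)" for z
    proof -
      have AB: "A i \<inter> B \<inter> hyperplane z \<in> sets borel" for i using Ab BH[of z] by (simp add: Int_assoc)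
      have "disjoint_family (\<lambda>i. A i \<inter> B \<inter> hyperplane z)"
        using union(1) unfolding disjoint_family_on_def by blast
      then have "(\<Sum>i. emeasure ?H (A i \<inter> B \<inter> hyperplane z)) = emeasure ?H (\<Union>i. A i \<inter> B \<inter> hyperplane z)"
        using sets_H[OF AB] by (intro suminf_emeasure) auto
      moreover have "(\<Union>i. A i \<inter> B \<inter> hyperplane z) = (\<Union>i. A i) \<inter> B \<inter> hyperplane z" by blast
      moreover have "(\<Union>i. A i \<inter> B \<inter> hyperplane z) \<in> sets borel" using AB by blast
      ultimately show ?thesis using em[OF AB] em by simp
    qed
    ultimately show ?case by simp
  qed
qed

section \<open>Integration over slices\<close>

text \<open>The bound on closed cubes passes to half-open dyadic cells, by countable additivity and
  monotone limits to open sets, and by outer regularity of Lebesgue measure to Borel sets.\<close>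

lemma emeasure_le_of_cells:
  fixes \<nu> :: "(real^'n) measure"
  assumes \<nu>: "sets \<nu> = sets borel" and C: "0 \<le> C"
    and cell: "\<And>a h. 0 < h \<Longrightarrow> emeasure \<nu> {x. \<forall>i. a $ i \<le> x $ i \<and> x $ i \<le> a $ i + h} \<le> ennreal (C * h ^ CARD('n))"
    and A: "A \<in> sets borel"
  shows "emeasure \<nu> A \<le> ennreal C * emeasure lborel A"
proof -
  \<comment> \<open>Half-open dyadic cubes of side \<open>1 / 2 ^ m\<close>, indexed by their
    integer corners; for fixed \<open>m\<close> they partition the space.\<close>
  define cl where "cl m g = {x :: real^'n. \<forall>i. \<lfloor>2 ^ m * x $ i\<rfloor> = g i}" for m :: nat and g :: "'n \<Rightarrow> int"
  have clb: "cl m g \<in> sets borel" for m g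
  proof -
    have "cl m g = (\<Inter>i\<in>UNIV. {x \<in> space borel. \<lfloor>2 ^ m * x $ i\<rfloor> = g i})" by (auto simp: cl_def)
    moreover have "{x \<in> space (borel :: (real^'n) measure). \<lfloor>2 ^ m * x $ i\<rfloor> = g i} \<in> sets borel" for i
      by measurable
    ultimately show ?thesis by simp
  qed
  have cl_le: "emeasure \<nu> (cl m g) \<le> ennreal C * emeasure lborel (cl m g)" for m g
  proof -
    define h where "h = 1 / (2 :: real) ^ m"
    define a :: "real^'n" where "a = (\<chi> i. of_int (g i) * h)"
    have h: "0 < h" by (simp add: h_def)
    have sub: "cl m g \<subseteq> {x. \<forall>i. a $ i \<le> x $ i \<and> x $ i \<le> a $ i + h}"
    proof (clarsimp simp: cl_def a_def)
      fix x :: "real^'n" and i assume "\<forall>i. \<lfloor>2 ^ m * x $ i\<rfloor> = g i"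
      then have "of_int (g i) \<le> 2 ^ m * x $ i" "2 ^ m * x $ i < of_int (g i) + 1"
        using of_int_floor_le[of "2 ^ m * x $ i"] floor_correct[of "2 ^ m * x $ i"] by auto
      then show "of_int (g i) * h \<le> x $ i \<and> x $ i \<le> of_int (g i) * h + h"
        by (simp add: h_def field_simps)
    qed
    have box: "box a (a + (\<chi> i. h)) \<subseteq> cl m g"
    proof
      fix x assume "x \<in> box a (a + (\<chi> i. h))"
      then have "of_int (g i) * h < x $ i" "x $ i < of_int (g i) * h + h" for i
        by (auto simp: mem_box_cart a_def)
      then have "of_int (g i) < 2 ^ m * x $ i" "2 ^ m * x $ i < of_int (g i) + 1" for i
        by (simp_all add: h_def field_simps)
      then show "x \<in> cl m g" unfolding cl_def
        by (auto intro!: floor_unique less_imp_le)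
    qed
    have "emeasure \<nu> (cl m g) \<le> emeasure \<nu> {x. \<forall>i. a $ i \<le> x $ i \<and> x $ i \<le> a $ i + h}"
    proof (rule emeasure_mono[OF sub])
      have "{x. \<forall>i. a $ i \<le> x $ i \<and> x $ i \<le> a $ i + h} = cbox a (a + (\<chi> i. h))" by (auto simp: mem_box_cart)
      then show "{x. \<forall>i. a $ i \<le> x $ i \<and> x $ i \<le> a $ i + h} \<in> sets \<nu>" unfolding \<nu> by simp
    qed
    also have "\<dots> \<le> ennreal (C * h ^ CARD('n))" by (rule cell[OF h])
    also have "\<dots> = ennreal C * ennreal (h ^ CARD('n))" using C h by (simp add: ennreal_mult)
    also have "ennreal (h ^ CARD('n)) = emeasure lborel (box a (a + (\<chi> i. h)))"
    proof -
      have "measure lborel (cbox a (a + (\<chi> i. h))) = h ^ CARD('n)"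
        using h by (subst content_cbox_cart) (auto simp: interval_ne_empty_cart)
      moreover have "emeasure lborel (cbox a (a + (\<chi> i. h))) = ennreal (measure lborel (cbox a (a + (\<chi> i. h))))"
        using emeasure_lborel_cbox_finite by (intro emeasure_eq_ennreal_measure) (auto simp: less_top)
      moreover have "emeasure lborel (box a (a + (\<chi> i. h))) = emeasure lborel (cbox a (a + (\<chi> i. h)))"
        by (simp add: emeasure_lborel_box_eq emeasure_lborel_cbox_eq)
      ultimately show ?thesis by simp
    qed
    also have "ennreal C * emeasure lborel (box a (a + (\<chi> i. h))) \<le> ennreal C * emeasure lborel (cl m g)"
      using clb by (intro mult_left_mono emeasure_mono box) auto
    finally show ?thesis .
  qed
  have op: "emeasure \<nu> V \<le> ennreal C * emeasure lborel V" if V: "open V" for V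
  proof -
    define I where "I m = {g. cl m g \<subseteq> V}" for m
    define W where "W m = (\<Union>g\<in>I m. cl m g)" for m
    have dis: "disjoint_family_on (cl m) (I m)" for m
      by (auto simp: disjoint_family_on_def cl_def fun_eq_iff)
    have cnt: "countable (I m)" for m by (rule countable_subset[OF subset_UNIV]) simp
    have Wb: "W m \<in> sets borel" for m
      unfolding W_def using cnt clb by (intro sets.countable_UN'') auto
    have WV: "W m \<subseteq> V" for m by (auto simp: W_def I_def)
    have Wle: "emeasure \<nu> (W m) \<le> ennreal C * emeasure lborel V" for m
    proof -
      have "emeasure \<nu> (W m) = (\<integral>\<^sup>+g. emeasure \<nu> (cl m g) \<partial>count_space (I m))"
        unfolding W_def using clb dis cnt by (intro emeasure_UN_countable) (auto simp: \<nu>)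
      also have "\<dots> \<le> (\<integral>\<^sup>+g. ennreal C * emeasure lborel (cl m g) \<partial>count_space (I m))"
        by (intro nn_integral_mono cl_le)
      also have "\<dots> = ennreal C * (\<integral>\<^sup>+g. emeasure lborel (cl m g) \<partial>count_space (I m))"
        by (rule nn_integral_cmult) simp
      also have "(\<integral>\<^sup>+g. emeasure lborel (cl m g) \<partial>count_space (I m)) = emeasure lborel (W m)"
        unfolding W_def using clb dis cnt by (intro emeasure_UN_countable[symmetric]) auto
      also have "ennreal C * emeasure lborel (W m) \<le> ennreal C * emeasure lborel V"
        using V by (intro mult_left_mono emeasure_mono WV) auto
      finally show ?thesis .
    qed
    have inc: "incseq W"
    proof (rule incseq_SucI, rule subsetI)
      fix m x assume "x \<in> W m"
      then obtain g where g: "cl m g \<subseteq> V" "x \<in> cl m g" by (auto simp: W_def I_def)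
      define g' where "g' i = \<lfloor>2 ^ Suc m * x $ i\<rfloor>" for i
      \<comment> \<open>Halving the side refines the cells, since the coarse index is the fine one
        divided by two; this makes the unions \<open>W m\<close> increase.\<close>
      have half: "\<lfloor>t\<rfloor> = \<lfloor>2 * t\<rfloor> div 2" for t :: real
        using floor_divide_real_eq_div[of 2 "2 * t"] by simp
      have "cl (Suc m) g' \<subseteq> cl m g"
      proof
        fix y assume "y \<in> cl (Suc m) g'"
        then have "\<lfloor>2 * (2 ^ m * y $ i)\<rfloor> = \<lfloor>2 * (2 ^ m * x $ i)\<rfloor>" for i by (simp add: cl_def g'_def mult.assoc)
        then have "\<lfloor>2 ^ m * y $ i\<rfloor> = \<lfloor>2 ^ m * x $ i\<rfloor>" for i
          using half[of "2 ^ m * y $ i"] half[of "2 ^ m * x $ i"] by simp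
        then show "y \<in> cl m g" using g(2) by (simp add: cl_def)
      qed
      then have "g' \<in> I (Suc m)" using g(1) by (auto simp: I_def)
      moreover have "x \<in> cl (Suc m) g'" by (simp add: cl_def g'_def)
      ultimately show "x \<in> W (Suc m)" unfolding W_def by blast
    qed
    have "V = (\<Union>m. W m)"
    proof
      show "V \<subseteq> (\<Union>m. W m)"
      proof
        fix x assume "x \<in> V"
        then obtain e where e: "0 < e" "ball x e \<subseteq> V" using V open_contains_ball by blast
        obtain m where m: "real CARD('n) / e < 2 ^ m" using real_arch_pow[of 2] by auto
        define g where "g i = \<lfloor>2 ^ m * x $ i\<rfloor>" for i
        have "cl m g \<subseteq> ball x e"
        proof
          fix y assume "y \<in> cl m g"
          then have "\<lfloor>2 ^ m * y $ i\<rfloor> = \<lfloor>2 ^ m * x $ i\<rfloor>" for i by (simp add: cl_def g_def)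
          note fl = this
          have "\<bar>2 ^ m * x $ i - 2 ^ m * y $ i\<bar> < 1" for i
            using fl[of i] floor_correct[of "2 ^ m * x $ i"] floor_correct[of "2 ^ m * y $ i"] by linarith
          then have "2 ^ m * \<bar>(x - y) $ i\<bar> \<le> 1" for i
            by (simp add: abs_mult right_diff_distrib[symmetric] less_imp_le)
          then have "\<bar>(x - y) $ i\<bar> \<le> 1 / 2 ^ m" for i by (simp add: field_simps)
          then have "(\<Sum>i\<in>UNIV. \<bar>(x - y) $ i\<bar>) \<le> (\<Sum>i\<in>(UNIV :: 'n set). 1 / 2 ^ m)" by (intro sum_mono)
          then have "norm (x - y) \<le> real CARD('n) / 2 ^ m" using norm_le_l1_cart[of "x - y"] by simp
          also have "\<dots> < e" using m e by (simp add: field_simps)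
          finally show "y \<in> ball x e" by (simp add: dist_norm)
        qed
        then have "g \<in> I m" using e by (auto simp: I_def)
        moreover have "x \<in> cl m g" by (simp add: cl_def g_def)
        ultimately have "x \<in> W m" unfolding W_def by blast
        then show "x \<in> (\<Union>m. W m)" by blast
      qed
    qed (use WV in blast)
    then have "emeasure \<nu> V = (SUP m. emeasure \<nu> (W m))"
      using Wb inc by (subst SUP_emeasure_incseq) (auto simp: \<nu>)
    also have "\<dots> \<le> ennreal C * emeasure lborel V" by (rule SUP_least) (rule Wle)
    finally show ?thesis .
  qed
  show ?thesis
  proof (rule ennreal_le_epsilon)
    fix e :: real assume e: "0 < e"
    \<comment> \<open>\<open>C + 1\<close> in place of \<open>C\<close> avoids a division by
      zero.\<close>
    have e': "0 < e / (C + 1)" using e C by simp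
    obtain U where U: "open U" "A \<subseteq> U" "emeasure lborel (U - A) < ennreal (e / (C + 1))"
      using outer_regular_lborel[OF A e'] by blast
    have "emeasure \<nu> A \<le> emeasure \<nu> U" using U by (intro emeasure_mono) (auto simp: \<nu>)
    also have "\<dots> \<le> ennreal C * emeasure lborel U" by (rule op[OF U(1)])
    also have "emeasure lborel U = emeasure lborel A + emeasure lborel (U - A)"
      using U A by (subst plus_emeasure) (auto simp: Un_absorb1)
    also have "ennreal C * (emeasure lborel A + emeasure lborel (U - A)) \<le> ennreal C * (emeasure lborel A + ennreal (e / (C + 1)))"
      using U(3) by (intro mult_left_mono add_left_mono) auto
    also have "\<dots> = ennreal C * emeasure lborel A + ennreal (C * (e / (C + 1)))"
      using less_imp_le[OF e'] by (simp only: distrib_left ennreal_mult[OF C])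
    also have "\<dots> \<le> ennreal C * emeasure lborel A + ennreal e"
      using C e by (intro add_left_mono ennreal_leI) (simp add: field_simps)
    finally show "emeasure \<nu> A \<le> ennreal C * emeasure lborel A + ennreal e" .
  qed
qed

section \<open>Families of slice measures\<close>

abbreviation slice_space :: "(real \<times> (real^'n)) measure" where
  "slice_space \<equiv> restrict_space borel (UNIV \<times> sphere 0 1)"

text \<open>\<open>\<kappa> (r, \<phi>)\<close> is the part in a large ball of surface measure on the hyperplane, or of length on the line.\<close>

locale slice_kernel =
  fixes \<kappa> :: "real \<times> (real^'n) \<Rightarrow> (real^'n) measure" and Cm Cc :: real
  assumes sets_kernel: "sets (\<kappa> z) = sets borel"
    and mass: "norm \<phi> = 1 \<Longrightarrow> emeasure (\<kappa> (r, \<phi>)) UNIV \<le> ennreal Cm" and Cm: "0 \<le> Cm" and Cc: "0 \<le> Cc"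
    and measurable_kernel: "A \<in> sets borel \<Longrightarrow> (\<lambda>z. emeasure (\<kappa> z) A) \<in> borel_measurable slice_space"
    and cells: "norm \<phi> = 1 \<Longrightarrow> 0 < h \<Longrightarrow>
      (\<integral>\<^sup>+r. emeasure (\<kappa> (r, \<phi>)) {x. \<forall>i. a $ i \<le> x $ i \<and> x $ i \<le> a $ i + h} \<partial>lborel) \<le> ennreal (Cc * h ^ CARD('n))"
begin

lemma space_kernel [simp]: "space (\<kappa> z) = UNIV"
  using sets_eq_imp_space_eq[OF sets_kernel] by simp

lemma measurable_kernel_cong: "borel_measurable (\<kappa> z) = borel_measurable borel"
  by (intro measurable_cong_sets sets_kernel refl)

lemma measurable_slice_line:
  assumes "norm \<phi> = 1"
  shows "(\<lambda>r. (r, \<phi>)) \<in> lborel \<rightarrow>\<^sub>M slice_space"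
  using assms by (intro measurable_restrict_space2) (auto simp: borel_prod[symmetric])

lemma measurable_slice_nn_integral:
  assumes "f \<in> borel_measurable borel"
  shows "(\<lambda>z. \<integral>\<^sup>+x. f x \<partial>\<kappa> z) \<in> borel_measurable slice_space"
  using assms
proof (induction rule: borel_measurable_induct)
  case (cong f g)
  then have "f = g" by auto
  with cong show ?case by simp
next
  case (set A)
  then show ?case using measurable_kernel[OF set] by (simp add: sets_kernel)
next
  case (mult u c)
  then show ?case by (simp add: nn_integral_cmult measurable_kernel_cong)
next
  case (add u v)
  then show ?case by (simp add: nn_integral_add measurable_kernel_cong)
next
  case (seq U)
  have "(\<integral>\<^sup>+x. (SUP i. U i x) \<partial>\<kappa> z) = (SUP i. \<integral>\<^sup>+x. U i x \<partial>\<kappa> z)" for z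
    using seq by (intro nn_integral_monotone_convergence_SUP) (auto simp: measurable_kernel_cong)
  then show ?case using seq by (simp add: SUP_apply[abs_def])
qed

lemma measurable_slice_nn_integral_line:
  assumes "norm \<phi> = 1" "f \<in> borel_measurable borel"
  shows "(\<lambda>r. \<integral>\<^sup>+x. f x \<partial>\<kappa> (r, \<phi>)) \<in> borel_measurable lborel"
  using measurable_compose[OF measurable_slice_line[OF assms(1)] measurable_slice_nn_integral[OF assms(2)]] by simp

text \<open>For a fixed direction the integral of the kernels over \<open>r\<close> is itself a
  Borel measure \<open>\<nu>\<close>, and the locale assumption on cubes is the hypothesis of the
  cell comparison.\<close>

lemma slice_emeasure_le:
  assumes \<phi>: "norm \<phi> = 1" and A: "A \<in> sets borel"
  shows "(\<integral>\<^sup>+r. emeasure (\<kappa> (r, \<phi>)) A \<partial>lborel) \<le> ennreal Cc * emeasure lborel A"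
proof -
  define \<mu> where "\<mu> A = (\<integral>\<^sup>+r. emeasure (\<kappa> (r, \<phi>)) A \<partial>lborel)" for A
  define \<nu> where "\<nu> = measure_of UNIV (sets borel) \<mu>"
  have sets\<nu>: "sets \<nu> = sets borel"
    unfolding \<nu>_def using sets.sigma_sets_eq[of borel] by (simp add: sets_measure_of_conv)
  have line: "(\<lambda>r. emeasure (\<kappa> (r, \<phi>)) X) \<in> borel_measurable lborel" if "X \<in> sets borel" for X
    using measurable_compose[OF measurable_slice_line[OF \<phi>] measurable_kernel[OF that]] by simp
  have em: "emeasure \<nu> X = \<mu> X" if "X \<in> sets borel" for X
    unfolding \<nu>_def
  proof (rule emeasure_measure_of_sigma)
    show "sigma_algebra UNIV (sets borel)" using sets.sigma_algebra_axioms[of borel] by simp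
    show "positive (sets borel) \<mu>" by (simp add: positive_def \<mu>_def)
    show "countably_additive (sets borel) \<mu>"
    proof (rule countably_additiveI)
      fix X :: "nat \<Rightarrow> (real^'n) set" assume X: "range X \<subseteq> sets borel" "disjoint_family X"
      have "(\<Sum>i. \<mu> (X i)) = (\<integral>\<^sup>+r. (\<Sum>i. emeasure (\<kappa> (r, \<phi>)) (X i)) \<partial>lborel)"
        unfolding \<mu>_def using X line by (intro nn_integral_suminf[symmetric]) auto
      also have "\<dots> = \<mu> (\<Union>i. X i)"
        unfolding \<mu>_def using X by (intro nn_integral_cong suminf_emeasure) (auto simp: sets_kernel)
      finally show "(\<Sum>i. \<mu> (X i)) = \<mu> (\<Union>i. X i)" .
    qed
  qed (use that in auto)
  have "emeasure \<nu> A \<le> ennreal Cc * emeasure lborel A"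
  proof (rule emeasure_le_of_cells[OF sets\<nu> Cc _ A])
    fix a :: "real^'n" and h :: real assume h: "0 < h"
    have "{x. \<forall>i. a $ i \<le> x $ i \<and> x $ i \<le> a $ i + h} = cbox a (a + (\<chi> i. h))" by (auto simp: mem_box_cart)
    then have "{x. \<forall>i. a $ i \<le> x $ i \<and> x $ i \<le> a $ i + h} \<in> sets borel" by simp
    then show "emeasure \<nu> {x. \<forall>i. a $ i \<le> x $ i \<and> x $ i \<le> a $ i + h} \<le> ennreal (Cc * h ^ CARD('n))"
      using cells[OF \<phi> h, of a] by (simp only: em \<mu>_def)
  qed
  then show ?thesis by (simp add: em[OF A] \<mu>_def)
qed

lemma slice_nn_integral_le:
  assumes \<phi>: "norm \<phi> = 1" and f: "f \<in> borel_measurable borel"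
  shows "(\<integral>\<^sup>+r. (\<integral>\<^sup>+x. f x \<partial>\<kappa> (r, \<phi>)) \<partial>lborel) \<le> ennreal Cc * (\<integral>\<^sup>+x. f x \<partial>lborel)"
  using f
proof (induction rule: borel_measurable_induct)
  case (cong f g)
  then have "f = g" by auto
  with cong show ?case by simp
next
  case (set A)
  then show ?case using slice_emeasure_le[OF \<phi> set] by (simp add: sets_kernel)
next
  case (mult u c)
  have "(\<integral>\<^sup>+r. (\<integral>\<^sup>+x. c * u x \<partial>\<kappa> (r, \<phi>)) \<partial>lborel) = c * (\<integral>\<^sup>+r. (\<integral>\<^sup>+x. u x \<partial>\<kappa> (r, \<phi>)) \<partial>lborel)"
    using mult measurable_slice_nn_integral_line[OF \<phi> mult(2)] by (simp add: nn_integral_cmult measurable_kernel_cong)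
  also have "\<dots> \<le> c * (ennreal Cc * (\<integral>\<^sup>+x. u x \<partial>lborel))" by (intro mult_left_mono mult.IH) simp
  also have "\<dots> = ennreal Cc * (\<integral>\<^sup>+x. c * u x \<partial>lborel)" using mult by (simp add: nn_integral_cmult mult.left_commute)
  finally show ?case .
next
  case (add u v)
  have "(\<integral>\<^sup>+r. (\<integral>\<^sup>+x. v x + u x \<partial>\<kappa> (r, \<phi>)) \<partial>lborel)
      = (\<integral>\<^sup>+r. (\<integral>\<^sup>+x. v x \<partial>\<kappa> (r, \<phi>)) \<partial>lborel) + (\<integral>\<^sup>+r. (\<integral>\<^sup>+x. u x \<partial>\<kappa> (r, \<phi>)) \<partial>lborel)"
    using add measurable_slice_nn_integral_line[OF \<phi>] by (simp add: nn_integral_add measurable_kernel_cong)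
  also have "\<dots> \<le> ennreal Cc * (\<integral>\<^sup>+x. v x \<partial>lborel) + ennreal Cc * (\<integral>\<^sup>+x. u x \<partial>lborel)"
    by (intro add_mono add.IH)
  also have "\<dots> = ennreal Cc * (\<integral>\<^sup>+x. v x + u x \<partial>lborel)" using add by (simp add: nn_integral_add distrib_left)
  finally show ?case .
next
  case (seq U)
  have 1: "(\<integral>\<^sup>+x. (SUP i. U i x) \<partial>\<kappa> (r, \<phi>)) = (SUP i. \<integral>\<^sup>+x. U i x \<partial>\<kappa> (r, \<phi>))" for r
    using seq by (intro nn_integral_monotone_convergence_SUP) (auto simp: measurable_kernel_cong)
  have "(\<integral>\<^sup>+r. (\<integral>\<^sup>+x. (SUP i. U i x) \<partial>\<kappa> (r, \<phi>)) \<partial>lborel) = (SUP i. \<integral>\<^sup>+r. (\<integral>\<^sup>+x. U i x \<partial>\<kappa> (r, \<phi>)) \<partial>lborel)"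
    unfolding 1 using seq measurable_slice_nn_integral_line[OF \<phi>]
    by (intro nn_integral_monotone_convergence_SUP) (auto simp: incseq_def le_fun_def intro!: nn_integral_mono)
  also have "\<dots> \<le> ennreal Cc * (\<integral>\<^sup>+x. (SUP i. U i x) \<partial>lborel)"
  proof (rule SUP_least)
    fix i
    have "(\<integral>\<^sup>+r. (\<integral>\<^sup>+x. U i x \<partial>\<kappa> (r, \<phi>)) \<partial>lborel) \<le> ennreal Cc * (\<integral>\<^sup>+x. U i x \<partial>lborel)" by (rule seq.IH)
    also have "\<dots> \<le> ennreal Cc * (\<integral>\<^sup>+x. (SUP i. U i x) \<partial>lborel)"
      by (intro mult_left_mono nn_integral_mono SUP_upper) auto
    finally show "(\<integral>\<^sup>+r. (\<integral>\<^sup>+x. U i x \<partial>\<kappa> (r, \<phi>)) \<partial>lborel) \<le> ennreal Cc * (\<integral>\<^sup>+x. (SUP i. U i x) \<partial>lborel)" .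
  qed
  finally show ?case by (simp add: SUP_apply[abs_def])
qed

end

section \<open>The parameter space and Borel representatives\<close>

abbreviation sphere_measure :: "(real^'n) measure" where
  "sphere_measure \<equiv> restrict_space (hausdorff_measure (CARD('n) - 1)) (sphere 0 1)"

abbreviation sigma_pair :: "(real \<times> (real^'n)) measure" where
  "sigma_pair \<equiv> lebesgue_on {0::real..} \<Otimes>\<^sub>M sphere_measure"

lemma sets_hausdorff_borel: "A \<in> sets borel \<Longrightarrow> A \<in> sets (hausdorff_measure k)"
  using borel_subset_sets_hausdorff_measure by auto

lemma sphere_in_sets: "sphere (0 :: real^'n) 1 \<in> sets (hausdorff_measure k)"
  by (intro sets_hausdorff_borel borel_closed) simp

lemma finite_sphere_measure: "finite_measure (sphere_measure :: (real^'n) measure)"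
proof (rule finite_measureI)
  have "emeasure (sphere_measure :: (real^'n) measure) (sphere 0 1) = hausdorff_outer (CARD('n) - 1) (sphere (0 :: real^'n) 1)"
    using sphere_in_sets by (subst emeasure_restrict_space) (auto simp: emeasure_hausdorff_measure)
  then show "emeasure (sphere_measure :: (real^'n) measure) (space sphere_measure) \<noteq> \<infinity>"
    using hausdorff_outer_sphere_finite[where 'n = 'n] by (simp add: space_restrict_space less_top)
qed

lemma pair_sigma_finite_sigma_pair: "pair_sigma_finite (lebesgue_on {0::real..}) (sphere_measure :: (real^'n) measure)"
proof -
  interpret finite_measure "sphere_measure :: (real^'n) measure" by (rule finite_sphere_measure)
  have "sigma_finite_measure (lebesgue_on {0::real..})"
    by (intro sigma_finite_measure_restrict_space sigma_finite_lebesgue) simp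
  then show ?thesis using sigma_finite_measure_axioms by (rule pair_sigma_finite.intro)
qed

lemma space_sigma_pair: "space (sigma_pair :: (real \<times> (real^'n)) measure) = {0..} \<times> sphere 0 1"
  by (simp add: space_pair_measure space_restrict_space)

lemma Sigma_measure_eq: "Sigma_measure = completion sigma_pair"
  by (simp add: Sigma_measure_def)

lemma space_Sigma_measure: "space (Sigma_measure :: (real \<times> (real^'n)) measure) = {0..} \<times> sphere 0 1"
  unfolding Sigma_measure_eq space_completion by (rule space_sigma_pair)

text \<open>The parameter measure has at least the Borel sets of \<open>slice_space\<close>, because
  both of its factors are defined on sigma-algebras containing the Borel sets.\<close>

lemma measurable_sigma_pair_id: "(\<lambda>z. z) \<in> (sigma_pair :: (real \<times> (real^'n)) measure) \<rightarrow>\<^sub>M slice_space"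
proof (rule measurable_restrict_space2)
  have 1: "fst \<in> borel_measurable (sigma_pair :: (real \<times> (real^'n)) measure)"
    by (rule measurable_compose[OF measurable_fst measurable_lebesgue_on_id])
  have "(\<lambda>x. x) \<in> borel_measurable (sphere_measure :: (real^'n) measure)"
    by (intro measurable_restrict_space1) (auto intro!: measurableI sets_hausdorff_borel)
  then have 2: "snd \<in> borel_measurable (sigma_pair :: (real \<times> (real^'n)) measure)"
    by (rule measurable_compose[OF measurable_snd])
  show "(\<lambda>z. z) \<in> borel_measurable (sigma_pair :: (real \<times> (real^'n)) measure)"
    using borel_measurable_Pair[OF 1 2] by simp
qed (unfold space_sigma_pair, auto)

lemma measurable_sigma_pairI:
  assumes "f \<in> measurable slice_space N"
  shows "f \<in> measurable sigma_pair N"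
  using measurable_compose[OF measurable_sigma_pair_id assms] by simp

lemma (in complete_measure) borel_measurable_cong_AE:
  fixes f g :: "'a \<Rightarrow> 'b::topological_space"
  assumes f: "f \<in> borel_measurable M" and eq: "AE x in M. f x = g x"
  shows "g \<in> borel_measurable M"
proof (rule measurableI)
  fix A :: "'b set" assume A: "A \<in> sets borel"
  show "g -` A \<inter> space M \<in> sets M"
  proof (rule in_sets_AE[of "f -` A \<inter> space M"])
    show "AE x in M. x \<in> f -` A \<inter> space M \<longleftrightarrow> x \<in> g -` A \<inter> space M"
      using eq by eventually_elim auto
  qed (use measurable_sets[OF f A] in auto)
qed simp

lemma borel_measurable_component:
  fixes f :: "'a \<Rightarrow> real^'m"
  assumes "f \<in> borel_measurable N"
  shows "(\<lambda>x. f x $ i) \<in> borel_measurable N"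
  using borel_measurable_inner[OF assms borel_measurable_const[of "axis i 1"]] by (simp add: inner_axis)

lemma borel_measurable_vec_lambda:
  fixes f :: "'m::finite \<Rightarrow> 'a \<Rightarrow> real"
  assumes "\<And>i. f i \<in> borel_measurable N"
  shows "(\<lambda>x. \<chi> i. f i x) \<in> borel_measurable N"
  using assms by (subst borel_measurable_euclidean_space) (auto simp: Basis_vec_def inner_axis)

text \<open>The slice kernels live on Borel sets, whereas \<open>w\<close> is only Lebesgue
  measurable. The representative is built componentwise and cut off outside the open set
  \<open>\<Omega>\<close>.\<close>

lemma borel_representative:
  fixes w :: "real^'n \<Rightarrow> real^'m"
  assumes \<Omega>: "open \<Omega>" and w: "w \<in> borel_measurable (lebesgue_on \<Omega>)"
  obtains w' where "w' \<in> borel_measurable borel" "\<And>x. x \<notin> \<Omega> \<Longrightarrow> w' x = 0"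
    "AE x in lborel. zero_extension \<Omega> w x = w' x"
proof -
  have "(\<lambda>x. if x \<in> \<Omega> then w x else 0) \<in> borel_measurable lebesgue"
    using borel_measurable_if_lebesgue_on[of \<Omega> UNIV w] w \<Omega> by (simp add: lebesgue_on_UNIV_eq)
  then have z: "zero_extension \<Omega> w \<in> borel_measurable lebesgue" by (simp add: zero_extension_def[abs_def])
  have "\<exists>g\<in>borel_measurable lborel. AE x in lborel. zero_extension \<Omega> w x $ i = g x" for i
  proof -
    have "(\<lambda>x. zero_extension \<Omega> w x $ i) \<in> borel_measurable (completion lborel)" using z by (rule borel_measurable_component)
    from completion_ex_borel_measurable_real[OF this] show ?thesis .
  qed
  then obtain g where g: "\<And>i. g i \<in> borel_measurable lborel" "\<And>i. AE x in lborel. zero_extension \<Omega> w x $ i = g i x" by metis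
  define w' :: "real^'n \<Rightarrow> real^'m" where "w' x = indicator \<Omega> x *\<^sub>R (\<chi> i. g i x)" for x
  have all: "AE x in lborel. \<forall>i. zero_extension \<Omega> w x $ i = g i x"
    using g(2) by (simp add: AE_all_countable)
  show thesis
  proof (rule that[of w'])
    have [measurable]: "g i \<in> borel_measurable borel" for i using g(1) by simp
    have "(\<lambda>x. \<chi> i. g i x) \<in> borel_measurable borel"
      by (rule borel_measurable_vec_lambda) simp
    then show "w' \<in> borel_measurable borel" unfolding w'_def
      using \<Omega> by (intro borel_measurable_scaleR borel_measurable_indicator) auto
    show "w' x = 0" if "x \<notin> \<Omega>" for x using that by (simp add: w'_def)
    show "AE x in lborel. zero_extension \<Omega> w x = w' x"
      using all by eventually_elim (auto simp: w'_def zero_extension_def vec_eq_iff indicator_def)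
  qed
qed

lemma Lp_pow_representative:
  fixes w w' :: "real^'n \<Rightarrow> real^'m"
  assumes \<Omega>: "open \<Omega>" and p: "0 < p"
    and w': "\<And>x. x \<notin> \<Omega> \<Longrightarrow> w' x = 0" "AE x in lborel. zero_extension \<Omega> w x = w' x"
  shows "Lp_pow lborel p w' = Lp_pow (lebesgue_on \<Omega>) p w"
proof -
  have "Lp_pow (lebesgue_on \<Omega>) p w = (\<integral>\<^sup>+x. ennreal (norm (w x) powr p) * indicator \<Omega> x \<partial>lebesgue)"
    unfolding Lp_pow_def using \<Omega> by (intro nn_integral_restrict_space) auto
  also have "\<dots> = (\<integral>\<^sup>+x. ennreal (norm (w x) powr p) * indicator \<Omega> x \<partial>lborel)" by (rule nn_integral_completion)
  also have "\<dots> = Lp_pow lborel p w'"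
    unfolding Lp_pow_def
  proof (rule nn_integral_cong_AE)
    show "AE x in lborel. ennreal (norm (w x) powr p) * indicator \<Omega> x = ennreal (norm (w' x) powr p)"
      using w'(2)
    proof eventually_elim
      case (elim x)
      then show ?case using w'(1)[of x] p by (cases "x \<in> \<Omega>") (auto simp: zero_extension_def)
    qed
  qed
  finally show ?thesis ..
qed

section \<open>Lipschitz bounds for slice operators\<close>

context slice_kernel
begin

definition sphere_area :: real where "sphere_area = enn2real (hausdorff_outer (CARD('n) - 1) (sphere (0 :: real^'n) 1))"

lemma Sigma_slice_integral_le:
  assumes f: "f \<in> borel_measurable borel"
  shows "(\<integral>\<^sup>+z. (\<integral>\<^sup>+x. f x \<partial>\<kappa> z) \<partial>Sigma_measure) \<le> ennreal (Cc * sphere_area) * (\<integral>\<^sup>+x. f x \<partial>lborel)"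
proof -
  let ?L = "lebesgue_on {0::real..}" and ?S = "sphere_measure :: (real^'n) measure"
  interpret pair_sigma_finite ?L ?S by (rule pair_sigma_finite_sigma_pair)
  have m: "(\<lambda>z. \<integral>\<^sup>+x. f x \<partial>\<kappa> z) \<in> borel_measurable (?L \<Otimes>\<^sub>M ?S)"
    by (rule measurable_sigma_pairI[OF measurable_slice_nn_integral[OF f]])
  have "(\<integral>\<^sup>+z. (\<integral>\<^sup>+x. f x \<partial>\<kappa> z) \<partial>Sigma_measure) = (\<integral>\<^sup>+z. (\<integral>\<^sup>+x. f x \<partial>\<kappa> z) \<partial>(?L \<Otimes>\<^sub>M ?S))"
    unfolding Sigma_measure_eq by (rule nn_integral_completion)
  also have "\<dots> = (\<integral>\<^sup>+\<phi>. (\<integral>\<^sup>+r. (\<integral>\<^sup>+x. f x \<partial>\<kappa> (r, \<phi>)) \<partial>?L) \<partial>?S)"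
    by (rule nn_integral_snd[OF m, symmetric])
  also have "\<dots> \<le> (\<integral>\<^sup>+\<phi>. ennreal Cc * (\<integral>\<^sup>+x. f x \<partial>lborel) \<partial>?S)"
  proof (rule nn_integral_mono)
    fix \<phi> assume "\<phi> \<in> space ?S"
    then have \<phi>: "norm \<phi> = 1" by (simp add: space_restrict_space)
    have "(\<integral>\<^sup>+r. (\<integral>\<^sup>+x. f x \<partial>\<kappa> (r, \<phi>)) \<partial>?L) = (\<integral>\<^sup>+r. (\<integral>\<^sup>+x. f x \<partial>\<kappa> (r, \<phi>)) * indicator {0..} r \<partial>lebesgue)"
      by (intro nn_integral_restrict_space) simp
    also have "\<dots> = (\<integral>\<^sup>+r. (\<integral>\<^sup>+x. f x \<partial>\<kappa> (r, \<phi>)) * indicator {0..} r \<partial>lborel)" by (rule nn_integral_completion)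
    also have "\<dots> \<le> (\<integral>\<^sup>+r. (\<integral>\<^sup>+x. f x \<partial>\<kappa> (r, \<phi>)) \<partial>lborel)"
      by (intro nn_integral_mono) (auto simp: indicator_def)
    also have "\<dots> \<le> ennreal Cc * (\<integral>\<^sup>+x. f x \<partial>lborel)" by (rule slice_nn_integral_le[OF \<phi> f])
    finally show "(\<integral>\<^sup>+r. (\<integral>\<^sup>+x. f x \<partial>\<kappa> (r, \<phi>)) \<partial>?L) \<le> ennreal Cc * (\<integral>\<^sup>+x. f x \<partial>lborel)" .
  qed
  also have "\<dots> = ennreal Cc * (\<integral>\<^sup>+x. f x \<partial>lborel) * emeasure ?S (space ?S)" by simp
  also have "emeasure ?S (space ?S) = ennreal sphere_area"
  proof -
    have "emeasure ?S (sphere 0 1) = hausdorff_outer (CARD('n) - 1) (sphere (0 :: real^'n) 1)"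
      using sphere_in_sets by (subst emeasure_restrict_space) (auto simp: emeasure_hausdorff_measure)
    then show ?thesis
      using hausdorff_outer_sphere_finite[where 'n = 'n] by (simp add: space_restrict_space sphere_area_def less_top)
  qed
  finally show ?thesis
    using Cc by (simp add: ennreal_mult sphere_area_def mult_ac)
qed

text \<open>Domination by Lebesgue measure makes the mass of \<open>N\<close> on slices integrate to
  zero. This lets a transform be computed from any Borel representative for almost every
  parameter.\<close>

lemma AE_slice_null:
  assumes N: "N \<in> null_sets lborel"
  shows "AE z in Sigma_measure. emeasure (\<kappa> z) N = 0"
proof -
  have Nb: "N \<in> sets borel" and 0: "emeasure lborel N = 0" using N by auto
  have "(\<integral>\<^sup>+z. (\<integral>\<^sup>+x. indicator N x \<partial>\<kappa> z) \<partial>Sigma_measure) \<le> ennreal (Cc * sphere_area) * (\<integral>\<^sup>+x. indicator N x \<partial>lborel)"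
    using Nb by (intro Sigma_slice_integral_le) simp
  also have "\<dots> = 0" using Nb by (simp add: 0)
  finally have "(\<integral>\<^sup>+z. emeasure (\<kappa> z) N \<partial>Sigma_measure) = 0" using Nb by (simp add: sets_kernel)
  moreover have "(\<lambda>z. emeasure (\<kappa> z) N) \<in> borel_measurable Sigma_measure"
    unfolding Sigma_measure_eq by (intro measurable_completion measurable_sigma_pairI measurable_kernel Nb)
  ultimately show ?thesis by (simp add: nn_integral_0_iff_AE)
qed

lemma AE_slice_integrable:
  fixes w :: "real^'n \<Rightarrow> 'b::euclidean_space"
  assumes w: "w \<in> borel_measurable borel" and fin: "(\<integral>\<^sup>+x. ennreal (norm (w x)) \<partial>lborel) < \<infinity>"
  shows "AE z in Sigma_measure. integrable (\<kappa> z) w"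
proof -
  have m: "(\<lambda>x. ennreal (norm (w x))) \<in> borel_measurable borel" using w by measurable
  have "(\<integral>\<^sup>+z. (\<integral>\<^sup>+x. ennreal (norm (w x)) \<partial>\<kappa> z) \<partial>Sigma_measure) < \<infinity>"
    using Sigma_slice_integral_le[OF m] fin by (auto simp: ennreal_mult_less_top intro: le_less_trans)
  then have "AE z in Sigma_measure. (\<integral>\<^sup>+x. ennreal (norm (w x)) \<partial>\<kappa> z) \<noteq> \<infinity>"
    using measurable_slice_nn_integral[OF m] unfolding Sigma_measure_eq
    by (intro nn_integral_PInf_AE measurable_completion measurable_sigma_pairI) auto
  then show ?thesis
    by eventually_elim (use w in \<open>auto intro!: integrableI_bounded simp: measurable_kernel_cong less_top\<close>)
qed

lemma measurable_slice_integral_real: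
  fixes f :: "real^'n \<Rightarrow> real"
  assumes f: "f \<in> borel_measurable borel"
  shows "(\<lambda>z. \<integral>x. f x \<partial>\<kappa> z) \<in> borel_measurable slice_space"
proof -
  have m: "(\<lambda>x. ennreal \<bar>f x\<bar>) \<in> borel_measurable borel" "(\<lambda>x. ennreal (f x)) \<in> borel_measurable borel"
    "(\<lambda>x. ennreal (- f x)) \<in> borel_measurable borel" using f by measurable
  note [measurable] = m[THEN measurable_slice_nn_integral]
  \<comment> \<open>The case distinction encodes the convention that a non-integrable function has
    integral \<open>0\<close>; both branches are measurable in \<open>z\<close>.\<close>
  have "(\<lambda>z. \<integral>x. f x \<partial>\<kappa> z) = (\<lambda>z. if (\<integral>\<^sup>+x. ennreal \<bar>f x\<bar> \<partial>\<kappa> z) < \<infinity>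
      then enn2real (\<integral>\<^sup>+x. ennreal (f x) \<partial>\<kappa> z) - enn2real (\<integral>\<^sup>+x. ennreal (- f x) \<partial>\<kappa> z) else 0)"
  proof
    fix z
    have i: "integrable (\<kappa> z) f \<longleftrightarrow> (\<integral>\<^sup>+x. ennreal \<bar>f x\<bar> \<partial>\<kappa> z) < \<infinity>"
      using f by (simp add: integrable_iff_bounded measurable_kernel_cong)
    show "(\<integral>x. f x \<partial>\<kappa> z) = (if (\<integral>\<^sup>+x. ennreal \<bar>f x\<bar> \<partial>\<kappa> z) < \<infinity>
      then enn2real (\<integral>\<^sup>+x. ennreal (f x) \<partial>\<kappa> z) - enn2real (\<integral>\<^sup>+x. ennreal (- f x) \<partial>\<kappa> z) else 0)"
      using i real_lebesgue_integral_def[of "\<kappa> z" f] not_integrable_integral_eq[of "\<kappa> z" f] by auto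
  qed
  then show ?thesis by simp
qed

text \<open>Taken componentwise like the Radon transform, so that the two can be compared even on
  slices where the vector function is not integrable.\<close>

definition slice_integral :: "(real^'n \<Rightarrow> real^'m) \<Rightarrow> real \<times> (real^'n) \<Rightarrow> real^'m" where
  "slice_integral w z = (\<chi> i. \<integral>x. w x $ i \<partial>\<kappa> z)"

lemma slice_integral_eq:
  assumes "integrable (\<kappa> z) w"
  shows "slice_integral w z = (\<integral>x. w x \<partial>\<kappa> z)"
proof -
  have "(\<integral>x. w x \<bullet> axis i 1 \<partial>\<kappa> z) = (\<integral>x. w x \<partial>\<kappa> z) \<bullet> axis i 1" for i
    using assms by (intro integral_inner_left)
  then show ?thesis by (simp add: slice_integral_def vec_eq_iff inner_axis)
qed

lemma measurable_slice_integral: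
  assumes w: "w \<in> borel_measurable borel"
  shows "slice_integral w \<in> borel_measurable slice_space"
proof -
  have "(\<lambda>z. \<integral>x. w x $ i \<partial>\<kappa> z) \<in> borel_measurable slice_space" for i
    using w by (intro measurable_slice_integral_real borel_measurable_component)
  then show ?thesis unfolding slice_integral_def[abs_def] by (rule borel_measurable_vec_lambda)
qed

text \<open>Jensen on a slice of mass at most \<open>Cm\<close> costs
  \<open>Cm powr (p - 1)\<close>; integrating the slices over all parameters costs
  \<open>Cc * sphere_area\<close>. The fibrewise map \<open>\<Lambda>\<close> extracts the transform
  from the vector-valued slice integral: it is the identity for the Radon transform and the
  tangential component for the ray transform.\<close>

lemma slice_operator_Lipschitz:
  fixes F :: "(real^'n \<Rightarrow> real^'m) \<Rightarrow> real \<times> (real^'n) \<Rightarrow> 'b::euclidean_space"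
    and \<Lambda> :: "real \<times> (real^'n) \<Rightarrow> real^'m \<Rightarrow> 'b"
  assumes \<Omega>: "open \<Omega>" "bounded \<Omega>" and p: "1 < p"
    and \<Lambda>m: "(\<lambda>(z, x). \<Lambda> z x) \<in> borel_measurable borel"
    and \<Lambda>d: "\<And>z x y. \<Lambda> z x - \<Lambda> z y = \<Lambda> z (x - y)" and \<Lambda>n: "\<And>r \<phi> x. norm \<phi> = 1 \<Longrightarrow> norm (\<Lambda> (r, \<phi>) x) \<le> norm x"
    and rep: "\<And>w w'. w \<in> Lp_space (lebesgue_on \<Omega>) p \<Longrightarrow> w' \<in> borel_measurable borel \<Longrightarrow> (\<And>x. x \<notin> \<Omega> \<Longrightarrow> w' x = 0) \<Longrightarrow>
      AE x in lborel. zero_extension \<Omega> w x = w' x \<Longrightarrow> AE z in Sigma_measure. integrable (\<kappa> z) w' \<Longrightarrow>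
      AE z in Sigma_measure. F w z = \<Lambda> z (slice_integral w' z)"
  shows "w \<in> Lp_space (lebesgue_on \<Omega>) p \<Longrightarrow> F w \<in> borel_measurable Sigma_measure"
    and "\<exists>C\<ge>0. \<forall>u\<in>Lp_space (lebesgue_on \<Omega>) p. \<forall>v\<in>Lp_space (lebesgue_on \<Omega>) p.
      Lp_pow Sigma_measure p (\<lambda>z. F u z - F v z) \<le> ennreal C * Lp_pow (lebesgue_on \<Omega>) p (\<lambda>x. u x - v x)"
proof -
  let ?M = "lebesgue_on \<Omega>" and ?S = "Sigma_measure :: (real \<times> (real^'n)) measure"
  interpret M: finite_measure ?M using \<Omega> by (intro finite_measure_lebesgue_on_bounded)
  have all: "\<exists>w'. w' \<in> borel_measurable borel \<and> (\<forall>x. x \<notin> \<Omega> \<longrightarrow> w' x = 0) \<and> (AE x in lborel. zero_extension \<Omega> w x = w' x)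
      \<and> (AE z in ?S. integrable (\<kappa> z) w') \<and> (AE z in ?S. F w z = \<Lambda> z (slice_integral w' z))"
    if w: "w \<in> Lp_space ?M p" for w :: "real^'n \<Rightarrow> real^'m"
  proof -
    have wm: "w \<in> borel_measurable ?M" using w by (simp add: Lp_space_iff)
    obtain w' where w': "w' \<in> borel_measurable borel" "\<And>x. x \<notin> \<Omega> \<Longrightarrow> w' x = 0" "AE x in lborel. zero_extension \<Omega> w x = w' x"
      by (rule borel_representative[OF \<Omega>(1) wm]) (rule that)
    have "Lp_pow lborel 1 w' = Lp_pow ?M 1 w" using Lp_pow_representative[OF \<Omega>(1) _ w'(2,3), of 1] by simp
    moreover have "Lp_pow ?M 1 w < \<infinity>"
      using M.Lp_space_integrable(1)[OF p w] by (simp add: Lp_pow_def integrable_iff_bounded)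
    ultimately have "(\<integral>\<^sup>+x. ennreal (norm (w' x)) \<partial>lborel) < \<infinity>" by (simp add: Lp_pow_def)
    then have i: "AE z in ?S. integrable (\<kappa> z) w'" by (rule AE_slice_integrable[OF w'(1)])
    show ?thesis
      by (rule exI[of _ w']) (intro conjI allI impI w' i rep[OF w w' i])
  qed
  have \<Lambda>slice_integral: "(\<lambda>z. \<Lambda> z (slice_integral w' z)) \<in> borel_measurable ?S" if "w' \<in> borel_measurable borel" for w' :: "real^'n \<Rightarrow> real^'m"
  proof -
    have id: "(\<lambda>z. z) \<in> borel_measurable (slice_space :: (real \<times> (real^'n)) measure)" by (intro measurable_restrict_space1) simp
    have "(\<lambda>z. (\<lambda>(z, x). \<Lambda> z x) (z, slice_integral w' z)) \<in> borel_measurable slice_space"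
      by (rule measurable_compose[OF borel_measurable_Pair[OF id measurable_slice_integral[OF that]] \<Lambda>m])
    then show ?thesis unfolding Sigma_measure_eq by (intro measurable_completion measurable_sigma_pairI) simp
  qed
  show "F w \<in> borel_measurable ?S" if wL: "w \<in> Lp_space ?M p" for w
  proof -
    obtain w' where w': "w' \<in> borel_measurable borel" "\<forall>x. x \<notin> \<Omega> \<longrightarrow> w' x = 0" "AE x in lborel. zero_extension \<Omega> w x = w' x"
      "AE z in ?S. integrable (\<kappa> z) w'" "AE z in ?S. F w z = \<Lambda> z (slice_integral w' z)" using all[OF wL] by (elim exE conjE) (rule that)
    have "AE z in ?S. \<Lambda> z (slice_integral w' z) = F w z" using w'(5) by eventually_elim simp
    with \<Lambda>slice_integral[OF w'(1)] show ?thesis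
      unfolding Sigma_measure_eq by (rule completion.borel_measurable_cong_AE)
  qed
  define C where "C = Cm powr (p - 1) * (Cc * sphere_area)"
  have "0 \<le> C" using Cc by (simp add: C_def sphere_area_def)
  moreover have "Lp_pow ?S p (\<lambda>z. F u z - F v z) \<le> ennreal C * Lp_pow ?M p (\<lambda>x. u x - v x)"
    if u: "u \<in> Lp_space ?M p" and v: "v \<in> Lp_space ?M p" for u v
  proof -
    obtain u' where u': "u' \<in> borel_measurable borel" "\<forall>x. x \<notin> \<Omega> \<longrightarrow> u' x = 0" "AE x in lborel. zero_extension \<Omega> u x = u' x"
      "AE z in ?S. integrable (\<kappa> z) u'" "AE z in ?S. F u z = \<Lambda> z (slice_integral u' z)" using all[OF u] by (elim exE conjE) (rule that)
    obtain v' where v': "v' \<in> borel_measurable borel" "\<forall>x. x \<notin> \<Omega> \<longrightarrow> v' x = 0" "AE x in lborel. zero_extension \<Omega> v x = v' x"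
      "AE z in ?S. integrable (\<kappa> z) v'" "AE z in ?S. F v z = \<Lambda> z (slice_integral v' z)" using all[OF v] by (elim exE conjE) (rule that)
    define d where "d x = u' x - v' x" for x
    have dm: "d \<in> borel_measurable borel" unfolding d_def using u'(1) v'(1) by measurable
    have dpm: "(\<lambda>x. ennreal (norm (d x) powr p)) \<in> borel_measurable borel" using dm by measurable
    have "Lp_pow ?S p (\<lambda>z. F u z - F v z) \<le> (\<integral>\<^sup>+z. ennreal (Cm powr (p - 1)) * (\<integral>\<^sup>+x. ennreal (norm (d x) powr p) \<partial>\<kappa> z) \<partial>?S)"
      unfolding Lp_pow_def
    proof (rule nn_integral_mono_AE)
      have "AE z in ?S. z \<in> space ?S" by (rule AE_space)
      then show "AE z in ?S. ennreal (norm (F u z - F v z) powr p) \<le> ennreal (Cm powr (p - 1)) * (\<integral>\<^sup>+x. ennreal (norm (d x) powr p) \<partial>\<kappa> z)"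
        using u'(4,5) v'(4,5)
      proof eventually_elim
        case (elim z)
        obtain r \<phi> where z: "z = (r, \<phi>)" "norm \<phi> = 1" using elim(1) by (cases z) (auto simp: space_Sigma_measure)
        have "F u z - F v z = \<Lambda> z ((\<integral>x. u' x \<partial>\<kappa> z) - (\<integral>x. v' x \<partial>\<kappa> z))"
          using elim by (simp add: slice_integral_eq \<Lambda>d)
        also have "(\<integral>x. u' x \<partial>\<kappa> z) - (\<integral>x. v' x \<partial>\<kappa> z) = (\<integral>x. d x \<partial>\<kappa> z)"
          unfolding d_def using elim by (intro Bochner_Integration.integral_diff[symmetric])
        finally have "norm (F u z - F v z) \<le> norm (\<integral>x. d x \<partial>\<kappa> z)" using \<Lambda>n[OF z(2)] by (simp add: z(1))
        then have "ennreal (norm (F u z - F v z) powr p) \<le> ennreal (norm (\<integral>x. d x \<partial>\<kappa> z) powr p)"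
          using p by (intro ennreal_leI powr_mono2) auto
        also have "\<dots> \<le> ennreal (Cm powr (p - 1)) * Lp_pow (\<kappa> z) p d"
          using mass[OF z(2), of r] dm by (intro norm_integral_powr_le p Cm) (auto simp: z(1) measurable_kernel_cong)
        finally show ?case by (simp add: Lp_pow_def)
      qed
    qed
    also have "\<dots> = ennreal (Cm powr (p - 1)) * (\<integral>\<^sup>+z. (\<integral>\<^sup>+x. ennreal (norm (d x) powr p) \<partial>\<kappa> z) \<partial>?S)"
      using measurable_slice_nn_integral[OF dpm] unfolding Sigma_measure_eq
      by (intro nn_integral_cmult measurable_completion measurable_sigma_pairI)
    also have "\<dots> \<le> ennreal (Cm powr (p - 1)) * (ennreal (Cc * sphere_area) * (\<integral>\<^sup>+x. ennreal (norm (d x) powr p) \<partial>lborel))"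
      by (intro mult_left_mono Sigma_slice_integral_le dpm) simp
    also have "\<dots> = ennreal C * Lp_pow lborel p d"
      using Cc by (simp add: C_def sphere_area_def ennreal_mult Lp_pow_def mult.assoc)
    also have "Lp_pow lborel p d = Lp_pow ?M p (\<lambda>x. u x - v x)"
    proof (rule Lp_pow_representative[OF \<Omega>(1)])
      show "d x = 0" if "x \<notin> \<Omega>" for x using that u'(2) v'(2) by (simp add: d_def)
      show "AE x in lborel. zero_extension \<Omega> (\<lambda>x. u x - v x) x = d x"
        using u'(3) v'(3) by eventually_elim (auto simp: d_def zero_extension_def split: if_splits)
    qed (use p in simp)
    finally show ?thesis .
  qed
  ultimately show "\<exists>C\<ge>0. \<forall>u\<in>Lp_space ?M p. \<forall>v\<in>Lp_space ?M p.
      Lp_pow ?S p (\<lambda>z. F u z - F v z) \<le> ennreal C * Lp_pow ?M p (\<lambda>x. u x - v x)" by blast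
qed

end

section \<open>Positive measure of slices and caps\<close>

lemma emeasure_lborel_open_pos:
  fixes U :: "'a::euclidean_space set"
  assumes "open U" "U \<noteq> {}"
  shows "0 < emeasure lborel U"
proof (rule ccontr)
  assume "\<not> ?thesis"
  then have "U \<in> null_sets lborel" using assms(1) by (simp add: null_sets_def)
  then have "U \<in> null_sets lebesgue" by (rule null_sets_completionI)
  then have "negligible U" by (simp add: negligible_iff_null_sets)
  then show False using open_not_negligible[OF assms] by simp
qed

text \<open>Points of \<open>W\<close> with displacement \<open>c y\<close> between \<open>0\<close>
  and \<open>1\<close> form a nonempty open set contained in the thickening of \<open>S\<close> by a
  unit segment; its positive volume bounds the outer measure of \<open>S\<close> from below.\<close>

lemma hausdorff_outer_pos:
  fixes S :: "(real^'n) set"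
  assumes c: "continuous_on UNIV c" and W: "open W" and x0: "x0 \<in> W" "c x0 = 1 / 2"
    and S: "\<And>y. y \<in> W \<Longrightarrow> y - c y *\<^sub>R axis i 1 \<in> S"
  shows "0 < hausdorff_outer (CARD('n) - 1) S"
proof -
  define V where "V = W \<inter> c -` {0<..<1}"
  have V: "open V" unfolding V_def using c W by (intro open_Int open_vimage) auto
  have "x0 \<in> V" using x0 by (simp add: V_def)
  then have pos: "0 < emeasure lborel V" using V by (intro emeasure_lborel_open_pos) auto
  have "\<exists>x\<in>S. \<exists>t\<in>{0..1}. y = x + t *\<^sub>R axis i 1" if "y \<in> V" for y
    using that S[of y] by (intro bexI[of _ "y - c y *\<^sub>R axis i 1"] bexI[of _ "c y"]) (auto simp: V_def)
  then have "emeasure lborel V \<le> ennreal (3 * 4 ^ (CARD('n) - 1) / unit_ball_vol (real (CARD('n) - 1))) * hausdorff_outer (CARD('n) - 1) S"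
    using V by (intro emeasure_le_hausdorff_outer[where i = i]) auto
  with pos show ?thesis by (cases "hausdorff_outer (CARD('n) - 1) S = 0") (auto simp: zero_less_iff_neq_zero)
qed

text \<open>\<open>c y\<close> is the displacement along the axis \<open>i\<close> that separates
  \<open>y\<close> from the hyperplane.\<close>

lemma hausdorff_outer_hyperplane_pos:
  fixes \<Omega> :: "(real^'n) set"
  assumes \<Omega>: "open \<Omega>" and x: "x \<in> \<Omega>" "x \<bullet> \<phi> = r" and \<phi>: "\<phi> \<noteq> 0"
  shows "0 < hausdorff_outer (CARD('n) - 1) (\<Omega> \<inter> {x. x \<bullet> \<phi> = r})"
proof -
  obtain i where i: "\<phi> $ i \<noteq> 0" using \<phi> by (auto simp: vec_eq_iff)
  define c where "c y = (y \<bullet> \<phi> - r) / \<phi> $ i" for y :: "real^'n"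
  have c: "continuous_on UNIV c" unfolding c_def using i by (intro continuous_intros) auto
  let ?W = "(\<lambda>y. y - c y *\<^sub>R axis i 1) -` \<Omega>"
  have ax: "axis i 1 \<bullet> \<phi> = \<phi> $ i" by (simp add: inner_commute[of "axis i 1"] inner_axis)
  have c0: "c (x + (1 / 2) *\<^sub>R axis i 1) = 1 / 2"
    using x i by (simp add: c_def inner_add_left ax)
  show ?thesis
  proof (rule hausdorff_outer_pos[OF c, where W = ?W and i = i and ?x0.0 = "x + (1 / 2) *\<^sub>R axis i 1"])
    show "open ?W" using c \<Omega> by (intro open_vimage continuous_intros)
    show "x + (1 / 2) *\<^sub>R axis i 1 \<in> ?W" unfolding vimage_eq c0 using x by simp
    show "y - c y *\<^sub>R axis i 1 \<in> \<Omega> \<inter> {x. x \<bullet> \<phi> = r}" if "y \<in> ?W" for y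
      using that i by (simp add: inner_diff_left ax c_def)
  qed (rule c0)
qed

text \<open>\<open>q y\<close> is the squared \<open>i\<close>-th coordinate of the points of the
  sphere on the line through \<open>y\<close> parallel to the axis \<open>i\<close>, and
  \<open>c y\<close> is the displacement from the one on the same side as
  \<open>\<phi>\<close>.\<close>

lemma hausdorff_outer_cap_pos:
  fixes \<phi> :: "real^'n"
  assumes \<phi>: "norm \<phi> = 1" and U: "open U" "\<phi> \<in> U"
  shows "0 < hausdorff_outer (CARD('n) - 1) (U \<inter> sphere 0 1)"
proof -
  obtain i where i: "\<phi> $ i \<noteq> 0" using \<phi> by (metis norm_zero vec_eq_iff zero_index zero_neq_one)
  define q where "q y = 1 - y \<bullet> y + y $ i * y $ i" for y :: "real^'n"
  define c where "c y = y $ i - sgn (\<phi> $ i) * sqrt (q y)" for y :: "real^'n"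
  have q: "continuous_on UNIV q" unfolding q_def by (intro continuous_intros)
  have c: "continuous_on UNIV c" unfolding c_def using q by (intro continuous_intros)
  let ?W = "(\<lambda>y. y - c y *\<^sub>R axis i 1) -` U \<inter> q -` {0<..}"
  let ?y = "\<phi> + (1 / 2) *\<^sub>R axis i 1"
  have \<phi>1: "\<phi> \<bullet> \<phi> = 1" using \<phi> by (simp add: norm_eq_1)
  have q0: "q ?y = \<phi> $ i * \<phi> $ i"
    by (simp add: q_def inner_add_left inner_add_right \<phi>1 inner_axis inner_commute[of "axis i 1"] algebra_simps)
  have c0: "c ?y = 1 / 2"
    unfolding c_def q0 by (simp add: real_sgn_eq)
  show ?thesis
  proof (rule hausdorff_outer_pos[OF c, where W = ?W and i = i and ?x0.0 = ?y])
    show "open ?W" using c q U by (intro open_Int open_vimage continuous_intros) auto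
    have "0 < q ?y" unfolding q0 using i by (auto simp: zero_less_mult_iff)
    then show "?y \<in> ?W" unfolding Int_iff vimage_eq c0 using U by simp
    show "y - c y *\<^sub>R axis i 1 \<in> U \<inter> sphere 0 1" if "y \<in> ?W" for y
    proof -
      have q: "0 < q y" using that by simp
      have "sgn (\<phi> $ i) * sqrt (q y) * (sgn (\<phi> $ i) * sqrt (q y)) = q y"
        using i q by (simp add: sgn_real_def)
      then have "(y $ i - c y) * (y $ i - c y) = q y" by (simp add: c_def)
      then have "(y - c y *\<^sub>R axis i 1) \<bullet> (y - c y *\<^sub>R axis i 1) = 1"
        by (simp add: q_def inner_diff_left inner_diff_right inner_axis inner_commute[of "axis i 1"] algebra_simps)
      then show ?thesis using that by (simp add: norm_eq_1)
    qed
  qed (rule c0)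
qed

text \<open>A neighbourhood contains a product of an interval and a cap, both of positive measure;
  \<open>0 < r\<close> allows the interval to be taken in the half-line.\<close>

lemma Sigma_measure_open_pos:
  fixes \<phi> :: "real^'n"
  assumes V: "open V" "(r, \<phi>) \<in> V" and r: "0 < r" and \<phi>: "norm \<phi> = 1"
  shows "\<not> (AE z in Sigma_measure. z \<notin> V)"
proof
  assume "AE z in (Sigma_measure :: (real \<times> (real^'n)) measure). z \<notin> V"
  then have ae: "AE z in (sigma_pair :: (real \<times> (real^'n)) measure). z \<notin> V"
    unfolding Sigma_measure_eq AE_completion_iff .
  let ?L = "lebesgue_on {0::real..}" and ?S = "sphere_measure :: (real^'n) measure"
  interpret pair_sigma_finite ?L ?S by (rule pair_sigma_finite_sigma_pair)
  obtain A B where AB: "open A" "open B" "r \<in> A" "\<phi> \<in> B" "A \<times> B \<subseteq> V"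
    using V by (rule open_prod_elim) auto
  let ?A = "A \<inter> {0<..}" and ?B = "B \<inter> sphere 0 1"
  have A: "?A \<in> sets ?L" using AB by (intro sets_restrict_space_iff[THEN iffD2]) auto
  have Bs: "?B \<in> sets (hausdorff_measure (CARD('n) - 1))"
    using AB sphere_in_sets by (intro sets.Int) (auto intro: sets_hausdorff_borel)
  then have B: "?B \<in> sets ?S" using sphere_in_sets by (subst sets_restrict_space_iff) auto
  have "emeasure ?L ?A = emeasure lebesgue ?A" by (intro emeasure_restrict_space) auto
  also have "\<dots> = emeasure lborel ?A" using AB(1) by simp
  also have "\<dots> > 0"
  proof (rule emeasure_lborel_open_pos)
    show "open ?A" using AB(1) by (intro open_Int) auto
    show "?A \<noteq> {}" using AB(3) r by auto
  qed
  finally have "emeasure ?L ?A \<noteq> 0" by simp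
  moreover have "emeasure ?S ?B \<noteq> 0"
  proof -
    have "emeasure ?S ?B = emeasure (hausdorff_measure (CARD('n) - 1)) ?B"
      using sphere_in_sets by (intro emeasure_restrict_space) auto
    also have "\<dots> = hausdorff_outer (CARD('n) - 1) ?B" using Bs by (rule emeasure_hausdorff_measure)
    finally show ?thesis using hausdorff_outer_cap_pos[OF \<phi> AB(2,4)] by simp
  qed
  ultimately have "emeasure (?L \<Otimes>\<^sub>M ?S) (?A \<times> ?B) \<noteq> 0"
    by (simp only: M2.emeasure_pair_measure_Times[OF A B] mult_eq_0_iff) simp
  moreover have "AE z in ?L \<Otimes>\<^sub>M ?S. z \<notin> ?A \<times> ?B"
    using ae by eventually_elim (use AB in auto)
  then have "emeasure (?L \<Otimes>\<^sub>M ?S) (?A \<times> ?B) = 0"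
    using A B by (subst (asm) AE_iff_null_sets[symmetric]) auto
  ultimately show False by simp
qed

lemma open_not_in_hyperplane:
  fixes b :: "'a::real_inner"
  assumes "open \<Omega>" "\<Omega> \<noteq> {}" "b \<noteq> 0"
  obtains x where "x \<in> \<Omega>" "x \<bullet> b \<noteq> 0"
proof -
  obtain x where x: "x \<in> \<Omega>" using assms by blast
  obtain e where e: "0 < e" "ball x e \<subseteq> \<Omega>" using assms(1) x by (meson open_contains_ball)
  define y where "y = x + (e / (2 * norm b)) *\<^sub>R b"
  have "y \<in> ball x e" using e assms(3) by (simp add: y_def dist_norm)
  then have y: "y \<in> \<Omega>" using e by blast
  have "y \<bullet> b = x \<bullet> b + e / (2 * norm b) * (b \<bullet> b)" by (simp add: y_def inner_add_left)
  moreover have "e / (2 * norm b) * (b \<bullet> b) \<noteq> 0" using e assms(3) by simp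
  ultimately show thesis using that[OF x] that[OF y] by fastforce
qed

text \<open>Completeness transfers measurability to \<open>g\<close>, for which it is not assumed.
  On slices only almost everywhere agreement with a Borel function is known.\<close>

lemma (in complete_measure) integral_cong_AE_complete:
  fixes f g :: "'a \<Rightarrow> real"
  assumes f: "f \<in> borel_measurable M" and eq: "AE x in M. f x = g x"
  shows "(\<integral>x. g x \<partial>M) = (\<integral>x. f x \<partial>M)"
  using borel_measurable_cong_AE[OF f eq] f eq by (intro integral_cong_AE) auto

text \<open>A set of outer measure zero splits every set additively, by monotonicity and
  subadditivity, so all subsets of null sets are Caratheodory measurable.\<close>

lemma complete_hausdorff_measure: "complete_measure (hausdorff_measure k :: 'a::metric_space measure)"
proof
  fix A B :: "'a set"
  assume AB: "B \<subseteq> A" "A \<in> null_sets (hausdorff_measure k)"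
  then have "hausdorff_outer k A = 0" using emeasure_hausdorff_measure[of A k] by (auto simp: null_sets_def)
  then have B: "hausdorff_outer k X = 0" if "X \<subseteq> B" for X
    using hausdorff_outer_mono[of X A k] that AB(1) by simp
  have "hausdorff_outer k (S \<inter> B) + hausdorff_outer k (S - B) = hausdorff_outer k S" for S
    using hausdorff_outer_Un_le[of k "S \<inter> B" "S - B"] hausdorff_outer_mono[of "S - B" S k] B[of "S \<inter> B"]
    by (simp add: Int_Diff_Un antisym)
  then show "B \<in> sets (hausdorff_measure k)"
    unfolding sets_hausdorff_measure algebra.lambda_system_eq[OF algebra_Pow] by (simp add: Int_commute)
qed

section \<open>The Radon transform\<close>

text \<open>The ball makes the mass finite and loses nothing for functions supported in
  \<open>\<Omega>\<close>; the distribution under the identity restricts the measure to Borel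
  sets.\<close>

definition hyperplane_kernel :: "real \<Rightarrow> real \<times> (real^'n) \<Rightarrow> (real^'n) measure" where
  "hyperplane_kernel R z = distr (restrict_space (hausdorff_measure (CARD('n) - 1)) (cball 0 R \<inter> hyperplane z)) borel (\<lambda>x. x)"

lemma hyperplane_borel: "cball 0 R \<inter> hyperplane z \<in> sets (borel :: (real^'n) measure)"
  unfolding hyperplane_def by (intro borel_closed closed_Int closed_cball closed_hyperplane_through[unfolded hyperplane_def])

lemma measurable_hyperplane_kernel_id:
  "(\<lambda>x. x) \<in> borel_measurable (restrict_space (hausdorff_measure k) A)"
  by (intro measurable_restrict_space1 measurableI) (auto intro: sets_hausdorff_borel)

lemma emeasure_hyperplane_kernel:
  assumes A: "A \<in> sets borel"
  shows "emeasure (hyperplane_kernel R z) A = hausdorff_outer (CARD('n) - 1) (A \<inter> cball 0 R \<inter> hyperplane (z :: real \<times> (real^'n)))"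
proof -
  let ?B = "cball 0 R \<inter> hyperplane z"
  have B: "?B \<in> sets (hausdorff_measure (CARD('n) - 1))" by (rule sets_hausdorff_borel[OF hyperplane_borel])
  have "emeasure (hyperplane_kernel R z) A = emeasure (restrict_space (hausdorff_measure (CARD('n) - 1)) ?B) (A \<inter> ?B)"
    unfolding hyperplane_kernel_def using A
    by (subst emeasure_distr[OF measurable_hyperplane_kernel_id]) (auto simp: space_restrict_space)
  also have "\<dots> = emeasure (hausdorff_measure (CARD('n) - 1)) (A \<inter> ?B)"
    using B by (intro emeasure_restrict_space) auto
  also have "\<dots> = hausdorff_outer (CARD('n) - 1) (A \<inter> ?B)"
    by (intro emeasure_hausdorff_measure sets.Int B sets_hausdorff_borel A)
  finally show ?thesis by (simp only: Int_assoc)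
qed

lemma abs_inner_diff_le_cube:
  fixes x a \<phi> :: "real^'n" and h :: real
  assumes \<phi>: "norm \<phi> = 1" and x: "\<And>i. a $ i \<le> x $ i \<and> x $ i \<le> a $ i + h"
  shows "\<bar>x \<bullet> \<phi> - a \<bullet> \<phi>\<bar> \<le> CARD('n) * h"
proof -
  have "\<bar>(x - a) \<bullet> \<phi>\<bar> \<le> norm (x - a) * norm \<phi>" by (rule Cauchy_Schwarz_ineq2)
  also have "\<dots> \<le> (\<Sum>i\<in>UNIV. \<bar>(x - a) $ i\<bar>)" using norm_le_l1_cart[of "x - a"] \<phi> by simp
  also have "\<dots> \<le> (\<Sum>i\<in>(UNIV :: 'n set). h)"
  proof (rule sum_mono)
    show "\<bar>(x - a) $ i\<bar> \<le> h" for i using x[of i] by simp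
  qed
  finally show ?thesis by (simp add: inner_diff_left)
qed

lemma interval_indicator_integral:
  assumes "0 \<le> B" "0 \<le> C"
  shows "(\<integral>\<^sup>+r. ennreal C * indicator {c - B..c + B} r \<partial>lborel) = ennreal (2 * B * C)"
proof -
  have "(\<integral>\<^sup>+r. ennreal C * indicator {c - B..c + B} r \<partial>lborel) = ennreal C * emeasure lborel {c - B..c + B}"
    by (rule nn_integral_cmult_indicator) simp
  also have "\<dots> = ennreal C * ennreal (2 * B)" using assms by simp
  finally show ?thesis using assms by (simp add: ennreal_mult' mult_ac)
qed

text \<open>A cube of side \<open>h\<close> meets the hyperplane only for \<open>r\<close> within
  \<open>CARD('n) * h\<close> of the value at its corner, and each slice has measure at most the
  graph constant times \<open>h ^ (CARD('n) - 1)\<close>. The product of interval length and slice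
  bound is the cell estimate.\<close>

lemma slice_kernel_hyperplane:
  assumes R: "0 \<le> R"
  shows "slice_kernel (hyperplane_kernel R :: real \<times> (real^'n) \<Rightarrow> _)
    (graph_const TYPE('n) (sqrt CARD('n)) * R ^ (CARD('n) - 1)) (2 * CARD('n) * graph_const TYPE('n) (sqrt CARD('n)))"
proof
  let ?G = "graph_const TYPE('n) (sqrt CARD('n))" and ?k = "CARD('n) - 1"
  have G: "0 \<le> ?G" by (rule graph_const_nonneg) simp
  have ball_le: "hausdorff_outer ?k (cball 0 R \<inter> hyperplane (r, \<phi>)) \<le> ennreal (?G * R ^ ?k)" if "norm \<phi> = 1" for r and \<phi> :: "real^'n"
    unfolding hyperplane_def snd_conv fst_conv
  proof (rule hausdorff_outer_hyperplane_le[OF that R, of _ 0])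
    show "\<bar>x $ j - 0 $ j\<bar> \<le> R" if "x \<in> cball 0 R" for x :: "real^'n" and j
      using that component_le_norm_cart[of x j] by simp
  qed
  show "sets (hyperplane_kernel R z) = sets borel" for z :: "real \<times> (real^'n)" by (simp add: hyperplane_kernel_def)
  show "0 \<le> ?G * R ^ ?k" "0 \<le> 2 * CARD('n) * ?G" using G R by simp_all
  show "emeasure (hyperplane_kernel R (r, \<phi>)) UNIV \<le> ennreal (?G * R ^ ?k)" if "norm \<phi> = 1" for r and \<phi> :: "real^'n"
    using ball_le[OF that, of r] by (simp add: emeasure_hyperplane_kernel)
  show "(\<lambda>z. emeasure (hyperplane_kernel R z) A) \<in> borel_measurable slice_space" if "A \<in> sets borel" for A :: "(real^'n) set"
    unfolding emeasure_hyperplane_kernel[OF that]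
  proof (rule borel_measurable_hausdorff_slice[OF compact_cball _ that])
    show "hausdorff_outer ?k (cball 0 R \<inter> hyperplane z) < \<infinity>" if "z \<in> UNIV \<times> sphere 0 1" for z :: "real \<times> (real^'n)"
      using that ball_le[of "snd z" "fst z"] by (auto intro: le_less_trans)
  qed
  show "(\<integral>\<^sup>+r. emeasure (hyperplane_kernel R (r, \<phi>)) {x. \<forall>i. a $ i \<le> x $ i \<and> x $ i \<le> a $ i + h} \<partial>lborel)
      \<le> ennreal (2 * CARD('n) * ?G * h ^ CARD('n))" if \<phi>: "norm \<phi> = 1" and h: "0 < h" for \<phi> a :: "real^'n" and h
  proof -
    let ?Q = "{x. \<forall>i. a $ i \<le> x $ i \<and> x $ i \<le> a $ i + h}" and ?B = "CARD('n) * h"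
    have "?Q = cbox a (a + (\<chi> i. h))" by (auto simp: mem_box_cart)
    then have Q: "?Q \<in> sets borel" by simp
    have "(\<integral>\<^sup>+r. emeasure (hyperplane_kernel R (r, \<phi>)) ?Q \<partial>lborel)
        \<le> (\<integral>\<^sup>+r. ennreal (?G * h ^ ?k) * indicator {a \<bullet> \<phi> - ?B..a \<bullet> \<phi> + ?B} r \<partial>lborel)"
    proof (rule nn_integral_mono)
      fix r :: real
      let ?X = "?Q \<inter> cball 0 R \<inter> {x. x \<bullet> \<phi> = r}"
      show "emeasure (hyperplane_kernel R (r, \<phi>)) ?Q \<le> ennreal (?G * h ^ ?k) * indicator {a \<bullet> \<phi> - ?B..a \<bullet> \<phi> + ?B} r"
      proof (cases "?X = {}")
        case True
        then show ?thesis unfolding emeasure_hyperplane_kernel[OF Q] hyperplane_def snd_conv fst_conv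
          by (simp add: hausdorff_outer_empty)
      next
        case False
        then obtain x where "x \<in> ?Q" "x \<bullet> \<phi> = r" by blast
        then have "\<bar>r - a \<bullet> \<phi>\<bar> \<le> ?B" using abs_inner_diff_le_cube[OF \<phi>, of a x h] by simp
        then have ind: "indicator {a \<bullet> \<phi> - ?B..a \<bullet> \<phi> + ?B} r = (1 :: ennreal)" by (simp add: indicator_def abs_le_iff)
        have "hausdorff_outer ?k ?X \<le> ennreal (?G * h ^ ?k)"
        proof (rule hausdorff_outer_hyperplane_le[OF \<phi>, of _ _ a])
          show "\<bar>x $ j - a $ j\<bar> \<le> h" if "x \<in> ?Q \<inter> cball 0 R" for x j using that h by (auto simp: abs_le_iff algebra_simps)
        qed (use h in simp)
        then show ?thesis unfolding emeasure_hyperplane_kernel[OF Q] hyperplane_def snd_conv fst_conv ind by simp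
      qed
    qed
    also have "\<dots> = ennreal (2 * ?B * (?G * h ^ ?k))"
      using h G by (intro interval_indicator_integral) auto
    also have "2 * ?B * (?G * h ^ ?k) = 2 * CARD('n) * ?G * (h * h ^ ?k)" by simp
    also have "h * h ^ ?k = h ^ CARD('n)" by (simp flip: power_Suc)
    finally show ?thesis .
  qed
qed

text \<open>Inside the slice the two integrands differ at most on \<open>N\<close>, which is null
  for the slice measure; outside \<open>\<Omega>\<close> both vanish, so the restriction to the ball
  is harmless.\<close>

lemma radon_transform_representative:
  fixes w w' :: "real^'n \<Rightarrow> real^'m"
  assumes \<Omega>: "\<Omega> \<subseteq> ball 0 R" and w': "w' \<in> borel_measurable borel" "\<And>x. x \<notin> \<Omega> \<Longrightarrow> w' x = 0"
    and N: "N \<in> sets borel" "{x. zero_extension \<Omega> w x \<noteq> w' x} \<subseteq> N" and null: "emeasure (hyperplane_kernel R z) N = 0"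
  shows "radon_transform \<Omega> w z $ i = (\<integral>x. w' x $ i \<partial>hyperplane_kernel R z)"
proof -
  let ?H = "hausdorff_measure (CARD('n) - 1) :: (real^'n) measure" and ?B = "cball 0 R \<inter> hyperplane z"
  interpret H: complete_measure ?H by (rule complete_hausdorff_measure)
  have B: "?B \<in> sets ?H" by (rule sets_hausdorff_borel[OF hyperplane_borel])
  have wi: "(\<lambda>x. w' x $ i) \<in> borel_measurable borel" using w'(1) by (rule borel_measurable_component)
  have idH: "(\<lambda>x. x) \<in> ?H \<rightarrow>\<^sub>M borel" by (rule measurableI) (auto intro: sets_hausdorff_borel)
  have wH: "(\<lambda>x. w' x $ i) \<in> borel_measurable ?H" using measurable_compose[OF idH wi] .
  have "(\<integral>x. w' x $ i \<partial>hyperplane_kernel R z) = (\<integral>x. w' x $ i \<partial>restrict_space ?H ?B)"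
    unfolding hyperplane_kernel_def by (rule integral_distr[OF measurable_hyperplane_kernel_id wi])
  also have "\<dots> = (\<integral>x. indicator ?B x *\<^sub>R w' x $ i \<partial>?H)"
    using B by (intro integral_restrict_space) auto
  also have "\<dots> = (\<integral>x. indicator (hyperplane z) x *\<^sub>R zero_extension \<Omega> w x $ i \<partial>?H)"
  proof (rule H.integral_cong_AE_complete[symmetric])
    show "(\<lambda>x. indicator ?B x *\<^sub>R w' x $ i) \<in> borel_measurable ?H"
      using B wH by (intro borel_measurable_scaleR borel_measurable_indicator)
    have NB: "N \<inter> ?B \<in> sets ?H" by (rule sets.Int[OF sets_hausdorff_borel[OF N(1)] B])
    have "emeasure ?H (N \<inter> ?B) = 0"
      using null unfolding emeasure_hyperplane_kernel[OF N(1)] emeasure_hausdorff_measure[OF NB] by (simp only: Int_assoc)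
    then have "N \<inter> ?B \<in> null_sets ?H" using NB by (simp add: null_sets_def)
    then show "AE x in ?H. indicator ?B x *\<^sub>R w' x $ i = indicator (hyperplane z) x *\<^sub>R zero_extension \<Omega> w x $ i"
    proof (rule AE_I')
      show "{x \<in> space ?H. indicator ?B x *\<^sub>R w' x $ i \<noteq> indicator (hyperplane z) x *\<^sub>R zero_extension \<Omega> w x $ i} \<subseteq> N \<inter> ?B"
      proof clarify
        fix x assume ne: "indicator ?B x *\<^sub>R w' x $ i \<noteq> indicator (hyperplane z) x *\<^sub>R zero_extension \<Omega> w x $ i"
        have x: "x \<in> \<Omega>" using ne w'(2)[of x] by (cases "x \<in> \<Omega>") (auto simp: zero_extension_def)
        then have xR: "x \<in> cball 0 R" using \<Omega> by auto
        then have h: "x \<in> hyperplane z" using ne by (cases "x \<in> hyperplane z") auto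
        then have "zero_extension \<Omega> w x \<noteq> w' x" using ne xR by auto
        then show "x \<in> N \<inter> ?B" using N(2) xR h by auto
      qed
    qed
  qed
  also have "\<dots> = radon_transform \<Omega> w z $ i"
    by (simp add: radon_transform_def split_beta set_lebesgue_integral_def hyperplane_def)
  finally show ?thesis by simp
qed

lemma radon_transform_scaleR: "radon_transform \<Omega> (\<lambda>x. c *\<^sub>R w x) z = c *\<^sub>R radon_transform \<Omega> w z"
proof -
  have "zero_extension \<Omega> (\<lambda>x. c *\<^sub>R w x) x $ i = c * zero_extension \<Omega> w x $ i" for x i
    by (simp add: zero_extension_def)
  then show ?thesis
    by (simp add: radon_transform_def split_beta vec_eq_iff)
qed

text \<open>If the foot point \<open>r *\<^sub>R \<phi>\<close> lies in \<open>\<Omega>\<close>, the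
  slice of \<open>\<Omega>\<close> has positive finite measure and the transform is that measure
  times \<open>a\<close>. Such parameters form an open set, which is not null.\<close>

lemma radon_transform_const_eq_0:
  fixes a :: "real^'m" and \<Omega> :: "(real^'n) set"
  assumes \<Omega>: "open \<Omega>" "\<Omega> \<noteq> {}" "\<Omega> \<subseteq> ball 0 R" and R: "0 \<le> R"
    and zero: "AE z in Sigma_measure. radon_transform \<Omega> (\<lambda>x. a) z = 0"
  shows "a = 0"
proof (rule ccontr)
  assume "a \<noteq> 0"
  then obtain i where i: "a $ i \<noteq> 0" by (auto simp: vec_eq_iff)
  \<comment> \<open>The origin is avoided so that \<open>x0\<close> has polar coordinates with
    positive radius.\<close>
  obtain x0 where x0: "x0 \<in> \<Omega>" "x0 \<noteq> 0"
  proof -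
    have ax: "axis j 1 \<noteq> (0 :: real^'n)" for j by (simp add: axis_eq_0_iff)
    obtain x where "x \<in> \<Omega>" "x \<bullet> axis undefined 1 \<noteq> 0" by (rule open_not_in_hyperplane[OF \<Omega>(1,2) ax])
    then show thesis using that[of x] by (cases "x = 0") auto
  qed
  let ?V = "(\<lambda>z. fst z *\<^sub>R snd z) -` \<Omega>" and ?H = "hausdorff_measure (CARD('n) - 1) :: (real^'n) measure"
  have "AE z in Sigma_measure. z \<notin> ?V"
    using zero AE_space
  proof eventually_elim
    case (elim z)
    show ?case
    proof
      assume z: "z \<in> ?V"
      obtain r \<phi> where r: "z = (r, \<phi>)" "norm \<phi> = 1" using elim(2) by (cases z) (auto simp: space_Sigma_measure)
      have "\<phi> \<noteq> 0" "(r *\<^sub>R \<phi>) \<bullet> \<phi> = r" using r(2) by (auto simp: norm_eq_1)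
      let ?A = "\<Omega> \<inter> {x. x \<bullet> \<phi> = r}"
      have "0 < hausdorff_outer (CARD('n) - 1) ?A"
        using z r \<open>(r *\<^sub>R \<phi>) \<bullet> \<phi> = r\<close> \<open>\<phi> \<noteq> 0\<close> by (intro hausdorff_outer_hyperplane_pos[OF \<Omega>(1)]) auto
      moreover have Ab: "?A \<in> sets borel"
        using \<Omega>(1) closed_hyperplane[of \<phi> r] by (intro sets.Int) (auto simp: inner_commute)
      moreover have "hausdorff_outer (CARD('n) - 1) ?A \<le> ennreal (graph_const TYPE('n) (sqrt CARD('n)) * R ^ (CARD('n) - 1))"
      proof (rule hausdorff_outer_hyperplane_le[OF r(2) R, of _ 0])
        show "\<bar>x $ j - 0 $ j\<bar> \<le> R" if "x \<in> \<Omega>" for x j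
          using subsetD[OF \<Omega>(3) that] component_le_norm_cart[of x j] by simp
      qed
      ultimately have "0 < emeasure ?H ?A" "emeasure ?H ?A < \<infinity>"
        unfolding emeasure_hausdorff_measure[OF sets_hausdorff_borel[OF Ab]] by (auto intro: le_less_trans)
      then have pos: "measure ?H ?A \<noteq> 0" by (simp add: measure_def enn2real_eq_0_iff less_top)
      have "radon_transform \<Omega> (\<lambda>x. a) z $ i = (\<integral>x. indicator ?A x *\<^sub>R a $ i \<partial>?H)"
      proof -
        have "indicator {x. x \<bullet> \<phi> = r} x *\<^sub>R zero_extension \<Omega> (\<lambda>x. a) x $ i = indicator ?A x *\<^sub>R a $ i" for x
          by (simp add: zero_extension_def indicator_def)
        then show ?thesis unfolding r(1) radon_transform_def set_lebesgue_integral_def by (simp only: split vec_lambda_beta)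
      qed
      also have "\<dots> = measure ?H ?A * a $ i"
        using Ab \<open>emeasure ?H ?A < \<infinity>\<close> by (simp add: sets_hausdorff_borel)
      finally show False using elim(1) pos i by simp
    qed
  qed
  moreover have "open ?V" using \<Omega>(1) by (intro open_vimage continuous_intros)
  moreover have "(norm x0, (1 / norm x0) *\<^sub>R x0) \<in> ?V" using x0 by simp
  ultimately show False using Sigma_measure_open_pos[of ?V "norm x0" "(1 / norm x0) *\<^sub>R x0"] x0 by simp
qed

section \<open>The ray transform\<close>

lemma inner_perp:
  "\<theta> \<bullet> perp \<theta> = 0" "perp \<theta> \<bullet> \<theta> = 0" "perp \<theta> \<bullet> perp \<theta> = \<theta> \<bullet> \<theta>"
  by (simp_all add: perp_def inner_vec_def sum_2 algebra_simps)

lemma norm_perp [simp]: "norm (perp \<theta>) = norm \<theta>"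
  by (simp add: norm_eq_sqrt_inner inner_perp)

lemma linear_perp: "linear perp"
  by (rule linearI) (simp_all add: perp_def vec_eq_iff forall_2)

lemma continuous_on_perp: "continuous_on A perp"
  using linear_perp by (rule linear_continuous_on[OF linear_conv_bounded_linear[THEN iffD1]])

lemma inner_perp_commute: "a \<bullet> perp x = - (x \<bullet> perp a)"
  by (simp add: perp_def inner_vec_def sum_2 algebra_simps)

definition line_point :: "real \<times> (real^2) \<Rightarrow> real \<Rightarrow> real^2" where
  "line_point z t = fst z *\<^sub>R snd z + t *\<^sub>R perp (snd z)"

lemma continuous_line_point: "continuous_on UNIV (\<lambda>(z, t). line_point z t)"
  unfolding line_point_def split_beta
  by (intro continuous_intros continuous_on_compose2[OF continuous_on_perp[of UNIV]]) auto

lemma continuous_line_point_right: "continuous_on UNIV (line_point z)"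
  unfolding line_point_def by (intro continuous_intros)

lemma measurable_line_point: "line_point z \<in> borel_measurable borel"
  by (intro borel_measurable_continuous_onI continuous_line_point_right)

lemma line_point_inner:
  assumes "norm \<theta> = 1"
  shows "line_point (r, \<theta>) t \<bullet> \<theta> = r" "line_point (r, \<theta>) t \<bullet> perp \<theta> = t"
proof -
  have "\<theta> \<bullet> \<theta> = 1" using assms by (simp add: norm_eq_1)
  then show "line_point (r, \<theta>) t \<bullet> \<theta> = r" "line_point (r, \<theta>) t \<bullet> perp \<theta> = t"
    by (simp_all add: line_point_def inner_add_left inner_perp)
qed

lemma line_point_bound:
  assumes "norm \<theta> = 1" "line_point (r, \<theta>) t \<in> ball 0 R"
  shows "t \<in> {-R..R}"
proof -
  have "\<bar>t\<bar> \<le> norm (line_point (r, \<theta>) t) * norm (perp \<theta>)"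
    using Cauchy_Schwarz_ineq2[of "line_point (r, \<theta>) t" "perp \<theta>"] by (simp add: line_point_inner assms(1))
  then show ?thesis using assms by (auto simp: abs_le_iff)
qed

text \<open>Restricting the parameter to \<open>{-R..R}\<close> gives finite mass; a point of the
  line inside the ball of radius \<open>R\<close> has its parameter in this range, because the
  parameter is its inner product with a unit vector.\<close>

definition line_kernel :: "real \<Rightarrow> real \<times> (real^2) \<Rightarrow> (real^2) measure" where
  "line_kernel R z = distr (restrict_space lborel {-R..R}) borel (line_point z)"

lemma measurable_line_kernel_point: "line_point z \<in> borel_measurable (restrict_space lborel {-R..R})"
  using measurable_line_point by (intro measurable_restrict_space1) simp

lemma emeasure_line_kernel:
  assumes A: "A \<in> sets borel"
  shows "emeasure (line_kernel R z) A = (\<integral>\<^sup>+t. indicator {-R..R} t * indicator A (line_point z t) \<partial>lborel)"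
proof -
  have "emeasure (line_kernel R z) A = (\<integral>\<^sup>+x. indicator A x \<partial>line_kernel R z)"
    using A by (simp add: line_kernel_def)
  also have "\<dots> = (\<integral>\<^sup>+t. indicator A (line_point z t) \<partial>restrict_space lborel {-R..R})"
    unfolding line_kernel_def using A by (intro nn_integral_distr measurable_line_kernel_point) simp
  also have "\<dots> = (\<integral>\<^sup>+t. indicator A (line_point z t) * indicator {-R..R} t \<partial>lborel)"
    by (intro nn_integral_restrict_space) simp
  finally show ?thesis by (simp add: mult.commute)
qed

text \<open>The pair \<open>(r, t)\<close> gives orthonormal coordinates of the plane. A square of
  side \<open>h\<close> lies in a rectangle of sides \<open>4 * h\<close> in these coordinates,
  whence the constant \<open>16\<close>.\<close>

lemma slice_kernel_line:
  assumes R: "0 \<le> R"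
  shows "slice_kernel (line_kernel R) (2 * R) 16"
proof
  show "sets (line_kernel R z) = sets borel" for z by (simp add: line_kernel_def)
  show "0 \<le> 2 * R" "(0 :: real) \<le> 16" using R by simp_all
  show "emeasure (line_kernel R (r, \<phi>)) UNIV \<le> ennreal (2 * R)" if "norm \<phi> = 1" for r and \<phi> :: "real^2"
    using R by (simp add: emeasure_line_kernel)
  show "(\<lambda>z. emeasure (line_kernel R z) A) \<in> borel_measurable slice_space" if A: "A \<in> sets borel" for A :: "(real^2) set"
  proof -
    have lp: "(\<lambda>(z, t). line_point z t) \<in> borel_measurable (borel \<Otimes>\<^sub>M lborel)"
    proof -
      have "(\<lambda>(z, t). line_point z t) \<in> borel_measurable (borel :: ((real \<times> (real^2)) \<times> real) measure)"
        by (intro borel_measurable_continuous_onI continuous_line_point)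
      moreover have "sets (borel \<Otimes>\<^sub>M lborel) = sets (borel :: ((real \<times> (real^2)) \<times> real) measure)"
        unfolding borel_prod[symmetric] by (intro sets_pair_measure_cong) simp_all
      ultimately show ?thesis using measurable_cong_sets by blast
    qed
    have "(\<lambda>z. \<integral>\<^sup>+t. indicator {-R..R} t * indicator A (line_point z t) \<partial>lborel) \<in> borel_measurable borel"
    proof (rule lborel.borel_measurable_nn_integral)
      have 1: "(\<lambda>x. indicator {-R..R} (snd x) :: ennreal) \<in> borel_measurable ((borel :: (real \<times> (real^2)) measure) \<Otimes>\<^sub>M lborel)"
        by measurable
      have 2: "(\<lambda>x. indicator A (case x of (z, t) \<Rightarrow> line_point z t) :: ennreal) \<in> borel_measurable (borel \<Otimes>\<^sub>M lborel)"
        by (rule measurable_compose[OF lp borel_measurable_indicator[OF A]])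
      show "(\<lambda>(z, t). indicator {-R..R} t * indicator A (line_point z t) :: ennreal) \<in> borel_measurable (borel \<Otimes>\<^sub>M lborel)"
        using borel_measurable_times_ennreal[OF 1 2] by (simp add: split_beta')
    qed
    then show ?thesis unfolding emeasure_line_kernel[OF A] by (intro measurable_restrict_space1)
  qed
  show "(\<integral>\<^sup>+r. emeasure (line_kernel R (r, \<phi>)) {x. \<forall>i. a $ i \<le> x $ i \<and> x $ i \<le> a $ i + h} \<partial>lborel)
      \<le> ennreal (16 * h ^ CARD(2))" if \<phi>: "norm \<phi> = 1" and h: "0 < h" for \<phi> a :: "real^2" and h
  proof -
    let ?Q = "{x. \<forall>i. a $ i \<le> x $ i \<and> x $ i \<le> a $ i + h}"
    let ?I = "\<lambda>b. {b - 2 * h..b + 2 * h}"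
    have "?Q = cbox a (a + (\<chi> i. h))" by (auto simp: mem_box_cart)
    then have Q: "?Q \<in> sets borel" by simp
    have "(\<integral>\<^sup>+r. emeasure (line_kernel R (r, \<phi>)) ?Q \<partial>lborel)
        \<le> (\<integral>\<^sup>+r. (\<integral>\<^sup>+t. indicator (?I (a \<bullet> \<phi>)) r * indicator (?I (a \<bullet> perp \<phi>)) t \<partial>lborel) \<partial>lborel)"
      unfolding emeasure_line_kernel[OF Q]
    proof (intro nn_integral_mono)
      fix r t :: real
      let ?x = "line_point (r, \<phi>) t"
      show "indicator {-R..R} t * indicator ?Q ?x \<le> (indicator (?I (a \<bullet> \<phi>)) r * indicator (?I (a \<bullet> perp \<phi>)) t :: ennreal)"
      proof (cases "?x \<in> ?Q")
        case True
        then have "\<bar>?x \<bullet> \<phi> - a \<bullet> \<phi>\<bar> \<le> CARD(2) * h" "\<bar>?x \<bullet> perp \<phi> - a \<bullet> perp \<phi>\<bar> \<le> CARD(2) * h"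
          using \<phi> by (intro abs_inner_diff_le_cube; simp)+
        then have "r \<in> ?I (a \<bullet> \<phi>)" "t \<in> ?I (a \<bullet> perp \<phi>)"
          by (auto simp: line_point_inner[OF \<phi>] abs_le_iff)
        then show ?thesis by (simp add: indicator_def)
      qed simp
    qed
    also have "\<dots> = (\<integral>\<^sup>+r. ennreal (4 * h) * indicator (?I (a \<bullet> \<phi>)) r \<partial>lborel)"
      using h by (simp add: nn_integral_cmult mult.commute)
    also have "\<dots> = ennreal (2 * (2 * h) * (4 * h))" using h by (intro interval_indicator_integral) auto
    finally show ?thesis by (simp add: power2_eq_square)
  qed
qed

lemma ray_transform_representative:
  assumes \<Omega>: "\<Omega> \<subseteq> ball 0 R" and w': "w' \<in> borel_measurable borel" "\<And>x. x \<notin> \<Omega> \<Longrightarrow> w' x = 0"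
    and N: "N \<in> sets borel" "{x. zero_extension \<Omega> w x \<noteq> w' x} \<subseteq> N" and null: "emeasure (line_kernel R z) N = 0"
    and z: "norm (snd z) = 1" and i: "integrable (line_kernel R z) w'"
  shows "ray_transform \<Omega> w z = (\<integral>x. w' x \<partial>line_kernel R z) \<bullet> perp (snd z)"
proof -
  let ?\<theta> = "perp (snd z)" and ?I = "{-R..R}"
  have wm: "(\<lambda>x. w' x \<bullet> ?\<theta>) \<in> borel_measurable borel" using w'(1) by measurable
  have wl: "(\<lambda>t. w' (line_point z t) \<bullet> ?\<theta>) \<in> borel_measurable lborel"
    using measurable_compose[OF measurable_line_point wm] by simp
  have f: "(\<lambda>t. indicator ?I t *\<^sub>R (w' (line_point z t) \<bullet> ?\<theta>)) \<in> borel_measurable lborel"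
    using wl by (intro borel_measurable_scaleR borel_measurable_indicator) auto
  have "(\<integral>x. w' x \<partial>line_kernel R z) \<bullet> ?\<theta> = (\<integral>x. w' x \<bullet> ?\<theta> \<partial>line_kernel R z)"
    using i by (intro integral_inner_left[symmetric])
  also have "\<dots> = (\<integral>t. w' (line_point z t) \<bullet> ?\<theta> \<partial>restrict_space lborel ?I)"
    unfolding line_kernel_def by (rule integral_distr[OF measurable_line_kernel_point wm])
  also have "\<dots> = (\<integral>t. indicator ?I t *\<^sub>R (w' (line_point z t) \<bullet> ?\<theta>) \<partial>lborel)"
    by (intro integral_restrict_space) simp
  also have "\<dots> = (\<integral>t. indicator ?I t *\<^sub>R (w' (line_point z t) \<bullet> ?\<theta>) \<partial>lebesgue)"
    by (rule integral_completion[symmetric, OF f])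
  also have "\<dots> = (\<integral>t. zero_extension \<Omega> w (line_point z t) \<bullet> ?\<theta> \<partial>lebesgue)"
  proof (rule completion.integral_cong_AE_complete[symmetric])
    show "(\<lambda>t. indicator ?I t *\<^sub>R (w' (line_point z t) \<bullet> ?\<theta>)) \<in> borel_measurable lebesgue"
      using f by (rule measurable_completion)
    have m: "(\<lambda>t. indicator ?I t * indicator N (line_point z t) :: ennreal) \<in> borel_measurable lborel"
    proof (rule borel_measurable_times_ennreal)
      show "(\<lambda>t. indicator N (line_point z t) :: ennreal) \<in> borel_measurable lborel"
        using measurable_compose[OF measurable_line_point borel_measurable_indicator[OF N(1)]] by simp
    qed simp
    have "AE t in lborel. indicator ?I t * indicator N (line_point z t) = (0 :: ennreal)"
      using null m unfolding emeasure_line_kernel[OF N(1)] by (simp add: nn_integral_0_iff_AE)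
    then have "AE t in lebesgue. indicator ?I t * indicator N (line_point z t) = (0 :: ennreal)"
      by (rule AE_completion)
    then show "AE t in lebesgue. indicator ?I t *\<^sub>R (w' (line_point z t) \<bullet> ?\<theta>) = zero_extension \<Omega> w (line_point z t) \<bullet> ?\<theta>"
    proof eventually_elim
      case (elim t)
      show ?case
      proof (cases "line_point z t \<in> \<Omega>")
        case True
        then have t: "t \<in> ?I" using \<Omega> line_point_bound[of "snd z" "fst z" t R] z by auto
        then have "line_point z t \<notin> N" using elim by (auto simp: indicator_def split: if_splits)
        then have "zero_extension \<Omega> w (line_point z t) = w' (line_point z t)" using N(2) by auto
        then show ?thesis using t by simp
      next
        case False
        then show ?thesis using w'(2) by (simp add: zero_extension_def)
      qed
    qed
  qed
  also have "\<dots> = ray_transform \<Omega> w z" by (simp add: ray_transform_def line_point_def split_beta)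
  finally show ?thesis by simp
qed

lemma ray_transform_scaleR: "ray_transform \<Omega> (\<lambda>x. c *\<^sub>R w x) z = c *\<^sub>R ray_transform \<Omega> w z"
proof -
  have "zero_extension \<Omega> (\<lambda>x. c *\<^sub>R w x) x \<bullet> y = c * (zero_extension \<Omega> w x \<bullet> y)" for x y
    by (simp add: zero_extension_def)
  then show ?thesis by (simp add: ray_transform_def split_beta)
qed

text \<open>Besides a foot point in \<open>\<Omega>\<close>, the direction must not annihilate the
  constant: the integrand is \<open>a \<bullet> perp \<theta>\<close>, which equals
  \<open>- (\<theta> \<bullet> perp a)\<close>. Both conditions on the parameter are open, and a
  point \<open>x0\<close> with \<open>x0 \<bullet> perp a\<close> nonzero shows that they are
  compatible.\<close>

lemma ray_transform_const_eq_0: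
  assumes \<Omega>: "open \<Omega>" "\<Omega> \<noteq> {}" "\<Omega> \<subseteq> ball 0 R"
    and zero: "AE z in Sigma_measure. ray_transform \<Omega> (\<lambda>x. a) z = 0"
  shows "a = 0"
proof (rule ccontr)
  assume "a \<noteq> 0"
  then have pa: "perp a \<noteq> 0" by (metis norm_perp norm_eq_zero)
  obtain x0 where x0: "x0 \<in> \<Omega>" "x0 \<bullet> perp a \<noteq> 0" by (rule open_not_in_hyperplane[OF \<Omega>(1,2) pa])
  then have x00: "x0 \<noteq> 0" by auto
  let ?V = "(\<lambda>z. fst z *\<^sub>R snd z) -` \<Omega> \<inter> (\<lambda>z. snd z \<bullet> perp a) -` (- {0})"
  have "AE z in Sigma_measure. z \<notin> ?V"
    using zero AE_space
  proof eventually_elim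
    case (elim z)
    show ?case
    proof
      assume z: "z \<in> ?V"
      obtain r \<theta> where r: "z = (r, \<theta>)" "norm \<theta> = 1" using elim(2) by (cases z) (auto simp: space_Sigma_measure)
      let ?A = "line_point z -` \<Omega>"
      have A: "open ?A" using \<Omega>(1) continuous_line_point_right by (rule open_vimage)
      have "0 \<in> ?A" using z by (simp add: line_point_def)
      then have "0 < emeasure lborel ?A" using A by (intro emeasure_lborel_open_pos) auto
      moreover have "?A \<subseteq> {-R..R}" using \<Omega>(3) line_point_bound[OF r(2)] r(1) by auto
      then have "emeasure lborel ?A \<le> emeasure lborel {-R..R}" by (intro emeasure_mono) auto
      then have fin: "emeasure lborel ?A < \<infinity>" by (rule le_less_trans) (simp add: emeasure_lborel_Icc_eq)
      ultimately have pos: "measure lebesgue ?A \<noteq> 0"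
        using A by (simp add: measure_def enn2real_eq_0_iff less_top)
      have "zero_extension \<Omega> (\<lambda>x. a) (r *\<^sub>R \<theta> + t *\<^sub>R perp \<theta>) \<bullet> perp \<theta> = indicator ?A t *\<^sub>R (a \<bullet> perp \<theta>)" for t
        by (simp add: zero_extension_def indicator_def r(1) line_point_def)
      then have "ray_transform \<Omega> (\<lambda>x. a) z = (\<integral>t. indicator ?A t *\<^sub>R (a \<bullet> perp \<theta>) \<partial>lebesgue)"
        unfolding r(1) ray_transform_def by (simp only: split)
      also have "\<dots> = measure lebesgue ?A * (a \<bullet> perp \<theta>)"
        using A fin by simp
      finally have "a \<bullet> perp \<theta> = 0" using elim(1) pos by simp
      then show False using z r(1) by (simp add: inner_perp_commute[of a])
    qed
  qed
  moreover have "open ?V" using \<Omega>(1) by (intro open_Int open_vimage continuous_intros) auto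
  moreover have "(norm x0, (1 / norm x0) *\<^sub>R x0) \<in> ?V" using x0 x00 by simp
  ultimately show False using Sigma_measure_open_pos[of ?V "norm x0" "(1 / norm x0) *\<^sub>R x0"] x00 by simp
qed

section \<open>Well-posedness\<close>

lemma (in regularization_setting) domain_subset_ball: "\<Omega> \<subseteq> ball 0 R"
  using domain(6) closure_subset by fast

lemma (in regularization_setting) R_nonneg: "0 \<le> R"
  using domain(1) domain_subset_ball by (metis ball_eq_empty not_le order_less_imp_le subset_empty)

lemma (in slice_kernel) AE_zero_extension_null:
  assumes "AE x in lborel. zero_extension \<Omega> w x = w' x"
  obtains N where "N \<in> sets borel" "{x. zero_extension \<Omega> w x \<noteq> w' x} \<subseteq> N" "AE z in Sigma_measure. emeasure (\<kappa> z) N = 0"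
proof -
  obtain N where N: "{x \<in> space lborel. \<not> zero_extension \<Omega> w x = w' x} \<subseteq> N" "emeasure lborel N = 0" "N \<in> sets lborel"
    using assms by (rule AE_E)
  then have "N \<in> null_sets lborel" by (simp add: null_sets_def)
  then show thesis using that[of N] AE_slice_null N by simp
qed

lemma (in regularization_setting) radon_tikhonov_operator:
  "tikhonov_operator p s l \<Omega> R K d \<rho> (radon_transform \<Omega>)"
proof -
  interpret slice_kernel "hyperplane_kernel R :: real \<times> (real^'n) \<Rightarrow> _"
    "graph_const TYPE('n) (sqrt CARD('n)) * R ^ (CARD('n) - 1)" "2 * CARD('n) * graph_const TYPE('n) (sqrt CARD('n))"
    by (rule slice_kernel_hyperplane[OF R_nonneg])
  let ?\<Lambda> = "\<lambda>(z :: real \<times> (real^'n)) (x :: real^'m). x"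
  have m: "(\<lambda>(z, x). ?\<Lambda> z x) \<in> borel_measurable borel"
    unfolding split_beta by (intro borel_measurable_continuous_onI continuous_intros)
  have rep: "AE z in Sigma_measure. radon_transform \<Omega> w z = ?\<Lambda> z (slice_integral w' z)"
    if w': "w' \<in> borel_measurable borel" "\<And>x. x \<notin> \<Omega> \<Longrightarrow> w' x = 0" "AE x in lborel. zero_extension \<Omega> w x = w' x"
    for w w' :: "real^'n \<Rightarrow> real^'m"
  proof -
    obtain N where N: "N \<in> sets borel" "{x. zero_extension \<Omega> w x \<noteq> w' x} \<subseteq> N" and
      ae: "AE z in Sigma_measure. emeasure (hyperplane_kernel R z) N = 0"
      by (rule AE_zero_extension_null[OF w'(3)])
    show ?thesis using ae
    proof eventually_elim
      case (elim z)
      then show ?case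
        using radon_transform_representative[OF domain_subset_ball w'(1,2) N] by (simp add: vec_eq_iff slice_integral_def)
    qed
  qed
  note L = slice_operator_Lipschitz[OF domain(4,2) p m, where F = "radon_transform \<Omega>"]
  show ?thesis
  proof (intro tikhonov_operator.intro tikhonov_operator_axioms.intro)
    show "regularization_setting p s l \<Omega> R K d \<rho>" by (rule regularization_setting_axioms)
    show "radon_transform \<Omega> w \<in> borel_measurable Sigma_measure" if "w \<in> Lp_space (lebesgue_on \<Omega>) p" for w :: "real^'n \<Rightarrow> real^'m"
      by (rule L(1)[OF _ _ _ that]) (simp_all add: rep)
    show "\<exists>C\<ge>0. \<forall>u\<in>Lp_space (lebesgue_on \<Omega>) p. \<forall>v\<in>Lp_space (lebesgue_on \<Omega>) p.
      Lp_pow Sigma_measure p (\<lambda>z. radon_transform \<Omega> u z - radon_transform \<Omega> v z :: real^'m) \<le> ennreal C * Lp_pow (lebesgue_on \<Omega>) p (\<lambda>x. u x - v x)"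
      by (rule L(2)) (simp_all add: rep)
    show "a = 0" if "AE z in Sigma_measure. radon_transform \<Omega> (\<lambda>x. a) z = 0" for a :: "real^'m"
      by (rule radon_transform_const_eq_0[OF domain(4,1) domain_subset_ball R_nonneg that])
  qed (rule radon_transform_scaleR)
qed

lemma ray_tikhonov_operator:
  assumes "regularization_setting p s l \<Omega> R K d \<rho>"
  shows "tikhonov_operator p s l \<Omega> R K d \<rho> (ray_transform \<Omega>)"
proof -
  interpret regularization_setting p s l \<Omega> R K d \<rho> by fact
  interpret slice_kernel "line_kernel R" "2 * R" 16 by (rule slice_kernel_line[OF R_nonneg])
  \<comment> \<open>The tangential component of the slice integral; \<open>perp (snd z)\<close> is a
    unit vector for the relevant parameters, so this map does not increase norms.\<close>
  let ?\<Lambda> = "\<lambda>(z :: real \<times> (real^2)) x. x \<bullet> perp (snd z)"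
  have "continuous_on UNIV (\<lambda>(z, x). ?\<Lambda> z x)"
    unfolding split_beta by (intro continuous_intros continuous_on_compose2[OF continuous_on_perp[of UNIV]]) auto
  then have m: "(\<lambda>(z, x). ?\<Lambda> z x) \<in> borel_measurable borel" by (rule borel_measurable_continuous_onI)
  have n: "norm (?\<Lambda> (r, \<phi>) x) \<le> norm x" if "norm \<phi> = 1" for r x and \<phi> :: "real^2"
    using Cauchy_Schwarz_ineq2[of x "perp \<phi>"] that by simp
  have rep: "AE z in Sigma_measure. ray_transform \<Omega> w z = ?\<Lambda> z (slice_integral w' z)"
    if w': "w' \<in> borel_measurable borel" "\<And>x. x \<notin> \<Omega> \<Longrightarrow> w' x = 0" "AE x in lborel. zero_extension \<Omega> w x = w' x"
      and i: "AE z in Sigma_measure. integrable (line_kernel R z) w'"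
    for w w'
  proof -
    obtain N where N: "N \<in> sets borel" "{x. zero_extension \<Omega> w x \<noteq> w' x} \<subseteq> N" and
      ae: "AE z in Sigma_measure. emeasure (line_kernel R z) N = 0"
      by (rule AE_zero_extension_null[OF w'(3)])
    show ?thesis using ae i AE_space
    proof eventually_elim
      case (elim z)
      then have "norm (snd z) = 1" by (auto simp: space_Sigma_measure)
      then show ?case
        using ray_transform_representative[OF domain_subset_ball w'(1,2) N elim(1) _ elim(2)] elim(2) by (simp add: slice_integral_eq)
    qed
  qed
  note L = slice_operator_Lipschitz[OF domain(4,2) p m _ n, where F = "ray_transform \<Omega>"]
  show ?thesis
  proof (intro tikhonov_operator.intro tikhonov_operator_axioms.intro)
    show "regularization_setting p s l \<Omega> R K d \<rho>" by fact
    show "ray_transform \<Omega> w \<in> borel_measurable Sigma_measure" if "w \<in> Lp_space (lebesgue_on \<Omega>) p" for w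
      by (rule L(1)[OF _ _ _ that]) (simp_all add: rep inner_diff_left)
    show "\<exists>C\<ge>0. \<forall>u\<in>Lp_space (lebesgue_on \<Omega>) p. \<forall>v\<in>Lp_space (lebesgue_on \<Omega>) p.
      Lp_pow Sigma_measure p (\<lambda>z. ray_transform \<Omega> u z - ray_transform \<Omega> v z) \<le> ennreal C * Lp_pow (lebesgue_on \<Omega>) p (\<lambda>x. u x - v x)"
      by (rule L(2)) (simp_all add: rep inner_diff_left)
    show "a = 0" if "AE z in Sigma_measure. ray_transform \<Omega> (\<lambda>x. a) z = 0" for a
      by (rule ray_transform_const_eq_0[OF domain(4,1) domain_subset_ball that])
  qed (rule ray_transform_scaleR)
qed

lemma (in tikhonov_operator) well_posed:
  assumes "v0 \<in> Lp_space Sigma_measure p" "solutions adm F v0 \<noteq> {}"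
  shows "minimizing_solutions adm F \<Phi> v0 \<noteq> {} \<and> tikhonov_existence p adm F \<Phi> \<and>
    tikhonov_stability s p \<Omega> adm F \<Phi> \<and> tikhonov_convergence s p \<Omega> adm F \<Phi> v0"
proof -
  have "adm \<noteq> {}" using assms(2) by (auto simp: solutions_def)
  then show ?thesis
    using minimizing_solution_exists[OF assms] existence stability convergence[OF assms] by blast
qed

theorem corollary3p8:
  fixes p s R :: real and l :: nat
    and \<Omega> :: "(real^'n) set" and K :: "(real^'m) set"
    and d :: "real^'m \<Rightarrow> real^'m \<Rightarrow> real" and \<rho> :: "real^'n \<Rightarrow> real"
    and v0 :: "real \<times> (real^'n) \<Rightarrow> real^'m"
    and \<Omega>\<^sub>2 K\<^sub>2 :: "(real^2) set"
    and d\<^sub>2 :: "real^2 \<Rightarrow> real^2 \<Rightarrow> real" and \<rho>\<^sub>2 :: "real^2 \<Rightarrow> real"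
    and v0\<^sub>2 :: "real \<times> (real^2) \<Rightarrow> real"
  shows
    "(let D = sobolev_into s p \<Omega> K; \<Phi> = regularizer s p l \<Omega> d \<rho>; F = radon_transform \<Omega> in
      regularization_setting p s l \<Omega> R K d \<rho> \<and>
      v0 \<in> Lp_space Sigma_measure p \<and> solutions D F v0 \<noteq> {} \<longrightarrow>
        minimizing_solutions D F \<Phi> v0 \<noteq> {} \<and>
        tikhonov_existence p D F \<Phi> \<and>
        tikhonov_stability s p \<Omega> D F \<Phi> \<and>
        tikhonov_convergence s p \<Omega> D F \<Phi> v0) \<and>
     (let D = sobolev_into s p \<Omega>\<^sub>2 K\<^sub>2; \<Phi> = regularizer s p l \<Omega>\<^sub>2 d\<^sub>2 \<rho>\<^sub>2; F = ray_transform \<Omega>\<^sub>2 in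
      regularization_setting p s l \<Omega>\<^sub>2 R K\<^sub>2 d\<^sub>2 \<rho>\<^sub>2 \<and>
      v0\<^sub>2 \<in> Lp_space Sigma_measure p \<and> solutions D F v0\<^sub>2 \<noteq> {} \<longrightarrow>
        minimizing_solutions D F \<Phi> v0\<^sub>2 \<noteq> {} \<and>
        tikhonov_existence p D F \<Phi> \<and>
        tikhonov_stability s p \<Omega>\<^sub>2 D F \<Phi> \<and>
        tikhonov_convergence s p \<Omega>\<^sub>2 D F \<Phi> v0\<^sub>2)"
  unfolding Let_def
proof (rule conjI; rule impI; elim conjE)
  assume setting: "regularization_setting p s l \<Omega> R K d \<rho>"
    and v0: "v0 \<in> Lp_space Sigma_measure p" "solutions (sobolev_into s p \<Omega> K) (radon_transform \<Omega>) v0 \<noteq> {}"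
  interpret tikhonov_operator p s l \<Omega> R K d \<rho> "radon_transform \<Omega>"
    by (rule regularization_setting.radon_tikhonov_operator[OF setting])
  show "minimizing_solutions adm (radon_transform \<Omega>) \<Phi> v0 \<noteq> {} \<and> tikhonov_existence p adm (radon_transform \<Omega>) \<Phi> \<and>
      tikhonov_stability s p \<Omega> adm (radon_transform \<Omega>) \<Phi> \<and> tikhonov_convergence s p \<Omega> adm (radon_transform \<Omega>) \<Phi> v0"
    by (rule well_posed[OF v0])
next
  assume setting: "regularization_setting p s l \<Omega>\<^sub>2 R K\<^sub>2 d\<^sub>2 \<rho>\<^sub>2"
    and v0: "v0\<^sub>2 \<in> Lp_space Sigma_measure p" "solutions (sobolev_into s p \<Omega>\<^sub>2 K\<^sub>2) (ray_transform \<Omega>\<^sub>2) v0\<^sub>2 \<noteq> {}"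
  interpret tikhonov_operator p s l \<Omega>\<^sub>2 R K\<^sub>2 d\<^sub>2 \<rho>\<^sub>2 "ray_transform \<Omega>\<^sub>2"
    by (rule ray_tikhonov_operator[OF setting])
  show "minimizing_solutions adm (ray_transform \<Omega>\<^sub>2) \<Phi> v0\<^sub>2 \<noteq> {} \<and> tikhonov_existence p adm (ray_transform \<Omega>\<^sub>2) \<Phi> \<and>
      tikhonov_stability s p \<Omega>\<^sub>2 adm (ray_transform \<Omega>\<^sub>2) \<Phi> \<and> tikhonov_convergence s p \<Omega>\<^sub>2 adm (ray_transform \<Omega>\<^sub>2) \<Phi> v0\<^sub>2"
    by (rule well_posed[OF v0])
qed

end
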